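(* Let $R$ be a ring and $R^{\mathrm e}=R\otimes_{\mathbb Z}R^{\mathrm{op}}$. The category of $(R^{\mathrm e},R^{\mathrm e})$-bimodules endowed with the normal lax monoidal structure $\times_R$, the strong monoidal structure $\otimes_{R^{\mathrm e}}$ and the maps $\{w^p\}_{p\ge-1}$ and $\{\chi^p\}_{p\ge-1}$ (all described in the context) is a lax-strong duoidal category.
   Context: **Lax monoidal category.** A category with functors $\lambda^n:\mathcal D^{n+1}\to\mathcal D$ ($n\ge-1$), natural transformations $\lambda^p(-,\lambda^q,-)\to\lambda^{p+q}$ ($p\ge0,q\ge-1$, each of the $p+1$ positions), and a unit $\mathrm{Id}\to\lambda^0$, such that: $\lambda^p\to\lambda^0\lambda^p\to\lambda^p$ and $\lambda^p\to\lambda^p(-,\lambda^0,-)\to\lambda^p$ are identities; the two composites $\lambda^p(-,\lambda^q,-,\lambda^r,-)\to\lambda^{p+q+r}$ agree; the two composites $\lambda^p(-,\lambda^q(-,\lambda^r,-),-)\to\lambda^{p+q+r}$ agree. **Lax-strong duoidal category.** A category $\mathcal D$ with a lax monoidal structure $\lambda$, a (strong) monoidal structure $(\otimes,1_\otimes)$, natural maps $\chi^n:\lambda^n(x_0,\dots,x_n)\otimes\lambda^n(y_0,\dots,y_n)\to\lambda^n(x_0\otimes y_0,\dots,x_n\otimes y_n)$ and morphisms $w^n:1_\otimes\to\lambda^n(1_\otimes,\dots,1_\otimes)$ for $n\ge-1$ such that: (i) each $(\chi^n,w^n)$ makes $\lambda^n:(\mathcal D^{n+1},\otimes)\to(\mathcal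 D,\otimes)$ a lax monoidal functor in the usual sense; (ii) $\{\chi^n\}$ makes $\otimes:(\mathcal D\times\mathcal D)^\lambda\to\mathcal D^\lambda$ an oplax functor: $x\otimes y\to\lambda^0(x)\otimes\lambda^0(y)\xrightarrow{\chi^0}\lambda^0(x\otimes y)$ is the unit of $\lambda$, and for $p\ge0,q\ge-1$ the composite of the associators $\lambda^p(-,\lambda^q,-)(\mathbf x)\otimes\lambda^p(-,\lambda^q,-)(\mathbf y)\to\lambda^{p+q}(\mathbf x)\otimes\lambda^{p+q}(\mathbf y)$ with $\chi^{p+q}$ equals $\chi^p$ followed by $\lambda^p(-,\chi^q,-)$ and the associator $\lambda^p(-,\lambda^q,-)(\mathbf x\otimes\mathbf y)\to\lambda^{p+q}(\mathbf x\otimes\mathbf y)$; (iii) $\{w^n\}$ makes $1_\otimes$ a comonoid in $\mathcal D^\lambda$: $w^0$ is the unit $1_\otimes\to\lambda^0(1_\otimes)$ and $w^{p+q}$ equals $1_\otimes\xrightarrow{w^p}\lambda^p(1_\otimes)\xrightarrow{\lambda^p(-,w^q,-)}\lambda^p(-,\lambda^q,-)(1_\otimes)\to\lambda^{p+q}(1_\otimes)$. **Bimodules.** An $(R^{\mathrm e},R^{\mathrm e})$-bimodule carries commuting left actions of $r\in R$, $\bar r\in R^{\mathrm{op}}$ and right actions of $s\in R$, $\bar s\in R^{\mathrm{op}}$. $\otimes_{R^{\mathrm e}}$ is the usual tensor product of bimodules with unit $R^{\mathrm e}$. **$\times_R$.** For $n\ge0$, let $M^{(0)}\otimes_R\cdots\otimes_RM^{(n)}$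 be the quotient of the tensor product of abelian groups by $\cdots\otimes\bar r m^{(j)}\otimes m^{(j+1)}\otimes\cdots=\cdots\otimes m^{(j)}\otimes r m^{(j+1)}\otimes\cdots$ ($r\in R$, $0\le j<n$), and $\times_R^n(M^{(0)},\dots,M^{(n)})$ the subgroup of elements $\sum_i m_i^{(0)}\otimes\cdots\otimes m_i^{(n)}$ with $\sum_i\cdots\otimes m_i^{(j)}\bar s\otimes m_i^{(j+1)}\otimes\cdots=\sum_i\cdots\otimes m_i^{(j)}\otimes m_i^{(j+1)}s\otimes\cdots$ ($s\in R$, $0\le j<n$), with bimodule structure $(r,s)\cdot(m^{(0)}\otimes\cdots\otimes m^{(n)})\cdot(r',s')=(r m^{(0)}r')\otimes\cdots\otimes(\bar s m^{(n)}\bar s')$; $\times^0_R=\mathrm{Id}$; $\times_R^{-1}=\mathrm{End}(R)=\mathrm{Hom}_{\mathbb Z}(R,R)$ with $[(r,r')f(s,s')](m)=r f(sms')r'$. Associators for $q\ge0$ are induced by the inclusions $M\times_R\cdots\times_RN\subset M\otimes_R\cdots\otimes_RN$. Unitors ($q=-1$, $p\geq 1$) send $\cdots\otimes\phi\otimes n\otimes\cdots$ to $\cdots\otimes\phi(1_R)\cdot n\otimes\cdots$ and, when $\mathrm{End}(R)$ is in last position, $\cdots\otimes z\otimes\phi$ to $\cdots\otimes\overline{\phi(1_R)}\cdot z$. This is a strictly normal lax monoidal structure. **Maps $w^p$.** $w^{-1}:R^{\mathrm e}\to\mathrm{End}(R)$ is the bimodule map with $(1,1)\mapsto\mathrm{id}_R$;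 for $p\ge0$, $w^p:R^{\mathrm e}\to R^{\mathrm e}\times_R\cdots\times_RR^{\mathrm e}$ ($p+1$ factors) is the bimodule map with $(1,1)\mapsto(1,1)\otimes\cdots\otimes(1,1)$. **Maps $\chi^p$.** $\chi^{-1}:\mathrm{End}(R)\otimes_{R^{\mathrm e}}\mathrm{End}(R)\to\mathrm{End}(R)$ is composition of endomorphisms; $\chi^0$ is the identity; for $p\ge1$, $\chi^p:(M^{(0)}\times_R\cdots\times_RM^{(p)})\otimes_{R^{\mathrm e}}(N^{(0)}\times_R\cdots\times_RN^{(p)})\to(M^{(0)}\otimes_{R^{\mathrm e}}N^{(0)})\times_R\cdots\times_R(M^{(p)}\otimes_{R^{\mathrm e}}N^{(p)})$ is induced by the shuffle $(m^{(0)}\otimes\cdots\otimes m^{(p)})\otimes(n^{(0)}\otimes\cdots\otimes n^{(p)})\mapsto(m^{(0)}\otimes n^{(0)})\otimes\cdots\otimes(m^{(p)}\otimes n^{(p)})$. *)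

theory Defs
  imports "HOL-Algebra.Free_Abelian_Groups" "HOL-Algebra.Generated_Groups"
begin

section \<open>Categories, functors and monoidal categories\<close>

record ('o, 'm) cat =
  Obj :: "'o set"
  Arr :: "'m set"
  Dom :: "'m \<Rightarrow> 'o"
  Cod :: "'m \<Rightarrow> 'o"
  Idn :: "'o \<Rightarrow> 'm"
  Comp :: "'m \<Rightarrow> 'm \<Rightarrow> 'm" (infixr "\<bullet>\<index>" 55)

definition Hom :: "('o, 'm, 'x) cat_scheme \<Rightarrow> 'o \<Rightarrow> 'o \<Rightarrow> 'm set" where
  "Hom C x y = {f \<in> Arr C. Dom C f = x \<and> Cod C f = y}"

locale category =
  fixes C :: "('o, 'm, 'x) cat_scheme" (structure)
  assumes Dom_Obj: "f \<in> Arr C \<Longrightarrow> Dom C f \<in> Obj C"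
    and Cod_Obj: "f \<in> Arr C \<Longrightarrow> Cod C f \<in> Obj C"
    and Idn_Hom: "x \<in> Obj C \<Longrightarrow> Idn C x \<in> Hom C x x"
    and Comp_Hom: "\<lbrakk>f \<in> Hom C x y; g \<in> Hom C y z\<rbrakk> \<Longrightarrow> g \<bullet> f \<in> Hom C x z"
    and Idn_left: "f \<in> Hom C x y \<Longrightarrow> Idn C y \<bullet> f = f"
    and Idn_right: "f \<in> Hom C x y \<Longrightarrow> f \<bullet> Idn C x = f"
    and Comp_assoc: "\<lbrakk>f \<in> Hom C x y; g \<in> Hom C y z; h \<in> Hom C z u\<rbrakk>
      \<Longrightarrow> (h \<bullet> g) \<bullet> f = h \<bullet> (g \<bullet> f)"

definition is_iso :: "('o, 'm, 'x) cat_scheme \<Rightarrow> 'm \<Rightarrow> bool" where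
  "is_iso C f \<longleftrightarrow> f \<in> Arr C \<and>
     (\<exists>g \<in> Hom C (Cod C f) (Dom C f).
        g \<bullet>\<^bsub>C\<^esub> f = Idn C (Dom C f) \<and> f \<bullet>\<^bsub>C\<^esub> g = Idn C (Cod C f))"

locale cat_functor = C: category C + D: category D
  for C :: "('o1, 'm1, 'x) cat_scheme" and D :: "('o2, 'm2, 'y) cat_scheme" +
  fixes FO :: "'o1 \<Rightarrow> 'o2" and FM :: "'m1 \<Rightarrow> 'm2"
  assumes FO_Obj: "x \<in> Obj C \<Longrightarrow> FO x \<in> Obj D"
    and FM_Hom: "f \<in> Hom C x y \<Longrightarrow> FM f \<in> Hom D (FO x) (FO y)"
    and FM_Idn: "x \<in> Obj C \<Longrightarrow> FM (Idn C x) = Idn D (FO x)"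
    and FM_Comp: "\<lbrakk>f \<in> Hom C x y; g \<in> Hom C y z\<rbrakk> \<Longrightarrow> FM (g \<bullet>\<^bsub>C\<^esub> f) = FM g \<bullet>\<^bsub>D\<^esub> FM f"

record ('o, 'm) moncat = "('o, 'm) cat" +
  tensO :: "'o \<Rightarrow> 'o \<Rightarrow> 'o" (infixl "\<boxtimes>\<index>" 70)
  tensM :: "'m \<Rightarrow> 'm \<Rightarrow> 'm" (infixl "\<boxdot>\<index>" 70)
  munit :: 'o
  asc :: "'o \<Rightarrow> 'o \<Rightarrow> 'o \<Rightarrow> 'm"
  lun :: "'o \<Rightarrow> 'm"
  run :: "'o \<Rightarrow> 'm"

locale monoidal_category = category V
  for V :: "('o, 'm, 'x) moncat_scheme" (structure) +
  assumes tensO_Obj: "\<lbrakk>x \<in> Obj V; y \<in> Obj V\<rbrakk> \<Longrightarrow> x \<boxtimes> y \<in> Obj V"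
    and tensM_Hom: "\<lbrakk>f \<in> Hom V x x'; g \<in> Hom V y y'\<rbrakk> \<Longrightarrow> f \<boxdot> g \<in> Hom V (x \<boxtimes> y) (x' \<boxtimes> y')"
    and tensM_Idn: "\<lbrakk>x \<in> Obj V; y \<in> Obj V\<rbrakk> \<Longrightarrow> Idn V x \<boxdot> Idn V y = Idn V (x \<boxtimes> y)"
    and tensM_Comp: "\<lbrakk>f \<in> Hom V x x'; f' \<in> Hom V x' x''; g \<in> Hom V y y'; g' \<in> Hom V y' y''\<rbrakk>
      \<Longrightarrow> (f' \<bullet> f) \<boxdot> (g' \<bullet> g) = (f' \<boxdot> g') \<bullet> (f \<boxdot> g)"
    and munit_Obj: "munit V \<in> Obj V"
    and asc_Hom: "\<lbrakk>x \<in> Obj V; y \<in> Obj V; z \<in> Obj V\<rbrakk>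
      \<Longrightarrow> asc V x y z \<in> Hom V ((x \<boxtimes> y) \<boxtimes> z) (x \<boxtimes> (y \<boxtimes> z))"
    and asc_iso: "\<lbrakk>x \<in> Obj V; y \<in> Obj V; z \<in> Obj V\<rbrakk> \<Longrightarrow> is_iso V (asc V x y z)"
    and asc_natural: "\<lbrakk>f \<in> Hom V x x'; g \<in> Hom V y y'; h \<in> Hom V z z'\<rbrakk>
      \<Longrightarrow> asc V x' y' z' \<bullet> ((f \<boxdot> g) \<boxdot> h) = (f \<boxdot> (g \<boxdot> h)) \<bullet> asc V x y z"
    and lun_Hom: "x \<in> Obj V \<Longrightarrow> lun V x \<in> Hom V (munit V \<boxtimes> x) x"
    and lun_iso: "x \<in> Obj V \<Longrightarrow> is_iso V (lun V x)"
    and lun_natural: "f \<in> Hom V x x' \<Longrightarrow> lun V x' \<bullet> (Idn V (munit V) \<boxdot> f) = f \<bullet> lun V x"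
    and run_Hom: "x \<in> Obj V \<Longrightarrow> run V x \<in> Hom V (x \<boxtimes> munit V) x"
    and run_iso: "x \<in> Obj V \<Longrightarrow> is_iso V (run V x)"
    and run_natural: "f \<in> Hom V x x' \<Longrightarrow> run V x' \<bullet> (f \<boxdot> Idn V (munit V)) = f \<bullet> run V x"
    and pentagon: "\<lbrakk>x \<in> Obj V; y \<in> Obj V; z \<in> Obj V; u \<in> Obj V\<rbrakk>
      \<Longrightarrow> asc V x y (z \<boxtimes> u) \<bullet> asc V (x \<boxtimes> y) z u
        = (Idn V x \<boxdot> asc V y z u) \<bullet> asc V x (y \<boxtimes> z) u \<bullet> (asc V x y z \<boxdot> Idn V u)"
    and triangle: "\<lbrakk>x \<in> Obj V; y \<in> Obj V\<rbrakk>
      \<Longrightarrow> (Idn V x \<boxdot> lun V y) \<bullet> asc V x (munit V) y = run V x \<boxdot> Idn V y"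

locale lax_monoidal_functor =
  V: monoidal_category V + W: monoidal_category W + cat_functor V W FO FM
  for V :: "('o1, 'm1, 'x) moncat_scheme" and W :: "('o2, 'm2, 'y) moncat_scheme"
    and FO :: "'o1 \<Rightarrow> 'o2" and FM :: "'m1 \<Rightarrow> 'm2" +
  fixes \<mu> :: "'o1 \<Rightarrow> 'o1 \<Rightarrow> 'm2" and \<eta> :: 'm2
  assumes mu_Hom: "\<lbrakk>x \<in> Obj V; y \<in> Obj V\<rbrakk>
      \<Longrightarrow> \<mu> x y \<in> Hom W (FO x \<boxtimes>\<^bsub>W\<^esub> FO y) (FO (x \<boxtimes>\<^bsub>V\<^esub> y))"
    and mu_natural: "\<lbrakk>f \<in> Hom V x x'; g \<in> Hom V y y'\<rbrakk>
      \<Longrightarrow> \<mu> x' y' \<bullet>\<^bsub>W\<^esub> (FM f \<boxdot>\<^bsub>W\<^esub> FM g) = FM (f \<boxdot>\<^bsub>V\<^esub> g) \<bullet>\<^bsub>W\<^esub> \<mu> x y"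
    and eta_Hom: "\<eta> \<in> Hom W (munit W) (FO (munit V))"
    and mu_assoc: "\<lbrakk>x \<in> Obj V; y \<in> Obj V; z \<in> Obj V\<rbrakk>
      \<Longrightarrow> FM (asc V x y z) \<bullet>\<^bsub>W\<^esub> \<mu> (x \<boxtimes>\<^bsub>V\<^esub> y) z \<bullet>\<^bsub>W\<^esub> (\<mu> x y \<boxdot>\<^bsub>W\<^esub> Idn W (FO z))
        = \<mu> x (y \<boxtimes>\<^bsub>V\<^esub> z) \<bullet>\<^bsub>W\<^esub> (Idn W (FO x) \<boxdot>\<^bsub>W\<^esub> \<mu> y z) \<bullet>\<^bsub>W\<^esub> asc W (FO x) (FO y) (FO z)"
    and mu_lun: "x \<in> Obj V
      \<Longrightarrow> FM (lun V x) \<bullet>\<^bsub>W\<^esub> \<mu> (munit V) x \<bullet>\<^bsub>W\<^esub> (\<eta> \<boxdot>\<^bsub>W\<^esub> Idn W (FO x)) = lun W (FO x)"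
    and mu_run: "x \<in> Obj V
      \<Longrightarrow> FM (run V x) \<bullet>\<^bsub>W\<^esub> \<mu> x (munit V) \<bullet>\<^bsub>W\<^esub> (Idn W (FO x) \<boxdot>\<^bsub>W\<^esub> \<eta>) = run W (FO x)"

text \<open>The cartesian powers of a (monoidal) category, with componentwise structure;
  \<open>n\<close>-tuples are lists of length \<open>n\<close>.\<close>

definition power_cat :: "('o, 'm, 'x) cat_scheme \<Rightarrow> nat \<Rightarrow> ('o list, 'm list) cat" where
  "power_cat C n = \<lparr>
     Obj = {xs. length xs = n \<and> set xs \<subseteq> Obj C},
     Arr = {fs. length fs = n \<and> set fs \<subseteq> Arr C},
     Dom = map (Dom C), Cod = map (Cod C),
     Idn = map (Idn C), Comp = map2 (Comp C)\<rparr>"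

definition power_moncat :: "('o, 'm, 'x) moncat_scheme \<Rightarrow> nat \<Rightarrow> ('o list, 'm list) moncat" where
  "power_moncat V n = cat.extend (power_cat V n) (moncat.fields
     (map2 (tensO V)) (map2 (tensM V)) (replicate n (munit V))
     (\<lambda>xs ys zs. map (\<lambda>(x, y, z). asc V x y z) (zip xs (zip ys zs)))
     (map (lun V)) (map (run V)))"


section \<open>Lax monoidal and lax-strong duoidal categories\<close>

text \<open>The functors \<open>\<lambda>\<^sup>n : D\<^sup>n\<^sup>+\<^sup>1 \<rightarrow> D\<close> for all \<open>n \<ge> -1\<close> are given together as functions on lists, a list
  of length \<open>n + 1\<close> being an argument of \<open>\<lambda>\<^sup>n\<close>. The component
  of \<open>\<lambda>\<^sup>p(-, \<lambda>\<^sup>q, -) \<rightarrow> \<lambda>\<^sup>p\<^sup>+\<^sup>q\<close> at \<open>\<lambda>\<^sup>p(xs, \<lambda>\<^sup>q(ys), zs)\<close> is \<open>lasc L xs ys zs\<close>,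
  so that \<open>p = length xs + length zs\<close>, \<open>q = length ys - 1\<close>, and the position is \<open>length xs\<close>.\<close>

record ('o, 'm) lax_structure =
  lamO :: "'o list \<Rightarrow> 'o"
  lamM :: "'m list \<Rightarrow> 'm"
  lasc :: "'o list \<Rightarrow> 'o list \<Rightarrow> 'o list \<Rightarrow> 'm"
  lunit :: "'o \<Rightarrow> 'm"

locale lax_monoidal_category = category C
  for C :: "('o, 'm, 'x) cat_scheme" (structure) +
  fixes L :: "('o, 'm, 'y) lax_structure_scheme"
  assumes lam_functor: "cat_functor (power_cat C n) C (lamO L) (lamM L)"
    and lasc_Hom: "\<lbrakk>set xs \<subseteq> Obj C; set ys \<subseteq> Obj C; set zs \<subseteq> Obj C\<rbrakk>
      \<Longrightarrow> lasc L xs ys zs \<in> Hom C (lamO L (xs @ [lamO L ys] @ zs)) (lamO L (xs @ ys @ zs))"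
    and lasc_natural: "\<lbrakk>set fs \<subseteq> Arr C; set gs \<subseteq> Arr C; set hs \<subseteq> Arr C\<rbrakk>
      \<Longrightarrow> lasc L (map (Cod C) fs) (map (Cod C) gs) (map (Cod C) hs) \<bullet> lamM L (fs @ [lamM L gs] @ hs)
        = lamM L (fs @ gs @ hs) \<bullet> lasc L (map (Dom C) fs) (map (Dom C) gs) (map (Dom C) hs)"
    and lunit_Hom: "x \<in> Obj C \<Longrightarrow> lunit L x \<in> Hom C x (lamO L [x])"
    and lunit_natural: "f \<in> Hom C x y \<Longrightarrow> lunit L y \<bullet> f = lamM L [f] \<bullet> lunit L x"
    and lunit_outer: "set ys \<subseteq> Obj C
      \<Longrightarrow> lasc L [] ys [] \<bullet> lunit L (lamO L ys) = Idn C (lamO L ys)"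
    and lunit_inner: "\<lbrakk>set xs \<subseteq> Obj C; y \<in> Obj C; set zs \<subseteq> Obj C\<rbrakk>
      \<Longrightarrow> lasc L xs [y] zs \<bullet> lamM L (map (Idn C) xs @ [lunit L y] @ map (Idn C) zs)
        = Idn C (lamO L (xs @ [y] @ zs))"
    and lasc_parallel: "\<lbrakk>set xs \<subseteq> Obj C; set ys \<subseteq> Obj C; set zs \<subseteq> Obj C; set us \<subseteq> Obj C; set vs \<subseteq> Obj C\<rbrakk>
      \<Longrightarrow> lasc L (xs @ ys @ zs) us vs \<bullet> lasc L xs ys (zs @ [lamO L us] @ vs)
        = lasc L xs ys (zs @ us @ vs) \<bullet> lasc L (xs @ [lamO L ys] @ zs) us vs"
    and lasc_nested: "\<lbrakk>set xs \<subseteq> Obj C; set ys \<subseteq> Obj C; set us \<subseteq> Obj C; set vs \<subseteq> Obj C; set zs \<subseteq> Obj C\<rbrakk>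
      \<Longrightarrow> lasc L xs (ys @ us @ vs) zs
            \<bullet> lamM L (map (Idn C) xs @ [lasc L ys us vs] @ map (Idn C) zs)
        = lasc L (xs @ ys) us (vs @ zs) \<bullet> lasc L xs (ys @ [lamO L us] @ vs) zs"

text \<open>Here \<open>\<chi> xs ys\<close> (for lists of equal length \<open>n + 1\<close>) is the component of \<open>\<chi>\<^sup>n\<close>,
  and \<open>w n\<close> is the morphism written \<open>w\<^sup>n\<^sup>-\<^sup>1\<close> in the usual indexing, i.e. \<open>n\<close> counts the arguments.\<close>

locale lax_strong_duoidal_category =
  monoidal_category V + lax_monoidal_category V L
  for V :: "('o, 'm, 'x) moncat_scheme" (structure)
    and L :: "('o, 'm, 'y) lax_structure_scheme" +
  fixes \<chi> :: "'o list \<Rightarrow> 'o list \<Rightarrow> 'm" and w :: "nat \<Rightarrow> 'm"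
  assumes lam_lax_monoidal:
      "lax_monoidal_functor (power_moncat V n) V (lamO L) (lamM L) \<chi> (w n)"
    and chi_unit: "\<lbrakk>x \<in> Obj V; y \<in> Obj V\<rbrakk>
      \<Longrightarrow> \<chi> [x] [y] \<bullet> (lunit L x \<boxdot> lunit L y) = lunit L (x \<boxtimes> y)"
    and chi_lasc:
      "\<lbrakk>set xs \<subseteq> Obj V; set ys \<subseteq> Obj V; set zs \<subseteq> Obj V;
        set xs' \<subseteq> Obj V; set ys' \<subseteq> Obj V; set zs' \<subseteq> Obj V;
        length xs' = length xs; length ys' = length ys; length zs' = length zs\<rbrakk>
      \<Longrightarrow> \<chi> (xs @ ys @ zs) (xs' @ ys' @ zs') \<bullet> (lasc L xs ys zs \<boxdot> lasc L xs' ys' zs')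
        = lasc L (map2 (tensO V) xs xs') (map2 (tensO V) ys ys') (map2 (tensO V) zs zs')
          \<bullet> lamM L (map (Idn V) (map2 (tensO V) xs xs') @ [\<chi> ys ys']
                      @ map (Idn V) (map2 (tensO V) zs zs'))
          \<bullet> \<chi> (xs @ [lamO L ys] @ zs) (xs' @ [lamO L ys'] @ zs')"
    and w_unit: "w 1 = lunit L (munit V)"
    and w_lasc: "w (a + b + c)
        = lasc L (replicate a (munit V)) (replicate b (munit V)) (replicate c (munit V))
          \<bullet> lamM L (replicate a (Idn V (munit V)) @ [w b] @ replicate c (Idn V (munit V)))
          \<bullet> w (a + 1 + c)"


section \<open>Bimodules\<close>

text \<open>The ring is a type of sort \<open>{ring, monoid_mult}\<close>, that is, a unital associative ring in which
  \<open>0 = 1\<close> is allowed (unlike in class \<open>ring_1\<close>). As in the library theory of free abelian groups,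
  the addition of an abelian group is the \<open>mult\<close> field of a monoid record.
  The fields \<open>lact\<close> and \<open>ract\<close> are the actions of the ring \<open>R\<close>, and \<open>lbar\<close> and \<open>rbar\<close> are those of
  the opposite ring, whose elements are also written as elements of the type of \<open>R\<close>.\<close>

record ('r, 'a) bimod = "'a monoid" +
  lact :: "'r \<Rightarrow> 'a \<Rightarrow> 'a"
  lbar :: "'r \<Rightarrow> 'a \<Rightarrow> 'a"
  ract :: "'a \<Rightarrow> 'r \<Rightarrow> 'a"
  rbar :: "'a \<Rightarrow> 'r \<Rightarrow> 'a"

locale bimodule = comm_group M
  for M :: "('r::{ring,monoid_mult}, 'a) bimod" (structure) +
  assumes closed: "m \<in> carrier M \<Longrightarrow> lact M r m \<in> carrier M" "m \<in> carrier M \<Longrightarrow> lbar M r m \<in> carrier M"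
      "m \<in> carrier M \<Longrightarrow> ract M m r \<in> carrier M" "m \<in> carrier M \<Longrightarrow> rbar M m r \<in> carrier M"
    and additive:
      "\<lbrakk>m \<in> carrier M; m' \<in> carrier M\<rbrakk> \<Longrightarrow> lact M r (m \<otimes> m') = lact M r m \<otimes> lact M r m'"
      "\<lbrakk>m \<in> carrier M; m' \<in> carrier M\<rbrakk> \<Longrightarrow> lbar M r (m \<otimes> m') = lbar M r m \<otimes> lbar M r m'"
      "\<lbrakk>m \<in> carrier M; m' \<in> carrier M\<rbrakk> \<Longrightarrow> ract M (m \<otimes> m') r = ract M m r \<otimes> ract M m' r"
      "\<lbrakk>m \<in> carrier M; m' \<in> carrier M\<rbrakk> \<Longrightarrow> rbar M (m \<otimes> m') r = rbar M m r \<otimes> rbar M m' r"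
    and scalar_additive:
      "m \<in> carrier M \<Longrightarrow> lact M (r + s) m = lact M r m \<otimes> lact M s m"
      "m \<in> carrier M \<Longrightarrow> lbar M (r + s) m = lbar M r m \<otimes> lbar M s m"
      "m \<in> carrier M \<Longrightarrow> ract M m (r + s) = ract M m r \<otimes> ract M m s"
      "m \<in> carrier M \<Longrightarrow> rbar M m (r + s) = rbar M m r \<otimes> rbar M m s"
    and unital: "m \<in> carrier M \<Longrightarrow> lact M 1 m = m" "m \<in> carrier M \<Longrightarrow> lbar M 1 m = m"
      "m \<in> carrier M \<Longrightarrow> ract M m 1 = m" "m \<in> carrier M \<Longrightarrow> rbar M m 1 = m"
    and act_mult:
      "m \<in> carrier M \<Longrightarrow> lact M (r * s) m = lact M r (lact M s m)"
      "m \<in> carrier M \<Longrightarrow> lbar M (s * r) m = lbar M r (lbar M s m)"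
      "m \<in> carrier M \<Longrightarrow> ract M m (r * s) = ract M (ract M m r) s"
      "m \<in> carrier M \<Longrightarrow> rbar M m (s * r) = rbar M (rbar M m r) s"
    and commuting:
      "m \<in> carrier M \<Longrightarrow> lact M r (lbar M s m) = lbar M s (lact M r m)"
      "m \<in> carrier M \<Longrightarrow> ract M (rbar M m s) r = rbar M (ract M m r) s"
      "m \<in> carrier M \<Longrightarrow> lact M r (ract M m s) = ract M (lact M r m) s"
      "m \<in> carrier M \<Longrightarrow> lact M r (rbar M m s) = rbar M (lact M r m) s"
      "m \<in> carrier M \<Longrightarrow> lbar M r (ract M m s) = ract M (lbar M r m) s"
      "m \<in> carrier M \<Longrightarrow> lbar M r (rbar M m s) = rbar M (lbar M r m) s"

definition bimod_hom :: "('r, 'a) bimod \<Rightarrow> ('r, 'b) bimod \<Rightarrow> ('a \<Rightarrow> 'b) set" where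
  "bimod_hom M N = {f \<in> hom M N. \<forall>m \<in> carrier M. \<forall>r.
     f (lact M r m) = lact N r (f m) \<and> f (lbar M r m) = lbar N r (f m) \<and>
     f (ract M m r) = ract N (f m) r \<and> f (rbar M m r) = rbar N (f m) r}"

text \<open>The universe of elements is a type \<open>'u\<close>: the bimodules in the category have carriers that are
  sets of elements of \<open>'u\<close>. Constructions such as tensor products first produce a bimodule over
  another type; \<open>small\<close> transports it along an injection \<open>enc\<close> of the carrier into \<open>'u\<close>, with
  inverse \<open>dec\<close>. Such injections exist when \<open>'u\<close> is large enough.\<close>

definition enc :: "'b set \<Rightarrow> 'b \<Rightarrow> 'u" where
  "enc A = (SOME f. inj_on f A)"

definition dec :: "'b set \<Rightarrow> 'u \<Rightarrow> 'b" where
  "dec A = the_inv_into A (enc A)"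

definition small :: "('r, 'b) bimod \<Rightarrow> ('r, 'u) bimod" where
  "small M = (let e = enc (carrier M); d = dec (carrier M) in \<lparr>
     carrier = e ` carrier M,
     monoid.mult = \<lambda>x y. e (d x \<otimes>\<^bsub>M\<^esub> d y), one = e \<one>\<^bsub>M\<^esub>,
     lact = \<lambda>r x. e (lact M r (d x)), lbar = \<lambda>r x. e (lbar M r (d x)),
     ract = \<lambda>x s. e (ract M (d x) s), rbar = \<lambda>x s. e (rbar M (d x) s)\<rparr>)"


section \<open>Tensor products\<close>

text \<open>\<open>tensor Ms B\<close> is the quotient of the tensor product over the integers of the abelian
  groups \<open>Ms\<close> by the relations \<open>B\<close>. Its elements are classes of formal
  sums of tuples, tuples being lists.\<close>

definition tuples :: "('a, 'x) monoid_scheme list \<Rightarrow> 'a list set" where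
  "tuples Ms = {t. length t = length Ms \<and> (\<forall>i < length Ms. t ! i \<in> carrier (Ms ! i))}"

definition multilinear_rels :: "('a, 'x) monoid_scheme list \<Rightarrow> ('a list \<Rightarrow>\<^sub>0 int) set" where
  "multilinear_rels Ms =
     {frag_of (t[i := a \<otimes>\<^bsub>Ms ! i\<^esub> b]) - frag_of (t[i := a]) - frag_of (t[i := b]) | t i a b.
        t \<in> tuples Ms \<and> i < length Ms \<and> a \<in> carrier (Ms ! i) \<and> b \<in> carrier (Ms ! i)}"

definition tensor_rels ::
    "('a, 'x) monoid_scheme list \<Rightarrow> ('a list \<Rightarrow>\<^sub>0 int) set \<Rightarrow> ('a list \<Rightarrow>\<^sub>0 int) set" where
  "tensor_rels Ms B = generate (free_Abelian_group (tuples Ms)) (multilinear_rels Ms \<union> B)"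

definition tensor ::
    "('a, 'x) monoid_scheme list \<Rightarrow> ('a list \<Rightarrow>\<^sub>0 int) set \<Rightarrow> ('a list \<Rightarrow>\<^sub>0 int) set monoid" where
  "tensor Ms B = free_Abelian_group (tuples Ms) Mod tensor_rels Ms B"

definition tclass ::
    "('a, 'x) monoid_scheme list \<Rightarrow> ('a list \<Rightarrow>\<^sub>0 int) set \<Rightarrow> ('a list \<Rightarrow>\<^sub>0 int) \<Rightarrow> ('a list \<Rightarrow>\<^sub>0 int) set" where
  "tclass Ms B c = tensor_rels Ms B #>\<^bsub>free_Abelian_group (tuples Ms)\<^esub> c"

definition representative :: "'a set \<Rightarrow> 'a" where
  "representative X = (SOME c. c \<in> X)"

definition apply_slot :: "nat \<Rightarrow> ('a \<Rightarrow> 'a) \<Rightarrow> ('a list \<Rightarrow>\<^sub>0 int) \<Rightarrow> ('a list \<Rightarrow>\<^sub>0 int)" where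
  "apply_slot i g = frag_extend (\<lambda>t. frag_of (t[i := g (t ! i)]))"

text \<open>\<open>evaluate G \<phi>\<close> sends a formal sum \<open>\<Sum> k t\<close> to the element \<open>\<Sum> k \<phi>(t)\<close> of the abelian group \<open>G\<close>.\<close>

definition evaluate :: "('a, 'x) monoid_scheme \<Rightarrow> ('t \<Rightarrow> 'a) \<Rightarrow> ('t \<Rightarrow>\<^sub>0 int) \<Rightarrow> 'a" where
  "evaluate G \<phi> c = finprod G (\<lambda>t. \<phi> t [^]\<^bsub>G\<^esub> Poly_Mapping.lookup c t) (Poly_Mapping.keys c)"


section \<open>The category of bimodules\<close>

record ('r, 'u) bimod_arr =
  bdom :: "('r, 'u) bimod"
  bcod :: "('r, 'u) bimod"
  bfun :: "'u \<Rightarrow> 'u"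

definition mk_arr ::
    "('r, 'u) bimod \<Rightarrow> ('r, 'u) bimod \<Rightarrow> ('u \<Rightarrow> 'u) \<Rightarrow> ('r, 'u) bimod_arr" where
  "mk_arr M N f = \<lparr>bdom = M, bcod = N, bfun = restrict f (carrier M)\<rparr>"

definition bimod_id :: "('r, 'u) bimod \<Rightarrow> ('r, 'u) bimod_arr" where
  "bimod_id M = mk_arr M M (\<lambda>x. x)"

definition bimod_cat :: "(('r::{ring,monoid_mult}, 'u) bimod, ('r, 'u) bimod_arr) cat" where
  "bimod_cat = \<lparr>
     Obj = {M. bimodule M},
     Arr = {f. bimodule (bdom f) \<and> bimodule (bcod f) \<and>
               bfun f \<in> bimod_hom (bdom f) (bcod f) \<inter> extensional (carrier (bdom f))},
     Dom = bdom, Cod = bcod, Idn = bimod_id,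
     Comp = (\<lambda>g f. mk_arr (bdom f) (bcod g) (\<lambda>x. bfun g (bfun f x)))\<rparr>"


section \<open>The tensor product over the enveloping ring\<close>

definition ring_group :: "'r::{ring,monoid_mult} monoid" where
  "ring_group = \<lparr>carrier = UNIV, monoid.mult = (+), one = 0\<rparr>"

text \<open>\<open>R\<^sup>e = R \<otimes> R\<^sup>o\<^sup>p\<close> as a bimodule over itself:
  \<open>(r \<otimes> r') (a \<otimes> b) (s \<otimes> s') = r a s \<otimes> s' b r'\<close>, the products in both factors being those of \<open>R\<close>.\<close>

abbreviation env_class :: "('r list \<Rightarrow>\<^sub>0 int) \<Rightarrow> ('r::{ring,monoid_mult} list \<Rightarrow>\<^sub>0 int) set" where
  "env_class \<equiv> tclass [ring_group, ring_group] {}"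

definition env_raw :: "('r::{ring,monoid_mult}, ('r list \<Rightarrow>\<^sub>0 int) set) bimod" where
  "env_raw = monoid.extend (tensor [ring_group, ring_group] {}) (bimod.fields
     (\<lambda>r X. env_class (apply_slot 0 (\<lambda>a. r * a) (representative X)))
     (\<lambda>r X. env_class (apply_slot 1 (\<lambda>b. b * r) (representative X)))
     (\<lambda>X s. env_class (apply_slot 0 (\<lambda>a. a * s) (representative X)))
     (\<lambda>X s. env_class (apply_slot 1 (\<lambda>b. s * b) (representative X))))"

definition env :: "('r::{ring,monoid_mult}, 'u) bimod" where
  "env = small env_raw"

definition env_rep :: "'u \<Rightarrow> ('r::{ring,monoid_mult} list \<Rightarrow>\<^sub>0 int)" where
  "env_rep x = representative (dec (carrier (env_raw :: ('r, _) bimod)) x)"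

definition env_one :: "'r::{ring,monoid_mult} itself \<Rightarrow> 'u" where
  "env_one R = enc (carrier env_raw) (env_class (frag_of [1, 1 :: 'r]))"

definition env_balanced :: "('r, 'a) bimod \<Rightarrow> ('r, 'a) bimod \<Rightarrow> ('a list \<Rightarrow>\<^sub>0 int) set" where
  "env_balanced M N =
     {frag_of [ract M (rbar M m s') s, n] - frag_of [m, lact N s (lbar N s' n)] | m n s s'.
        m \<in> carrier M \<and> n \<in> carrier N}"

abbreviation tens_class ::
    "('r, 'a) bimod \<Rightarrow> ('r, 'a) bimod \<Rightarrow> ('a list \<Rightarrow>\<^sub>0 int) \<Rightarrow> ('a list \<Rightarrow>\<^sub>0 int) set" where
  "tens_class M N \<equiv> tclass [M, N] (env_balanced M N)"

definition tens_raw ::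
    "('r, 'a) bimod \<Rightarrow> ('r, 'a) bimod \<Rightarrow> ('r, ('a list \<Rightarrow>\<^sub>0 int) set) bimod" where
  "tens_raw M N = monoid.extend (tensor [M, N] (env_balanced M N)) (bimod.fields
     (\<lambda>r X. tens_class M N (apply_slot 0 (\<lambda>m. lact M r m) (representative X)))
     (\<lambda>r X. tens_class M N (apply_slot 0 (\<lambda>m. lbar M r m) (representative X)))
     (\<lambda>X s. tens_class M N (apply_slot 1 (\<lambda>n. ract N n s) (representative X)))
     (\<lambda>X s. tens_class M N (apply_slot 1 (\<lambda>n. rbar N n s) (representative X))))"

definition tens :: "('r, 'u) bimod \<Rightarrow> ('r, 'u) bimod \<Rightarrow> ('r, 'u) bimod" where
  "tens M N = small (tens_raw M N)"

definition pure :: "('r, 'u) bimod \<Rightarrow> ('r, 'u) bimod \<Rightarrow> 'u \<Rightarrow> 'u \<Rightarrow> 'u" where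
  "pure M N m n = enc (carrier (tens_raw M N)) (tens_class M N (frag_of [m, n]))"

text \<open>\<open>tens_eval M N P \<phi>\<close> is the map \<open>M \<otimes> N \<rightarrow> P\<close> induced by \<open>m \<otimes> n \<mapsto> \<phi>(m, n)\<close>.\<close>

definition tens_eval :: "('r, 'u) bimod \<Rightarrow> ('r, 'u) bimod \<Rightarrow> ('r, 'u) bimod
    \<Rightarrow> ('u \<Rightarrow> 'u \<Rightarrow> 'u) \<Rightarrow> 'u \<Rightarrow> 'u" where
  "tens_eval M N P \<phi> x =
     evaluate P (\<lambda>t. \<phi> (t ! 0) (t ! 1)) (representative (dec (carrier (tens_raw M N)) x))"

definition tens_arr :: "('r, 'u) bimod \<Rightarrow> ('r, 'u) bimod \<Rightarrow> ('r, 'u) bimod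
    \<Rightarrow> ('u \<Rightarrow> 'u \<Rightarrow> 'u) \<Rightarrow> ('r, 'u) bimod_arr" where
  "tens_arr M N P \<phi> = mk_arr (tens M N) P (tens_eval M N P \<phi>)"

definition bimod_moncat :: "(('r::{ring,monoid_mult}, 'u) bimod, ('r, 'u) bimod_arr) moncat" where
  "bimod_moncat = cat.extend bimod_cat (moncat.fields
     tens
     (\<lambda>f g. tens_arr (bdom f) (bdom g) (tens (bcod f) (bcod g))
               (\<lambda>m n. pure (bcod f) (bcod g) (bfun f m) (bfun g n)))
     env
     (\<lambda>M N P. let Q = tens M (tens N P) in
        tens_arr (tens M N) P Q
          (\<lambda>x p. tens_eval M N Q (\<lambda>m n. pure M (tens N P) m (pure N P n p)) x))
     (\<lambda>M. tens_arr env M M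
        (\<lambda>e m. evaluate M (\<lambda>t. lact M (t ! 0) (lbar M (t ! 1) m)) (env_rep e)))
     (\<lambda>M. tens_arr M env M
        (\<lambda>m e. evaluate M (\<lambda>t. ract M (rbar M m (t ! 1)) (t ! 0)) (env_rep e))))"


section \<open>The Takeuchi product\<close>

definition end_raw :: "('r::{ring,monoid_mult}, 'r \<Rightarrow> 'r) bimod" where
  "end_raw = \<lparr>
     carrier = hom ring_group ring_group,
     monoid.mult = \<lambda>f g m. f m + g m, one = \<lambda>m. 0,
     lact = \<lambda>r f m. r * f m, lbar = \<lambda>r f m. f m * r,
     ract = \<lambda>f s m. f (s * m), rbar = \<lambda>f s m. f (m * s)\<rparr>"

definition end_enc :: "('r::{ring,monoid_mult} \<Rightarrow> 'r) \<Rightarrow> 'u" where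
  "end_enc = enc (carrier end_raw)"

definition end_dec :: "'u \<Rightarrow> ('r::{ring,monoid_mult} \<Rightarrow> 'r)" where
  "end_dec = dec (carrier end_raw)"

definition R_balanced :: "('r, 'a) bimod list \<Rightarrow> ('a list \<Rightarrow>\<^sub>0 int) set" where
  "R_balanced Ms =
     {frag_of (t[j := lbar (Ms ! j) r (t ! j)])
        - frag_of (t[Suc j := lact (Ms ! Suc j) r (t ! Suc j)]) | t j r.
      t \<in> tuples Ms \<and> Suc j < length Ms}"

abbreviation R_class :: "('r, 'a) bimod list \<Rightarrow> ('a list \<Rightarrow>\<^sub>0 int) \<Rightarrow> ('a list \<Rightarrow>\<^sub>0 int) set" where
  "R_class Ms \<equiv> tclass Ms (R_balanced Ms)"

definition times_raw :: "('r, 'a) bimod list \<Rightarrow> ('r, ('a list \<Rightarrow>\<^sub>0 int) set) bimod" where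
  "times_raw Ms = (let l = length Ms - 1 in \<lparr>
     carrier = {R_class Ms c | c. c \<in> carrier (free_Abelian_group (tuples Ms)) \<and>
       (\<forall>j s. Suc j < length Ms \<longrightarrow>
          R_class Ms (apply_slot j (\<lambda>m. rbar (Ms ! j) m s) c)
            = R_class Ms (apply_slot (Suc j) (\<lambda>m. ract (Ms ! Suc j) m s) c))},
     monoid.mult = monoid.mult (tensor Ms (R_balanced Ms)),
     one = one (tensor Ms (R_balanced Ms)),
     lact = \<lambda>r X. R_class Ms (apply_slot 0 (\<lambda>m. lact (Ms ! 0) r m) (representative X)),
     lbar = \<lambda>r X. R_class Ms (apply_slot l (\<lambda>m. lbar (Ms ! l) r m) (representative X)),
     ract = \<lambda>X s. R_class Ms (apply_slot 0 (\<lambda>m. ract (Ms ! 0) m s) (representative X)),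
     rbar = \<lambda>X s. R_class Ms (apply_slot l (\<lambda>m. rbar (Ms ! l) m s) (representative X))\<rparr>)"

fun timesR :: "('r::{ring,monoid_mult}, 'u) bimod list \<Rightarrow> ('r, 'u) bimod" where
  "timesR [] = small end_raw"
| "timesR [M] = M"
| "timesR (M # N # Ms) = small (times_raw (M # N # Ms))"

text \<open>For nonempty \<open>Ms\<close>, the inclusion of the Takeuchi product into the tensor product over \<open>R\<close>:
  \<open>times_rep Ms x\<close> is a formal sum of tuples representing \<open>x\<close>, and \<open>times_of Ms c\<close> is the element
  represented by \<open>c\<close>. For a single factor \<open>M\<close> the product is \<open>M\<close> itself and not a quotient.\<close>

definition times_rep :: "('r, 'u) bimod list \<Rightarrow> 'u \<Rightarrow> ('u list \<Rightarrow>\<^sub>0 int)" where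
  "times_rep Ms x = (if length Ms = 1 then frag_of [x]
     else representative (dec (carrier (times_raw Ms)) x))"

definition times_of :: "('r, 'u) bimod list \<Rightarrow> ('u list \<Rightarrow>\<^sub>0 int) \<Rightarrow> 'u" where
  "times_of Ms c = (if length Ms = 1 then evaluate (hd Ms) hd c
     else enc (carrier (times_raw Ms)) (R_class Ms c))"

definition times_map :: "('r::{ring,monoid_mult}, 'u) bimod_arr list \<Rightarrow> ('r, 'u) bimod_arr" where
  "times_map fs = (if fs = [] then bimod_id (timesR []) else
     mk_arr (timesR (map bdom fs)) (timesR (map bcod fs))
       (\<lambda>x. times_of (map bcod fs)
              (frag_extend (\<lambda>t. frag_of (map2 bfun fs t)) (times_rep (map bdom fs) x))))"

text \<open>The associators for \<open>q \<ge> 0\<close>, i.e. for nonempty \<open>Ns\<close>, flatten tuples.\<close>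

definition times_assoc :: "('r::{ring,monoid_mult}, 'u) bimod list \<Rightarrow> ('r, 'u) bimod list
    \<Rightarrow> ('r, 'u) bimod list \<Rightarrow> ('r, 'u) bimod_arr" where
  "times_assoc Ms Ns Ps =
     mk_arr (timesR (Ms @ [timesR Ns] @ Ps)) (timesR (Ms @ Ns @ Ps))
       (\<lambda>x. times_of (Ms @ Ns @ Ps) (frag_extend
          (\<lambda>t. frag_extend
             (\<lambda>u. frag_of (take (length Ms) t @ u @ drop (Suc (length Ms)) t))
             (times_rep Ns (t ! length Ms)))
          (times_rep (Ms @ [timesR Ns] @ Ps) x)))"

text \<open>The unitors, i.e. the case \<open>q = -1\<close>. \<open>contract Ms Ps\<close> acts on tuples \<open>(ms, \<phi>, ps)\<close>;
  the second case is that of \<open>End(R)\<close> in last position.\<close>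

definition contract :: "('r::{ring,monoid_mult}, 'u) bimod list \<Rightarrow> ('r, 'u) bimod list
    \<Rightarrow> 'u list \<Rightarrow> 'u list" where
  "contract Ms Ps t = (let ms = take (length Ms) t; ps = drop (Suc (length Ms)) t;
       a = end_dec (t ! length Ms) 1 in
     if Ps \<noteq> [] then ms @ [lact (hd Ps) a (hd ps)] @ tl ps
     else butlast ms @ [lbar (last Ms) a (last ms)])"

definition times_unitor :: "('r::{ring,monoid_mult}, 'u) bimod list
    \<Rightarrow> ('r, 'u) bimod list \<Rightarrow> ('r, 'u) bimod_arr" where
  "times_unitor Ms Ps = (if Ms = [] \<and> Ps = [] then bimod_id (timesR []) else
     mk_arr (timesR (Ms @ [timesR []] @ Ps)) (timesR (Ms @ Ps))
       (\<lambda>x. times_of (Ms @ Ps)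
          (frag_extend (\<lambda>t. frag_of (contract Ms Ps t)) (times_rep (Ms @ [timesR []] @ Ps) x))))"

definition times_structure ::
    "(('r::{ring,monoid_mult}, 'u) bimod, ('r, 'u) bimod_arr) lax_structure" where
  "times_structure = \<lparr>
     lamO = timesR, lamM = times_map,
     lasc = \<lambda>Ms Ns Ps. if Ns = [] then times_unitor Ms Ps else times_assoc Ms Ns Ps,
     lunit = bimod_id\<rparr>"


section \<open>The duoidal structure maps\<close>

text \<open>For \<open>n \<ge> 2\<close> factors, the value of the shuffle on \<open>x \<otimes> y\<close>.\<close>

definition shuffle :: "('r, 'u) bimod list \<Rightarrow> ('r, 'u) bimod list \<Rightarrow> 'u \<Rightarrow> 'u \<Rightarrow> 'u" where
  "shuffle Ms Ns x y = times_of (map2 tens Ms Ns)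
     (frag_extend (\<lambda>t. frag_extend
        (\<lambda>u. frag_of (map (\<lambda>i. pure (Ms ! i) (Ns ! i) (t ! i) (u ! i)) [0..<length Ms]))
        (times_rep Ns y)) (times_rep Ms x))"

definition chi_map :: "('r::{ring,monoid_mult}, 'u) bimod list \<Rightarrow> ('r, 'u) bimod list
    \<Rightarrow> ('r, 'u) bimod_arr" where
  "chi_map Ms Ns =
     (if Ms = [] then
        tens_arr (timesR []) (timesR []) (timesR [])
          (\<lambda>f g. end_enc ((end_dec f :: 'r \<Rightarrow> 'r) \<circ> end_dec g))
      else if length Ms = 1 then bimod_id (tens (hd Ms) (hd Ns))
      else tens_arr (timesR Ms) (timesR Ns) (timesR (map2 tens Ms Ns)) (shuffle Ms Ns))"

text \<open>The bimodule \<open>R\<^sup>e\<close> is generated by \<open>(1, 1)\<close>, so a bimodule map out of it is determined by the image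
  of \<open>(1, 1)\<close>.\<close>

definition w_map :: "nat \<Rightarrow> ('r::{ring,monoid_mult}, 'u) bimod_arr" where
  "w_map n = (THE f. f \<in> Hom bimod_cat env (timesR (replicate n env)) \<and>
     bfun f (env_one TYPE('r)) =
       (if n = 0 then end_enc (id :: 'r \<Rightarrow> 'r)
        else times_of (replicate n (env :: ('r, 'u) bimod))
               (frag_of (replicate n (env_one TYPE('r))))))"

end

(* A Takeuchi product of bimodules is a subquotient of the free abelian group on the tuples of their
   elements. Every structure map is therefore induced by a map from tuples to formal sums of tuples,
   and most identities between such maps can be checked on single tuples, modulo the relations of the
   tensor product over R. The exceptions are identities that contract two copies of End(R):
   there the two sides differ on tuples, and they agree only because the Takeuchi condition on formal
   sums moves a scalar from one slot to the next, as in sum phi(1) psi(x) = sum phi(x) psi(1) for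
   sum phi (x) psi in End(R) x_R End(R). The same condition on the left factor is what makes the
   shuffle well defined on the tensor product over R^e. Finally, R^e is free on one central generator,
   so a map out of R^e is an element q with rq = qr for all scalars r of R and of its opposite, and
   the identities for the w^p reduce to the image of (1, 1). *)

theory Submission
  imports Defs
begin

section \<open>Formal integer sums: congruence modulo a subgroup and linear extension\<close>

section \<open>Formal sums\<close>

text \<open>A Takeuchi product is a subgroup of a tensor product over R, and in general the single
  tuples lying in it do not span it, so there are no generators on which to test maps. Tuple-level
  work therefore takes place in the ambient tensor product: a map is given by a function on all
  tuples, and that its linear extension respects the Takeuchi condition is shown separately
  (\<open>transports\<close>). This may use the condition itself: a contraction of End(R) in the
  first or last slot is compatible with one outer right action only on Takeuchi sums. The pair
  \<open>times_of\<close>, \<open>times_rep\<close> hides two encodings: elements are codes in a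
  fixed universe, obtained from chosen injections, and a product of one factor is that factor and no
  quotient. Beyond it an identity is membership of a difference in \<open>rels\<close>. The empty
  product End(R) is not made of tuples; its elements are compared by their values, and lemmas about
  tuples assume a nonempty list of factors.\<close>

definition diff_closed :: "'a::ab_group_add set \<Rightarrow> bool" where
  "diff_closed H \<longleftrightarrow> 0 \<in> H \<and> (\<forall>x\<in>H. \<forall>y\<in>H. x - y \<in> H)"

lemma diff_closedD:
  assumes "diff_closed H"
  shows "0 \<in> H" "x \<in> H \<Longrightarrow> y \<in> H \<Longrightarrow> x - y \<in> H" "x \<in> H \<Longrightarrow> - x \<in> H"
    "x \<in> H \<Longrightarrow> y \<in> H \<Longrightarrow> x + y \<in> H"
proof -
  show 0: "0 \<in> H" and d: "x \<in> H \<Longrightarrow> y \<in> H \<Longrightarrow> x - y \<in> H" for x y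
    using assms by (auto simp: diff_closed_def)
  show m: "x \<in> H \<Longrightarrow> - x \<in> H" for x using d[OF 0] by force
  show "x \<in> H \<Longrightarrow> y \<in> H \<Longrightarrow> x + y \<in> H" using d[OF _ m, of x y] by simp
qed

text \<open>Throughout, \<open>x - y \<in> H\<close> serves as congruence modulo a subgroup
  \<open>H\<close>. This avoids quotients and lets \<open>H\<close> be a set of relations, the
  kernel of an evaluation or a preimage.\<close>

lemma mod_trans:
  assumes "diff_closed H" "x - y \<in> H" "y - z \<in> H"
  shows "x - z \<in> H"
  using diff_closedD(4)[OF assms] by simp

lemma mod_sym: "diff_closed H \<Longrightarrow> x - y \<in> H \<Longrightarrow> y - x \<in> H"
  using diff_closedD(3)[of H "x - y"] by simp

text \<open>A formal sum is built from its keys by differences, which \<open>H\<close> absorbs. This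
  is the passage from single tuples to formal sums on which the later comparisons rest.\<close>

lemma frag_extend_mem:
  assumes "diff_closed H" "\<And>t. t \<in> Poly_Mapping.keys c \<Longrightarrow> f t \<in> H"
  shows "frag_extend f c \<in> H"
proof -
  have "Poly_Mapping.keys c \<subseteq> {t. f t \<in> H}" using assms by auto
  then show ?thesis
    by (induction rule: frag_induction)
      (auto simp: frag_extend_diff diff_closedD[OF assms(1)])
qed

lemma frag_extend_fun_diff: "frag_extend (\<lambda>t. f t - g t) c = frag_extend f c - frag_extend g c"
  by (rule frag_induction[OF subset_UNIV, where c = c]) (auto simp: frag_extend_diff algebra_simps)

lemma frag_extend_zero_fun [simp]: "frag_extend (\<lambda>t. 0) c = 0"
  by (simp add: frag_extend_eq_0)

lemma frag_extend_frag_of [simp]: "frag_extend frag_of c = c"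
  by (metis frag_expansion)

lemma frag_extend_cong_mod:
  assumes "diff_closed H" "\<And>t. t \<in> Poly_Mapping.keys c \<Longrightarrow> f t - g t \<in> H"
  shows "frag_extend f c - frag_extend g c \<in> H"
  using frag_extend_mem[OF assms] by (simp add: frag_extend_fun_diff)

lemma frag_extend_compose:
  "frag_extend f (frag_extend g c) = frag_extend (\<lambda>t. frag_extend f (g t)) c"
  by (rule frag_induction[OF subset_UNIV, where c = c]) (auto simp: frag_extend_diff)

text \<open>Fubini for finite sums; a shuffle of two formal sums can thus be expanded in either
  argument first.\<close>

lemma frag_extend_swap:
  "frag_extend (\<lambda>t. frag_extend (\<lambda>u. f t u) d) c = frag_extend (\<lambda>u. frag_extend (\<lambda>t. f t u) c) d"
  by (rule frag_induction[OF subset_UNIV, where c = c])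
    (auto simp: frag_extend_diff frag_extend_fun_diff)

lemma keys_frag_extend_subset:
  "(\<And>t. t \<in> Poly_Mapping.keys c \<Longrightarrow> Poly_Mapping.keys (f t) \<subseteq> S)
    \<Longrightarrow> Poly_Mapping.keys (frag_extend f c) \<subseteq> S"
  using keys_frag_extend by fastforce

abbreviation sums :: "'a set \<Rightarrow> ('a \<Rightarrow>\<^sub>0 int) set" where
  "sums S \<equiv> {c. Poly_Mapping.keys c \<subseteq> S}"

lemma carrier_free: "carrier (free_Abelian_group S) = sums S"
  by (auto simp: free_Abelian_group_def)

lemma diff_closed_sums: "diff_closed (sums S)"
  unfolding diff_closed_def using keys_diff by fastforce

lemma sums_mem [simp]: "frag_of t \<in> sums S \<longleftrightarrow> t \<in> S"
  by simp

lemma apply_slot_of [simp]: "apply_slot i g (frag_of t) = frag_of (t[i := g (t ! i)])"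
  by (simp add: apply_slot_def)

lemma apply_slot_diff: "apply_slot i g (c - d) = apply_slot i g c - apply_slot i g d"
  by (simp add: apply_slot_def frag_extend_diff)

lemma apply_slot_add: "apply_slot i g (c + d) = apply_slot i g c + apply_slot i g d"
  by (simp add: apply_slot_def frag_extend_add)

lemma apply_slot_frag_extend:
  "apply_slot i g (frag_extend f c) = frag_extend (\<lambda>t. apply_slot i g (f t)) c"
  by (simp add: apply_slot_def frag_extend_compose)

lemma frag_extend_apply_slot:
  "frag_extend f (apply_slot i g c) = frag_extend (\<lambda>t. f (t[i := g (t ! i)])) c"
  by (simp add: apply_slot_def frag_extend_compose)

section \<open>Evaluation of formal sums in an abelian group\<close>

context comm_group
begin

text \<open>Keys may cancel in \<open>c + d\<close>, so the products that define the evaluations of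
  \<open>c\<close>, \<open>d\<close> and \<open>c + d\<close> run over different index sets. A
  common finite superset makes them comparable, since the extra factors are neutral.\<close>

lemma evaluate_superset:
  assumes "finite A" "Poly_Mapping.keys c \<subseteq> A" "\<phi> \<in> A \<rightarrow> carrier G"
  shows "evaluate G \<phi> c = finprod G (\<lambda>t. \<phi> t [^] Poly_Mapping.lookup c t) A"
  unfolding evaluate_def
  by (rule finprod_mono_neutral_cong_left)
    (use assms in \<open>auto simp: Pi_iff in_keys_iff\<close>)

lemma evaluate_hom:
  assumes "\<phi> \<in> S \<rightarrow> carrier G"
  shows "evaluate G \<phi> \<in> hom (free_Abelian_group S) G"
proof (rule homI)
  fix c d assume "c \<in> carrier (free_Abelian_group S)" "d \<in> carrier (free_Abelian_group S)"
  then have cd: "Poly_Mapping.keys c \<subseteq> S" "Poly_Mapping.keys d \<subseteq> S" by auto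
  let ?A = "Poly_Mapping.keys c \<union> Poly_Mapping.keys d"
  have A: "\<phi> \<in> ?A \<rightarrow> carrier G" using cd assms by auto
  have "evaluate G \<phi> (c + d) = finprod G (\<lambda>t. \<phi> t [^] Poly_Mapping.lookup (c + d) t) ?A"
    by (rule evaluate_superset) (use A keys_add[of c d] in auto)
  also have "\<dots> = finprod G (\<lambda>t. \<phi> t [^] Poly_Mapping.lookup c t \<otimes> \<phi> t [^] Poly_Mapping.lookup d t) ?A"
    by (rule finprod_cong') (use A in \<open>auto simp: lookup_add int_pow_mult Pi_iff\<close>)
  also have "\<dots> = evaluate G \<phi> c \<otimes> evaluate G \<phi> d"
    by (subst (1 2) evaluate_superset[of ?A])
      (use A in \<open>auto simp: Pi_iff intro!: finprod_multf\<close>)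
  finally show "evaluate G \<phi> (c \<otimes>\<^bsub>free_Abelian_group S\<^esub> d) = evaluate G \<phi> c \<otimes> evaluate G \<phi> d"
    by simp
next
  fix c assume "c \<in> carrier (free_Abelian_group S)"
  then show "evaluate G \<phi> c \<in> carrier G"
    using assms unfolding evaluate_def by (auto intro!: finprod_closed)
qed

lemma evaluate_of [simp]: "\<phi> t \<in> carrier G \<Longrightarrow> evaluate G \<phi> (frag_of t) = \<phi> t"
  by (simp add: evaluate_def finprod_singleton keys_frag_of)

lemma evaluate_closed: "\<phi> \<in> S \<rightarrow> carrier G \<Longrightarrow> Poly_Mapping.keys c \<subseteq> S \<Longrightarrow> evaluate G \<phi> c \<in> carrier G"
  using evaluate_hom by (fastforce simp: hom_def)

lemma evaluate_add:
  "\<phi> \<in> S \<rightarrow> carrier G \<Longrightarrow> Poly_Mapping.keys c \<subseteq> S \<Longrightarrow> Poly_Mapping.keys d \<subseteq> S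
    \<Longrightarrow> evaluate G \<phi> (c + d) = evaluate G \<phi> c \<otimes> evaluate G \<phi> d"
  using evaluate_hom[of \<phi> S] by (auto simp: hom_def)

lemma evaluate_zero [simp]: "evaluate G \<phi> 0 = \<one>"
  by (simp add: evaluate_def)

lemma evaluate_diff:
  assumes "\<phi> \<in> S \<rightarrow> carrier G" "Poly_Mapping.keys c \<subseteq> S" "Poly_Mapping.keys d \<subseteq> S"
  shows "evaluate G \<phi> (c - d) = evaluate G \<phi> c \<otimes> inv evaluate G \<phi> d"
proof -
  have cd: "Poly_Mapping.keys (c - d) \<subseteq> S" using assms keys_diff by fastforce
  have "evaluate G \<phi> c = evaluate G \<phi> (c - d) \<otimes> evaluate G \<phi> d"
    using evaluate_add[OF assms(1) cd assms(3)] by simp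
  then show ?thesis
    using evaluate_closed[OF assms(1)] assms cd by (simp add: inv_solve_right)
qed

text \<open>Uniqueness in the universal property of the free abelian group. Iterated evaluations,
  and images of evaluations under homomorphisms, are identified by recognizing both sides as
  homomorphisms with equal values on generators.\<close>

lemma evaluate_unique:
  assumes "F \<in> hom (free_Abelian_group S) G" "\<And>t. t \<in> S \<Longrightarrow> F (frag_of t) = \<phi> t"
    "Poly_Mapping.keys c \<subseteq> S"
  shows "F c = evaluate G \<phi> c"
proof -
  interpret F: group_hom "free_Abelian_group S" G F
    using assms(1) by (simp add: group_hom_def group_hom_axioms_def is_group)
  have phi: "\<phi> \<in> S \<rightarrow> carrier G"
    using F.hom_closed[OF frag_of_in_free_Abelian_group[THEN iffD2]] assms(2) by (metis Pi_I)
  have "Poly_Mapping.keys c \<subseteq> S \<and> F c = evaluate G \<phi> c"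
    using assms(3)
  proof (induction c rule: frag_induction)
    case zero then show ?case using F.hom_one by simp
  next
    case (one x)
    then have "\<phi> x \<in> carrier G" using phi by auto
    with one show ?case using assms(2) by (simp add: keys_frag_of)
  next
    case (diff a b)
    then have ab: "Poly_Mapping.keys (a - b) \<subseteq> S" using keys_diff by fastforce
    have "F (a - b) \<otimes> F b = F a" using F.hom_mult[of "a - b" b] ab diff by simp
    then have "F (a - b) = F a \<otimes> inv (F b)"
      using ab diff F.hom_closed[of a] F.hom_closed[of b] F.hom_closed[of "a - b"]
      by (simp add: inv_solve_right)
    then show ?case using ab diff evaluate_diff[OF phi] by simp
  qed
  then show ?thesis by simp
qed

lemma evaluate_hom_comp:
  assumes "comm_group H" "h \<in> hom H G" "\<phi> \<in> S \<rightarrow> carrier H" "Poly_Mapping.keys c \<subseteq> S"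
  shows "h (evaluate H \<phi> c) = evaluate G (\<lambda>t. h (\<phi> t)) c"
proof -
  interpret H: comm_group H by fact
  have "h \<circ> evaluate H \<phi> \<in> hom (free_Abelian_group S) G"
    by (rule Group.hom_compose[OF H.evaluate_hom[OF assms(3)] assms(2)])
  then show ?thesis
    using evaluate_unique[of "h \<circ> evaluate H \<phi>" S "\<lambda>t. h (\<phi> t)" c] assms(3,4)
    by (simp add: Pi_iff)
qed

lemma evaluate_frag_extend:
  assumes "\<phi> \<in> T \<rightarrow> carrier G" "\<And>t. t \<in> S \<Longrightarrow> Poly_Mapping.keys (f t) \<subseteq> T" "Poly_Mapping.keys c \<subseteq> S"
  shows "evaluate G \<phi> (frag_extend f c) = evaluate G (\<lambda>t. evaluate G \<phi> (f t)) c"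
proof -
  have "frag_extend f \<in> hom (free_Abelian_group S) (free_Abelian_group T)"
    using assms(2)
    by (intro homI) (simp_all add: frag_extend_add keys_frag_extend_subset subsetD[where B = S])
  then have "evaluate G \<phi> \<circ> frag_extend f \<in> hom (free_Abelian_group S) G"
    by (rule Group.hom_compose[OF _ evaluate_hom[OF assms(1)]])
  then show ?thesis
    using evaluate_unique[of "evaluate G \<phi> \<circ> frag_extend f" S "\<lambda>t. evaluate G \<phi> (f t)" c] assms(3)
    by simp
qed

lemma evaluate_cong:
  assumes "\<And>t. t \<in> Poly_Mapping.keys c \<Longrightarrow> \<phi> t = \<psi> t" "\<psi> \<in> Poly_Mapping.keys c \<rightarrow> carrier G"
  shows "evaluate G \<phi> c = evaluate G \<psi> c"
  unfolding evaluate_def by (rule finprod_cong') (use assms in \<open>auto simp: Pi_iff\<close>)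

end


section \<open>Tuples, multilinearity relations and their quotients\<close>

section \<open>Tuples and relations\<close>

lemma tuples_list_all2: "tuples Ms = {t. list_all2 (\<lambda>a M. a \<in> carrier M) t Ms}"
  by (auto simp: tuples_def list_all2_conv_all_nth)

lemma tuples_Nil [simp]: "t \<in> tuples [] \<longleftrightarrow> t = []"
  by (simp add: tuples_list_all2)

lemma tuples_Cons [simp]: "a # t \<in> tuples (M # Ms) \<longleftrightarrow> a \<in> carrier M \<and> t \<in> tuples Ms"
  by (simp add: tuples_list_all2)

lemma tuples_ConsE:
  assumes "t \<in> tuples (M # Ms)"
  obtains a u where "t = a # u" "a \<in> carrier M" "u \<in> tuples Ms"
  using assms by (auto simp: tuples_list_all2 list_all2_Cons2)

lemma tuples_length: "t \<in> tuples Ms \<Longrightarrow> length t = length Ms"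
  by (simp add: tuples_def)

lemma tuples_appendI: "t \<in> tuples Ms \<Longrightarrow> u \<in> tuples Ns \<Longrightarrow> t @ u \<in> tuples (Ms @ Ns)"
  by (simp add: tuples_list_all2 list_all2_appendI)

lemma tuples_appendE:
  assumes "t \<in> tuples (Ms @ Ns)"
  obtains u v where "t = u @ v" "u \<in> tuples Ms" "v \<in> tuples Ns"
  using assms by (auto simp: tuples_list_all2 list_all2_append2)

lemma tuples_append_iff:
  "length t = length Ms \<Longrightarrow> t @ u \<in> tuples (Ms @ Ns) \<longleftrightarrow> t \<in> tuples Ms \<and> u \<in> tuples Ns"
  by (auto simp: tuples_list_all2 list_all2_append)

lemma tuples_nth: "t \<in> tuples Ms \<Longrightarrow> i < length Ms \<Longrightarrow> t ! i \<in> carrier (Ms ! i)"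
  by (simp add: tuples_def)

lemma tuples_update: "t \<in> tuples Ms \<Longrightarrow> (i < length Ms \<Longrightarrow> a \<in> carrier (Ms ! i)) \<Longrightarrow> t[i := a] \<in> tuples Ms"
  by (auto simp: tuples_def nth_list_update) (metis nth_list_update_eq nth_list_update_neq)

lemma tuples_splitE:
  assumes "t \<in> tuples Ms" "i < length Ms"
  obtains Ms1 M Ms2 t1 a t2 where "Ms = Ms1 @ M # Ms2" "t = t1 @ a # t2" "length Ms1 = i"
    "t1 \<in> tuples Ms1" "a \<in> carrier M" "t2 \<in> tuples Ms2"
proof -
  have Ms: "Ms = take i Ms @ Ms ! i # drop (Suc i) Ms" using assms(2) by (simp add: id_take_nth_drop)
  with assms(1) have "t \<in> tuples (take i Ms @ Ms ! i # drop (Suc i) Ms)" by simp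
  then obtain t1 v where t: "t = t1 @ v" "t1 \<in> tuples (take i Ms)" "v \<in> tuples (Ms ! i # drop (Suc i) Ms)"
    by (rule tuples_appendE)
  obtain a t2 where "v = a # t2" "a \<in> carrier (Ms ! i)" "t2 \<in> tuples (drop (Suc i) Ms)"
    using t(3) by (rule tuples_ConsE)
  with Ms t show ?thesis using that[of "take i Ms" "Ms ! i" "drop (Suc i) Ms" t1 a t2] assms(2) by simp
qed

text \<open>The generators are defined by updating position \<open>i\<close> of a tuple. Splitting
  the lists around that position makes the relations compatible with \<open>@\<close>, which
  flattening and contraction of tuples require.\<close>

lemma tensor_rels_multilinear:
  assumes "t \<in> tuples Ms1" "u \<in> tuples Ms2" "a \<in> carrier M" "b \<in> carrier M"
  shows "frag_of (t @ (a \<otimes>\<^bsub>M\<^esub> b) # u) - frag_of (t @ a # u) - frag_of (t @ b # u)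
    \<in> tensor_rels (Ms1 @ M # Ms2) B"
proof -
  have "t @ a # u \<in> tuples (Ms1 @ M # Ms2)" using assms by (simp add: tuples_appendI)
  then have "frag_of ((t @ a # u)[length t := a \<otimes>\<^bsub>M\<^esub> b]) - frag_of ((t @ a # u)[length t := a])
     - frag_of ((t @ a # u)[length t := b]) \<in> multilinear_rels (Ms1 @ M # Ms2)"
    unfolding multilinear_rels_def using assms tuples_length[of t Ms1]
    by (intro CollectI exI[of _ "t @ a # u"] exI[of _ "length t"] exI[of _ a] exI[of _ b])
      (auto simp: nth_append)
  then show ?thesis unfolding tensor_rels_def by (auto intro!: generate.incl)
qed

lemma tensor_rels_incl: "B \<subseteq> tensor_rels Ms B"
  unfolding tensor_rels_def by (auto intro: generate.incl)

context
  fixes Ms :: "('a, 'x) monoid_scheme list" and B :: "('a list \<Rightarrow>\<^sub>0 int) set"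
  assumes grp: "\<forall>M\<in>set Ms. comm_group M" and B: "B \<subseteq> sums (tuples Ms)"
begin

lemma tensor_gens_subset: "multilinear_rels Ms \<union> B \<subseteq> sums (tuples Ms)"
proof -
  have "frag_of (t[i := a \<otimes>\<^bsub>Ms ! i\<^esub> b]) - frag_of (t[i := a]) - frag_of (t[i := b]) \<in> sums (tuples Ms)"
    if "t \<in> tuples Ms" "i < length Ms" "a \<in> carrier (Ms ! i)" "b \<in> carrier (Ms ! i)" for t i a b
  proof -
    have "a \<otimes>\<^bsub>Ms ! i\<^esub> b \<in> carrier (Ms ! i)"
      using bspec[OF grp, of "Ms ! i"] that by (simp add: comm_group_def comm_monoid_def monoid.m_closed)
    then show ?thesis
      using that by (intro diff_closedD[OF diff_closed_sums]) (auto intro: tuples_update)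
  qed
  then have "multilinear_rels Ms \<subseteq> sums (tuples Ms)"
    unfolding multilinear_rels_def by blast
  then show ?thesis using B by blast
qed

lemma tensor_rels_subset: "tensor_rels Ms B \<subseteq> sums (tuples Ms)"
  unfolding tensor_rels_def
  using group.generate_incl[OF group_free_Abelian_group] tensor_gens_subset
  by (metis carrier_free)

lemma diff_closed_tensor_rels: "diff_closed (tensor_rels Ms B)"
proof -
  interpret F: group "free_Abelian_group (tuples Ms)" by simp
  have sub: "subgroup (tensor_rels Ms B) (free_Abelian_group (tuples Ms))"
    unfolding tensor_rels_def by (rule F.generate_is_subgroup) (metis carrier_free tensor_gens_subset)
  have "x - y \<in> tensor_rels Ms B" if "x \<in> tensor_rels Ms B" "y \<in> tensor_rels Ms B" for x y
  proof -
    have "x \<otimes>\<^bsub>free_Abelian_group (tuples Ms)\<^esub> inv\<^bsub>free_Abelian_group (tuples Ms)\<^esub> y \<in> tensor_rels Ms B"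
      using sub that by (meson subgroup.m_closed subgroup.m_inv_closed)
    moreover have "Poly_Mapping.keys y \<subseteq> tuples Ms" using that tensor_rels_subset by auto
    ultimately show ?thesis by simp
  qed
  then show ?thesis
    using subgroup.one_closed[OF sub] by (auto simp: diff_closed_def)
qed

text \<open>Induction over the generated subgroup. The set \<open>H\<close> is any subgroup of
  formal sums, typically the preimage of other relations under a linear extension, or the kernel of
  an evaluation.\<close>

lemma tensor_rels_least:
  assumes H: "diff_closed H"
    and mult: "\<And>Ms1 M Ms2 t u a b. \<lbrakk>Ms = Ms1 @ M # Ms2; t \<in> tuples Ms1; u \<in> tuples Ms2;
      a \<in> carrier M; b \<in> carrier M\<rbrakk>
      \<Longrightarrow> frag_of (t @ (a \<otimes>\<^bsub>M\<^esub> b) # u) - frag_of (t @ a # u) - frag_of (t @ b # u) \<in> H"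
    and BH: "B \<subseteq> H"
  shows "tensor_rels Ms B \<subseteq> H"
proof
  fix c assume "c \<in> tensor_rels Ms B"
  then have "c \<in> generate (free_Abelian_group (tuples Ms)) (multilinear_rels Ms \<union> B)"
    by (simp add: tensor_rels_def)
  moreover have gens: "multilinear_rels Ms \<union> B \<subseteq> H"
  proof -
    have "frag_of (t[i := a \<otimes>\<^bsub>Ms ! i\<^esub> b]) - frag_of (t[i := a]) - frag_of (t[i := b]) \<in> H"
      if t: "t \<in> tuples Ms" and i: "i < length Ms" and ab: "a \<in> carrier (Ms ! i)" "b \<in> carrier (Ms ! i)"
      for t i a b
    proof -
      obtain Ms1 M Ms2 t1 a' t2 where *: "Ms = Ms1 @ M # Ms2" "t = t1 @ a' # t2" "length Ms1 = i"
        "t1 \<in> tuples Ms1" "a' \<in> carrier M" "t2 \<in> tuples Ms2"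
        using tuples_splitE[OF t i] by blast
      have "length t1 = i" using * tuples_length by metis
      then show ?thesis using mult[OF *(1,4,6), of a b] ab * by (auto simp: nth_append)
    qed
    then show ?thesis using BH by (auto simp: multilinear_rels_def)
  qed
  ultimately show "c \<in> H"
  proof (induction rule: generate.induct)
    \<comment> \<open>The inverse of the free abelian group is known to be negation on its carrier,
      so the generators have to be placed there.\<close>
    case (inv h)
    then have "Poly_Mapping.keys h \<subseteq> tuples Ms" using tensor_gens_subset by auto
    then show ?case using inv diff_closedD(3)[OF H, of h] by auto
  qed (use diff_closedD[OF H] in auto)
qed

lemma tclass_eq_iff: "tclass Ms B c = tclass Ms B d \<longleftrightarrow> c - d \<in> tensor_rels Ms B"
proof -
  let ?K = "tensor_rels Ms B"
  note K = diff_closed_tensor_rels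
  have cl: "tclass Ms B c = {k + c | k. k \<in> ?K}" for c
    by (auto simp: tclass_def r_coset_def)
  show ?thesis
  proof
    assume "tclass Ms B c = tclass Ms B d"
    moreover have "c \<in> tclass Ms B c" unfolding cl using diff_closedD(1)[OF K] by force
    ultimately obtain k where "k \<in> ?K" "c = k + d" unfolding cl by auto
    then show "c - d \<in> ?K" by simp
  next
    assume *: "c - d \<in> ?K"
    have "k + c \<in> tclass Ms B d" if "k \<in> ?K" for k
      unfolding cl using diff_closedD(4)[OF K that *]
      by (intro CollectI exI[of _ "k + (c - d)"]) simp
    moreover have "k + d \<in> tclass Ms B c" if "k \<in> ?K" for k
      unfolding cl using diff_closedD(2)[OF K that *]
      by (intro CollectI exI[of _ "k - (c - d)"]) simp
    ultimately show "tclass Ms B c = tclass Ms B d"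
      unfolding cl by auto
  qed
qed

lemma mult_tclass: "monoid.mult (tensor Ms B) (tclass Ms B c) (tclass Ms B d) = tclass Ms B (c + d)"
proof -
  let ?K = "tensor_rels Ms B"
  note K = diff_closed_tensor_rels
  have cl: "tclass Ms B c = {k + c | k. k \<in> ?K}" for c
    by (auto simp: tclass_def r_coset_def)
  have "k + (c + d) \<in> {k + c + (k' + d) | k k'. k \<in> ?K \<and> k' \<in> ?K}" if "k \<in> ?K" for k
    using that diff_closedD(1)[OF K]
    by (intro CollectI exI[of _ k] exI[of _ 0]) (auto simp: algebra_simps)
  moreover have "k + c + (k' + d) \<in> tclass Ms B (c + d)" if "k \<in> ?K" "k' \<in> ?K" for k k'
    unfolding cl using diff_closedD(4)[OF K that]
    by (intro CollectI exI[of _ "k + k'"]) (auto simp: algebra_simps)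
  moreover have "tclass Ms B c <#>\<^bsub>free_Abelian_group (tuples Ms)\<^esub> tclass Ms B d
      = {k + c + (k' + d) | k k'. k \<in> ?K \<and> k' \<in> ?K}"
    unfolding cl by (auto simp: set_mult_def)
  ultimately show ?thesis
    by (auto simp: tensor_def FactGroup_def cl)
qed

lemma one_tensor: "\<one>\<^bsub>tensor Ms B\<^esub> = tclass Ms B 0"
  by (auto simp: tensor_def FactGroup_def tclass_def r_coset_def)

lemma carrier_tensor: "carrier (tensor Ms B) = tclass Ms B ` sums (tuples Ms)"
  by (auto simp: tensor_def FactGroup_def tclass_def RCOSETS_def)

text \<open>A representative is an arbitrary element of its coset, hence determined only up to
  relations; all actions on the quotients pass through such a choice.\<close>

lemma tclass_representative:
  shows "tclass Ms B (representative (tclass Ms B c)) = tclass Ms B c"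
    and "representative (tclass Ms B c) - c \<in> tensor_rels Ms B"
    and "c \<in> sums (tuples Ms) \<Longrightarrow> representative (tclass Ms B c) \<in> sums (tuples Ms)"
proof -
  have "c \<in> tclass Ms B c"
    using diff_closedD(1)[OF diff_closed_tensor_rels] by (force simp: tclass_def r_coset_def)
  then have "representative (tclass Ms B c) \<in> tclass Ms B c"
    unfolding representative_def by (rule someI)
  then show *: "representative (tclass Ms B c) - c \<in> tensor_rels Ms B"
    by (auto simp: tclass_def r_coset_def)
  then show "tclass Ms B (representative (tclass Ms B c)) = tclass Ms B c"
    by (simp add: tclass_eq_iff)
  show "representative (tclass Ms B c) \<in> sums (tuples Ms)" if "c \<in> sums (tuples Ms)"
    using diff_closedD(4)[OF diff_closed_sums _ that, of "representative (tclass Ms B c) - c"]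
      * tensor_rels_subset by auto
qed

end

section \<open>Operations on a single slot of a tuple\<close>

lemma apply_slot_sums:
  assumes "c \<in> sums (tuples Ms)" "i < length Ms" "\<And>a. a \<in> carrier (Ms ! i) \<Longrightarrow> h a \<in> carrier (Ms ! i)"
  shows "apply_slot i h c \<in> sums (tuples Ms)"
  unfolding apply_slot_def
  using assms by (simp add: keys_frag_extend_subset tuples_update tuples_nth subsetD)

lemma apply_slot_commute:
  assumes "c \<in> sums (tuples Ms)" "i < length Ms" "j < length Ms"
    and "i = j \<Longrightarrow> (\<And>a. a \<in> carrier (Ms ! i) \<Longrightarrow> g (h a) = h (g a))"
  shows "apply_slot i g (apply_slot j h c) = apply_slot j h (apply_slot i g c)"
proof -
  have "apply_slot i g (frag_of (t[j := h (t ! j)])) = apply_slot j h (frag_of (t[i := g (t ! i)]))"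
    if "t \<in> tuples Ms" for t
    using that assms tuples_length[OF that] tuples_nth[OF that]
    by (cases "i = j") (auto simp: list_update_swap)
  then show ?thesis
    using assms(1) unfolding apply_slot_def frag_extend_compose
    by (intro frag_extend_eq) auto
qed

lemma apply_slot_compose:
  assumes "c \<in> sums (tuples Ms)" "i < length Ms"
    and "\<And>a. a \<in> carrier (Ms ! i) \<Longrightarrow> f a = g (h a)"
  shows "apply_slot i f c = apply_slot i g (apply_slot i h c)"
  using assms unfolding apply_slot_def frag_extend_compose
  by (intro frag_extend_eq) (auto simp: tuples_nth subset_iff tuples_length)

lemma apply_slot_id:
  assumes "c \<in> sums (tuples Ms)" "i < length Ms" "\<And>a. a \<in> carrier (Ms ! i) \<Longrightarrow> f a = a"
  shows "apply_slot i f c = c"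
proof -
  have "apply_slot i f c = frag_extend frag_of c"
    unfolding apply_slot_def using assms by (intro frag_extend_eq) (auto simp: tuples_nth subset_iff)
  then show ?thesis by simp
qed

context
  fixes Ms :: "('a, 'x) monoid_scheme list" and B :: "('a list \<Rightarrow>\<^sub>0 int) set"
  assumes grp: "\<forall>M\<in>set Ms. comm_group M" and B: "B \<subseteq> sums (tuples Ms)"
begin

text \<open>An additive operation in one slot carries multilinearity relations to multilinearity
  relations, whether its slot lies before, at or after the slot in which the relation adds. Only the
  additional relations \<open>B\<close> have to be inspected for the particular operation.\<close>

lemma apply_slot_rels:
  assumes i: "i < length Ms" and h: "h \<in> hom (Ms ! i) (Ms ! i)"
    and hB: "\<And>b. b \<in> B \<Longrightarrow> apply_slot i h b \<in> tensor_rels Ms B"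
    and c: "c \<in> tensor_rels Ms B"
  shows "apply_slot i h c \<in> tensor_rels Ms B"
proof -
  let ?K = "tensor_rels Ms B"
  note K = diff_closed_tensor_rels[OF grp B]
  have "?K \<subseteq> {c. apply_slot i h c \<in> ?K}"
  proof (rule tensor_rels_least[OF grp B])
    show "diff_closed {c. apply_slot i h c \<in> ?K}"
      unfolding diff_closed_def by (auto simp: apply_slot_diff diff_closedD[OF K]) (simp add: apply_slot_def diff_closedD[OF K])
    fix Ms1 M Ms2 t u a b
    assume Ms: "Ms = Ms1 @ M # Ms2" and t: "t \<in> tuples Ms1" and u: "u \<in> tuples Ms2"
      and ab: "a \<in> carrier M" "b \<in> carrier M"
    have lt: "length t = length Ms1" using t by (rule tuples_length)
    consider "i < length Ms1" | "i = length Ms1" | k where "i = Suc (length Ms1 + k)" "k < length Ms2"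
      using i Ms less_imp_Suc_add[of "length Ms1" i] by (cases i "length Ms1" rule: linorder_cases) auto
    then show "frag_of (t @ (a \<otimes>\<^bsub>M\<^esub> b) # u) - frag_of (t @ a # u) - frag_of (t @ b # u)
        \<in> {c. apply_slot i h c \<in> ?K}"
    proof cases
      case 1
      then have "t[i := h (t ! i)] \<in> tuples Ms1"
        using tuples_update[OF t, of i] tuples_nth[OF t, of i] h Ms by (auto simp: hom_def nth_append)
      from tensor_rels_multilinear[OF this u ab] 1 lt show ?thesis
        by (simp add: apply_slot_diff list_update_append nth_append Ms)
    next
      case 2
      then have "h a \<in> carrier M" "h b \<in> carrier M" "h (a \<otimes>\<^bsub>M\<^esub> b) = h a \<otimes>\<^bsub>M\<^esub> h b"
        using h ab Ms by (auto simp: hom_def)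
      with tensor_rels_multilinear[OF t u this(1,2)] 2 lt show ?thesis
        by (simp add: apply_slot_diff list_update_append nth_append Ms)
    next
      case 3
      then have "u[k := h (u ! k)] \<in> tuples Ms2"
        using tuples_update[OF u, of k] tuples_nth[OF u, of k] h Ms by (auto simp: hom_def nth_append)
      from tensor_rels_multilinear[OF t this ab] 3 lt show ?thesis
        by (simp add: apply_slot_diff list_update_append nth_append Ms)
    qed
  qed (use hB in auto)
  then show ?thesis using c by auto
qed

text \<open>Formal sums do not add entries of tuples, so additivity of an action in the scalar
  appears only modulo multilinearity.\<close>

lemma apply_slot_sum:
  assumes "c \<in> sums (tuples Ms)" "i < length Ms"
    and "\<And>a. a \<in> carrier (Ms ! i) \<Longrightarrow> f a = g a \<otimes>\<^bsub>Ms ! i\<^esub> h a"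
    and g: "\<And>a. a \<in> carrier (Ms ! i) \<Longrightarrow> g a \<in> carrier (Ms ! i)"
    and h: "\<And>a. a \<in> carrier (Ms ! i) \<Longrightarrow> h a \<in> carrier (Ms ! i)"
  shows "apply_slot i f c - (apply_slot i g c + apply_slot i h c) \<in> tensor_rels Ms B"
proof -
  let ?F = "\<lambda>t. frag_of (t[i := f (t ! i)]) - frag_of (t[i := g (t ! i)]) - frag_of (t[i := h (t ! i)])"
  have "?F t \<in> tensor_rels Ms B" if t: "t \<in> tuples Ms" for t
  proof -
    obtain Ms1 M Ms2 t1 a t2 where *: "Ms = Ms1 @ M # Ms2" "t = t1 @ a # t2" "length Ms1 = i"
      "t1 \<in> tuples Ms1" "a \<in> carrier M" "t2 \<in> tuples Ms2"
      using tuples_splitE[OF t assms(2)] by blast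
    have "length t1 = i" "Ms ! i = M" using * tuples_length by auto
    then show ?thesis using tensor_rels_multilinear[OF *(4,6) g h, of a a] * assms(3)[of a]
      by (simp add: nth_append list_update_append)
  qed
  then have "frag_extend ?F c \<in> tensor_rels Ms B"
    using assms(1) by (intro frag_extend_mem[OF diff_closed_tensor_rels[OF grp B]]) auto
  then show ?thesis
    unfolding frag_extend_fun_diff apply_slot_def by (simp only: diff_diff_eq)
qed

end


section \<open>Bimodule structures on subquotients of free abelian groups\<close>

section \<open>Bimodules given by quotients\<close>

text \<open>The part of an action through one slot that is common to left and right actions of R and
  of its opposite. Multiplicativity is kept apart, because the order of the scalars differs between
  the four actions.\<close>

definition slot_action ::
    "('a, 'x) monoid_scheme list \<Rightarrow> ('a list \<Rightarrow>\<^sub>0 int) set \<Rightarrow> nat \<Rightarrow> ('r::{ring,monoid_mult} \<Rightarrow> 'a \<Rightarrow> 'a) \<Rightarrow> bool" where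
  "slot_action Ms B i g \<longleftrightarrow> i < length Ms \<and> (\<forall>r. g r \<in> hom (Ms ! i) (Ms ! i)) \<and>
     (\<forall>r s. \<forall>a\<in>carrier (Ms ! i). g (r + s) a = g r a \<otimes>\<^bsub>Ms ! i\<^esub> g s a) \<and>
     (\<forall>a\<in>carrier (Ms ! i). g 1 a = a) \<and>
     (\<forall>r. \<forall>b\<in>B. apply_slot i (g r) b \<in> tensor_rels Ms B)"

text \<open>The raw bimodules act through a chosen representative. The slot operation preserves the
  relations, so every formal sum in the class gives the same result.\<close>

lemma slot_action_tclass:
  assumes "\<forall>M\<in>set Ms. comm_group M" "B \<subseteq> sums (tuples Ms)" "slot_action Ms B i g"
  shows "tclass Ms B (apply_slot i (g r) (representative (tclass Ms B c))) = tclass Ms B (apply_slot i (g r) c)"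
proof -
  have "apply_slot i (g r) (representative (tclass Ms B c) - c) \<in> tensor_rels Ms B"
    by (rule apply_slot_rels[OF assms(1,2)])
      (use assms tclass_representative(2)[OF assms(1,2)] in \<open>auto simp: slot_action_def\<close>)
  then show ?thesis
    by (simp add: tclass_eq_iff[OF assms(1,2)] apply_slot_diff)
qed

text \<open>Associativity, unit laws and commutation of the actions already hold for formal sums,
  whereas additivity in the scalar holds only for classes. Hence \<open>cl\<close> appears in the
  scalar laws and not in the other module laws.\<close>

lemma bimodule_image:
  assumes C: "diff_closed C"
    and carrier: "carrier Q = cl ` C"
    and mult: "\<And>c d. c \<in> C \<Longrightarrow> d \<in> C \<Longrightarrow> cl c \<otimes>\<^bsub>Q\<^esub> cl d = cl (c + d)" and one: "\<one>\<^bsub>Q\<^esub> = cl 0"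
    and ops: "\<And>c r. c \<in> C \<Longrightarrow> lact Q r (cl c) = cl (L r c)" "\<And>c r. c \<in> C \<Longrightarrow> lbar Q r (cl c) = cl (LB r c)"
      "\<And>c r. c \<in> C \<Longrightarrow> ract Q (cl c) r = cl (R r c)" "\<And>c r. c \<in> C \<Longrightarrow> rbar Q (cl c) r = cl (RB r c)"
    and closed: "\<And>c r. c \<in> C \<Longrightarrow> L r c \<in> C" "\<And>c r. c \<in> C \<Longrightarrow> LB r c \<in> C"
      "\<And>c r. c \<in> C \<Longrightarrow> R r c \<in> C" "\<And>c r. c \<in> C \<Longrightarrow> RB r c \<in> C"
    and additive: "\<And>c d r. L r (c + d) = L r c + L r d" "\<And>c d r. LB r (c + d) = LB r c + LB r d"
      "\<And>c d r. R r (c + d) = R r c + R r d" "\<And>c d r. RB r (c + d) = RB r c + RB r d"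
    and scalar: "\<And>c r s. c \<in> C \<Longrightarrow> cl (L (r + s) c) = cl (L r c + L s c)"
      "\<And>c r s. c \<in> C \<Longrightarrow> cl (LB (r + s) c) = cl (LB r c + LB s c)"
      "\<And>c r s. c \<in> C \<Longrightarrow> cl (R (r + s) c) = cl (R r c + R s c)"
      "\<And>c r s. c \<in> C \<Longrightarrow> cl (RB (r + s) c) = cl (RB r c + RB s c)"
    and unital: "\<And>c. c \<in> C \<Longrightarrow> L 1 c = c" "\<And>c. c \<in> C \<Longrightarrow> LB 1 c = c"
      "\<And>c. c \<in> C \<Longrightarrow> R 1 c = c" "\<And>c. c \<in> C \<Longrightarrow> RB 1 c = c"
    and act_mult: "\<And>c r s. c \<in> C \<Longrightarrow> L (r * s) c = L r (L s c)" "\<And>c r s. c \<in> C \<Longrightarrow> LB (s * r) c = LB r (LB s c)"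
      "\<And>c r s. c \<in> C \<Longrightarrow> R (r * s) c = R s (R r c)" "\<And>c r s. c \<in> C \<Longrightarrow> RB (s * r) c = RB s (RB r c)"
    and comm: "\<And>c r s. c \<in> C \<Longrightarrow> L r (LB s c) = LB s (L r c)" "\<And>c r s. c \<in> C \<Longrightarrow> R r (RB s c) = RB s (R r c)"
      "\<And>c r s. c \<in> C \<Longrightarrow> L r (R s c) = R s (L r c)" "\<And>c r s. c \<in> C \<Longrightarrow> L r (RB s c) = RB s (L r c)"
      "\<And>c r s. c \<in> C \<Longrightarrow> LB r (R s c) = R s (LB r c)" "\<And>c r s. c \<in> C \<Longrightarrow> LB r (RB s c) = RB s (LB r c)"
  shows "bimodule Q"
proof -
  note Cs = diff_closedD[OF C]
  have "comm_group Q"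
  proof (rule comm_groupI)
    fix x assume "x \<in> carrier Q"
    then obtain c where "c \<in> C" "x = cl c" by (auto simp: carrier)
    then show "\<exists>y\<in>carrier Q. y \<otimes>\<^bsub>Q\<^esub> x = \<one>\<^bsub>Q\<^esub>"
      by (intro bexI[of _ "cl (- c)"]) (auto simp: carrier mult one Cs)
  qed (auto simp: carrier mult one Cs add_ac)
  then show ?thesis
    by (intro bimodule.intro bimodule_axioms.intro)
      (auto simp: carrier mult Cs ops closed additive scalar unital act_mult comm)
qed

text \<open>One construction serves R^e, the tensor product over R^e and the Takeuchi products: a
  subgroup \<open>C\<close> of formal sums, with each of the four actions living in a slot of its
  own. Commutation is demanded of actions that share a slot; operations on different slots commute
  by themselves.\<close>

lemma slot_quotient_bimodule:
  fixes Ms :: "('a, 'x) monoid_scheme list" and Q :: "('r::{ring,monoid_mult}, ('a list \<Rightarrow>\<^sub>0 int) set) bimod"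
  assumes grp: "\<forall>M\<in>set Ms. comm_group M" and B: "B \<subseteq> sums (tuples Ms)"
    and act: "slot_action Ms B i1 L" "slot_action Ms B i2 LB" "slot_action Ms B i3 R" "slot_action Ms B i4 RB"
    and C: "diff_closed C" "C \<subseteq> sums (tuples Ms)"
      "\<And>c r. c \<in> C \<Longrightarrow> apply_slot i1 (L r) c \<in> C" "\<And>c r. c \<in> C \<Longrightarrow> apply_slot i2 (LB r) c \<in> C"
      "\<And>c r. c \<in> C \<Longrightarrow> apply_slot i3 (R r) c \<in> C" "\<And>c r. c \<in> C \<Longrightarrow> apply_slot i4 (RB r) c \<in> C"
    and carrier: "carrier Q = tclass Ms B ` C"
    and mult: "monoid.mult Q = monoid.mult (tensor Ms B)" and one: "\<one>\<^bsub>Q\<^esub> = \<one>\<^bsub>tensor Ms B\<^esub>"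
    and ops: "\<And>X r. lact Q r X = tclass Ms B (apply_slot i1 (L r) (representative X))"
      "\<And>X r. lbar Q r X = tclass Ms B (apply_slot i2 (LB r) (representative X))"
      "\<And>X r. ract Q X r = tclass Ms B (apply_slot i3 (R r) (representative X))"
      "\<And>X r. rbar Q X r = tclass Ms B (apply_slot i4 (RB r) (representative X))"
    and act_mult:
      "\<And>a r s. a \<in> carrier (Ms ! i1) \<Longrightarrow> L (r * s) a = L r (L s a)"
      "\<And>a r s. a \<in> carrier (Ms ! i2) \<Longrightarrow> LB (s * r) a = LB r (LB s a)"
      "\<And>a r s. a \<in> carrier (Ms ! i3) \<Longrightarrow> R (r * s) a = R s (R r a)"
      "\<And>a r s. a \<in> carrier (Ms ! i4) \<Longrightarrow> RB (s * r) a = RB s (RB r a)"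
    and comm:
      "\<And>a r s. i1 = i2 \<Longrightarrow> a \<in> carrier (Ms ! i1) \<Longrightarrow> L r (LB s a) = LB s (L r a)"
      "\<And>a r s. i3 = i4 \<Longrightarrow> a \<in> carrier (Ms ! i3) \<Longrightarrow> R r (RB s a) = RB s (R r a)"
      "\<And>a r s. i1 = i3 \<Longrightarrow> a \<in> carrier (Ms ! i1) \<Longrightarrow> L r (R s a) = R s (L r a)"
      "\<And>a r s. i1 = i4 \<Longrightarrow> a \<in> carrier (Ms ! i1) \<Longrightarrow> L r (RB s a) = RB s (L r a)"
      "\<And>a r s. i2 = i3 \<Longrightarrow> a \<in> carrier (Ms ! i2) \<Longrightarrow> LB r (R s a) = R s (LB r a)"
      "\<And>a r s. i2 = i4 \<Longrightarrow> a \<in> carrier (Ms ! i2) \<Longrightarrow> LB r (RB s a) = RB s (LB r a)"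
  shows "bimodule Q"
proof -
  have opsc: "\<And>c r. lact Q r (tclass Ms B c) = tclass Ms B (apply_slot i1 (L r) c)"
    "\<And>c r. lbar Q r (tclass Ms B c) = tclass Ms B (apply_slot i2 (LB r) c)"
    "\<And>c r. ract Q (tclass Ms B c) r = tclass Ms B (apply_slot i3 (R r) c)"
    "\<And>c r. rbar Q (tclass Ms B c) r = tclass Ms B (apply_slot i4 (RB r) c)"
    by (simp_all add: ops slot_action_tclass[OF grp B act(1)] slot_action_tclass[OF grp B act(2)]
        slot_action_tclass[OF grp B act(3)] slot_action_tclass[OF grp B act(4)])
  have len: "i1 < length Ms" "i2 < length Ms" "i3 < length Ms" "i4 < length Ms"
    using act by (auto simp: slot_action_def)
  have Cs: "c \<in> C \<Longrightarrow> c \<in> sums (tuples Ms)" for c using C(2) by auto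
  have scalar: "tclass Ms B (apply_slot i (g (r + s)) c) = tclass Ms B (apply_slot i (g r) c + apply_slot i (g s) c)"
    if "slot_action Ms B i g" "c \<in> C" for i and g :: "'r \<Rightarrow> 'a \<Rightarrow> 'a" and r s c
    unfolding tclass_eq_iff[OF grp B]
    by (rule apply_slot_sum[OF grp B Cs[OF that(2)]]) (use that in \<open>auto simp: slot_action_def hom_def\<close>)
  have unital: "apply_slot i (g 1) c = c"
    if "slot_action Ms B i g" "c \<in> C" for i and g :: "'r \<Rightarrow> 'a \<Rightarrow> 'a" and c
    by (rule apply_slot_id[OF Cs[OF that(2)]]) (use that in \<open>auto simp: slot_action_def\<close>)
  have comp:
    "\<And>c r s. c \<in> C \<Longrightarrow> apply_slot i1 (L (r * s)) c = apply_slot i1 (L r) (apply_slot i1 (L s) c)"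
    "\<And>c r s. c \<in> C \<Longrightarrow> apply_slot i2 (LB (s * r)) c = apply_slot i2 (LB r) (apply_slot i2 (LB s) c)"
    "\<And>c r s. c \<in> C \<Longrightarrow> apply_slot i3 (R (r * s)) c = apply_slot i3 (R s) (apply_slot i3 (R r) c)"
    "\<And>c r s. c \<in> C \<Longrightarrow> apply_slot i4 (RB (s * r)) c = apply_slot i4 (RB s) (apply_slot i4 (RB r) c)"
    by (rule apply_slot_compose; (rule Cs len act_mult; assumption | rule len))+
  have comms:
    "\<And>c r s. c \<in> C \<Longrightarrow> apply_slot i1 (L r) (apply_slot i2 (LB s) c) = apply_slot i2 (LB s) (apply_slot i1 (L r) c)"
    "\<And>c r s. c \<in> C \<Longrightarrow> apply_slot i3 (R r) (apply_slot i4 (RB s) c) = apply_slot i4 (RB s) (apply_slot i3 (R r) c)"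
    "\<And>c r s. c \<in> C \<Longrightarrow> apply_slot i1 (L r) (apply_slot i3 (R s) c) = apply_slot i3 (R s) (apply_slot i1 (L r) c)"
    "\<And>c r s. c \<in> C \<Longrightarrow> apply_slot i1 (L r) (apply_slot i4 (RB s) c) = apply_slot i4 (RB s) (apply_slot i1 (L r) c)"
    "\<And>c r s. c \<in> C \<Longrightarrow> apply_slot i2 (LB r) (apply_slot i3 (R s) c) = apply_slot i3 (R s) (apply_slot i2 (LB r) c)"
    "\<And>c r s. c \<in> C \<Longrightarrow> apply_slot i2 (LB r) (apply_slot i4 (RB s) c) = apply_slot i4 (RB s) (apply_slot i2 (LB r) c)"
    by (rule apply_slot_commute; (rule Cs comm; assumption | rule len))+
  show ?thesis
    by (rule bimodule_image[OF C(1) carrier, where L = "\<lambda>r. apply_slot i1 (L r)" and LB = "\<lambda>r. apply_slot i2 (LB r)"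
          and R = "\<lambda>r. apply_slot i3 (R r)" and RB = "\<lambda>r. apply_slot i4 (RB r)"])
      (simp_all add: mult one mult_tclass[OF grp B] one_tensor[OF grp B] opsc C(3-6) apply_slot_add
        scalar[OF act(1)] scalar[OF act(2)] scalar[OF act(3)] scalar[OF act(4)]
        unital[OF act(1)] unital[OF act(2)] unital[OF act(3)] unital[OF act(4)]
        comp comms)
qed

lemma bimodule_comm_group: "bimodule M \<Longrightarrow> comm_group M"
  by (simp add: bimodule_def)


subsection \<open>Transport into the universe\<close>

lemma enc_inj: "\<exists>f :: 'b \<Rightarrow> 'u. inj_on f A \<Longrightarrow> inj_on (enc A :: 'b \<Rightarrow> 'u) A"
  unfolding enc_def by (erule someI_ex)

lemma dec_enc: "\<exists>f :: 'b \<Rightarrow> 'u. inj_on f A \<Longrightarrow> x \<in> A \<Longrightarrow> dec A (enc A x :: 'u) = x"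
  unfolding dec_def by (rule the_inv_into_f_f[OF enc_inj])

lemma small_simps:
  assumes "\<exists>f :: 'b \<Rightarrow> 'u. inj_on f (carrier M)"
  shows "carrier (small M :: ('r, 'u) bimod) = enc (carrier M) ` carrier M"
    and "x \<in> carrier M \<Longrightarrow> y \<in> carrier M \<Longrightarrow>
      enc (carrier M) x \<otimes>\<^bsub>small M :: ('r, 'u) bimod\<^esub> enc (carrier M) y = enc (carrier M) (x \<otimes>\<^bsub>M\<^esub> y)"
    and "\<one>\<^bsub>small M :: ('r, 'u) bimod\<^esub> = enc (carrier M) \<one>\<^bsub>M\<^esub>"
    and "x \<in> carrier M \<Longrightarrow> lact (small M :: ('r, 'u) bimod) r (enc (carrier M) x) = enc (carrier M) (lact M r x)"
    and "x \<in> carrier M \<Longrightarrow> lbar (small M :: ('r, 'u) bimod) r (enc (carrier M) x) = enc (carrier M) (lbar M r x)"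
    and "x \<in> carrier M \<Longrightarrow> ract (small M :: ('r, 'u) bimod) (enc (carrier M) x) r = enc (carrier M) (ract M x r)"
    and "x \<in> carrier M \<Longrightarrow> rbar (small M :: ('r, 'u) bimod) (enc (carrier M) x) r = enc (carrier M) (rbar M x r)"
  using dec_enc[OF assms] by (auto simp: small_def Let_def)

lemma bimodule_small:
  fixes M :: "('r::{ring,monoid_mult}, 'b) bimod"
  assumes M: "bimodule M" and "\<exists>f :: 'b \<Rightarrow> 'u. inj_on f (carrier M)"
  shows "bimodule (small M :: ('r, 'u) bimod)"
proof -
  interpret bimodule M by fact
  note s = small_simps[OF assms(2)]
  have "comm_group (small M :: ('r, 'u) bimod)"
  proof (rule comm_groupI)
    fix x assume "x \<in> carrier (small M :: ('r, 'u) bimod)"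
    then obtain m where m: "m \<in> carrier M" "x = enc (carrier M) m" by (auto simp: s)
    show "\<exists>y\<in>carrier (small M :: ('r, 'u) bimod). y \<otimes>\<^bsub>small M :: ('r, 'u) bimod\<^esub> x = \<one>\<^bsub>small M :: ('r, 'u) bimod\<^esub>"
      by (rule bexI[of _ "enc (carrier M) (inv\<^bsub>M\<^esub> m)"]) (use m in \<open>auto simp: s\<close>)
  qed (auto simp: s m_ac)
  then show ?thesis
    by (intro bimodule.intro bimodule_axioms.intro)
      (auto simp: s closed additive scalar_additive unital act_mult commuting)
qed

text \<open>\<open>el c\<close> is the code of the class of \<open>c\<close>, and \<open>rp\<close>
  picks a formal sum for a code. The set \<open>C\<close> consists of all formal sums for
  \<open>env_raw\<close> and \<open>tens_raw\<close>, and of the Takeuchi sums for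
  \<open>times_raw\<close>.\<close>

locale presented =
  fixes Ms :: "('a, 'x) monoid_scheme list" and B C :: "('a list \<Rightarrow>\<^sub>0 int) set"
    and Q :: "('r::{ring,monoid_mult}, ('a list \<Rightarrow>\<^sub>0 int) set) bimod" and u :: "'u itself"
  assumes grp: "\<forall>M\<in>set Ms. comm_group M" and B: "B \<subseteq> sums (tuples Ms)"
    and C: "diff_closed C" "tensor_rels Ms B \<subseteq> C" "C \<subseteq> sums (tuples Ms)"
    and Q: "bimodule Q" "carrier Q = tclass Ms B ` C" "monoid.mult Q = monoid.mult (tensor Ms B)"
      "\<one>\<^bsub>Q\<^esub> = \<one>\<^bsub>tensor Ms B\<^esub>"
    and inj: "\<exists>f :: ('a list \<Rightarrow>\<^sub>0 int) set \<Rightarrow> 'u. inj_on f (carrier Q)"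
begin

abbreviation el :: "('a list \<Rightarrow>\<^sub>0 int) \<Rightarrow> 'u" where
  "el c \<equiv> enc (carrier Q) (tclass Ms B c)"

abbreviation rp :: "'u \<Rightarrow> ('a list \<Rightarrow>\<^sub>0 int)" where
  "rp x \<equiv> representative (dec (carrier Q) x)"

abbreviation sm :: "('r, 'u) bimod" where
  "sm \<equiv> small Q"

lemmas small = small_simps[OF inj]

lemma bimodule_sm: "bimodule sm"
  by (rule bimodule_small[OF Q(1) inj])

lemma tclass_mem: "c \<in> C \<Longrightarrow> tclass Ms B c \<in> carrier Q"
  by (simp add: Q(2))

lemma el_closed: "c \<in> C \<Longrightarrow> el c \<in> carrier sm"
  by (simp add: small tclass_mem)

lemma el_eq_iff: "c \<in> C \<Longrightarrow> d \<in> C \<Longrightarrow> el c = el d \<longleftrightarrow> c - d \<in> tensor_rels Ms B"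
  using inj_on_eq_iff[OF enc_inj[OF inj], of "tclass Ms B c" "tclass Ms B d"]
  by (simp add: tclass_mem tclass_eq_iff[OF grp B])

lemma rp_el_mod: "c \<in> C \<Longrightarrow> rp (el c) - c \<in> tensor_rels Ms B"
  using dec_enc[OF inj, of "tclass Ms B c"] tclass_representative(2)[OF grp B] by (simp add: tclass_mem)

lemma rp_closed: "x \<in> carrier sm \<Longrightarrow> rp x \<in> C"
proof -
  assume "x \<in> carrier sm"
  then obtain c where "c \<in> C" "x = el c" using Q(2) by (auto simp: small(1))
  moreover then have "rp (el c) - c + c \<in> C"
    using rp_el_mod[of c] C by (intro diff_closedD(4)[OF C(1)]) auto
  ultimately show ?thesis by simp
qed

lemma el_rp: "x \<in> carrier sm \<Longrightarrow> el (rp x) = x"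
proof -
  assume x: "x \<in> carrier sm"
  then obtain c where "c \<in> C" "x = el c" using Q(2) by (auto simp: small(1))
  then show ?thesis using el_eq_iff[of "rp x" c] rp_closed[OF x] rp_el_mod by simp
qed

lemma el_add: "c \<in> C \<Longrightarrow> d \<in> C \<Longrightarrow> el c \<otimes>\<^bsub>sm\<^esub> el d = el (c + d)"
  by (simp add: small(2) tclass_mem Q(3) mult_tclass[OF grp B])

lemma el_zero: "\<one>\<^bsub>sm\<^esub> = el 0"
  by (simp add: small(3) Q(4) one_tensor[OF grp B])

text \<open>Tuples generate the quotient when \<open>C\<close> is everything. In a Takeuchi product
  a single tuple may violate the condition, so this criterion belongs to \<open>env\<close> and
  \<open>tens\<close>.\<close>

lemma hom_eqI:
  assumes CS: "C = sums (tuples Ms)" and G: "group G" "f \<in> hom sm G" "g \<in> hom sm G"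
    and eq: "\<And>t. t \<in> tuples Ms \<Longrightarrow> f (el (frag_of t)) = g (el (frag_of t))"
    and x: "x \<in> carrier sm"
  shows "f x = g x"
proof -
  interpret sm: comm_group sm using bimodule_sm by (rule bimodule_comm_group)
  interpret f: group_hom sm G f using G by (simp add: group_hom_def group_hom_axioms_def sm.is_group)
  interpret g: group_hom sm G g using G by (simp add: group_hom_def group_hom_axioms_def sm.is_group)
  have "Poly_Mapping.keys c \<subseteq> tuples Ms \<Longrightarrow> Poly_Mapping.keys c \<subseteq> tuples Ms \<and> f (el c) = g (el c)" for c
  proof (induction c rule: frag_induction)
    case zero
    show ?case using f.hom_one g.hom_one by (simp add: el_zero)
  next
    case (diff a b)
    then have ab: "a \<in> C" "b \<in> C" "a - b \<in> C" using diff_closedD(2)[OF C(1)] CS by auto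
    then have "el a = el (a - b) \<otimes>\<^bsub>sm\<^esub> el b" by (simp add: el_add)
    then have "f (el a) = f (el (a - b)) \<otimes>\<^bsub>G\<^esub> f (el b)" "g (el a) = g (el (a - b)) \<otimes>\<^bsub>G\<^esub> g (el b)"
      using ab by (simp_all add: el_closed del: el_add)
    then have "f (el (a - b)) \<otimes>\<^bsub>G\<^esub> f (el b) = g (el (a - b)) \<otimes>\<^bsub>G\<^esub> f (el b)" using diff by simp
    then have "f (el (a - b)) = g (el (a - b))"
      using ab f.H.right_cancel by (simp add: el_closed)
    then show ?case using ab CS by auto
  qed (simp add: eq)
  then show ?thesis using rp_closed[OF x] CS el_rp[OF x] by (metis mem_Collect_eq)
qed

text \<open>Universal property of the presented group: the formal sums with neutral value form a
  subgroup that contains the generating relations, so the value does not depend on the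
  representative chosen by \<open>rp\<close>.\<close>

lemma evaluate_rp:
  assumes P: "comm_group P" and phi: "\<And>t. t \<in> tuples Ms \<Longrightarrow> \<phi> t \<in> carrier P"
    and mult: "\<And>Ms1 M Ms2 t u a b. \<lbrakk>Ms = Ms1 @ M # Ms2; t \<in> tuples Ms1; u \<in> tuples Ms2;
      a \<in> carrier M; b \<in> carrier M\<rbrakk> \<Longrightarrow> \<phi> (t @ (a \<otimes>\<^bsub>M\<^esub> b) # u) = \<phi> (t @ a # u) \<otimes>\<^bsub>P\<^esub> \<phi> (t @ b # u)"
    and bal: "\<And>b. b \<in> B \<Longrightarrow> evaluate P \<phi> b = \<one>\<^bsub>P\<^esub>"
  shows "(\<lambda>x. evaluate P \<phi> (rp x)) \<in> hom sm P"
    and "c \<in> C \<Longrightarrow> evaluate P \<phi> (rp (el c)) = evaluate P \<phi> c"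
proof -
  interpret P: comm_group P by fact
  have phi': "\<phi> \<in> tuples Ms \<rightarrow> carrier P" using phi by auto
  have inv_cancel: "x \<otimes>\<^bsub>P\<^esub> y \<otimes>\<^bsub>P\<^esub> inv\<^bsub>P\<^esub> x \<otimes>\<^bsub>P\<^esub> inv\<^bsub>P\<^esub> y = \<one>\<^bsub>P\<^esub>"
    if "x \<in> carrier P" "y \<in> carrier P" for x y
    using that P.m_comm[of x y] by (simp add: P.m_assoc)
  let ?H = "{c. Poly_Mapping.keys c \<subseteq> tuples Ms \<and> evaluate P \<phi> c = \<one>\<^bsub>P\<^esub>}"
  have "tensor_rels Ms B \<subseteq> ?H"
  proof (rule tensor_rels_least[OF grp B])
    show "diff_closed ?H"
      using diff_closedD(2)[OF diff_closed_sums] by (auto simp: diff_closed_def P.evaluate_diff[OF phi'])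
  next
    fix Ms1 M Ms2 t u a b
    assume *: "Ms = Ms1 @ M # Ms2" "t \<in> tuples Ms1" "u \<in> tuples Ms2" "a \<in> carrier M" "b \<in> carrier M"
    have "comm_group M" using grp * by auto
    then have "a \<otimes>\<^bsub>M\<^esub> b \<in> carrier M"
      using * by (simp add: comm_group_def comm_monoid_def monoid.m_closed)
    then have t: "t @ (a \<otimes>\<^bsub>M\<^esub> b) # u \<in> tuples Ms" "t @ a # u \<in> tuples Ms" "t @ b # u \<in> tuples Ms"
      using * by (auto simp: tuples_appendI)
    then have k: "frag_of (t @ (a \<otimes>\<^bsub>M\<^esub> b) # u) - frag_of (t @ a # u) \<in> sums (tuples Ms)"
      by (intro diff_closedD(2)[OF diff_closed_sums]) auto
    then have "frag_of (t @ (a \<otimes>\<^bsub>M\<^esub> b) # u) - frag_of (t @ a # u) - frag_of (t @ b # u) \<in> sums (tuples Ms)"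
      using t by (intro diff_closedD(2)[OF diff_closed_sums]) auto
    moreover have "evaluate P \<phi> (frag_of (t @ (a \<otimes>\<^bsub>M\<^esub> b) # u) - frag_of (t @ a # u) - frag_of (t @ b # u)) = \<one>\<^bsub>P\<^esub>"
      using k t phi mult[OF *] inv_cancel by (simp add: P.evaluate_diff[OF phi'])
    ultimately show "frag_of (t @ (a \<otimes>\<^bsub>M\<^esub> b) # u) - frag_of (t @ a # u) - frag_of (t @ b # u) \<in> ?H"
      by auto
  qed (use bal B in auto)
  then have eq: "evaluate P \<phi> c = evaluate P \<phi> d" if "c - d \<in> tensor_rels Ms B" "c \<in> C" "d \<in> C" for c d
  proof -
    have "Poly_Mapping.keys (c - d) \<subseteq> tuples Ms" "evaluate P \<phi> (c - d) = \<one>\<^bsub>P\<^esub>"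
      "Poly_Mapping.keys d \<subseteq> tuples Ms"
      using that \<open>tensor_rels Ms B \<subseteq> ?H\<close> C(3) by auto
    then show ?thesis
      using P.evaluate_add[OF phi', of "c - d" d] P.evaluate_closed[OF phi', of d] by simp
  qed
  \<comment> \<open>\<open>rp\<close> is additive only modulo the relations, and evaluation kills
    those.\<close>
  have rel: "rp (x \<otimes>\<^bsub>sm\<^esub> y) - (rp x + rp y) \<in> tensor_rels Ms B" if "x \<in> carrier sm" "y \<in> carrier sm" for x y
  proof -
    have "rp x + rp y \<in> C" using that by (intro diff_closedD(4)[OF C(1)] rp_closed)
    moreover have "x \<otimes>\<^bsub>sm\<^esub> y = el (rp x + rp y)"
      using that el_add[of "rp x" "rp y"] el_rp rp_closed by simp
    ultimately show ?thesis using rp_el_mod by simp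
  qed
  show "(\<lambda>x. evaluate P \<phi> (rp x)) \<in> hom sm P"
  proof (rule homI)
    fix x y assume xy: "x \<in> carrier sm" "y \<in> carrier sm"
    have "x \<otimes>\<^bsub>sm\<^esub> y \<in> carrier sm"
      using xy bimodule_comm_group[OF bimodule_sm] by (simp add: comm_group_def comm_monoid_def monoid.m_closed)
    then have "evaluate P \<phi> (rp (x \<otimes>\<^bsub>sm\<^esub> y)) = evaluate P \<phi> (rp x + rp y)"
      by (intro eq rel xy rp_closed diff_closedD(4)[OF C(1)])
    then show "evaluate P \<phi> (rp (x \<otimes>\<^bsub>sm\<^esub> y)) = evaluate P \<phi> (rp x) \<otimes>\<^bsub>P\<^esub> evaluate P \<phi> (rp y)"
      using P.evaluate_add[OF phi'] rp_closed[OF xy(1)] rp_closed[OF xy(2)] C(3) by auto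
  qed (use rp_closed C(3) P.evaluate_closed[OF phi'] in blast)
  show "c \<in> C \<Longrightarrow> evaluate P \<phi> (rp (el c)) = evaluate P \<phi> c"
    by (intro eq rp_el_mod rp_closed el_closed)
qed

end


section \<open>Cardinality of the universe of codes\<close>

section \<open>Sizes\<close>

text \<open>Over an infinite set, neither finite lists nor finitely supported integer functions
  raise the cardinality.\<close>

lemma frag_list_embeds:
  fixes e :: "'a \<Rightarrow> 'u"
  assumes "infinite (UNIV :: 'u set)" "inj e"
  shows "\<exists>f :: ('a list \<Rightarrow>\<^sub>0 int) \<Rightarrow> 'u. inj f"
proof -
  have "(UNIV :: ('a list \<Rightarrow>\<^sub>0 int) set) = carrier (free_Abelian_group UNIV)"
    by (auto simp: carrier_free)
  then have "(UNIV :: ('a list \<Rightarrow>\<^sub>0 int) set) \<lesssim> (UNIV :: 'a list set)"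
    using eqpoll_free_Abelian_group_infinite[OF infinite_UNIV_listI] by (metis eqpoll_imp_lepoll)
  also have "(UNIV :: 'a list set) \<lesssim> (UNIV :: 'u list set)"
    using assms(2) by (auto simp: lepoll_def intro!: exI[of _ "map e"] inj_mapI)
  also have "(UNIV :: 'u list set) \<lesssim> (UNIV :: 'u set)"
    using card_of_lists_infinite[OF assms(1)]
    by (simp add: eqpoll_imp_lepoll flip: eqpoll_iff_card_of_ordIso)
  finally show ?thesis by (auto simp: lepoll_def)
qed

text \<open>Choosing a representative in each class embeds the quotient into the formal
  sums.\<close>

lemma tclass_embeds:
  fixes f :: "('a list \<Rightarrow>\<^sub>0 int) \<Rightarrow> 'u"
  assumes "\<forall>M\<in>set Ms. comm_group M" "B \<subseteq> sums (tuples Ms)" "inj f"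
    and "A \<subseteq> range (tclass Ms B)"
  shows "\<exists>g :: ('a list \<Rightarrow>\<^sub>0 int) set \<Rightarrow> 'u. inj_on g A"
proof -
  have "tclass Ms B (representative X) = X" if "X \<in> A" for X
    using that assms(4) tclass_representative(1)[OF assms(1,2)] by auto
  then have "inj_on representative A" by (metis inj_onI)
  then have "inj_on (f \<circ> representative) A"
    using assms(3) by (meson comp_inj_on inj_on_subset top_greatest)
  then show ?thesis by blast
qed

lemma ring_group_simps [simp]:
  "carrier ring_group = UNIV" "a \<otimes>\<^bsub>ring_group\<^esub> b = a + b" "\<one>\<^bsub>ring_group\<^esub> = 0"
  by (simp_all add: ring_group_def)

lemma comm_group_ring_group: "comm_group (ring_group :: 'r::{ring,monoid_mult} monoid)"
  by (rule comm_groupI) (auto simp: algebra_simps intro: exI[of _ "- x" for x])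

text \<open>An infinite universe has codes for the quotients of formal sums of its own tuples. The
  additive endomorphisms of R can be more numerous than finite sums over R, so End(R) has an
  assumption of its own.\<close>

locale big_universe =
  fixes r :: "'r::{ring,monoid_mult} itself" and u :: "'u itself"
  assumes infinite_universe: "infinite (UNIV :: 'u set)"
    and End_embeds: "\<exists>e :: ('r \<Rightarrow> 'r) \<Rightarrow> 'u. inj_on e (hom ring_group ring_group)"
begin

abbreviation End :: "('r, 'u) bimod" where
  "End \<equiv> timesR []"

abbreviation Env :: "('r, 'u) bimod" where
  "Env \<equiv> env"

lemma frag_universe_embeds: "\<exists>f :: ('u list \<Rightarrow>\<^sub>0 int) \<Rightarrow> 'u. inj f"
  using frag_list_embeds[OF infinite_universe inj_on_id] .

text \<open>Left multiplication embeds R into its additive endomorphisms, the element being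
  recovered as the value at 1; so codes for End(R) provide codes for R^e.\<close>

lemma frag_ring_embeds: "\<exists>f :: ('r list \<Rightarrow>\<^sub>0 int) \<Rightarrow> 'u. inj f"
proof -
  obtain e :: "('r \<Rightarrow> 'r) \<Rightarrow> 'u" where e: "inj_on e (hom ring_group ring_group)"
    using End_embeds by blast
  have "inj (\<lambda>r. e ((*) r))"
  proof (rule injI)
    fix r s assume "e ((*) r) = e ((*) s)"
    then have "(*) r = (*) s"
      using e by (auto simp: hom_def distrib_left dest!: inj_onD)
    then show "r = s" by (metis mult.right_neutral)
  qed
  then show ?thesis by (rule frag_list_embeds[OF infinite_universe])
qed

end

section \<open>R^e, End(R) and the tensor product over R^e, with their universal properties\<close>

section \<open>The bimodules \<open>R\<^sup>e\<close>, \<open>End(R)\<close> and \<open>M \<otimes> N\<close>\<close>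

lemma bimodule_homs:
  assumes "bimodule M"
  shows "lact M s \<in> hom M M" "lbar M s \<in> hom M M"
    "(\<lambda>m. ract M m s) \<in> hom M M" "(\<lambda>m. rbar M m s) \<in> hom M M"
  using bimodule.closed[OF assms] bimodule.additive[OF assms] by (auto intro!: homI)

lemma bimodule_end_raw: "bimodule (end_raw :: ('r::{ring,monoid_mult}, 'r \<Rightarrow> 'r) bimod)"
proof -
  have "comm_group (end_raw :: ('r, 'r \<Rightarrow> 'r) bimod)"
  proof (rule comm_groupI)
    fix f assume "f \<in> carrier (end_raw :: ('r, 'r \<Rightarrow> 'r) bimod)"
    then show "\<exists>g\<in>carrier (end_raw :: ('r, 'r \<Rightarrow> 'r) bimod). g \<otimes>\<^bsub>end_raw :: ('r, 'r \<Rightarrow> 'r) bimod\<^esub> f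
        = \<one>\<^bsub>end_raw :: ('r, 'r \<Rightarrow> 'r) bimod\<^esub>"
      by (intro bexI[of _ "\<lambda>x. - f x"]) (auto simp: end_raw_def hom_def)
  qed (auto simp: end_raw_def hom_def algebra_simps)
  then show ?thesis
    by (intro bimodule.intro bimodule_axioms.intro)
      (auto simp: end_raw_def hom_def algebra_simps)
qed

definition env_el :: "'r::{ring,monoid_mult} \<Rightarrow> 'r \<Rightarrow> 'u" where
  "env_el a b = enc (carrier env_raw) (env_class (frag_of [a, b]))"

lemma env_one_el: "env_one TYPE('r::{ring,monoid_mult}) = env_el (1 :: 'r) 1"
  by (simp add: env_one_def env_el_def)

lemma env_raw_simps:
  "carrier env_raw = carrier (tensor [ring_group, ring_group] {})"
  "monoid.mult env_raw = monoid.mult (tensor [ring_group, ring_group] {})"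
  "\<one>\<^bsub>env_raw\<^esub> = \<one>\<^bsub>tensor [ring_group, ring_group] {}\<^esub>"
  "lact env_raw s X = env_class (apply_slot 0 (\<lambda>a. s * a) (representative X))"
  "lbar env_raw s X = env_class (apply_slot 1 (\<lambda>b. b * s) (representative X))"
  "ract env_raw X s = env_class (apply_slot 0 (\<lambda>a. a * s) (representative X))"
  "rbar env_raw X s = env_class (apply_slot 1 (\<lambda>b. s * b) (representative X))"
  by (simp_all add: env_raw_def monoid.defs bimod.defs)

lemma tens_raw_simps:
  "carrier (tens_raw M N) = carrier (tensor [M, N] (env_balanced M N))"
  "monoid.mult (tens_raw M N) = monoid.mult (tensor [M, N] (env_balanced M N))"
  "\<one>\<^bsub>tens_raw M N\<^esub> = \<one>\<^bsub>tensor [M, N] (env_balanced M N)\<^esub>"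
  "lact (tens_raw M N) s X = tens_class M N (apply_slot 0 (\<lambda>m. lact M s m) (representative X))"
  "lbar (tens_raw M N) s X = tens_class M N (apply_slot 0 (\<lambda>m. lbar M s m) (representative X))"
  "ract (tens_raw M N) X s = tens_class M N (apply_slot 1 (\<lambda>n. ract N n s) (representative X))"
  "rbar (tens_raw M N) X s = tens_class M N (apply_slot 1 (\<lambda>n. rbar N n s) (representative X))"
  by (simp_all add: tens_raw_def monoid.defs bimod.defs)

lemma env_slot_actions:
  "slot_action [ring_group, ring_group] {} 0 (\<lambda>s a. s * a :: 'r::{ring,monoid_mult})"
  "slot_action [ring_group, ring_group] {} 1 (\<lambda>s b. b * s :: 'r)"
  "slot_action [ring_group, ring_group] {} 0 (\<lambda>s a. a * s :: 'r)"
  "slot_action [ring_group, ring_group] {} 1 (\<lambda>s b. s * b :: 'r)"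
  by (auto simp: slot_action_def hom_def distrib_left distrib_right)

lemma env_groups: "\<forall>M\<in>set [ring_group, ring_group :: 'r::{ring,monoid_mult} monoid]. comm_group M"
  by (simp add: comm_group_ring_group)

lemma bimodule_env_raw: "bimodule (env_raw :: ('r::{ring,monoid_mult}, _) bimod)"
  by (rule slot_quotient_bimodule[OF env_groups empty_subsetI env_slot_actions diff_closed_sums subset_refl];
      ((erule apply_slot_sums; simp) | simp add: env_raw_simps carrier_tensor[OF env_groups empty_subsetI] mult.assoc))

lemma env_balanced_subset:
  assumes "bimodule M" "bimodule N"
  shows "env_balanced M N \<subseteq> sums (tuples [M, N])"
proof -
  have "frag_of [ract M (rbar M m s') s, n] - frag_of [m, lact N s (lbar N s' n)] \<in> sums (tuples [M, N])"
    if "m \<in> carrier M" "n \<in> carrier N" for m n s s'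
    using that bimodule.closed[OF assms(1)] bimodule.closed[OF assms(2)]
    by (intro diff_closedD(2)[OF diff_closed_sums]) auto
  then show ?thesis unfolding env_balanced_def by blast
qed

lemma env_balanced_rel:
  assumes "m \<in> carrier M" "n \<in> carrier N"
  shows "frag_of [ract M (rbar M m s') s, n] - frag_of [m, lact N s (lbar N s' n)]
    \<in> tensor_rels [M, N] (env_balanced M N)"
proof (rule subsetD[OF tensor_rels_incl])
  show "frag_of [ract M (rbar M m s') s, n] - frag_of [m, lact N s (lbar N s' n)] \<in> env_balanced M N"
    unfolding env_balanced_def by (intro CollectI exI conjI) (rule refl assms)+
qed

text \<open>The balancing relations involve the right actions on \<open>M\<close> and the left
  actions on \<open>N\<close>. The outer actions, from the left on \<open>M\<close> and from the
  right on \<open>N\<close>, commute with these and so carry balancing relations to balancing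
  relations.\<close>

lemma tens_slot_actions:
  assumes M: "bimodule M" and N: "bimodule N"
  shows "slot_action [M, N] (env_balanced M N) 0 (lact M)"
    "slot_action [M, N] (env_balanced M N) 0 (lbar M)"
    "slot_action [M, N] (env_balanced M N) 1 (\<lambda>s n. ract N n s)"
    "slot_action [M, N] (env_balanced M N) 1 (\<lambda>s n. rbar N n s)"
proof -
  interpret M: bimodule M by fact
  interpret N: bimodule N by fact
  let ?K = "tensor_rels [M, N] (env_balanced M N)"
  have bal: "frag_of [ract M (rbar M m s') s, n] - frag_of [m, lact N s (lbar N s' n)] \<in> ?K"
    if "m \<in> carrier M" "n \<in> carrier N" for m n s s'
    by (rule env_balanced_rel[OF that])
  have act0: "slot_action [M, N] (env_balanced M N) 0 g"
    if g: "\<And>r. g r \<in> hom M M" "\<And>r s m. m \<in> carrier M \<Longrightarrow> g (r + s) m = g r m \<otimes>\<^bsub>M\<^esub> g s m"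
      "\<And>m. m \<in> carrier M \<Longrightarrow> g 1 m = m"
      "\<And>m r s s'. m \<in> carrier M \<Longrightarrow> g r (ract M (rbar M m s') s) = ract M (rbar M (g r m) s') s" for g
  proof -
    have "apply_slot 0 (g r) b \<in> ?K" if b: "b \<in> env_balanced M N" for r b
    proof -
      obtain m n s s' where b: "b = frag_of [ract M (rbar M m s') s, n] - frag_of [m, lact N s (lbar N s' n)]"
        and mn: "m \<in> carrier M" "n \<in> carrier N"
        using b unfolding env_balanced_def by blast
      have "g r m \<in> carrier M" using g(1) mn by (auto simp: hom_def)
      from bal[OF this mn(2)] show ?thesis unfolding b by (simp add: apply_slot_diff g(4) mn)
    qed
    then show ?thesis using g by (simp add: slot_action_def)
  qed
  have act1: "slot_action [M, N] (env_balanced M N) 1 g"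
    if g: "\<And>r. g r \<in> hom N N" "\<And>r s m. m \<in> carrier N \<Longrightarrow> g (r + s) m = g r m \<otimes>\<^bsub>N\<^esub> g s m"
      "\<And>m. m \<in> carrier N \<Longrightarrow> g 1 m = m"
      "\<And>n r s s'. n \<in> carrier N \<Longrightarrow> g r (lact N s (lbar N s' n)) = lact N s (lbar N s' (g r n))" for g
  proof -
    have "apply_slot 1 (g r) b \<in> ?K" if b: "b \<in> env_balanced M N" for r b
    proof -
      obtain m n s s' where b: "b = frag_of [ract M (rbar M m s') s, n] - frag_of [m, lact N s (lbar N s' n)]"
        and mn: "m \<in> carrier M" "n \<in> carrier N"
        using b unfolding env_balanced_def by blast
      have "g r n \<in> carrier N" using g(1) mn by (auto simp: hom_def)
      from bal[OF mn(1) this] show ?thesis unfolding b by (simp add: apply_slot_diff g(4) mn)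
    qed
    then show ?thesis using g by (simp add: slot_action_def)
  qed
  show "slot_action [M, N] (env_balanced M N) 0 (lact M)"
    "slot_action [M, N] (env_balanced M N) 0 (lbar M)"
    by (rule act0; simp add: bimodule_homs[OF M] M.scalar_additive M.unital M.closed M.commuting)+
  show "slot_action [M, N] (env_balanced M N) 1 (\<lambda>s n. ract N n s)"
    "slot_action [M, N] (env_balanced M N) 1 (\<lambda>s n. rbar N n s)"
    by (rule act1; simp add: bimodule_homs[OF N] N.scalar_additive N.unital N.closed N.commuting)+
qed

lemma bimodule_tens_raw:
  assumes M: "bimodule M" and N: "bimodule N"
  shows "bimodule (tens_raw M N)"
proof -
  interpret M: bimodule M by fact
  interpret N: bimodule N by fact
  have grp: "\<forall>K\<in>set [M, N]. comm_group K" using assms by (simp add: bimodule_comm_group)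
  show ?thesis
    by (rule slot_quotient_bimodule[OF grp env_balanced_subset[OF assms] tens_slot_actions[OF assms]
          diff_closed_sums subset_refl];
        ((erule apply_slot_sums; simp add: M.closed N.closed)
          | simp add: tens_raw_simps carrier_tensor[OF grp env_balanced_subset[OF assms]]
              M.act_mult N.act_mult M.commuting N.commuting))
qed

text \<open>The two scalars of R^e are balanced separately, whereas \<open>env_balanced\<close>
  moves both at once. The target is only an abelian group, so that a map can be induced in one pair
  of variables before its linearity in a further one is known.\<close>

definition balanced_map ::
    "('r::{ring,monoid_mult}, 'a) bimod \<Rightarrow> ('r, 'a) bimod \<Rightarrow> ('b, 'x) monoid_scheme \<Rightarrow> ('a \<Rightarrow> 'a \<Rightarrow> 'b) \<Rightarrow> bool" where
  "balanced_map M N P \<phi> \<longleftrightarrow>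
     (\<forall>n\<in>carrier N. (\<lambda>m. \<phi> m n) \<in> hom M P) \<and> (\<forall>m\<in>carrier M. \<phi> m \<in> hom N P) \<and>
     (\<forall>m\<in>carrier M. \<forall>n\<in>carrier N. \<forall>s.
        \<phi> (ract M m s) n = \<phi> m (lact N s n) \<and> \<phi> (rbar M m s) n = \<phi> m (lbar N s n))"

definition bilinear_map ::
    "('r::{ring,monoid_mult}, 'a) bimod \<Rightarrow> ('r, 'a) bimod \<Rightarrow> ('r, 'b) bimod \<Rightarrow> ('a \<Rightarrow> 'a \<Rightarrow> 'b) \<Rightarrow> bool" where
  "bilinear_map M N P \<phi> \<longleftrightarrow> balanced_map M N P \<phi> \<and>
     (\<forall>m\<in>carrier M. \<forall>n\<in>carrier N. \<forall>s.
        \<phi> (lact M s m) n = lact P s (\<phi> m n) \<and> \<phi> (lbar M s m) n = lbar P s (\<phi> m n) \<and>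
        \<phi> m (ract N n s) = ract P (\<phi> m n) s \<and> \<phi> m (rbar N n s) = rbar P (\<phi> m n) s)"

context big_universe
begin

lemma presented_env: "presented TYPE('u) [ring_group, ring_group] {} (sums (tuples [ring_group, ring_group]))
    (env_raw :: ('r, _) bimod)"
proof (rule presented.intro)
  obtain f :: "('r list \<Rightarrow>\<^sub>0 int) \<Rightarrow> 'u" where "inj f" using frag_ring_embeds by blast
  show "\<exists>f :: ('r list \<Rightarrow>\<^sub>0 int) set \<Rightarrow> 'u. inj_on f (carrier (env_raw :: ('r, _) bimod))"
    by (rule tclass_embeds[OF env_groups empty_subsetI \<open>inj f\<close>])
      (auto simp: env_raw_simps carrier_tensor[OF env_groups empty_subsetI])
  show "tensor_rels [ring_group, ring_group :: 'r monoid] {} \<subseteq> sums (tuples [ring_group, ring_group])"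
    by (rule tensor_rels_subset[OF env_groups empty_subsetI])
  show "carrier (env_raw :: ('r, _) bimod) = env_class ` sums (tuples [ring_group, ring_group])"
    by (simp only: env_raw_simps carrier_tensor[OF env_groups empty_subsetI])
  show "\<forall>M\<in>set [ring_group, ring_group :: 'r monoid]. comm_group M" by (rule env_groups)
qed (simp_all only: bimodule_env_raw env_raw_simps diff_closed_sums subset_refl env_groups empty_subsetI)

lemma presented_tens:
  assumes "bimodule (M :: ('r, 'u) bimod)" "bimodule N"
  shows "presented TYPE('u) [M, N] (env_balanced M N) (sums (tuples [M, N])) (tens_raw M N)"
proof (rule presented.intro)
  show grp: "\<forall>K\<in>set [M, N]. comm_group K" using assms by (simp add: bimodule_comm_group)
  show B: "env_balanced M N \<subseteq> sums (tuples [M, N])" by (rule env_balanced_subset[OF assms])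
  obtain f :: "('u list \<Rightarrow>\<^sub>0 int) \<Rightarrow> 'u" where "inj f" using frag_universe_embeds by blast
  show "\<exists>f :: ('u list \<Rightarrow>\<^sub>0 int) set \<Rightarrow> 'u. inj_on f (carrier (tens_raw M N))"
    by (rule tclass_embeds[OF grp B \<open>inj f\<close>]) (auto simp: tens_raw_simps carrier_tensor[OF grp B])
  show "tensor_rels [M, N] (env_balanced M N) \<subseteq> sums (tuples [M, N])"
    by (rule tensor_rels_subset[OF grp B])
  show "carrier (tens_raw M N) = tens_class M N ` sums (tuples [M, N])"
    by (simp only: tens_raw_simps carrier_tensor[OF grp B])
qed (simp_all only: bimodule_tens_raw[OF assms] tens_raw_simps diff_closed_sums subset_refl)

lemma bimodule_env: "bimodule Env"
proof -
  interpret E: presented "[ring_group, ring_group]" "{}" "sums (tuples [ring_group, ring_group])"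
    "env_raw :: ('r, _) bimod" u by (rule presented_env)
  show ?thesis unfolding env_def by (rule E.bimodule_sm)
qed

lemma env_el_closed: "env_el a b \<in> carrier Env" for a b :: 'r
proof -
  interpret E: presented "[ring_group, ring_group]" "{}" "sums (tuples [ring_group, ring_group])"
    "env_raw :: ('r, _) bimod" u by (rule presented_env)
  show ?thesis unfolding env_def env_el_def by (rule E.el_closed) simp
qed

lemma env_el_act:
  fixes a b s :: 'r
  shows "lact Env s (env_el a b) = env_el (s * a) b"
    "lbar Env s (env_el a b) = env_el a (b * s)"
    "ract Env (env_el a b) s = env_el (a * s) b"
    "rbar Env (env_el a b) s = env_el a (s * b)"
proof -
  interpret E: presented "[ring_group, ring_group]" "{}" "sums (tuples [ring_group, ring_group])"
    "env_raw :: ('r, _) bimod" u by (rule presented_env)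
  have "env_class (frag_of [a, b]) \<in> carrier env_raw" by (rule E.tclass_mem) simp
  then show "lact Env s (env_el a b) = env_el (s * a) b"
    "lbar Env s (env_el a b) = env_el a (b * s)"
    "ract Env (env_el a b) s = env_el (a * s) b"
    "rbar Env (env_el a b) s = env_el a (s * b)"
    unfolding env_def env_el_def
    by (simp_all add: E.small env_raw_simps(4-7) slot_action_tclass[OF env_groups _ env_slot_actions(1)]
        slot_action_tclass[OF env_groups _ env_slot_actions(2), simplified]
        slot_action_tclass[OF env_groups _ env_slot_actions(3)]
        slot_action_tclass[OF env_groups _ env_slot_actions(4), simplified])
qed

lemma tuples2E:
  assumes "t \<in> tuples [M, N]"
  obtains m n where "t = [m, n]" "m \<in> carrier M" "n \<in> carrier N"
  using assms by (auto elim!: tuples_ConsE)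

text \<open>For merely additive maps all pure elements \<open>(a, b)\<close> are compared; the
  reduction to \<open>(1, 1)\<close> in \<open>env_bimod_hom_eqI\<close> uses linearity over R and
  its opposite.\<close>

lemma env_hom_eqI:
  assumes "group G" "f \<in> hom Env G" "g \<in> hom Env G"
    and "\<And>a b :: 'r. f (env_el a b) = g (env_el a b)" "x \<in> carrier Env"
  shows "f x = g x"
proof -
  interpret E: presented "[ring_group, ring_group]" "{}" "sums (tuples [ring_group, ring_group])"
    "env_raw :: ('r, _) bimod" u by (rule presented_env)
  show ?thesis
    by (rule E.hom_eqI[OF refl assms(1) assms(2,3)[unfolded env_def] _ assms(5)[unfolded env_def]])
      (auto simp: assms(4)[unfolded env_el_def] elim!: tuples2E)
qed

lemma split_pair:
  "[a, b] = Ms1 @ M # Ms2 \<longleftrightarrow> Ms1 = [] \<and> M = a \<and> Ms2 = [b] \<or> Ms1 = [a] \<and> M = b \<and> Ms2 = []"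
  by (cases Ms1) (auto simp: Cons_eq_append_conv)

lemma env_evaluate:
  fixes \<phi> :: "'r list \<Rightarrow> 'u"
  assumes P: "comm_group P" and "\<And>a b. \<phi> [a, b] \<in> carrier P"
    and "\<And>a a' b. \<phi> [a + a', b] = \<phi> [a, b] \<otimes>\<^bsub>P\<^esub> \<phi> [a', b]"
    and "\<And>a b b'. \<phi> [a, b + b'] = \<phi> [a, b] \<otimes>\<^bsub>P\<^esub> \<phi> [a, b']"
  shows "(\<lambda>x. evaluate P \<phi> (env_rep x)) \<in> hom Env P"
    and "evaluate P \<phi> (env_rep (env_el a b :: 'u)) = \<phi> [a, b]"
proof -
  interpret E: presented "[ring_group, ring_group]" "{}" "sums (tuples [ring_group, ring_group])"
    "env_raw :: ('r, _) bimod" u by (rule presented_env)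
  interpret P: comm_group P by fact
  have *: "\<phi> t \<in> carrier P" if "t \<in> tuples [ring_group, ring_group]" for t
    using that assms by (auto elim!: tuples2E)
  have **: "\<phi> (t @ (a \<otimes>\<^bsub>M\<^esub> b) # u) = \<phi> (t @ a # u) \<otimes>\<^bsub>P\<^esub> \<phi> (t @ b # u)"
    if "[ring_group, ring_group] = Ms1 @ M # Ms2" "t \<in> tuples Ms1" "u \<in> tuples Ms2"
    for Ms1 M Ms2 t u a b
    using that assms by (auto simp: split_pair elim!: tuples_ConsE)
  show "(\<lambda>x. evaluate P \<phi> (env_rep x)) \<in> hom Env P"
    unfolding env_def env_rep_def by (rule E.evaluate_rp[OF P * **]) auto
  have "evaluate P \<phi> (env_rep (env_el a b :: 'u)) = evaluate P \<phi> (frag_of [a, b])"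
    unfolding env_el_def env_rep_def by (rule E.evaluate_rp(2)[OF P * **]) auto
  then show "evaluate P \<phi> (env_rep (env_el a b :: 'u)) = \<phi> [a, b]"
    using assms by simp
qed

context
  fixes M N :: "('r, 'u) bimod"
  assumes M: "bimodule M" and N: "bimodule N"
begin

interpretation M: bimodule M by (rule M)
interpretation N: bimodule N by (rule N)
interpretation T: presented "[M, N]" "env_balanced M N" "sums (tuples [M, N])" "tens_raw M N" u
  by (rule presented_tens[OF M N])

lemma bimodule_tens: "bimodule (tens M N)"
  unfolding tens_def by (rule T.bimodule_sm)

lemma pure_balanced_map: "balanced_map M N (tens M N) (pure M N)"
proof -
  let ?K = "tensor_rels [M, N] (env_balanced M N)"
  have fr: "frag_of [m, n] \<in> sums (tuples [M, N])" if "m \<in> carrier M" "n \<in> carrier N" for m n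
    using that by simp
  have cl: "pure M N m n \<in> carrier (tens M N)" if "m \<in> carrier M" "n \<in> carrier N" for m n
    unfolding tens_def pure_def using fr[OF that] by (rule T.el_closed)
  have eqI: "pure M N m n = pure M N m' n'"
    if "m \<in> carrier M" "n \<in> carrier N" "m' \<in> carrier M" "n' \<in> carrier N"
      "frag_of [m, n] - frag_of [m', n'] \<in> ?K" for m n m' n'
    unfolding pure_def using T.el_eq_iff[OF fr fr] that by blast
  have addI: "pure M N m n = pure M N m' n' \<otimes>\<^bsub>tens M N\<^esub> pure M N m'' n''"
    if "m \<in> carrier M" "n \<in> carrier N" "m' \<in> carrier M" "n' \<in> carrier N" "m'' \<in> carrier M" "n'' \<in> carrier N"
      "frag_of [m, n] - frag_of [m', n'] - frag_of [m'', n''] \<in> ?K" for m n m' n' m'' n''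
    unfolding pure_def tens_def
    using T.el_add[OF fr fr] T.el_eq_iff[OF fr diff_closedD(4)[OF diff_closed_sums fr fr]] that
    by (simp only: diff_diff_eq)
  have K: "frag_of [ract M (rbar M m s') s, n] - frag_of [m, lact N s (lbar N s' n)] \<in> ?K"
    if "m \<in> carrier M" "n \<in> carrier N" for m n s s'
    by (rule env_balanced_rel[OF that])
  show ?thesis
    unfolding balanced_map_def
  proof (intro conjI ballI allI)
    fix n assume n: "n \<in> carrier N"
    show "(\<lambda>m. pure M N m n) \<in> hom M (tens M N)"
      using n cl tensor_rels_multilinear[of "[]" "[]" "[n]" "[N]" _ M]
      by (intro homI addI) auto
    fix m s assume m: "m \<in> carrier M"
    \<comment> \<open>Setting one of the two scalars in the relation to 1 isolates the
      other.\<close>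
    show "pure M N (ract M m s) n = pure M N m (lact N s n)"
      using eqI[OF _ _ _ _ K[OF m n, of 1 s]] m n by (simp add: M.unital N.unital M.closed N.closed)
    show "pure M N (rbar M m s) n = pure M N m (lbar N s n)"
      using eqI[OF _ _ _ _ K[OF m n, of s 1]] m n by (simp add: M.unital N.unital M.closed N.closed)
  next
    fix m assume m: "m \<in> carrier M"
    show "pure M N m \<in> hom N (tens M N)"
      using m cl tensor_rels_multilinear[of "[m]" "[M]" "[]" "[]" _ N]
      by (intro homI addI) auto
  qed
qed

lemma pure_closed: "m \<in> carrier M \<Longrightarrow> n \<in> carrier N \<Longrightarrow> pure M N m n \<in> carrier (tens M N)"
  using pure_balanced_map unfolding balanced_map_def by (auto simp: hom_def)

lemma pure_bilinear_map: "bilinear_map M N (tens M N) (pure M N)"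
proof -
  have grp: "\<forall>K\<in>set [M, N]. comm_group K" using M N by (simp add: bimodule_comm_group)
  note B = env_balanced_subset[OF M N] and act = tens_slot_actions[OF M N]
  have mem: "tens_class M N (frag_of [m, n]) \<in> carrier (tens_raw M N)"
    if "m \<in> carrier M" "n \<in> carrier N" for m n
    using that by (intro T.tclass_mem) simp
  show ?thesis
    unfolding bilinear_map_def
    by (auto simp: pure_balanced_map)
      (simp_all add: tens_def pure_def T.small mem tens_raw_simps(4-7) slot_action_tclass[OF grp B act(1)]
        slot_action_tclass[OF grp B act(2)] slot_action_tclass[OF grp B act(3), simplified]
        slot_action_tclass[OF grp B act(4), simplified])
qed

lemma tens_hom_eqI:
  assumes "group G" "f \<in> hom (tens M N) G" "g \<in> hom (tens M N) G"
    and "\<And>m n. m \<in> carrier M \<Longrightarrow> n \<in> carrier N \<Longrightarrow> f (pure M N m n) = g (pure M N m n)"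
    and "x \<in> carrier (tens M N)"
  shows "f x = g x"
  by (rule T.hom_eqI[OF refl assms(1) assms(2,3)[unfolded tens_def] _ assms(5)[unfolded tens_def]])
    (auto simp: assms(4)[unfolded pure_def] elim!: tuples2E)

text \<open>Multilinearity relations are killed because \<open>\<phi>\<close> is additive in each
  variable; the combined balancing relation is killed by applying the two separate balancing laws in
  succession.\<close>

lemma tens_eval:
  assumes P: "comm_group P" and phi: "balanced_map M N P \<phi>"
  shows "tens_eval M N P \<phi> \<in> hom (tens M N) P"
    and "m \<in> carrier M \<Longrightarrow> n \<in> carrier N \<Longrightarrow> tens_eval M N P \<phi> (pure M N m n) = \<phi> m n"
proof -
  interpret P: comm_group P by fact
  let ?f = "\<lambda>t. \<phi> (t ! 0) (t ! 1)"
  have cl: "\<phi> m n \<in> carrier P" if "m \<in> carrier M" "n \<in> carrier N" for m n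
    using phi that by (auto simp: balanced_map_def hom_def)
  have cl': "?f t \<in> carrier P" if "t \<in> tuples [M, N]" for t
    using that cl by (auto elim!: tuples2E)
  have mult: "?f (t @ (a \<otimes>\<^bsub>K\<^esub> b) # u) = ?f (t @ a # u) \<otimes>\<^bsub>P\<^esub> ?f (t @ b # u)"
    if "[M, N] = Ms1 @ K # Ms2" "t \<in> tuples Ms1" "u \<in> tuples Ms2" "a \<in> carrier K" "b \<in> carrier K"
    for Ms1 K Ms2 t u a b
    using that phi by (auto simp: split_pair balanced_map_def hom_def elim!: tuples_ConsE)
  have bal: "evaluate P ?f b = \<one>\<^bsub>P\<^esub>" if b0: "b \<in> env_balanced M N" for b
  proof -
    obtain m n s s' where b: "b = frag_of [ract M (rbar M m s') s, n] - frag_of [m, lact N s (lbar N s' n)]"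
      and mn: "m \<in> carrier M" "n \<in> carrier N"
      using b0 unfolding env_balanced_def by blast
    have "evaluate P ?f b = ?f [ract M (rbar M m s') s, n] \<otimes>\<^bsub>P\<^esub> inv\<^bsub>P\<^esub> ?f [m, lact N s (lbar N s' n)]"
      unfolding b using mn cl M.closed N.closed cl'
      by (subst P.evaluate_diff[where S = "tuples [M, N]"]) (auto simp: Pi_iff)
    moreover have "\<phi> (ract M (rbar M m s') s) n = \<phi> m (lact N s (lbar N s' n))"
      using phi mn M.closed N.closed by (simp add: balanced_map_def M.commuting N.commuting)
    ultimately show ?thesis using cl mn N.closed by simp
  qed
  show "tens_eval M N P \<phi> \<in> hom (tens M N) P"
    using T.evaluate_rp(1)[OF P cl' mult bal] unfolding tens_def tens_eval_def .
  show "m \<in> carrier M \<Longrightarrow> n \<in> carrier N \<Longrightarrow> tens_eval M N P \<phi> (pure M N m n) = \<phi> m n"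
    using T.evaluate_rp(2)[OF P cl' mult bal, where c = "frag_of [m, n]"] cl unfolding pure_def tens_eval_def
    by simp
qed

end

end

section \<open>The monoidal category of bimodules under the tensor product over R^e\<close>

section \<open>The monoidal category of bimodules\<close>

lemma hom_comp: "f \<in> hom G H \<Longrightarrow> g \<in> hom H K \<Longrightarrow> (\<lambda>x. g (f x)) \<in> hom G K"
  using Group.hom_compose[of f G H g K] by (simp add: comp_def)

lemma hom_pointwise_mult:
  assumes "comm_group P" "f \<in> hom G P" "g \<in> hom G P"
  shows "(\<lambda>x. f x \<otimes>\<^bsub>P\<^esub> g x) \<in> hom G P"
proof -
  interpret P: comm_group P by fact
  show ?thesis
    using assms(2,3) by (auto intro!: homI simp: hom_def P.m_ac Pi_iff)
qed

lemma bimod_moncat_simps [simp]: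
  "Obj bimod_moncat = {M. bimodule M}"
  "Arr bimod_moncat = {f. bimodule (bdom f) \<and> bimodule (bcod f) \<and>
     bfun f \<in> bimod_hom (bdom f) (bcod f) \<inter> extensional (carrier (bdom f))}"
  "Dom bimod_moncat = bdom" "Cod bimod_moncat = bcod" "Idn bimod_moncat = bimod_id"
  "tensO bimod_moncat = tens" "munit bimod_moncat = env"
  by (simp_all add: bimod_moncat_def bimod_cat_def cat.defs moncat.defs)

lemma bimod_moncat_arrows:
  "Comp bimod_moncat = (\<lambda>g f. mk_arr (bdom f) (bcod g) (\<lambda>x. bfun g (bfun f x)))"
  "tensM bimod_moncat = (\<lambda>f g. tens_arr (bdom f) (bdom g) (tens (bcod f) (bcod g))
               (\<lambda>m n. pure (bcod f) (bcod g) (bfun f m) (bfun g n)))"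
  "asc bimod_moncat = (\<lambda>M N P. tens_arr (tens M N) P (tens M (tens N P))
          (\<lambda>x p. tens_eval M N (tens M (tens N P)) (\<lambda>m n. pure M (tens N P) m (pure N P n p)) x))"
  "lun bimod_moncat = (\<lambda>M. tens_arr env M M
        (\<lambda>e m. evaluate M (\<lambda>t. lact M (t ! 0) (lbar M (t ! 1) m)) (env_rep e)))"
  "run bimod_moncat = (\<lambda>M. tens_arr M env M
        (\<lambda>m e. evaluate M (\<lambda>t. ract M (rbar M m (t ! 1)) (t ! 0)) (env_rep e)))"
  by (simp_all add: bimod_moncat_def bimod_cat_def cat.defs moncat.defs Let_def)

definition bimod_Hom ::
    "('r::{ring,monoid_mult}, 'u) bimod \<Rightarrow> ('r, 'u) bimod \<Rightarrow> ('r, 'u) bimod_arr set" where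
  "bimod_Hom M N = {f. bimodule M \<and> bimodule N \<and> bdom f = M \<and> bcod f = N \<and>
     bfun f \<in> bimod_hom M N \<and> bfun f \<in> extensional (carrier M)}"

lemma Hom_bimod [simp]: "Hom bimod_moncat = bimod_Hom" "Hom bimod_cat = bimod_Hom"
  by (auto simp: Hom_def bimod_Hom_def bimod_cat_def fun_eq_iff)

lemma mk_arr_sel [simp]:
  "bdom (mk_arr M N f) = M" "bcod (mk_arr M N f) = N"
  "x \<in> carrier M \<Longrightarrow> bfun (mk_arr M N f) x = f x"
  by (auto simp: mk_arr_def)

lemma bimod_homI:
  assumes "f \<in> hom M N"
    and "\<And>m s. m \<in> carrier M \<Longrightarrow> f (lact M s m) = lact N s (f m)"
    "\<And>m s. m \<in> carrier M \<Longrightarrow> f (lbar M s m) = lbar N s (f m)"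
    "\<And>m s. m \<in> carrier M \<Longrightarrow> f (ract M m s) = ract N (f m) s"
    "\<And>m s. m \<in> carrier M \<Longrightarrow> f (rbar M m s) = rbar N (f m) s"
  shows "f \<in> bimod_hom M N"
  using assms by (auto simp: bimod_hom_def)

lemma bimod_homD:
  assumes "f \<in> bimod_hom M N"
  shows "f \<in> hom M N" "m \<in> carrier M \<Longrightarrow> f m \<in> carrier N"
    "m \<in> carrier M \<Longrightarrow> m' \<in> carrier M \<Longrightarrow> f (m \<otimes>\<^bsub>M\<^esub> m') = f m \<otimes>\<^bsub>N\<^esub> f m'"
    "m \<in> carrier M \<Longrightarrow> f (lact M s m) = lact N s (f m)"
    "m \<in> carrier M \<Longrightarrow> f (lbar M s m) = lbar N s (f m)"
    "m \<in> carrier M \<Longrightarrow> f (ract M m s) = ract N (f m) s"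
    "m \<in> carrier M \<Longrightarrow> f (rbar M m s) = rbar N (f m) s"
  using assms by (auto simp: bimod_hom_def hom_def)

lemma bimod_HomD:
  assumes "f \<in> bimod_Hom M N"
  shows "bimodule M" "bimodule N" "bdom f = M" "bcod f = N" "bfun f \<in> bimod_hom M N"
    "m \<in> carrier M \<Longrightarrow> bfun f m \<in> carrier N"
  using assms by (auto simp: bimod_Hom_def bimod_hom_def hom_def)

lemmas bimod_Hom_simps = bimod_homD(3-)[OF bimod_HomD(5)]

lemma bimodule_group: "bimodule M \<Longrightarrow> group M"
  by (simp add: bimodule_def comm_group_def)

lemma bimodule_mult_closed [simp]:
  "bimodule M \<Longrightarrow> m \<in> carrier M \<Longrightarrow> m' \<in> carrier M \<Longrightarrow> m \<otimes>\<^bsub>M\<^esub> m' \<in> carrier M"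
  by (simp add: bimodule_def comm_group_def comm_monoid_def monoid.m_closed)

lemma mk_arr_Hom:
  assumes "bimodule M" "bimodule N" "f \<in> bimod_hom M N"
  shows "mk_arr M N f \<in> bimod_Hom M N"
proof -
  have "restrict f (carrier M) \<in> bimod_hom M N"
    using assms bimodule.closed[OF assms(1)]
    by (auto simp: bimod_hom_def hom_def)
  then show ?thesis using assms by (simp add: bimod_Hom_def mk_arr_def)
qed

lemma arr_eqI:
  assumes "f \<in> bimod_Hom M N" "g \<in> bimod_Hom M N" "\<And>x. x \<in> carrier M \<Longrightarrow> bfun f x = bfun g x"
  shows "f = g"
proof -
  have "bfun f = bfun g"
    using assms by (intro extensionalityI[of _ "carrier M"]) (auto simp: bimod_Hom_def)
  then show ?thesis using assms(1,2) by (simp add: bimod_Hom_def bimod_arr.equality)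
qed

lemma bimod_hom_id: "(\<lambda>x. x) \<in> bimod_hom M M"
  by (auto simp: bimod_hom_def hom_def)

lemma bimod_id_Hom: "bimodule M \<Longrightarrow> bimod_id M \<in> bimod_Hom M M"
  unfolding bimod_id_def by (intro mk_arr_Hom bimod_hom_id)

lemma bimod_id_sel [simp]:
  "bdom (bimod_id M) = M" "bcod (bimod_id M) = M" "x \<in> carrier M \<Longrightarrow> bfun (bimod_id M) x = x"
  by (simp_all add: bimod_id_def)

lemma comp_sel [simp]:
  "bdom (g \<bullet>\<^bsub>bimod_moncat\<^esub> f) = bdom f" "bcod (g \<bullet>\<^bsub>bimod_moncat\<^esub> f) = bcod g"
  "x \<in> carrier (bdom f) \<Longrightarrow> bfun (g \<bullet>\<^bsub>bimod_moncat\<^esub> f) x = bfun g (bfun f x)"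
  by (simp_all add: bimod_moncat_arrows)

lemma comp_Hom:
  assumes "f \<in> bimod_Hom M N" "g \<in> bimod_Hom N P"
  shows "g \<bullet>\<^bsub>bimod_moncat\<^esub> f \<in> bimod_Hom M P"
proof -
  have "(\<lambda>x. bfun g (bfun f x)) \<in> bimod_hom M P"
    using assms by (intro bimod_homI hom_comp[OF bimod_homD(1)[OF bimod_HomD(5)] bimod_homD(1)[OF bimod_HomD(5)]])
      (auto simp: bimod_Hom_simps[of f] bimod_Hom_simps[of g] bimod_HomD(6))
  then show ?thesis
    using mk_arr_Hom[OF bimod_HomD(1)[OF assms(1)] bimod_HomD(2)[OF assms(2)]]
      bimod_HomD(3,4)[OF assms(1)] bimod_HomD(3,4)[OF assms(2)]
    by (simp add: bimod_moncat_arrows(1))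
qed

lemma bimod_isoI:
  assumes "f \<in> bimod_Hom M N" "g \<in> bimod_Hom N M"
    "g \<bullet>\<^bsub>bimod_moncat\<^esub> f = bimod_id M" "f \<bullet>\<^bsub>bimod_moncat\<^esub> g = bimod_id N"
  shows "is_iso bimod_moncat f"
  using assms bimod_HomD(3,4)[OF assms(1)] unfolding is_iso_def
  by (auto simp: bimod_Hom_def intro!: bexI[of _ g])

lemma category_bimod: "category (bimod_moncat :: (('r::{ring,monoid_mult}, 'u) bimod, _) moncat)"
proof (rule category.intro)
  fix f M N assume f: "f \<in> Hom (bimod_moncat :: (('r, 'u) bimod, _) moncat) M N"
  then have f: "f \<in> bimod_Hom M N" by simp
  note MN = bimod_HomD[OF f]
  show "Idn bimod_moncat N \<bullet>\<^bsub>bimod_moncat\<^esub> f = f"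
    using arr_eqI[OF comp_Hom[OF f bimod_id_Hom[OF MN(2)]] f] MN by simp
  show "f \<bullet>\<^bsub>bimod_moncat\<^esub> Idn bimod_moncat M = f"
    using arr_eqI[OF comp_Hom[OF bimod_id_Hom[OF MN(1)] f] f] MN by simp
next
  fix f M N g P h Q
  assume "f \<in> Hom (bimod_moncat :: (('r, 'u) bimod, _) moncat) M N"
    "g \<in> Hom (bimod_moncat :: (('r, 'u) bimod, _) moncat) N P"
    "h \<in> Hom (bimod_moncat :: (('r, 'u) bimod, _) moncat) P Q"
  then have fgh: "f \<in> bimod_Hom M N" "g \<in> bimod_Hom N P" "h \<in> bimod_Hom P Q" by auto
  note d = bimod_HomD(3,4)[OF fgh(1)] bimod_HomD(3,4)[OF fgh(2)] bimod_HomD(3,4)[OF fgh(3)]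
  show "(h \<bullet>\<^bsub>bimod_moncat\<^esub> g) \<bullet>\<^bsub>bimod_moncat\<^esub> f = h \<bullet>\<^bsub>bimod_moncat\<^esub> (g \<bullet>\<^bsub>bimod_moncat\<^esub> f)"
    using arr_eqI[OF comp_Hom[OF fgh(1) comp_Hom[OF fgh(2,3)]] comp_Hom[OF comp_Hom[OF fgh(1,2)] fgh(3)]]
    by (simp add: d bimod_HomD(6)[OF fgh(1)])
qed (auto simp: bimod_id_Hom comp_Hom)

lemma bilinear_mapI:
  assumes "\<And>m n. m \<in> carrier M \<Longrightarrow> n \<in> carrier N \<Longrightarrow> \<phi> m n \<in> carrier P"
    and "\<And>m m' n. m \<in> carrier M \<Longrightarrow> m' \<in> carrier M \<Longrightarrow> n \<in> carrier N \<Longrightarrow> \<phi> (m \<otimes>\<^bsub>M\<^esub> m') n = \<phi> m n \<otimes>\<^bsub>P\<^esub> \<phi> m' n"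
    "\<And>m n n'. m \<in> carrier M \<Longrightarrow> n \<in> carrier N \<Longrightarrow> n' \<in> carrier N \<Longrightarrow> \<phi> m (n \<otimes>\<^bsub>N\<^esub> n') = \<phi> m n \<otimes>\<^bsub>P\<^esub> \<phi> m n'"
    "\<And>m n s. m \<in> carrier M \<Longrightarrow> n \<in> carrier N \<Longrightarrow> \<phi> (ract M m s) n = \<phi> m (lact N s n)"
    "\<And>m n s. m \<in> carrier M \<Longrightarrow> n \<in> carrier N \<Longrightarrow> \<phi> (rbar M m s) n = \<phi> m (lbar N s n)"
    "\<And>m n s. m \<in> carrier M \<Longrightarrow> n \<in> carrier N \<Longrightarrow> \<phi> (lact M s m) n = lact P s (\<phi> m n)"
    "\<And>m n s. m \<in> carrier M \<Longrightarrow> n \<in> carrier N \<Longrightarrow> \<phi> (lbar M s m) n = lbar P s (\<phi> m n)"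
    "\<And>m n s. m \<in> carrier M \<Longrightarrow> n \<in> carrier N \<Longrightarrow> \<phi> m (ract N n s) = ract P (\<phi> m n) s"
    "\<And>m n s. m \<in> carrier M \<Longrightarrow> n \<in> carrier N \<Longrightarrow> \<phi> m (rbar N n s) = rbar P (\<phi> m n) s"
  shows "bilinear_map M N P \<phi>"
  using assms by (auto simp: bilinear_map_def balanced_map_def intro!: homI)

lemma bilinear_mapD:
  assumes "bilinear_map M N P \<phi>" "m \<in> carrier M" "n \<in> carrier N"
  shows "\<phi> m n \<in> carrier P"
    and "m' \<in> carrier M \<Longrightarrow> \<phi> (m \<otimes>\<^bsub>M\<^esub> m') n = \<phi> m n \<otimes>\<^bsub>P\<^esub> \<phi> m' n"
    "n' \<in> carrier N \<Longrightarrow> \<phi> m (n \<otimes>\<^bsub>N\<^esub> n') = \<phi> m n \<otimes>\<^bsub>P\<^esub> \<phi> m n'"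
    "\<phi> (ract M m s) n = \<phi> m (lact N s n)"
    "\<phi> (rbar M m s) n = \<phi> m (lbar N s n)"
    "\<phi> (lact M s m) n = lact P s (\<phi> m n)"
    "\<phi> (lbar M s m) n = lbar P s (\<phi> m n)"
    "\<phi> m (ract N n s) = ract P (\<phi> m n) s"
    "\<phi> m (rbar N n s) = rbar P (\<phi> m n) s"
  using assms by (auto simp: bilinear_map_def balanced_map_def hom_def)

lemma balanced_mapI:
  assumes "\<And>m n. m \<in> carrier M \<Longrightarrow> n \<in> carrier N \<Longrightarrow> \<phi> m n \<in> carrier P"
    and "\<And>m m' n. m \<in> carrier M \<Longrightarrow> m' \<in> carrier M \<Longrightarrow> n \<in> carrier N \<Longrightarrow> \<phi> (m \<otimes>\<^bsub>M\<^esub> m') n = \<phi> m n \<otimes>\<^bsub>P\<^esub> \<phi> m' n"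
    "\<And>m n n'. m \<in> carrier M \<Longrightarrow> n \<in> carrier N \<Longrightarrow> n' \<in> carrier N \<Longrightarrow> \<phi> m (n \<otimes>\<^bsub>N\<^esub> n') = \<phi> m n \<otimes>\<^bsub>P\<^esub> \<phi> m n'"
    "\<And>m n s. m \<in> carrier M \<Longrightarrow> n \<in> carrier N \<Longrightarrow> \<phi> (ract M m s) n = \<phi> m (lact N s n)"
    "\<And>m n s. m \<in> carrier M \<Longrightarrow> n \<in> carrier N \<Longrightarrow> \<phi> (rbar M m s) n = \<phi> m (lbar N s n)"
  shows "balanced_map M N P \<phi>"
  using assms by (auto simp: balanced_map_def intro!: homI)

context big_universe
begin

abbreviation Bimod :: "(('r, 'u) bimod, ('r, 'u) bimod_arr) moncat" where
  "Bimod \<equiv> bimod_moncat"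

abbreviation comp_arr :: "('r, 'u) bimod_arr \<Rightarrow> ('r, 'u) bimod_arr \<Rightarrow> ('r, 'u) bimod_arr" (infixr "\<cdot>" 55) where
  "g \<cdot> f \<equiv> g \<bullet>\<^bsub>Bimod\<^esub> f"

text \<open>Two orientations for the outer actions: \<open>pure_pull\<close> takes them out of a
  pure tensor, \<open>pure_simps\<close> takes them into it, while both move middle scalars to the
  right factor. The associator needs scalars pushed into an inner tensor on the right; its inverse
  needs them pulled out of an inner tensor on the left.\<close>

lemmas pure_pull = bilinear_mapD(2-9)[OF pure_bilinear_map]
lemmas pure_simps = bilinear_mapD(2-5)[OF pure_bilinear_map] bilinear_mapD(6-9)[OF pure_bilinear_map, symmetric]

context
  fixes M N P :: "('r, 'u) bimod"
  assumes M: "bimodule M" and N: "bimodule N" and P: "bimodule P"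
begin

lemma tens_eval_bimod_hom:
  assumes phi: "bilinear_map M N P \<phi>"
  shows "tens_eval M N P \<phi> \<in> bimod_hom (tens M N) P"
proof -
  interpret M: bimodule M by (rule M)
  interpret N: bimodule N by (rule N)
  interpret P: bimodule P by (rule P)
  have T: "bimodule (tens M N)" by (rule bimodule_tens[OF M N])
  have bal: "balanced_map M N P \<phi>" using phi by (simp add: bilinear_map_def)
  note ev = tens_eval[OF M N P.comm_group_axioms bal]
  note eqI = tens_hom_eqI[OF M N P.is_group]
  show ?thesis
  proof (rule bimod_homI[OF ev(1)])
    fix x s assume x: "x \<in> carrier (tens M N)"
    show "tens_eval M N P \<phi> (lact (tens M N) s x) = lact P s (tens_eval M N P \<phi> x)"
      by (rule eqI[OF hom_comp[OF bimodule_homs(1)[OF T] ev(1)] hom_comp[OF ev(1) bimodule_homs(1)[OF P]] _ x])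
        (simp add: pure_simps[OF M N] ev(2) M.closed bilinear_mapD[OF phi])
    show "tens_eval M N P \<phi> (lbar (tens M N) s x) = lbar P s (tens_eval M N P \<phi> x)"
      by (rule eqI[OF hom_comp[OF bimodule_homs(2)[OF T] ev(1)] hom_comp[OF ev(1) bimodule_homs(2)[OF P]] _ x])
        (simp add: pure_simps[OF M N] ev(2) M.closed bilinear_mapD[OF phi])
    show "tens_eval M N P \<phi> (ract (tens M N) x s) = ract P (tens_eval M N P \<phi> x) s"
      by (rule eqI[OF hom_comp[OF bimodule_homs(3)[OF T] ev(1)] hom_comp[OF ev(1) bimodule_homs(3)[OF P]] _ x])
        (simp add: pure_simps[OF M N] ev(2) N.closed bilinear_mapD[OF phi])
    show "tens_eval M N P \<phi> (rbar (tens M N) x s) = rbar P (tens_eval M N P \<phi> x) s"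
      by (rule eqI[OF hom_comp[OF bimodule_homs(4)[OF T] ev(1)] hom_comp[OF ev(1) bimodule_homs(4)[OF P]] _ x])
        (simp add: pure_simps[OF M N] ev(2) N.closed bilinear_mapD[OF phi])
  qed
qed

lemma tens_arr_Hom: "bilinear_map M N P \<phi> \<Longrightarrow> tens_arr M N P \<phi> \<in> bimod_Hom (tens M N) P"
  unfolding tens_arr_def by (intro mk_arr_Hom tens_eval_bimod_hom bimodule_tens M N P)

lemma tens_arr_pure:
  assumes "bilinear_map M N P \<phi>" "m \<in> carrier M" "n \<in> carrier N"
  shows "bfun (tens_arr M N P \<phi>) (pure M N m n) = \<phi> m n"
  unfolding tens_arr_def
  using assms tens_eval(2)[OF M N bimodule_comm_group[OF P]] pure_closed[OF M N]
  by (simp add: bilinear_map_def)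

lemma tens_Hom_eqI:
  assumes "f \<in> bimod_Hom (tens M N) P" "g \<in> bimod_Hom (tens M N) P"
    and "\<And>m n. m \<in> carrier M \<Longrightarrow> n \<in> carrier N \<Longrightarrow> bfun f (pure M N m n) = bfun g (pure M N m n)"
  shows "f = g"
proof (rule arr_eqI[OF assms(1,2)])
  fix x assume "x \<in> carrier (tens M N)"
  then show "bfun f x = bfun g x"
    using tens_hom_eqI[OF M N bimodule_group[OF P],
        where f = "bfun f" and g = "bfun g"] assms(3) bimod_homD(1)[OF bimod_HomD(5)] assms(1,2)
    by blast
qed

end

lemma pure_hom_left:
  assumes "bimodule (M :: ('r, 'u) bimod)" "bimodule N" "n \<in> carrier N"
  shows "(\<lambda>m. pure M N m n) \<in> hom M (tens M N)"
  using pure_balanced_map[OF assms(1,2)] assms(3) by (auto simp: balanced_map_def)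

lemma pure_hom_right:
  assumes "bimodule (M :: ('r, 'u) bimod)" "bimodule N" "m \<in> carrier M"
  shows "pure M N m \<in> hom N (tens M N)"
  using pure_balanced_map[OF assms(1,2)] assms(3) by (auto simp: balanced_map_def)

lemma tens3_hom_eqI:
  assumes M: "bimodule (M :: ('r, 'u) bimod)" and N: "bimodule N" and P: "bimodule P"
    and G: "group G" and f: "f \<in> hom (tens (tens M N) P) G" and g: "g \<in> hom (tens (tens M N) P) G"
    and "\<And>m n p. m \<in> carrier M \<Longrightarrow> n \<in> carrier N \<Longrightarrow> p \<in> carrier P \<Longrightarrow>
      f (pure (tens M N) P (pure M N m n) p) = g (pure (tens M N) P (pure M N m n) p)"
    and "x \<in> carrier (tens (tens M N) P)"
  shows "f x = g x"
proof (rule tens_hom_eqI[OF bimodule_tens[OF M N] P G f g _ assms(8)])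
  fix y p assume y: "y \<in> carrier (tens M N)" and p: "p \<in> carrier P"
  note h = pure_hom_left[OF bimodule_tens[OF M N] P p]
  show "f (pure (tens M N) P y p) = g (pure (tens M N) P y p)"
    by (rule tens_hom_eqI[OF M N G hom_comp[OF h f] hom_comp[OF h g] _ y]) (rule assms(7)[OF _ _ p])
qed

lemma tens3_Hom_eqI:
  assumes M: "bimodule (M :: ('r, 'u) bimod)" and N: "bimodule N" and P: "bimodule P"
    and f: "f \<in> bimod_Hom (tens (tens M N) P) Q" and g: "g \<in> bimod_Hom (tens (tens M N) P) Q"
    and "\<And>m n p. m \<in> carrier M \<Longrightarrow> n \<in> carrier N \<Longrightarrow> p \<in> carrier P \<Longrightarrow>
      bfun f (pure (tens M N) P (pure M N m n) p) = bfun g (pure (tens M N) P (pure M N m n) p)"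
  shows "f = g"
proof (rule arr_eqI[OF f g])
  fix x assume "x \<in> carrier (tens (tens M N) P)"
  then show "bfun f x = bfun g x"
    using tens3_hom_eqI[OF M N P bimodule_group[OF bimod_HomD(2)[OF f]],
        where f = "bfun f" and g = "bfun g"] assms(6) bimod_homD(1)[OF bimod_HomD(5)] f g
    by blast
qed

lemma tens_map_bilinear:
  assumes f: "f \<in> bimod_Hom (M :: ('r, 'u) bimod) M'" and g: "g \<in> bimod_Hom N N'"
  shows "bilinear_map M N (tens M' N') (\<lambda>m n. pure M' N' (bfun f m) (bfun g n))"
  using bimod_HomD(2,6)[OF f] bimod_HomD(2,6)[OF g]
  by (intro bilinear_mapI) (simp_all add: bimod_Hom_simps[OF f] bimod_Hom_simps[OF g] pure_simps pure_closed)

lemma tens_map_Hom: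
  assumes f: "f \<in> bimod_Hom (M :: ('r, 'u) bimod) M'" and g: "g \<in> bimod_Hom N N'"
  shows "f \<boxdot>\<^bsub>Bimod\<^esub> g \<in> bimod_Hom (tens M N) (tens M' N')"
  using tens_arr_Hom[OF _ _ _ tens_map_bilinear[OF f g]] bimod_HomD(1-4)[OF f] bimod_HomD(1-4)[OF g]
  by (simp add: bimodule_tens bimod_moncat_arrows)

lemma tens_map_pure:
  assumes f: "f \<in> bimod_Hom (M :: ('r, 'u) bimod) M'" and g: "g \<in> bimod_Hom N N'"
    and "m \<in> carrier M" "n \<in> carrier N"
  shows "bfun (f \<boxdot>\<^bsub>Bimod\<^esub> g) (pure M N m n) = pure M' N' (bfun f m) (bfun g n)"
  using tens_arr_pure[OF _ _ _ tens_map_bilinear[OF f g]] bimod_HomD(1-4)[OF f] bimod_HomD(1-4)[OF g] assms(3,4)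
  by (simp add: bimodule_tens bimod_moncat_arrows)

lemma asc_inner:
  assumes "bimodule (M :: ('r, 'u) bimod)" "bimodule N" "bimodule P" "p \<in> carrier P"
  shows "balanced_map M N (tens M (tens N P)) (\<lambda>m n. pure M (tens N P) m (pure N P n p))"
  by (rule balanced_mapI) (use assms in \<open>simp_all add: pure_simps pure_closed bimodule_tens bimodule.closed\<close>)

text \<open>For each \<open>p\<close> the map \<open>F p\<close> on \<open>M \<otimes> N\<close>
  comes from the universal property. Laws of bilinearity in \<open>(x, p)\<close> then become
  equalities of additive maps in \<open>x\<close>, decided on pure tensors.\<close>

lemma asc_bilinear:
  assumes M: "bimodule (M :: ('r, 'u) bimod)" and N: "bimodule N" and P: "bimodule P"
  shows "bilinear_map (tens M N) P (tens M (tens N P))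
    (\<lambda>x p. tens_eval M N (tens M (tens N P)) (\<lambda>m n. pure M (tens N P) m (pure N P n p)) x)"
proof -
  let ?T = "tens M N" and ?Q = "tens M (tens N P)"
  define F where "F p = tens_eval M N ?Q (\<lambda>m n. pure M (tens N P) m (pure N P n p))" for p
  have T: "bimodule ?T" and NP: "bimodule (tens N P)" and Q: "bimodule ?Q"
    using assms by (simp_all add: bimodule_tens)
  note ev = tens_eval[OF M N bimodule_comm_group[OF Q] asc_inner[OF assms]]
  have hF: "F p \<in> hom ?T ?Q" if "p \<in> carrier P" for p using ev(1)[OF that] by (simp add: F_def)
  have F: "F p (pure M N m n) = pure M (tens N P) m (pure N P n p)"
    if "p \<in> carrier P" "m \<in> carrier M" "n \<in> carrier N" for p m n
    using ev(2)[OF that] by (simp add: F_def)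
  note simps = F pure_simps pure_closed M N P NP T Q bimodule.closed[OF P] bimodule.closed[OF M] bimodule.closed[OF N]
  note eqI = tens_hom_eqI[OF M N bimodule_group[OF Q]]
  have "bilinear_map ?T P ?Q (\<lambda>x p. F p x)"
  proof (rule bilinear_mapI)
    fix x p s assume x: "x \<in> carrier ?T" and p: "p \<in> carrier P"
    show "F p x \<in> carrier ?Q" using hF[OF p] x by (auto simp: hom_def)
    show "F p (x \<otimes>\<^bsub>?T\<^esub> x') = F p x \<otimes>\<^bsub>?Q\<^esub> F p x'" if "x' \<in> carrier ?T" for x'
      using hF[OF p] x that by (auto simp: hom_def)
    show "F (p \<otimes>\<^bsub>P\<^esub> p') x = F p x \<otimes>\<^bsub>?Q\<^esub> F p' x" if p': "p' \<in> carrier P" for p'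
      by (rule eqI[OF hF hom_pointwise_mult[OF bimodule_comm_group[OF Q] hF[OF p] hF[OF p']] _ x])
        (use p p' in \<open>simp_all add: simps\<close>)
    show "F p (ract ?T x s) = F (lact P s p) x"
      by (rule eqI[OF hom_comp[OF bimodule_homs(3)[OF T] hF[OF p]] hF _ x])
        (use p in \<open>simp_all add: simps\<close>)
    show "F p (rbar ?T x s) = F (lbar P s p) x"
      by (rule eqI[OF hom_comp[OF bimodule_homs(4)[OF T] hF[OF p]] hF _ x])
        (use p in \<open>simp_all add: simps\<close>)
    show "F p (lact ?T s x) = lact ?Q s (F p x)"
      by (rule eqI[OF hom_comp[OF bimodule_homs(1)[OF T] hF[OF p]] hom_comp[OF hF[OF p] bimodule_homs(1)[OF Q]] _ x])
        (use p in \<open>simp_all add: simps\<close>)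
    show "F p (lbar ?T s x) = lbar ?Q s (F p x)"
      by (rule eqI[OF hom_comp[OF bimodule_homs(2)[OF T] hF[OF p]] hom_comp[OF hF[OF p] bimodule_homs(2)[OF Q]] _ x])
        (use p in \<open>simp_all add: simps\<close>)
    show "F (ract P p s) x = ract ?Q (F p x) s"
      by (rule eqI[OF hF hom_comp[OF hF[OF p] bimodule_homs(3)[OF Q]] _ x])
        (use p in \<open>simp_all add: simps\<close>)
    show "F (rbar P p s) x = rbar ?Q (F p x) s"
      by (rule eqI[OF hF hom_comp[OF hF[OF p] bimodule_homs(4)[OF Q]] _ x])
        (use p in \<open>simp_all add: simps\<close>)
  qed
  then show ?thesis by (simp add: F_def)
qed

lemma asc_inv_inner:
  assumes "bimodule (M :: ('r, 'u) bimod)" "bimodule N" "bimodule P" "m \<in> carrier M"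
  shows "balanced_map N P (tens (tens M N) P) (\<lambda>n p. pure (tens M N) P (pure M N m n) p)"
  by (rule balanced_mapI) (use assms in \<open>simp_all add: pure_pull pure_closed bimodule_tens bimodule.closed\<close>)

text \<open>Mirror image of \<open>asc_bilinear\<close>: the first entry \<open>m\<close> is the
  parameter, and the universal property is that of the tensor product of the last two
  factors.\<close>

lemma asc_inv_bilinear:
  assumes M: "bimodule (M :: ('r, 'u) bimod)" and N: "bimodule N" and P: "bimodule P"
  shows "bilinear_map M (tens N P) (tens (tens M N) P)
    (\<lambda>m y. tens_eval N P (tens (tens M N) P) (\<lambda>n p. pure (tens M N) P (pure M N m n) p) y)"
proof -
  let ?T = "tens N P" and ?Q = "tens (tens M N) P"
  define F where "F = (\<lambda>m y. tens_eval N P ?Q (\<lambda>n p. pure (tens M N) P (pure M N m n) p) y)"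
  have T: "bimodule ?T" and MN: "bimodule (tens M N)" and Q: "bimodule ?Q"
    using assms by (simp_all add: bimodule_tens)
  note ev = tens_eval[OF N P bimodule_comm_group[OF Q] asc_inv_inner[OF assms]]
  have hF: "F m \<in> hom ?T ?Q" if "m \<in> carrier M" for m using ev(1)[OF that] by (simp add: F_def)
  have F: "F m (pure N P n p) = pure (tens M N) P (pure M N m n) p"
    if "p \<in> carrier P" "m \<in> carrier M" "n \<in> carrier N" for p m n
    using ev(2)[OF that(2,3,1)] by (simp add: F_def)
  note push = pure_simps(5-8)[OF N P]
  note simps = F pure_pull[OF M N] pure_pull[OF MN P] pure_pull(1-4)[OF N P] pure_closed M N P MN T Q
    bimodule.closed[OF P] bimodule.closed[OF M] bimodule.closed[OF N]
  note eqI = tens_hom_eqI[OF N P bimodule_group[OF Q]]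
  have "bilinear_map M ?T ?Q F"
  proof (rule bilinear_mapI)
    fix m x s assume x: "x \<in> carrier ?T" and m: "m \<in> carrier M"
    show "F m x \<in> carrier ?Q" using hF[OF m] x by (auto simp: hom_def)
    show "F m (x \<otimes>\<^bsub>?T\<^esub> x') = F m x \<otimes>\<^bsub>?Q\<^esub> F m x'" if "x' \<in> carrier ?T" for x'
      using hF[OF m] x that by (auto simp: hom_def)
    show "F (m \<otimes>\<^bsub>M\<^esub> m') x = F m x \<otimes>\<^bsub>?Q\<^esub> F m' x" if m': "m' \<in> carrier M" for m'
      by (rule eqI[OF hF hom_pointwise_mult[OF bimodule_comm_group[OF Q] hF[OF m] hF[OF m']] _ x])
        (use m m' in \<open>simp_all add: simps\<close>)
    show "F (ract M m s) x = F m (lact ?T s x)"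
      by (rule eqI[OF hF hom_comp[OF bimodule_homs(1)[OF T] hF[OF m]] _ x])
        (use m in \<open>simp_all add: push simps\<close>)
    show "F (rbar M m s) x = F m (lbar ?T s x)"
      by (rule eqI[OF hF hom_comp[OF bimodule_homs(2)[OF T] hF[OF m]] _ x])
        (use m in \<open>simp_all add: push simps\<close>)
    show "F m (ract ?T x s) = ract ?Q (F m x) s"
      by (rule eqI[OF hom_comp[OF bimodule_homs(3)[OF T] hF[OF m]] hom_comp[OF hF[OF m] bimodule_homs(3)[OF Q]] _ x])
        (use m in \<open>simp_all add: push simps\<close>)
    show "F m (rbar ?T x s) = rbar ?Q (F m x) s"
      by (rule eqI[OF hom_comp[OF bimodule_homs(4)[OF T] hF[OF m]] hom_comp[OF hF[OF m] bimodule_homs(4)[OF Q]] _ x])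
        (use m in \<open>simp_all add: push simps\<close>)
    show "F (lact M s m) x = lact ?Q s (F m x)"
      by (rule eqI[OF hF hom_comp[OF hF[OF m] bimodule_homs(1)[OF Q]] _ x])
        (use m in \<open>simp_all add: push simps\<close>)
    show "F (lbar M s m) x = lbar ?Q s (F m x)"
      by (rule eqI[OF hF hom_comp[OF hF[OF m] bimodule_homs(2)[OF Q]] _ x])
        (use m in \<open>simp_all add: push simps\<close>)
  qed
  then show ?thesis unfolding F_def .
qed

lemma asc_Hom:
  assumes M: "bimodule (M :: ('r, 'u) bimod)" and N: "bimodule N" and P: "bimodule P"
  shows "asc Bimod M N P \<in> bimod_Hom (tens (tens M N) P) (tens M (tens N P))"
  unfolding bimod_moncat_arrows
  by (rule tens_arr_Hom) (use assms in \<open>simp_all add: bimodule_tens asc_bilinear\<close>)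

lemma asc_pure:
  assumes M: "bimodule (M :: ('r, 'u) bimod)" and N: "bimodule N" and P: "bimodule P"
    and mnp: "m \<in> carrier M" "n \<in> carrier N" "p \<in> carrier P"
  shows "bfun (asc Bimod M N P) (pure (tens M N) P (pure M N m n) p) = pure M (tens N P) m (pure N P n p)"
proof -
  have Q: "bimodule (tens M (tens N P))" using assms by (simp add: bimodule_tens)
  show ?thesis
    unfolding bimod_moncat_arrows
    using tens_arr_pure[OF bimodule_tens[OF M N] P Q asc_bilinear[OF M N P], of "pure M N m n" p]
      tens_eval(2)[OF M N bimodule_comm_group[OF Q] asc_inner[OF M N P]] assms
    by (simp add: pure_closed)
qed

lemma tens3R_Hom_eqI:
  assumes M: "bimodule (M :: ('r, 'u) bimod)" and N: "bimodule N" and P: "bimodule P"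
    and f: "f \<in> bimod_Hom (tens M (tens N P)) Q" and g: "g \<in> bimod_Hom (tens M (tens N P)) Q"
    and eq: "\<And>m n p. m \<in> carrier M \<Longrightarrow> n \<in> carrier N \<Longrightarrow> p \<in> carrier P \<Longrightarrow>
      bfun f (pure M (tens N P) m (pure N P n p)) = bfun g (pure M (tens N P) m (pure N P n p))"
  shows "f = g"
proof (rule tens_Hom_eqI[OF M bimodule_tens[OF N P] bimod_HomD(2)[OF f] f g])
  fix m y assume m: "m \<in> carrier M" and y: "y \<in> carrier (tens N P)"
  note h = pure_hom_right[OF M bimodule_tens[OF N P] m]
  note hf = bimod_homD(1)[OF bimod_HomD(5)[OF f]] and hg = bimod_homD(1)[OF bimod_HomD(5)[OF g]]
  show "bfun f (pure M (tens N P) m y) = bfun g (pure M (tens N P) m y)"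
    by (rule tens_hom_eqI[OF N P bimodule_group[OF bimod_HomD(2)[OF f]] hom_comp[OF h hf] hom_comp[OF h hg] _ y])
      (rule eq[OF m])
qed

lemma asc_iso:
  assumes M: "bimodule (M :: ('r, 'u) bimod)" and N: "bimodule N" and P: "bimodule P"
  shows "is_iso Bimod (asc Bimod M N P)"
proof -
  let ?Q = "tens (tens M N) P" and ?Q' = "tens M (tens N P)"
  note [simp] = M N P bimodule_tens pure_closed
  have Q: "bimodule ?Q" "bimodule ?Q'" by simp_all
  define g where "g = tens_arr M (tens N P) ?Q
    (\<lambda>m y. tens_eval N P ?Q (\<lambda>n p. pure (tens M N) P (pure M N m n) p) y)"
  have g: "g \<in> bimod_Hom ?Q' ?Q"
    unfolding g_def by (rule tens_arr_Hom[OF M _ Q(1) asc_inv_bilinear]) simp_all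
  have g_pure: "bfun g (pure M (tens N P) m (pure N P n p)) = pure (tens M N) P (pure M N m n) p"
    if "m \<in> carrier M" "n \<in> carrier N" "p \<in> carrier P" for m n p
    using tens_arr_pure[OF M _ Q(1) asc_inv_bilinear[OF M N P], of m "pure N P n p"] that
      tens_eval(2)[OF N P bimodule_comm_group[OF Q(1)] asc_inv_inner[OF M N P]]
    by (simp add: g_def)
  note a = asc_Hom[OF M N P] and a_pure = asc_pure[OF M N P]
  note sel = bimod_HomD(3,4)[OF a] bimod_HomD(3,4)[OF g]
  have "g \<cdot> asc Bimod M N P = bimod_id ?Q"
    by (rule tens3_Hom_eqI[OF M N P comp_Hom[OF a g] bimod_id_Hom[OF Q(1)]]) (simp add: sel a_pure g_pure)
  moreover have "asc Bimod M N P \<cdot> g = bimod_id ?Q'"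
    by (rule tens3R_Hom_eqI[OF M N P comp_Hom[OF g a] bimod_id_Hom[OF Q(2)]]) (simp add: sel a_pure g_pure)
  ultimately show ?thesis by (rule bimod_isoI[OF a g])
qed

lemma env_action:
  assumes M: "bimodule (M :: ('r, 'u) bimod)" and m: "m \<in> carrier M"
  shows "(\<lambda>e. evaluate M (\<lambda>t. lact M (t ! 0) (lbar M (t ! 1) m)) (env_rep e)) \<in> hom Env M"
    "evaluate M (\<lambda>t. lact M (t ! 0) (lbar M (t ! 1) m)) (env_rep (env_el a b :: 'u)) = lact M a (lbar M b m)"
    "(\<lambda>e. evaluate M (\<lambda>t. ract M (rbar M m (t ! 1)) (t ! 0)) (env_rep e)) \<in> hom Env M"
    "evaluate M (\<lambda>t. ract M (rbar M m (t ! 1)) (t ! 0)) (env_rep (env_el a b :: 'u)) = ract M (rbar M m b) a"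
proof -
  interpret M: bimodule M by (rule M)
  show "(\<lambda>e. evaluate M (\<lambda>t. lact M (t ! 0) (lbar M (t ! 1) m)) (env_rep e)) \<in> hom Env M"
    by (rule env_evaluate(1)) (use m in \<open>simp_all add: M.comm_group_axioms M.closed M.additive M.scalar_additive\<close>)
  show "(\<lambda>e. evaluate M (\<lambda>t. ract M (rbar M m (t ! 1)) (t ! 0)) (env_rep e)) \<in> hom Env M"
    by (rule env_evaluate(1)) (use m in \<open>simp_all add: M.comm_group_axioms M.closed M.additive M.scalar_additive\<close>)
  show "evaluate M (\<lambda>t. lact M (t ! 0) (lbar M (t ! 1) m)) (env_rep (env_el a b :: 'u)) = lact M a (lbar M b m)"
    by (subst env_evaluate(2)) (use m in \<open>simp_all add: M.comm_group_axioms M.closed M.additive M.scalar_additive\<close>)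
  show "evaluate M (\<lambda>t. ract M (rbar M m (t ! 1)) (t ! 0)) (env_rep (env_el a b :: 'u)) = ract M (rbar M m b) a"
    by (subst env_evaluate(2)) (use m in \<open>simp_all add: M.comm_group_axioms M.closed M.additive M.scalar_additive\<close>)
qed

lemma lun_bilinear:
  assumes M: "bimodule (M :: ('r, 'u) bimod)"
  shows "bilinear_map env M M (\<lambda>e m. evaluate M (\<lambda>t. lact M (t ! 0) (lbar M (t ! 1) m)) (env_rep e))"
proof -
  interpret M: bimodule M by (rule M)
  note E = bimodule_env
  define F where "F m e = evaluate M (\<lambda>t. lact M (t ! 0) (lbar M (t ! 1) m)) (env_rep (e :: 'u))" for m e
  have hF: "F m \<in> hom Env M" if "m \<in> carrier M" for m
    using env_action(1)[OF M that] by (simp add: F_def[abs_def])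
  have F: "F m (env_el a b) = lact M a (lbar M b m)" if "m \<in> carrier M" for m and a b :: 'r
    using env_action(2)[OF M that] by (simp add: F_def)
  note simps = F env_el_act M.closed M.additive M.act_mult M.commuting M.m_ac
  note eqI = env_hom_eqI[OF M.is_group]
  have "bilinear_map env M M (\<lambda>e m. F m e)"
  proof (rule bilinear_mapI)
    fix e m s assume e: "e \<in> carrier Env" and m: "m \<in> carrier M"
    show "F m e \<in> carrier M" using hF[OF m] e by (auto simp: hom_def)
    show "F m (e \<otimes>\<^bsub>Env\<^esub> e') = F m e \<otimes>\<^bsub>M\<^esub> F m e'" if "e' \<in> carrier Env" for e'
      using hF[OF m] e that by (auto simp: hom_def)
    show "F (m \<otimes>\<^bsub>M\<^esub> m') e = F m e \<otimes>\<^bsub>M\<^esub> F m' e" if m': "m' \<in> carrier M" for m'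
      by (rule eqI[OF hF hom_pointwise_mult[OF M.comm_group_axioms hF[OF m] hF[OF m']] _ e])
        (use m m' in \<open>simp_all add: simps\<close>)
    show "F m (ract env e s) = F (lact M s m) e"
      by (rule eqI[OF hom_comp[OF bimodule_homs(3)[OF E] hF[OF m]] hF _ e]) (use m in \<open>simp_all add: simps\<close>)
    show "F m (rbar env e s) = F (lbar M s m) e"
      by (rule eqI[OF hom_comp[OF bimodule_homs(4)[OF E] hF[OF m]] hF _ e]) (use m in \<open>simp_all add: simps\<close>)
    show "F m (lact env s e) = lact M s (F m e)"
      by (rule eqI[OF hom_comp[OF bimodule_homs(1)[OF E] hF[OF m]] hom_comp[OF hF[OF m] bimodule_homs(1)[OF M]] _ e])
        (use m in \<open>simp_all add: simps\<close>)
    show "F m (lbar env s e) = lbar M s (F m e)"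
      by (rule eqI[OF hom_comp[OF bimodule_homs(2)[OF E] hF[OF m]] hom_comp[OF hF[OF m] bimodule_homs(2)[OF M]] _ e])
        (use m in \<open>simp_all add: simps\<close>)
    show "F (ract M m s) e = ract M (F m e) s"
      by (rule eqI[OF hF hom_comp[OF hF[OF m] bimodule_homs(3)[OF M]] _ e]) (use m in \<open>simp_all add: simps\<close>)
    show "F (rbar M m s) e = rbar M (F m e) s"
      by (rule eqI[OF hF hom_comp[OF hF[OF m] bimodule_homs(4)[OF M]] _ e]) (use m in \<open>simp_all add: simps\<close>)
  qed
  then show ?thesis by (simp add: F_def)
qed

lemma run_bilinear:
  assumes M: "bimodule (M :: ('r, 'u) bimod)"
  shows "bilinear_map M env M (\<lambda>m e. evaluate M (\<lambda>t. ract M (rbar M m (t ! 1)) (t ! 0)) (env_rep e))"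
proof -
  interpret M: bimodule M by (rule M)
  note E = bimodule_env
  define F where "F = (\<lambda>m e. evaluate M (\<lambda>t. ract M (rbar M m (t ! 1)) (t ! 0)) (env_rep (e :: 'u)))"
  have hF: "F m \<in> hom Env M" if "m \<in> carrier M" for m
    using env_action(3)[OF M that] by (simp add: F_def)
  have F: "F m (env_el a b) = ract M (rbar M m b) a" if "m \<in> carrier M" for m and a b :: 'r
    using env_action(4)[OF M that] by (simp add: F_def)
  note simps = F env_el_act M.closed M.additive M.act_mult M.commuting M.m_ac
  note eqI = env_hom_eqI[OF M.is_group]
  have "bilinear_map M env M F"
  proof (rule bilinear_mapI)
    fix e m s assume e: "e \<in> carrier Env" and m: "m \<in> carrier M"
    show "F m e \<in> carrier M" using hF[OF m] e by (auto simp: hom_def)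
    show "F m (e \<otimes>\<^bsub>Env\<^esub> e') = F m e \<otimes>\<^bsub>M\<^esub> F m e'" if "e' \<in> carrier Env" for e'
      using hF[OF m] e that by (auto simp: hom_def)
    show "F (m \<otimes>\<^bsub>M\<^esub> m') e = F m e \<otimes>\<^bsub>M\<^esub> F m' e" if m': "m' \<in> carrier M" for m'
      by (rule eqI[OF hF hom_pointwise_mult[OF M.comm_group_axioms hF[OF m] hF[OF m']] _ e])
        (use m m' in \<open>simp_all add: simps\<close>)
    show "F (ract M m s) e = F m (lact env s e)"
      by (rule eqI[OF hF hom_comp[OF bimodule_homs(1)[OF E] hF[OF m]] _ e]) (use m in \<open>simp_all add: simps\<close>)
    show "F (rbar M m s) e = F m (lbar env s e)"
      by (rule eqI[OF hF hom_comp[OF bimodule_homs(2)[OF E] hF[OF m]] _ e]) (use m in \<open>simp_all add: simps\<close>)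
    show "F m (ract env e s) = ract M (F m e) s"
      by (rule eqI[OF hom_comp[OF bimodule_homs(3)[OF E] hF[OF m]] hom_comp[OF hF[OF m] bimodule_homs(3)[OF M]] _ e])
        (use m in \<open>simp_all add: simps\<close>)
    show "F m (rbar env e s) = rbar M (F m e) s"
      by (rule eqI[OF hom_comp[OF bimodule_homs(4)[OF E] hF[OF m]] hom_comp[OF hF[OF m] bimodule_homs(4)[OF M]] _ e])
        (use m in \<open>simp_all add: simps\<close>)
    show "F (lact M s m) e = lact M s (F m e)"
      by (rule eqI[OF hF hom_comp[OF hF[OF m] bimodule_homs(1)[OF M]] _ e]) (use m in \<open>simp_all add: simps\<close>)
    show "F (lbar M s m) e = lbar M s (F m e)"
      by (rule eqI[OF hF hom_comp[OF hF[OF m] bimodule_homs(2)[OF M]] _ e]) (use m in \<open>simp_all add: simps\<close>)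
  qed
  then show ?thesis unfolding F_def .
qed

lemma
  assumes M: "bimodule (M :: ('r, 'u) bimod)"
  shows lun_Hom: "lun Bimod M \<in> bimod_Hom (tens env M) M"
    and run_Hom: "run Bimod M \<in> bimod_Hom (tens M env) M"
  unfolding bimod_moncat_arrows
  by (rule tens_arr_Hom; rule M bimodule_env lun_bilinear[OF M] run_bilinear[OF M])+

text \<open>\<open>(1, 1)\<close> generates R^e from the left and from the right with the same
  scalars, so a scalar can be brought to whichever side faces the tensor sign.\<close>

lemma env_gen:
  fixes a b :: 'r
  shows "(env_el a b :: 'u) = lact Env a (lbar Env b (env_el 1 (1 :: 'r)))"
    "(env_el a b :: 'u) = ract Env (rbar Env (env_el 1 (1 :: 'r)) b) a"
  by (simp_all add: env_el_act)

lemma env_bimod_hom_eqI: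
  assumes M: "bimodule (M :: ('r, 'u) bimod)"
    and f: "f \<in> bimod_hom Env M" and g: "g \<in> bimod_hom Env M"
    and eq: "f (env_el 1 (1 :: 'r)) = g (env_el 1 (1 :: 'r))" and e: "e \<in> carrier Env"
  shows "f e = g e"
proof (rule env_hom_eqI[OF bimodule_group[OF M] bimod_homD(1)[OF f] bimod_homD(1)[OF g] _ e])
  fix a b :: 'r
  note cl = bimodule.closed[OF bimodule_env env_el_closed[of 1 1]]
  show "f (env_el a b) = g (env_el a b)"
    unfolding env_gen(1)[of a b] bimod_homD(4,5)[OF f cl(2)] bimod_homD(4,5)[OF g cl(2)]
      bimod_homD(5)[OF f env_el_closed] bimod_homD(5)[OF g env_el_closed] eq ..
qed

text \<open>Every pure element of R^e is \<open>(1, 1)\<close> acted on from the right, and right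
  scalars cross the tensor sign to \<open>m\<close>; so pure tensors over pure elements of R^e have
  the form \<open>(1, 1) \<otimes> m\<close>.\<close>

lemma tens_env_Hom_eqI:
  assumes M: "bimodule (M :: ('r, 'u) bimod)"
    and f: "f \<in> bimod_Hom (tens env M) N" and g: "g \<in> bimod_Hom (tens env M) N"
    and eq: "\<And>m. m \<in> carrier M \<Longrightarrow>
      bfun f (pure env M (env_el 1 (1 :: 'r)) m) = bfun g (pure env M (env_el 1 (1 :: 'r)) m)"
  shows "f = g"
proof (rule tens_Hom_eqI[OF bimodule_env M bimod_HomD(2)[OF f] f g])
  fix e m assume e: "e \<in> carrier Env" and m: "m \<in> carrier M"
  note h = pure_hom_left[OF bimodule_env M m]
  show "bfun f (pure env M e m) = bfun g (pure env M e m)"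
  proof (rule env_hom_eqI[OF bimodule_group[OF bimod_HomD(2)[OF f]]
        hom_comp[OF h bimod_homD(1)[OF bimod_HomD(5)[OF f]]] hom_comp[OF h bimod_homD(1)[OF bimod_HomD(5)[OF g]]] _ e])
    fix a b :: 'r
    have "pure env M (env_el a b) m = pure env M (env_el 1 (1 :: 'r)) (lact M a (lbar M b m))"
      by (subst env_gen(2)) (simp add: pure_simps[OF bimodule_env M] m env_el_closed
          bimodule.closed[OF M] bimodule.closed[OF bimodule_env] bimodule.commuting[OF M])
    then show "bfun f (pure env M (env_el a b) m) = bfun g (pure env M (env_el a b) m)"
      using eq m by (simp add: bimodule.closed[OF M])
  qed
qed

lemma tens_env_Hom_eqI':
  assumes M: "bimodule (M :: ('r, 'u) bimod)"
    and f: "f \<in> bimod_Hom (tens M env) N" and g: "g \<in> bimod_Hom (tens M env) N"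
    and eq: "\<And>m. m \<in> carrier M \<Longrightarrow>
      bfun f (pure M env m (env_el 1 (1 :: 'r))) = bfun g (pure M env m (env_el 1 (1 :: 'r)))"
  shows "f = g"
proof (rule tens_Hom_eqI[OF M bimodule_env bimod_HomD(2)[OF f] f g])
  fix e m assume e: "e \<in> carrier Env" and m: "m \<in> carrier M"
  note h = pure_hom_right[OF M bimodule_env m]
  show "bfun f (pure M env m e) = bfun g (pure M env m e)"
  proof (rule env_hom_eqI[OF bimodule_group[OF bimod_HomD(2)[OF f]]
        hom_comp[OF h bimod_homD(1)[OF bimod_HomD(5)[OF f]]] hom_comp[OF h bimod_homD(1)[OF bimod_HomD(5)[OF g]]] _ e])
    fix a b :: 'r
    have "pure M env m (env_el a b) = pure M env (ract M (rbar M m b) a) (env_el 1 (1 :: 'r))"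
      by (subst env_gen(1)) (simp add: pure_simps[OF M bimodule_env] m env_el_closed
          bimodule.closed[OF M] bimodule.closed[OF bimodule_env] bimodule.commuting[OF bimodule_env])
    then show "bfun f (pure M env m (env_el a b)) = bfun g (pure M env m (env_el a b))"
      using eq m by (simp add: bimodule.closed[OF M])
  qed
qed

lemma lun_pure:
  fixes a b :: 'r
  assumes M: "bimodule (M :: ('r, 'u) bimod)" and m: "m \<in> carrier M"
  shows "bfun (lun Bimod M) (pure env M (env_el a b) m) = lact M a (lbar M b m)"
    "bfun (run Bimod M) (pure M env m (env_el a b)) = ract M (rbar M m b) a"
  unfolding bimod_moncat_arrows
  using tens_arr_pure[OF bimodule_env M M lun_bilinear[OF M] env_el_closed m]
    tens_arr_pure[OF M bimodule_env M run_bilinear[OF M] m env_el_closed]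
  by (simp_all only: env_action[OF M m])

text \<open>The inverse is \<open>m \<mapsto> (1, 1) \<otimes> m\<close>. It respects the left
  actions because a scalar acts on \<open>(1, 1)\<close> equally from both sides: it crosses from
  \<open>m\<close> to the right of \<open>(1, 1)\<close>, then passes to the left.\<close>

lemma lun_iso:
  assumes M: "bimodule (M :: ('r, 'u) bimod)"
  shows "is_iso Bimod (lun Bimod M)"
proof -
  let ?e = "env_el 1 (1 :: 'r) :: 'u"
  note E = bimodule_env
  define g where "g = mk_arr M (tens env M) (pure env M ?e)"
  have "pure env M ?e \<in> bimod_hom M (tens env M)"
  proof (rule bimod_homI[OF pure_hom_right[OF E M env_el_closed]])
    fix m s assume m: "m \<in> carrier M"
    show "pure env M ?e (lact M s m) = lact (tens env M) s (pure env M ?e m)"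
      "pure env M ?e (lbar M s m) = lbar (tens env M) s (pure env M ?e m)"
      "pure env M ?e (ract M m s) = ract (tens env M) (pure env M ?e m) s"
      "pure env M ?e (rbar M m s) = rbar (tens env M) (pure env M ?e m) s"
      using pure_simps(3)[OF E M env_el_closed m, of 1 1 s] pure_simps(4)[OF E M env_el_closed m, of 1 1 s]
      by (simp_all add: pure_simps(5-8)[OF E M env_el_closed m] env_el_act)
  qed
  then have g: "g \<in> bimod_Hom M (tens env M)"
    unfolding g_def by (intro mk_arr_Hom M bimodule_tens E)
  note l = lun_Hom[OF M]
  note sel = bimod_HomD(3,4)[OF l] bimod_HomD(3,4)[OF g]
  have pl: "pure env M ?e m \<in> carrier (tens env M)" if "m \<in> carrier M" for m
    by (rule pure_closed[OF E M env_el_closed that])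
  have "g \<cdot> lun Bimod M = bimod_id (tens env M)"
    by (rule tens_env_Hom_eqI[OF M comp_Hom[OF l g] bimod_id_Hom[OF bimodule_tens[OF E M]]])
      (simp add: sel pl lun_pure[OF M] bimodule.unital[OF M], simp add: g_def)
  moreover have "lun Bimod M \<cdot> g = bimod_id M"
    by (rule arr_eqI[OF comp_Hom[OF g l] bimod_id_Hom[OF M]])
      (simp add: sel, simp add: g_def lun_pure[OF M] bimodule.unital[OF M])
  ultimately show ?thesis by (rule bimod_isoI[OF l g])
qed

lemma run_iso:
  assumes M: "bimodule (M :: ('r, 'u) bimod)"
  shows "is_iso Bimod (run Bimod M)"
proof -
  let ?e = "env_el 1 (1 :: 'r) :: 'u"
  note E = bimodule_env
  define g where "g = mk_arr M (tens M env) (\<lambda>m. pure M env m ?e)"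
  have "(\<lambda>m. pure M env m ?e) \<in> bimod_hom M (tens M env)"
  proof (rule bimod_homI[OF pure_hom_left[OF M E env_el_closed]])
    fix m s assume m: "m \<in> carrier M"
    show "pure M env (lact M s m) ?e = lact (tens M env) s (pure M env m ?e)"
      "pure M env (lbar M s m) ?e = lbar (tens M env) s (pure M env m ?e)"
      "pure M env (ract M m s) ?e = ract (tens M env) (pure M env m ?e) s"
      "pure M env (rbar M m s) ?e = rbar (tens M env) (pure M env m ?e) s"
      using pure_simps(3)[OF M E m env_el_closed, of s 1 1] pure_simps(4)[OF M E m env_el_closed, of s 1 1]
      by (simp_all add: pure_simps(5-8)[OF M E m env_el_closed] env_el_act)
  qed
  then have g: "g \<in> bimod_Hom M (tens M env)"
    unfolding g_def by (intro mk_arr_Hom M bimodule_tens E)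
  note l = run_Hom[OF M]
  note sel = bimod_HomD(3,4)[OF l] bimod_HomD(3,4)[OF g]
  have pl: "pure M env m ?e \<in> carrier (tens M env)" if "m \<in> carrier M" for m
    by (rule pure_closed[OF M E that env_el_closed])
  have "g \<cdot> run Bimod M = bimod_id (tens M env)"
    by (rule tens_env_Hom_eqI'[OF M comp_Hom[OF l g] bimod_id_Hom[OF bimodule_tens[OF M E]]])
      (simp add: sel pl lun_pure[OF M] bimodule.unital[OF M], simp add: g_def)
  moreover have "run Bimod M \<cdot> g = bimod_id M"
    by (rule arr_eqI[OF comp_Hom[OF g l] bimod_id_Hom[OF M]])
      (simp add: sel, simp add: g_def lun_pure[OF M] bimodule.unital[OF M])
  ultimately show ?thesis by (rule bimod_isoI[OF l g])
qed

lemma tens4_Hom_eqI: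
  assumes M: "bimodule (M :: ('r, 'u) bimod)" and N: "bimodule N" and P: "bimodule P" and U: "bimodule U"
    and f: "f \<in> bimod_Hom (tens (tens (tens M N) P) U) Q" and g: "g \<in> bimod_Hom (tens (tens (tens M N) P) U) Q"
    and eq: "\<And>m n p u. m \<in> carrier M \<Longrightarrow> n \<in> carrier N \<Longrightarrow> p \<in> carrier P \<Longrightarrow> u \<in> carrier U \<Longrightarrow>
      bfun f (pure (tens (tens M N) P) U (pure (tens M N) P (pure M N m n) p) u)
      = bfun g (pure (tens (tens M N) P) U (pure (tens M N) P (pure M N m n) p) u)"
  shows "f = g"
proof -
  have T: "bimodule (tens (tens M N) P)" using M N P by (simp add: bimodule_tens)
  show ?thesis
  proof (rule tens_Hom_eqI[OF T U bimod_HomD(2)[OF f] f g])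
    fix y u assume y: "y \<in> carrier (tens (tens M N) P)" and u: "u \<in> carrier U"
    note h = pure_hom_left[OF T U u]
    show "bfun f (pure (tens (tens M N) P) U y u) = bfun g (pure (tens (tens M N) P) U y u)"
      by (rule tens3_hom_eqI[OF M N P bimodule_group[OF bimod_HomD(2)[OF f]]
            hom_comp[OF h bimod_homD(1)[OF bimod_HomD(5)[OF f]]] hom_comp[OF h bimod_homD(1)[OF bimod_HomD(5)[OF g]]] _ y])
        (rule eq[OF _ _ _ u])
  qed
qed

lemma monoidal_category_bimod: "monoidal_category Bimod"
proof (intro monoidal_category.intro category_bimod monoidal_category_axioms.intro;
    simp only: Hom_bimod bimod_moncat_simps mem_Collect_eq)
  note E = bimodule_env
  note [simp] = bimodule_tens E pure_closed env_el_closed asc_Hom asc_pure tens_map_pure lun_Hom run_Hom lun_pure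
  show "bimodule (tens M N)" if "bimodule (M :: ('r, 'u) bimod)" "bimodule N" for M N using that by simp
  show "f \<boxdot>\<^bsub>Bimod\<^esub> g \<in> bimod_Hom (tens M N) (tens M' N')"
    if "f \<in> bimod_Hom M M'" "g \<in> bimod_Hom N N'" for M M' N N' f g
    by (rule tens_map_Hom[OF that])
  show "bimod_id M \<boxdot>\<^bsub>Bimod\<^esub> bimod_id N = bimod_id (tens M N)"
    if M: "bimodule (M :: ('r, 'u) bimod)" and N: "bimodule N" for M N
    by (rule tens_Hom_eqI[OF M N bimodule_tens[OF M N] tens_map_Hom[OF bimod_id_Hom[OF M] bimod_id_Hom[OF N]]
          bimod_id_Hom[OF bimodule_tens[OF M N]]])
      (simp add: tens_map_pure[OF bimod_id_Hom[OF M] bimod_id_Hom[OF N]] M N)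
  show "(f' \<cdot> f) \<boxdot>\<^bsub>Bimod\<^esub> (g' \<cdot> g) = (f' \<boxdot>\<^bsub>Bimod\<^esub> g') \<cdot> (f \<boxdot>\<^bsub>Bimod\<^esub> g)"
    if f: "f \<in> bimod_Hom M M'" and f': "f' \<in> bimod_Hom M' M''" and g: "g \<in> bimod_Hom N N'" and g': "g' \<in> bimod_Hom N' N''"
    for M M' M'' N N' N'' f f' g g'
    by (rule tens_Hom_eqI[OF bimod_HomD(1)[OF f] bimod_HomD(1)[OF g] _
          tens_map_Hom[OF comp_Hom[OF f f'] comp_Hom[OF g g']] comp_Hom[OF tens_map_Hom[OF f g] tens_map_Hom[OF f' g']]])
      (simp_all add: tens_map_pure[OF comp_Hom[OF f f'] comp_Hom[OF g g']] tens_map_pure[OF f g] tens_map_pure[OF f' g']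
        bimod_HomD(1-4,6)[OF f] bimod_HomD(1-4,6)[OF g] bimod_HomD(2)[OF f'] bimod_HomD(2)[OF g']
        bimod_HomD(3)[OF tens_map_Hom[OF f g]])
  show "bimodule Env" by (rule E)
  fix M N P :: "('r, 'u) bimod"
  show "asc Bimod M N P \<in> bimod_Hom (tens (tens M N) P) (tens M (tens N P))"
    if "bimodule M" "bimodule N" "bimodule P" using that by simp
  show "is_iso Bimod (asc Bimod M N P)"
    if "bimodule M" "bimodule N" "bimodule P" using that by (rule asc_iso)
  show "lun Bimod M \<in> bimod_Hom (tens env M) M" "is_iso Bimod (lun Bimod M)"
    "run Bimod M \<in> bimod_Hom (tens M env) M" "is_iso Bimod (run Bimod M)"
    if "bimodule M"
    using that by (simp_all add: lun_iso run_iso)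
  show "lun Bimod M' \<cdot> (bimod_id env \<boxdot>\<^bsub>Bimod\<^esub> f) = f \<cdot> lun Bimod M"
    if f: "f \<in> bimod_Hom M M'" for M' f
  proof -
    note MM = bimod_HomD[OF f] and t = tens_map_Hom[OF bimod_id_Hom[OF E] f]
    show ?thesis
      by (rule tens_env_Hom_eqI[OF MM(1) comp_Hom[OF t lun_Hom[OF MM(2)]] comp_Hom[OF lun_Hom[OF MM(1)] f]])
        (simp add: bimod_HomD(3,4)[OF t] bimod_HomD(3)[OF lun_Hom[OF MM(1)]] MM tens_map_pure[OF bimod_id_Hom[OF E] f]
          bimodule.unital)
  qed
  show "run Bimod M' \<cdot> (f \<boxdot>\<^bsub>Bimod\<^esub> bimod_id env) = f \<cdot> run Bimod M"
    if f: "f \<in> bimod_Hom M M'" for M' f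
  proof -
    note MM = bimod_HomD[OF f] and t = tens_map_Hom[OF f bimod_id_Hom[OF E]]
    show ?thesis
      by (rule tens_env_Hom_eqI'[OF MM(1) comp_Hom[OF t run_Hom[OF MM(2)]] comp_Hom[OF run_Hom[OF MM(1)] f]])
        (simp add: bimod_HomD(3,4)[OF t] bimod_HomD(3)[OF run_Hom[OF MM(1)]] MM tens_map_pure[OF f bimod_id_Hom[OF E]]
          bimodule.unital)
  qed
  show "asc Bimod M' N' P' \<cdot> ((f \<boxdot>\<^bsub>Bimod\<^esub> g) \<boxdot>\<^bsub>Bimod\<^esub> h)
      = (f \<boxdot>\<^bsub>Bimod\<^esub> (g \<boxdot>\<^bsub>Bimod\<^esub> h)) \<cdot> asc Bimod M N P"
    if f: "f \<in> bimod_Hom M M'" and g: "g \<in> bimod_Hom N N'" and h: "h \<in> bimod_Hom P P'" for M' N' P' f g h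
  proof -
    note F = bimod_HomD[OF f] and G = bimod_HomD[OF g] and H = bimod_HomD[OF h]
    note fg = tens_map_Hom[OF f g] and gh = tens_map_Hom[OF g h]
    note l = tens_map_Hom[OF fg h] and r = tens_map_Hom[OF f gh]
    note a = asc_Hom[OF F(1) G(1) H(1)] and a' = asc_Hom[OF F(2) G(2) H(2)]
    show ?thesis
      by (rule tens3_Hom_eqI[OF F(1) G(1) H(1) comp_Hom[OF l a'] comp_Hom[OF a r]])
        (simp add: F G H bimod_HomD(3)[OF l] bimod_HomD(3)[OF a] tens_map_pure[OF fg h] tens_map_pure[OF f g]
          tens_map_pure[OF f gh] tens_map_pure[OF g h])
  qed
  show "asc Bimod M N (tens P U) \<cdot> asc Bimod (tens M N) P U
      = (bimod_id M \<boxdot>\<^bsub>Bimod\<^esub> asc Bimod N P U) \<cdot> asc Bimod M (tens N P) U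
        \<cdot> (asc Bimod M N P \<boxdot>\<^bsub>Bimod\<^esub> bimod_id U)"
    if M: "bimodule M" and N: "bimodule N" and P: "bimodule P" and U: "bimodule U" for U
  proof -
    note [simp] = M N P U
    note i = bimod_id_Hom[OF M] and j = bimod_id_Hom[OF U]
    note a1 = asc_Hom[OF bimodule_tens[OF M N] P U] and a2 = asc_Hom[OF M N bimodule_tens[OF P U]]
      and a3 = asc_Hom[OF M N P] and a4 = asc_Hom[OF M bimodule_tens[OF N P] U] and a5 = asc_Hom[OF N P U]
    note t3 = tens_map_Hom[OF a3 j] and t5 = tens_map_Hom[OF i a5]
    show ?thesis
      by (rule tens4_Hom_eqI[OF M N P U comp_Hom[OF a1 a2] comp_Hom[OF comp_Hom[OF t3 a4] t5]])
        (simp add: bimod_HomD(3)[OF a1] bimod_HomD(3)[OF t3] tens_map_pure[OF a3 j] tens_map_pure[OF i a5])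
  qed
  show "(bimod_id M \<boxdot>\<^bsub>Bimod\<^esub> lun Bimod N) \<cdot> asc Bimod M env N = run Bimod M \<boxdot>\<^bsub>Bimod\<^esub> bimod_id N"
    if M: "bimodule M" and N: "bimodule N"
  proof -
    let ?e = "env_el 1 (1 :: 'r) :: 'u"
    note [simp] = M N
    note i = bimod_id_Hom[OF M] and j = bimod_id_Hom[OF N] and a = asc_Hom[OF M E N]
    note l = tens_map_Hom[OF i lun_Hom[OF N]] and r = tens_map_Hom[OF run_Hom[OF M] j]
    have c: "(bimod_id M \<boxdot>\<^bsub>Bimod\<^esub> lun Bimod N) \<cdot> asc Bimod M env N
        \<in> bimod_Hom (tens (tens M env) N) (tens M N)" by (rule comp_Hom[OF a l])
    note pl = pure_hom_left[OF bimodule_tens[OF M E] N]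
    show ?thesis
    proof (rule tens3_Hom_eqI[OF M E N c r])
      fix m e n assume m: "m \<in> carrier M" and e: "e \<in> carrier Env" and n: "n \<in> carrier N"
      note h = hom_comp[OF pure_hom_right[OF M E m] pl[OF n]]
      show "bfun ((bimod_id M \<boxdot>\<^bsub>Bimod\<^esub> lun Bimod N) \<cdot> asc Bimod M env N) (pure (tens M env) N (pure M env m e) n)
        = bfun (run Bimod M \<boxdot>\<^bsub>Bimod\<^esub> bimod_id N) (pure (tens M env) N (pure M env m e) n)"
      \<comment> \<open>With \<open>m\<close> and \<open>n\<close> fixed, both sides are treated as
        additive maps of \<open>e\<close>, so they are compared on all pure elements
        \<open>(x, y)\<close>.\<close>
      proof (rule env_hom_eqI[OF bimodule_group[OF bimodule_tens[OF M N]]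
            hom_comp[OF h bimod_homD(1)[OF bimod_HomD(5)[OF c]]] hom_comp[OF h bimod_homD(1)[OF bimod_HomD(5)[OF r]]] _ e])
        fix x y :: 'r
        show "bfun ((bimod_id M \<boxdot>\<^bsub>Bimod\<^esub> lun Bimod N) \<cdot> asc Bimod M env N)
            (pure (tens M env) N (pure M env m (env_el x y)) n)
          = bfun (run Bimod M \<boxdot>\<^bsub>Bimod\<^esub> bimod_id N) (pure (tens M env) N (pure M env m (env_el x y)) n)"
          by (simp add: m n bimod_HomD(3)[OF a] tens_map_pure[OF i lun_Hom[OF N]] tens_map_pure[OF run_Hom[OF M] j]
              pure_simps[OF M N] bimodule.closed bimodule.commuting)
      qed
    qed
  qed
qed

end

section \<open>Componentwise structure on the powers of a monoidal category\<close>

section \<open>Powers of a monoidal category\<close>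

lemma power_cat_sel [simp]:
  "Obj (power_cat C n) = {xs. length xs = n \<and> set xs \<subseteq> Obj C}"
  "Dom (power_cat C n) = map (Dom C)" "Cod (power_cat C n) = map (Cod C)"
  "Idn (power_cat C n) = map (Idn C)" "Comp (power_cat C n) = map2 (Comp C)"
  by (simp_all add: power_cat_def)

lemma power_moncat_sel [simp]:
  "Obj (power_moncat V n) = {xs. length xs = n \<and> set xs \<subseteq> Obj V}"
  "Arr (power_moncat V n) = Arr (power_cat V n)"
  "Dom (power_moncat V n) = map (Dom V)" "Cod (power_moncat V n) = map (Cod V)"
  "Idn (power_moncat V n) = map (Idn V)" "Comp (power_moncat V n) = map2 (Comp V)"
  "tensO (power_moncat V n) = map2 (tensO V)" "tensM (power_moncat V n) = map2 (tensM V)"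
  "munit (power_moncat V n) = replicate n (munit V)"
  "asc (power_moncat V n) = (\<lambda>xs ys zs. map (\<lambda>(x, y, z). asc V x y z) (zip xs (zip ys zs)))"
  "lun (power_moncat V n) = map (lun V)" "run (power_moncat V n) = map (run V)"
  by (simp_all add: power_moncat_def power_cat_def cat.defs moncat.defs)

lemma power_Hom_iff:
  "fs \<in> Hom (power_cat C n) xs ys \<longleftrightarrow> length fs = n \<and> length xs = n \<and> length ys = n \<and>
     (\<forall>i<n. fs ! i \<in> Hom C (xs ! i) (ys ! i))"
  by (auto simp: Hom_def power_cat_def list_eq_iff_nth_eq set_conv_nth)

lemma power_moncat_Hom [simp]: "Hom (power_moncat V n) = Hom (power_cat V n)"
  by (simp add: Hom_def fun_eq_iff)

lemma all_nth_mem: "set xs \<subseteq> A \<longleftrightarrow> (\<forall>i<length xs. xs ! i \<in> A)"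
  by (auto simp: set_conv_nth)

lemma category_power:
  assumes "category C"
  shows "category (power_cat C n)"
proof -
  interpret category C by fact
  show ?thesis
  proof
    show "Dom (power_cat C n) fs \<in> Obj (power_cat C n)" "Cod (power_cat C n) fs \<in> Obj (power_cat C n)"
      if "fs \<in> Arr (power_cat C n)" for fs
      using that Dom_Obj Cod_Obj by (auto simp: power_cat_def)
  qed (auto simp: power_Hom_iff all_nth_mem Idn_Hom intro!: nth_equalityI
      intro: Comp_Hom, metis Idn_left, metis Idn_right, metis Comp_assoc)
qed

lemma is_isoE:
  assumes "is_iso C f" "f \<in> Hom C x y"
  obtains g where "g \<in> Hom C y x" "Comp C g f = Idn C x" "Comp C f g = Idn C y"
  using assms by (auto simp: is_iso_def Hom_def)

lemma power_iso:
  assumes "\<And>i. i < n \<Longrightarrow> is_iso V (fs ! i)" "fs \<in> Hom (power_cat V n) xs ys"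
  shows "is_iso (power_moncat V n) fs"
proof -
  have "\<forall>i. \<exists>g. i < n \<longrightarrow> g \<in> Hom V (ys ! i) (xs ! i) \<and> Comp V g (fs ! i) = Idn V (xs ! i) \<and> Comp V (fs ! i) g = Idn V (ys ! i)"
  proof
    fix i
    show "\<exists>g. i < n \<longrightarrow> g \<in> Hom V (ys ! i) (xs ! i) \<and> Comp V g (fs ! i) = Idn V (xs ! i) \<and> Comp V (fs ! i) g = Idn V (ys ! i)"
    proof (cases "i < n")
      case True
      then have "fs ! i \<in> Hom V (xs ! i) (ys ! i)" using assms(2) by (simp add: power_Hom_iff)
      then show ?thesis using is_isoE[OF assms(1)[OF True]] by metis
    qed simp
  qed
  then obtain g where g: "\<And>i. i < n \<Longrightarrow> g i \<in> Hom V (ys ! i) (xs ! i) \<and> Comp V (g i) (fs ! i) = Idn V (xs ! i)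
      \<and> Comp V (fs ! i) (g i) = Idn V (ys ! i)"
    by metis
  have d: "map (Dom V) fs = xs" "map (Cod V) fs = ys" "fs \<in> Arr (power_cat V n)"
    using assms(2) by (auto simp: Hom_def)
  have l: "length fs = n" "length xs = n" "length ys = n"
    using assms(2) by (auto simp: power_Hom_iff)
  have "map g [0..<n] \<in> Hom (power_cat V n) ys xs"
    using g l by (simp add: power_Hom_iff)
  moreover have "map2 (Comp V) (map g [0..<n]) fs = map (Idn V) xs" "map2 (Comp V) fs (map g [0..<n]) = map (Idn V) ys"
    using g l by (auto intro!: nth_equalityI)
  ultimately show ?thesis
    unfolding is_iso_def using d by (auto intro!: bexI[of _ "map g [0..<n]"])
qed

lemma monoidal_category_power:
  assumes "monoidal_category V"
  shows "monoidal_category (power_moncat V n)"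
proof -
  interpret monoidal_category V by fact
  interpret P: category "power_cat V n" by (rule category_power) unfold_locales
  show ?thesis
  proof (intro monoidal_category.intro monoidal_category_axioms.intro)
    show "category (power_moncat V n)"
    proof
      show "Dom (power_moncat V n) fs \<in> Obj (power_moncat V n)" "Cod (power_moncat V n) fs \<in> Obj (power_moncat V n)"
        if "fs \<in> Arr (power_moncat V n)" for fs
        using P.Dom_Obj[of fs] P.Cod_Obj[of fs] that by auto
    qed (use P.Idn_Hom P.Comp_Hom P.Idn_left P.Idn_right P.Comp_assoc in auto)
    fix xs ys zs assume xyz: "xs \<in> Obj (power_moncat V n)" "ys \<in> Obj (power_moncat V n)" "zs \<in> Obj (power_moncat V n)"
    show a: "asc (power_moncat V n) xs ys zs \<in> Hom (power_moncat V n)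
        (xs \<boxtimes>\<^bsub>power_moncat V n\<^esub> ys \<boxtimes>\<^bsub>power_moncat V n\<^esub> zs) (xs \<boxtimes>\<^bsub>power_moncat V n\<^esub> (ys \<boxtimes>\<^bsub>power_moncat V n\<^esub> zs))"
      using xyz by (simp add: power_Hom_iff all_nth_mem asc_Hom)
    show "is_iso (power_moncat V n) (asc (power_moncat V n) xs ys zs)"
      using xyz by (intro power_iso[OF _ a[simplified power_moncat_Hom]]) (simp add: all_nth_mem asc_iso)
  next
    fix xs assume xs: "xs \<in> Obj (power_moncat V n)"
    show a: "lun (power_moncat V n) xs \<in> Hom (power_moncat V n) (munit (power_moncat V n) \<boxtimes>\<^bsub>power_moncat V n\<^esub> xs) xs"
      using xs by (simp add: power_Hom_iff all_nth_mem lun_Hom)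
    show "is_iso (power_moncat V n) (lun (power_moncat V n) xs)"
      using xs by (intro power_iso[OF _ a[simplified power_moncat_Hom]]) (simp add: all_nth_mem lun_iso)
    show b: "run (power_moncat V n) xs \<in> Hom (power_moncat V n) (xs \<boxtimes>\<^bsub>power_moncat V n\<^esub> munit (power_moncat V n)) xs"
      using xs by (simp add: power_Hom_iff all_nth_mem run_Hom)
    show "is_iso (power_moncat V n) (run (power_moncat V n) xs)"
      using xs by (intro power_iso[OF _ b[simplified power_moncat_Hom]]) (simp add: all_nth_mem run_iso)
  qed (auto simp: power_Hom_iff all_nth_mem tensO_Obj tensM_Hom tensM_Idn munit_Obj pentagon triangle
      intro!: nth_equalityI, metis tensM_Comp, metis asc_natural, metis lun_natural, metis run_natural)
qed

section \<open>Relations over R, Takeuchi sums and the product bimodules\<close>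

section \<open>Takeuchi products\<close>

abbreviation bimods :: "('r::{ring,monoid_mult}, 'a) bimod list \<Rightarrow> bool" where
  "bimods Ms \<equiv> \<forall>M\<in>set Ms. bimodule M"

definition rels :: "('r::{ring,monoid_mult}, 'a) bimod list \<Rightarrow> ('a list \<Rightarrow>\<^sub>0 int) set" where
  "rels Ms = tensor_rels Ms (R_balanced Ms)"

text \<open>The preimage of the Takeuchi product among formal sums. Stated as a congruence modulo
  \<open>rels\<close>, the condition is independent of the representative, since right actions
  preserve the relations (\<open>rels_subset_takeuchi\<close>).\<close>

definition takeuchi :: "('r::{ring,monoid_mult}, 'a) bimod list \<Rightarrow> ('a list \<Rightarrow>\<^sub>0 int) set" where
  "takeuchi Ms = {c \<in> sums (tuples Ms). \<forall>j s. Suc j < length Ms \<longrightarrow>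
     apply_slot j (\<lambda>m. rbar (Ms ! j) m s) c - apply_slot (Suc j) (\<lambda>m. ract (Ms ! Suc j) m s) c \<in> rels Ms}"

text \<open>Multilinearity and balancing over R, read modulo \<open>H\<close>: the condition under
  which a linear extension sends \<open>rels\<close> into \<open>H\<close>
  (\<open>frag_extend_rels\<close>). Values are formal sums over any index type, so that ring-valued
  functions on tuples can be encoded as well.\<close>

definition balanced_on ::
    "('r::{ring,monoid_mult}, 'a) bimod list \<Rightarrow> ('b \<Rightarrow>\<^sub>0 int) set \<Rightarrow> ('a list \<Rightarrow> ('b \<Rightarrow>\<^sub>0 int)) \<Rightarrow> bool" where
  "balanced_on Ms H f \<longleftrightarrow>
     (\<forall>Ms1 M Ms2 t u a b. Ms = Ms1 @ M # Ms2 \<longrightarrow> t \<in> tuples Ms1 \<longrightarrow> u \<in> tuples Ms2 \<longrightarrow>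
        a \<in> carrier M \<longrightarrow> b \<in> carrier M \<longrightarrow>
        f (t @ (a \<otimes>\<^bsub>M\<^esub> b) # u) - f (t @ a # u) - f (t @ b # u) \<in> H) \<and>
     (\<forall>Ms1 M N Ms2 t u a b s. Ms = Ms1 @ M # N # Ms2 \<longrightarrow> t \<in> tuples Ms1 \<longrightarrow> u \<in> tuples Ms2 \<longrightarrow>
        a \<in> carrier M \<longrightarrow> b \<in> carrier N \<longrightarrow>
        f (t @ lbar M s a # b # u) - f (t @ a # lact N s b # u) \<in> H)"

lemma balanced_onI:
  assumes "\<And>Ms1 M Ms2 t u a b. Ms = Ms1 @ M # Ms2 \<Longrightarrow> t \<in> tuples Ms1 \<Longrightarrow> u \<in> tuples Ms2 \<Longrightarrow>
        a \<in> carrier M \<Longrightarrow> b \<in> carrier M \<Longrightarrow>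
        f (t @ (a \<otimes>\<^bsub>M\<^esub> b) # u) - f (t @ a # u) - f (t @ b # u) \<in> H"
    and "\<And>Ms1 M N Ms2 t u a b s. Ms = Ms1 @ M # N # Ms2 \<Longrightarrow> t \<in> tuples Ms1 \<Longrightarrow> u \<in> tuples Ms2 \<Longrightarrow>
        a \<in> carrier M \<Longrightarrow> b \<in> carrier N \<Longrightarrow>
        f (t @ lbar M s a # b # u) - f (t @ a # lact N s b # u) \<in> H"
  shows "balanced_on Ms H f"
  unfolding balanced_on_def using assms by blast

lemma balanced_on_mult:
  assumes "balanced_on (Ms1 @ M # Ms2) H f" "t \<in> tuples Ms1" "u \<in> tuples Ms2" "a \<in> carrier M" "b \<in> carrier M"
  shows "f (t @ (a \<otimes>\<^bsub>M\<^esub> b) # u) - f (t @ a # u) - f (t @ b # u) \<in> H"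
  using assms unfolding balanced_on_def by blast

lemma balanced_on_bal:
  assumes "balanced_on (Ms1 @ M # N # Ms2) H f" "t \<in> tuples Ms1" "u \<in> tuples Ms2" "a \<in> carrier M" "b \<in> carrier N"
  shows "f (t @ lbar M s a # b # u) - f (t @ a # lact N s b # u) \<in> H"
  using assms unfolding balanced_on_def by blast

lemma balanced_on_frag_extend:
  assumes H: "diff_closed H" and "\<And>v. v \<in> Poly_Mapping.keys d \<Longrightarrow> balanced_on Ms H (\<lambda>t. g t v)"
  shows "balanced_on Ms H (\<lambda>t. frag_extend (g t) d)"
proof (rule balanced_onI)
  fix Ms1 M Ms2 t u a b
  assume eq: "Ms = Ms1 @ M # Ms2" and "t \<in> tuples Ms1" "u \<in> tuples Ms2" "a \<in> carrier M" "b \<in> carrier M"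
  then show "frag_extend (g (t @ (a \<otimes>\<^bsub>M\<^esub> b) # u)) d - frag_extend (g (t @ a # u)) d - frag_extend (g (t @ b # u)) d \<in> H"
    unfolding frag_extend_fun_diff[symmetric]
    by (intro frag_extend_mem[OF H] balanced_on_mult[OF assms(2)[unfolded eq]])
next
  fix Ms1 M N Ms2 t u a b s
  assume eq: "Ms = Ms1 @ M # N # Ms2" and "t \<in> tuples Ms1" "u \<in> tuples Ms2" "a \<in> carrier M" "b \<in> carrier N"
  then show "frag_extend (g (t @ lbar M s a # b # u)) d - frag_extend (g (t @ a # lact N s b # u)) d \<in> H"
    unfolding frag_extend_fun_diff[symmetric]
    by (intro frag_extend_mem[OF H] balanced_on_bal[OF assms(2)[unfolded eq]])
qed

lemma split_middle:
  assumes "Ms @ Q # Ps = A @ M # B"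
  obtains C where "Ms = A @ M # C" "B = C @ Q # Ps" | "A = Ms" "M = Q" "B = Ps"
    | C where "A = Ms @ Q # C" "Ps = C @ M # B"
  using assms by (auto simp: append_eq_append_conv2 append_eq_Cons_conv Cons_eq_append_conv)

lemma split_middle2:
  assumes "Ms @ Q # Ps = A @ M # N # B"
  obtains C where "Ms = A @ M # N # C" "B = C @ Q # Ps" | "Ms = A @ [M]" "N = Q" "B = Ps"
    | "A = Ms" "M = Q" "Ps = N # B" | C where "A = Ms @ Q # C" "Ps = C @ M # N # B"
  using assms by (auto simp: append_eq_append_conv2 append_eq_Cons_conv Cons_eq_append_conv)

text \<open>A relation sits entirely to the left of the distinguished slot, in it, to its right, or
  across one of its two boundaries. Each possibility is one hypothesis, so that flattening and
  contraction can be analysed at the slot they change.\<close>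

lemma balanced_on_middle:
  assumes left: "\<And>y ps. y \<in> carrier Q \<Longrightarrow> ps \<in> tuples Ps \<Longrightarrow> balanced_on Ms H (\<lambda>ms. f (ms @ y # ps))"
    and right: "\<And>ms y. ms \<in> tuples Ms \<Longrightarrow> y \<in> carrier Q \<Longrightarrow> balanced_on Ps H (\<lambda>ps. f (ms @ y # ps))"
    and mid: "\<And>ms y y' ps. ms \<in> tuples Ms \<Longrightarrow> y \<in> carrier Q \<Longrightarrow> y' \<in> carrier Q \<Longrightarrow> ps \<in> tuples Ps \<Longrightarrow>
      f (ms @ (y \<otimes>\<^bsub>Q\<^esub> y') # ps) - f (ms @ y # ps) - f (ms @ y' # ps) \<in> H"
    and bal_left: "\<And>A M ms a y ps s. Ms = A @ [M] \<Longrightarrow> ms \<in> tuples A \<Longrightarrow> a \<in> carrier M \<Longrightarrow> y \<in> carrier Q \<Longrightarrow>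
      ps \<in> tuples Ps \<Longrightarrow> f (ms @ lbar M s a # y # ps) - f (ms @ a # lact Q s y # ps) \<in> H"
    and bal_right: "\<And>N B ms b y ps s. Ps = N # B \<Longrightarrow> ms \<in> tuples Ms \<Longrightarrow> y \<in> carrier Q \<Longrightarrow> b \<in> carrier N \<Longrightarrow>
      ps \<in> tuples B \<Longrightarrow> f (ms @ lbar Q s y # b # ps) - f (ms @ y # lact N s b # ps) \<in> H"
  shows "balanced_on (Ms @ Q # Ps) H f"
proof (rule balanced_onI)
  fix A M B t u a b
  assume split: "Ms @ Q # Ps = A @ M # B" and t: "t \<in> tuples A" and u: "u \<in> tuples B"
    and ab: "a \<in> carrier M" "b \<in> carrier M"
  from split show "f (t @ (a \<otimes>\<^bsub>M\<^esub> b) # u) - f (t @ a # u) - f (t @ b # u) \<in> H"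
  proof (cases rule: split_middle)
    case (1 C)
    with u obtain u1 y ps where "u = u1 @ y # ps" "u1 \<in> tuples C" "y \<in> carrier Q" "ps \<in> tuples Ps"
      by (auto elim!: tuples_appendE tuples_ConsE)
    then show ?thesis using balanced_on_mult[OF left[unfolded 1]] t ab by simp
  next
    case 2
    then show ?thesis using mid t u ab by simp
  next
    case (3 C)
    with t obtain ms y t2 where "t = ms @ y # t2" "ms \<in> tuples Ms" "y \<in> carrier Q" "t2 \<in> tuples C"
      by (auto elim!: tuples_appendE tuples_ConsE)
    then show ?thesis using balanced_on_mult[OF right[unfolded 3(2)]] u ab by simp
  qed
next
  fix A M N B t u a b s
  assume split: "Ms @ Q # Ps = A @ M # N # B" and t: "t \<in> tuples A" and u: "u \<in> tuples B"
    and ab: "a \<in> carrier M" "b \<in> carrier N"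
  from split show "f (t @ lbar M s a # b # u) - f (t @ a # lact N s b # u) \<in> H"
  proof (cases rule: split_middle2)
    case (1 C)
    with u obtain u1 y ps where "u = u1 @ y # ps" "u1 \<in> tuples C" "y \<in> carrier Q" "ps \<in> tuples Ps"
      by (auto elim!: tuples_appendE tuples_ConsE)
    then show ?thesis using balanced_on_bal[OF left[unfolded 1]] t ab by simp
  next
    case 2
    then show ?thesis using bal_left t u ab by simp
  next
    case 3
    then show ?thesis using bal_right t u ab by simp
  next
    case (4 C)
    with t obtain ms y t2 where "t = ms @ y # t2" "ms \<in> tuples Ms" "y \<in> carrier Q" "t2 \<in> tuples C"
      by (auto elim!: tuples_appendE tuples_ConsE)
    then show ?thesis using balanced_on_bal[OF right[unfolded 4(2)]] u ab by simp
  qed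
qed

lemma rels_mult:
  "t \<in> tuples Ms1 \<Longrightarrow> u \<in> tuples Ms2 \<Longrightarrow> a \<in> carrier M \<Longrightarrow> b \<in> carrier M \<Longrightarrow>
    frag_of (t @ (a \<otimes>\<^bsub>M\<^esub> b) # u) - frag_of (t @ a # u) - frag_of (t @ b # u) \<in> rels (Ms1 @ M # Ms2)"
  unfolding rels_def by (rule tensor_rels_multilinear)

lemma rels_balanced:
  assumes "t \<in> tuples Ms1" "u \<in> tuples Ms2" "a \<in> carrier M" "b \<in> carrier N"
  shows "frag_of (t @ lbar M s a # b # u) - frag_of (t @ a # lact N s b # u) \<in> rels (Ms1 @ M # N # Ms2)"
proof -
  have "t @ a # b # u \<in> tuples (Ms1 @ M # N # Ms2)" using assms by (simp add: tuples_appendI)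
  moreover have "length t = length Ms1" using assms by (simp add: tuples_length)
  ultimately have "frag_of (t @ lbar M s a # b # u) - frag_of (t @ a # lact N s b # u) \<in> R_balanced (Ms1 @ M # N # Ms2)"
    unfolding R_balanced_def
    by (intro CollectI exI[of _ "t @ a # b # u"] exI[of _ "length Ms1"] exI[of _ s])
      (simp add: nth_append list_update_append)
  then show ?thesis unfolding rels_def using tensor_rels_incl by blast
qed

text \<open>A fixed context around a tuple shifts the slots of a relation without changing its
  shape.\<close>

lemma balanced_on_context:
  assumes "ms \<in> tuples Ms" "ps \<in> tuples Ps"
  shows "balanced_on Ns (rels (Ms @ Ns @ Ps)) (\<lambda>u. frag_of (ms @ u @ ps))"
proof (rule balanced_onI)
  fix A M B t u a b
  assume *: "Ns = A @ M # B" "t \<in> tuples A" "u \<in> tuples B" "a \<in> carrier M" "b \<in> carrier M"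
  show "frag_of (ms @ (t @ (a \<otimes>\<^bsub>M\<^esub> b) # u) @ ps) - frag_of (ms @ (t @ a # u) @ ps) - frag_of (ms @ (t @ b # u) @ ps)
      \<in> rels (Ms @ Ns @ Ps)"
    using rels_mult[of "ms @ t" "Ms @ A" "u @ ps" "B @ Ps" a M b] * assms by (simp add: tuples_appendI)
next
  fix A M N B t u a b s
  assume *: "Ns = A @ M # N # B" "t \<in> tuples A" "u \<in> tuples B" "a \<in> carrier M" "b \<in> carrier N"
  show "frag_of (ms @ (t @ lbar M s a # b # u) @ ps) - frag_of (ms @ (t @ a # lact N s b # u) @ ps)
      \<in> rels (Ms @ Ns @ Ps)"
    using rels_balanced[of "ms @ t" "Ms @ A" "u @ ps" "B @ Ps" a M b N s] * assms by (simp add: tuples_appendI)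
qed

lemma bimods_comm_group: "bimods Ms \<Longrightarrow> \<forall>M\<in>set Ms. comm_group M"
  by (simp add: bimodule_comm_group)

lemma R_balancedE:
  assumes "b \<in> R_balanced Ms"
  obtains A M N B t u x y s where "Ms = A @ M # N # B" "t \<in> tuples A" "u \<in> tuples B" "x \<in> carrier M" "y \<in> carrier N"
    "b = frag_of (t @ lbar M s x # y # u) - frag_of (t @ x # lact N s y # u)"
proof -
  obtain t j s where b: "b = frag_of (t[j := lbar (Ms ! j) s (t ! j)]) - frag_of (t[Suc j := lact (Ms ! Suc j) s (t ! Suc j)])"
    and t: "t \<in> tuples Ms" and j: "Suc j < length Ms"
    using assms unfolding R_balanced_def by blast
  obtain A M B' t1 x t2 where 1: "Ms = A @ M # B'" "t = t1 @ x # t2" "length A = j"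
    "t1 \<in> tuples A" "x \<in> carrier M" "t2 \<in> tuples B'"
    using tuples_splitE[OF t Suc_lessD[OF j]] by blast
  with j obtain N B where B': "B' = N # B" by (cases B') auto
  obtain y u where 2: "t2 = y # u" "y \<in> carrier N" "u \<in> tuples B"
    using 1(6) unfolding B' by (rule tuples_ConsE)
  have "length t1 = j" using 1 by (simp add: tuples_length)
  then have "b = frag_of (t1 @ lbar M s x # y # u) - frag_of (t1 @ x # lact N s y # u)"
    unfolding b using 1 2 B' by (simp add: nth_append list_update_append)
  then show ?thesis using that 1 2 B' by blast
qed

lemma R_balanced_subset:
  assumes "bimods Ms"
  shows "R_balanced Ms \<subseteq> sums (tuples Ms)"
proof
  fix b assume "b \<in> R_balanced Ms"
  then show "b \<in> sums (tuples Ms)"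
  proof (cases rule: R_balancedE)
    case (1 A M N B t u x y s)
    have "bimodule M" "bimodule N" using assms 1 by auto
    then show ?thesis
      unfolding 1(6) using 1 by (intro diff_closedD(2)[OF diff_closed_sums]) (auto simp: tuples_appendI bimodule.closed)
  qed
qed

lemma diff_closed_rels: "bimods Ms \<Longrightarrow> diff_closed (rels Ms)"
  unfolding rels_def by (rule diff_closed_tensor_rels[OF bimods_comm_group R_balanced_subset])

lemma rels_subset: "bimods Ms \<Longrightarrow> rels Ms \<subseteq> sums (tuples Ms)"
  unfolding rels_def by (rule tensor_rels_subset[OF bimods_comm_group R_balanced_subset])

lemma frag_extend_rels:
  assumes Ms: "bimods Ms" and H: "diff_closed H" and f: "balanced_on Ms H f" and c: "c \<in> rels Ms"
  shows "frag_extend f c \<in> H"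
proof -
  have "rels Ms \<subseteq> {c. frag_extend f c \<in> H}"
    unfolding rels_def
  proof (rule tensor_rels_least[OF bimods_comm_group[OF Ms] R_balanced_subset[OF Ms]])
    show "diff_closed {c. frag_extend f c \<in> H}"
      using diff_closedD(1,2)[OF H] by (auto simp: diff_closed_def frag_extend_diff)
    show "R_balanced Ms \<subseteq> {c. frag_extend f c \<in> H}"
      using f by (auto elim!: R_balancedE simp: frag_extend_diff balanced_on_bal)
  qed (use f in \<open>simp add: frag_extend_diff balanced_on_mult\<close>)
  then show ?thesis using c by auto
qed

lemma rels_context:
  assumes "bimods Ms" "bimods Ns" "bimods Ps" "ms \<in> tuples Ms" "ps \<in> tuples Ps" "c \<in> rels Ns"
  shows "frag_extend (\<lambda>u. frag_of (ms @ u @ ps)) c \<in> rels (Ms @ Ns @ Ps)"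
  using assms by (intro frag_extend_rels[OF _ diff_closed_rels balanced_on_context]) auto

text \<open>Slot \<open>i\<close> enters a balancing relation through \<open>lbar\<close> only with
  a right neighbour, and through \<open>lact\<close> only with a left one; hence the guards. They
  admit the left action of R in the first slot and that of the opposite ring in the last, although R
  need not be commutative.\<close>

lemma apply_slot_rels_balanced:
  assumes Ms: "bimods Ms" and i: "i < length Ms" and h: "h \<in> hom (Ms ! i) (Ms ! i)"
    and lb: "\<And>s a. Suc i < length Ms \<Longrightarrow> a \<in> carrier (Ms ! i) \<Longrightarrow> h (lbar (Ms ! i) s a) = lbar (Ms ! i) s (h a)"
    and la: "\<And>s a. 0 < i \<Longrightarrow> a \<in> carrier (Ms ! i) \<Longrightarrow> h (lact (Ms ! i) s a) = lact (Ms ! i) s (h a)"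
    and c: "c \<in> rels Ms"
  shows "apply_slot i h c \<in> rels Ms"
  using c unfolding rels_def
proof (rule apply_slot_rels[OF bimods_comm_group[OF Ms] R_balanced_subset[OF Ms] i h, rotated])
  fix b assume "b \<in> R_balanced Ms"
  then have "apply_slot i h b \<in> rels Ms"
  proof (cases rule: R_balancedE)
    case (1 A M N B t u x y s)
    have hM: "a \<in> carrier (Ms ! i) \<Longrightarrow> h a \<in> carrier (Ms ! i)" for a using h by (auto simp: hom_def)
    have lt: "length t = length A" using 1 by (simp add: tuples_length)
    consider "i < length A" | "i = length A" | "i = Suc (length A)" | k where "i = Suc (Suc (length A + k))" "k < length B"
    proof (cases "i < Suc (Suc (length A))")
      case True
      then show ?thesis using that(1-3) by (auto simp: less_Suc_eq)
    next
      case False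
      then obtain k where k: "i = Suc (Suc (length A)) + k" by (metis le_Suc_ex not_less)
      then have "k < length B" using i 1(1) by simp
      with k show ?thesis using that(4)[of k] by simp
    qed
    then show ?thesis
    proof cases
      case a: 1
      then have "t[i := h (t ! i)] \<in> tuples A"
        using 1 hM[of "t ! i"] tuples_nth[OF 1(2), of i] by (intro tuples_update) (auto simp: nth_append)
      from rels_balanced[OF this 1(3,4,5)] show ?thesis
        unfolding 1 using a lt by (simp add: apply_slot_diff list_update_append nth_append)
    next
      case 2
      then have "h x \<in> carrier M" "h (lbar M s x) = lbar M s (h x)" using hM lb[of x s] 1 by auto
      with rels_balanced[OF 1(2,3) this(1) 1(5)] show ?thesis
        unfolding 1 using 2 lt by (simp add: apply_slot_diff list_update_append nth_append)
    next
      case 3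
      then have "h y \<in> carrier N" "h (lact N s y) = lact N s (h y)" using hM la[of y s] 1 by (auto simp: nth_append)
      with rels_balanced[OF 1(2,3,4) this(1)] show ?thesis
        unfolding 1 using 3 lt by (simp add: apply_slot_diff list_update_append nth_append)
    next
      case (4 k)
      then have "u[k := h (u ! k)] \<in> tuples B"
        using 1 hM[of "u ! k"] tuples_nth[OF 1(3), of k] by (intro tuples_update) (auto simp: nth_append)
      from rels_balanced[OF 1(2) this 1(4,5)] show ?thesis
        unfolding 1 using 4 lt by (simp add: apply_slot_diff list_update_append nth_append)
    qed
  qed
  then show "apply_slot i h b \<in> tensor_rels Ms (R_balanced Ms)" by (simp add: rels_def)
qed

lemma nth_bimod: "bimods Ms \<Longrightarrow> i < length Ms \<Longrightarrow> bimodule (Ms ! i)"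
  by simp

lemma apply_slot_right_rels:
  assumes Ms: "bimods Ms" and i: "i < length Ms" and c: "c \<in> rels Ms"
  shows "apply_slot i (\<lambda>m. ract (Ms ! i) m s) c \<in> rels Ms" "apply_slot i (\<lambda>m. rbar (Ms ! i) m s) c \<in> rels Ms"
  using bimodule_homs[OF nth_bimod[OF Ms i]] bimodule.commuting[OF nth_bimod[OF Ms i]]
  by (auto intro!: apply_slot_rels_balanced[OF Ms i _ _ _ c])

lemma rels_subset_takeuchi: "bimods Ms \<Longrightarrow> rels Ms \<subseteq> takeuchi Ms"
  using rels_subset[of Ms] apply_slot_right_rels[of Ms] diff_closedD(2)[OF diff_closed_rels[of Ms]]
  by (auto simp: takeuchi_def)

lemma takeuchiD:
  assumes "c \<in> takeuchi Ms"
  shows "c \<in> sums (tuples Ms)"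
    "Suc j < length Ms \<Longrightarrow>
      apply_slot j (\<lambda>m. rbar (Ms ! j) m s) c - apply_slot (Suc j) (\<lambda>m. ract (Ms ! Suc j) m s) c \<in> rels Ms"
  using assms by (auto simp: takeuchi_def)

lemma diff_closed_takeuchi:
  assumes "bimods Ms"
  shows "diff_closed (takeuchi Ms)"
  unfolding diff_closed_def
proof (intro conjI ballI)
  note R = diff_closed_rels[OF assms]
  show "0 \<in> takeuchi Ms" using rels_subset_takeuchi[OF assms] diff_closedD(1)[OF R] by auto
  fix c d assume c: "c \<in> takeuchi Ms" and d: "d \<in> takeuchi Ms"
  have "c - d \<in> sums (tuples Ms)"
    using c d by (intro diff_closedD(2)[OF diff_closed_sums]) (auto simp: takeuchi_def)
  moreover have "apply_slot j (\<lambda>m. rbar (Ms ! j) m s) (c - d) - apply_slot (Suc j) (\<lambda>m. ract (Ms ! Suc j) m s) (c - d) \<in> rels Ms"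
    if "Suc j < length Ms" for j s
  proof -
    have "(apply_slot j (\<lambda>m. rbar (Ms ! j) m s) c - apply_slot (Suc j) (\<lambda>m. ract (Ms ! Suc j) m s) c)
      - (apply_slot j (\<lambda>m. rbar (Ms ! j) m s) d - apply_slot (Suc j) (\<lambda>m. ract (Ms ! Suc j) m s) d) \<in> rels Ms"
      by (rule diff_closedD(2)[OF R takeuchiD(2)[OF c that] takeuchiD(2)[OF d that]])
    then show ?thesis by (simp add: apply_slot_diff algebra_simps)
  qed
  ultimately show "c - d \<in> takeuchi Ms" by (simp add: takeuchi_def)
qed

text \<open>Besides descending to classes, the operation has to commute with the right actions by
  which its slot enters the Takeuchi conditions, again only on the sides where there is a neighbour.
  Conditions away from the slot commute with it by themselves.\<close>

lemma takeuchi_apply_slot: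
  assumes Ms: "bimods Ms" and i: "i < length Ms" and h: "h \<in> hom (Ms ! i) (Ms ! i)"
    and lb: "\<And>s a. Suc i < length Ms \<Longrightarrow> a \<in> carrier (Ms ! i) \<Longrightarrow> h (lbar (Ms ! i) s a) = lbar (Ms ! i) s (h a)"
    and la: "\<And>s a. 0 < i \<Longrightarrow> a \<in> carrier (Ms ! i) \<Longrightarrow> h (lact (Ms ! i) s a) = lact (Ms ! i) s (h a)"
    and rb: "\<And>s a. Suc i < length Ms \<Longrightarrow> a \<in> carrier (Ms ! i) \<Longrightarrow> h (rbar (Ms ! i) a s) = rbar (Ms ! i) (h a) s"
    and ra: "\<And>s a. 0 < i \<Longrightarrow> a \<in> carrier (Ms ! i) \<Longrightarrow> h (ract (Ms ! i) a s) = ract (Ms ! i) (h a) s"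
    and c: "c \<in> takeuchi Ms"
  shows "apply_slot i h c \<in> takeuchi Ms"
proof -
  have cs: "c \<in> sums (tuples Ms)" using c by (simp add: takeuchi_def)
  have "apply_slot i h c \<in> sums (tuples Ms)"
    by (rule apply_slot_sums[OF cs i]) (use h in \<open>auto simp: hom_def\<close>)
  moreover have "apply_slot j (\<lambda>m. rbar (Ms ! j) m s) (apply_slot i h c)
      - apply_slot (Suc j) (\<lambda>m. ract (Ms ! Suc j) m s) (apply_slot i h c) \<in> rels Ms"
    if j: "Suc j < length Ms" for j s
  proof -
    have "apply_slot j (\<lambda>m. rbar (Ms ! j) m s) (apply_slot i h c) = apply_slot i h (apply_slot j (\<lambda>m. rbar (Ms ! j) m s) c)"
      by (rule apply_slot_commute[OF cs _ i]) (use j rb in auto)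
    moreover have "apply_slot (Suc j) (\<lambda>m. ract (Ms ! Suc j) m s) (apply_slot i h c)
        = apply_slot i h (apply_slot (Suc j) (\<lambda>m. ract (Ms ! Suc j) m s) c)"
      by (rule apply_slot_commute[OF cs _ i]) (use j ra in auto)
    moreover have "apply_slot i h (apply_slot j (\<lambda>m. rbar (Ms ! j) m s) c
        - apply_slot (Suc j) (\<lambda>m. ract (Ms ! Suc j) m s) c) \<in> rels Ms"
      by (rule apply_slot_rels_balanced[OF Ms i h lb la]) (use c j in \<open>auto simp: takeuchi_def\<close>)
    ultimately show ?thesis by (simp add: apply_slot_diff)
  qed
  ultimately show ?thesis by (simp add: takeuchi_def)
qed

text \<open>For one factor the tensor product collapses to \<open>M\<close>. Formal sums carry
  signs, so the induction uses two consequences of multilinearity: a neutral entry gives a relation,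
  and an inverse entry is congruent to minus the entry.\<close>

lemma evaluate_single:
  fixes M :: "('r::{ring,monoid_mult}, 'a) bimod"
  assumes M: "bimodule M" and c: "c \<in> sums (tuples [M])"
  shows "evaluate M hd c \<in> carrier M" "c - frag_of [evaluate M hd c] \<in> rels [M]"
proof -
  interpret M: bimodule M by fact
  have R: "diff_closed (rels [M])" using M by (intro diff_closed_rels) simp
  have hd: "hd \<in> tuples [M] \<rightarrow> carrier M" by (auto elim!: tuples_ConsE)
  note ev = M.evaluate_closed[OF hd]
  show "evaluate M hd c \<in> carrier M" using c ev by auto
  have mult: "frag_of [a \<otimes>\<^bsub>M\<^esub> b] - frag_of [a] - frag_of [b] \<in> rels [M]" if "a \<in> carrier M" "b \<in> carrier M" for a b
    using rels_mult[of "[]" "[]" "[]" "[]" a M b] that by simp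
  \<comment> \<open>Multilinearity with both entries neutral is exactly minus this tuple.\<close>
  have neg_one: "- frag_of [\<one>\<^bsub>M\<^esub>] \<in> rels [M]" using mult[of "\<one>\<^bsub>M\<^esub>" "\<one>\<^bsub>M\<^esub>"] by simp
  have invs: "frag_of [inv\<^bsub>M\<^esub> a] + frag_of [a] \<in> rels [M]" if "a \<in> carrier M" for a
    using diff_closedD(2)[OF R diff_closedD(3)[OF R neg_one] mult[of "inv\<^bsub>M\<^esub> a" a]] that by (simp add: algebra_simps)
  have "Poly_Mapping.keys c \<subseteq> tuples [M] \<and> c - frag_of [evaluate M hd c] \<in> rels [M]"
    using c unfolding mem_Collect_eq
  proof (induction c rule: frag_induction)
    case zero
    show ?case using neg_one by simp
  next
    case (one x)
    then show ?case using diff_closedD(1)[OF R] by (auto elim!: tuples_ConsE)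
  next
    case (diff a b)
    let ?x = "evaluate M hd a" and ?y = "evaluate M hd b"
    have xy: "?x \<in> carrier M" "?y \<in> carrier M" using diff ev by auto
    have "a - b - frag_of [?x \<otimes>\<^bsub>M\<^esub> inv\<^bsub>M\<^esub> ?y] = ((a - frag_of [?x]) - (b - frag_of [?y]))
        - (frag_of [?x \<otimes>\<^bsub>M\<^esub> inv\<^bsub>M\<^esub> ?y] - frag_of [?x] - frag_of [inv\<^bsub>M\<^esub> ?y]) - (frag_of [inv\<^bsub>M\<^esub> ?y] + frag_of [?y])"
      by simp
    also have "\<dots> \<in> rels [M]"
      using diff xy by (intro diff_closedD(2)[OF R diff_closedD(2)[OF R diff_closedD(2)[OF R] mult] invs]) auto
    finally have "a - b - frag_of [?x \<otimes>\<^bsub>M\<^esub> inv\<^bsub>M\<^esub> ?y] \<in> rels [M]" .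
    moreover have "evaluate M hd (a - b) = ?x \<otimes>\<^bsub>M\<^esub> inv\<^bsub>M\<^esub> ?y"
      using diff by (intro M.evaluate_diff[OF hd]) auto
    moreover have "Poly_Mapping.keys (a - b) \<subseteq> tuples [M]" using diff keys_diff by fastforce
    ultimately show ?case by simp
  qed
  then show "c - frag_of [evaluate M hd c] \<in> rels [M]" by simp
qed

text \<open>The counterpart of \<open>evaluate_single\<close>: together they show that for one
  factor congruence modulo \<open>rels\<close> is equality of values.\<close>

lemma evaluate_rels_single:
  fixes M :: "('r::{ring,monoid_mult}, 'a) bimod"
  assumes M: "bimodule M" and c: "c \<in> rels [M]"
  shows "evaluate M hd c = \<one>\<^bsub>M\<^esub>"
proof -
  interpret M: bimodule M by fact
  have bM: "bimods [M]" using M by simp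
  have hd: "hd \<in> tuples [M] \<rightarrow> carrier M" by (auto elim!: tuples_ConsE)
  let ?H = "{c. Poly_Mapping.keys c \<subseteq> tuples [M] \<and> evaluate M hd c = \<one>\<^bsub>M\<^esub>}"
  have "rels [M] \<subseteq> ?H"
    unfolding rels_def
  proof (rule tensor_rels_least[OF bimods_comm_group[OF bM] R_balanced_subset[OF bM]])
    show "diff_closed ?H"
      using diff_closedD(2)[OF diff_closed_sums] by (auto simp: diff_closed_def M.evaluate_diff[OF hd])
    show "R_balanced [M] \<subseteq> ?H" by (auto simp: R_balanced_def)
    fix Ms1 N Ms2 t u a b
    assume *: "[M] = Ms1 @ N # Ms2" "t \<in> tuples Ms1" "u \<in> tuples Ms2" "a \<in> carrier N" "b \<in> carrier N"
    then have [simp]: "t = []" "u = []" "N = M" by (auto simp: Cons_eq_append_conv)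
    have ab: "a \<in> carrier M" "b \<in> carrier M" using * by auto
    have k: "frag_of [a \<otimes>\<^bsub>M\<^esub> b] - frag_of [a] \<in> sums (tuples [M])"
      using ab by (intro diff_closedD(2)[OF diff_closed_sums]) auto
    then have "frag_of [a \<otimes>\<^bsub>M\<^esub> b] - frag_of [a] - frag_of [b] \<in> sums (tuples [M])"
      using ab by (intro diff_closedD(2)[OF diff_closed_sums]) auto
    moreover have "evaluate M hd (frag_of [a \<otimes>\<^bsub>M\<^esub> b] - frag_of [a] - frag_of [b]) = \<one>\<^bsub>M\<^esub>"
      using k ab by (simp add: M.evaluate_diff[OF hd] M.m_comm[of a b]) (simp add: M.m_assoc)
    ultimately show "frag_of (t @ (a \<otimes>\<^bsub>N\<^esub> b) # u) - frag_of (t @ a # u) - frag_of (t @ b # u) \<in> ?H"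
      by simp
  qed
  then show ?thesis using c by auto
qed

lemma timesR_small: "2 \<le> length Ms \<Longrightarrow> timesR Ms = small (times_raw Ms)"
  by (cases Ms rule: timesR.cases) auto

lemma slot_action_left:
  assumes "bimods Ms" "Ms \<noteq> []"
  shows "slot_action Ms (R_balanced Ms) 0 (\<lambda>s m. lact (Ms ! 0) s m)"
    "slot_action Ms (R_balanced Ms) 0 (\<lambda>s m. ract (Ms ! 0) m s)"
    "slot_action Ms (R_balanced Ms) (length Ms - 1) (\<lambda>s m. lbar (Ms ! (length Ms - 1)) s m)"
    "slot_action Ms (R_balanced Ms) (length Ms - 1) (\<lambda>s m. rbar (Ms ! (length Ms - 1)) m s)"
proof -
  define k where "k = length Ms - 1"
  have i: "0 < length Ms" and l: "k < length Ms" "\<not> Suc k < length Ms" using assms by (auto simp: k_def)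
  interpret A: bimodule "Ms ! 0" using nth_bimod[OF assms(1) i] .
  interpret B: bimodule "Ms ! k" using nth_bimod[OF assms(1) l(1)] .
  have R: "b \<in> rels Ms" if "b \<in> R_balanced Ms" for b using that tensor_rels_incl unfolding rels_def by blast
  have "slot_action Ms (R_balanced Ms) 0 (\<lambda>s m. lact (Ms ! 0) s m)"
    "slot_action Ms (R_balanced Ms) 0 (\<lambda>s m. ract (Ms ! 0) m s)"
    "slot_action Ms (R_balanced Ms) k (\<lambda>s m. lbar (Ms ! k) s m)"
    "slot_action Ms (R_balanced Ms) k (\<lambda>s m. rbar (Ms ! k) m s)"
    unfolding slot_action_def rels_def[symmetric]
    using i l bimodule_homs[OF A.bimodule_axioms] bimodule_homs[OF B.bimodule_axioms]
    by (auto simp: A.scalar_additive B.scalar_additive A.unital B.unital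
        intro!: apply_slot_rels_balanced[OF assms(1) _ _ _ _ R] A.commuting B.commuting
          A.commuting[symmetric] B.commuting[symmetric])
  then show "slot_action Ms (R_balanced Ms) 0 (\<lambda>s m. lact (Ms ! 0) s m)"
    "slot_action Ms (R_balanced Ms) 0 (\<lambda>s m. ract (Ms ! 0) m s)"
    "slot_action Ms (R_balanced Ms) (length Ms - 1) (\<lambda>s m. lbar (Ms ! (length Ms - 1)) s m)"
    "slot_action Ms (R_balanced Ms) (length Ms - 1) (\<lambda>s m. rbar (Ms ! (length Ms - 1)) m s)"
    unfolding k_def by simp_all
qed

lemma takeuchi_slot_actions:
  assumes Ms: "bimods Ms" "Ms \<noteq> []" and c: "c \<in> takeuchi Ms"
  shows "apply_slot 0 (\<lambda>m. lact (Ms ! 0) s m) c \<in> takeuchi Ms"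
    "apply_slot 0 (\<lambda>m. ract (Ms ! 0) m s) c \<in> takeuchi Ms"
    "apply_slot (length Ms - 1) (\<lambda>m. lbar (Ms ! (length Ms - 1)) s m) c \<in> takeuchi Ms"
    "apply_slot (length Ms - 1) (\<lambda>m. rbar (Ms ! (length Ms - 1)) m s) c \<in> takeuchi Ms"
proof -
  define k where "k = length Ms - 1"
  have i: "0 < length Ms" and l: "k < length Ms" "\<not> Suc k < length Ms" using assms by (auto simp: k_def)
  interpret A: bimodule "Ms ! 0" using nth_bimod[OF assms(1) i] .
  interpret B: bimodule "Ms ! k" using nth_bimod[OF assms(1) l(1)] .
  have "apply_slot 0 (\<lambda>m. lact (Ms ! 0) s m) c \<in> takeuchi Ms"
    "apply_slot 0 (\<lambda>m. ract (Ms ! 0) m s) c \<in> takeuchi Ms"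
    "apply_slot k (\<lambda>m. lbar (Ms ! k) s m) c \<in> takeuchi Ms"
    "apply_slot k (\<lambda>m. rbar (Ms ! k) m s) c \<in> takeuchi Ms"
    using i l bimodule_homs[OF A.bimodule_axioms] bimodule_homs[OF B.bimodule_axioms]
    by (auto intro!: takeuchi_apply_slot[OF Ms(1) _ _ _ _ _ _ c] A.commuting B.commuting
          A.commuting[symmetric] B.commuting[symmetric])
  then show "apply_slot 0 (\<lambda>m. lact (Ms ! 0) s m) c \<in> takeuchi Ms"
    "apply_slot 0 (\<lambda>m. ract (Ms ! 0) m s) c \<in> takeuchi Ms"
    "apply_slot (length Ms - 1) (\<lambda>m. lbar (Ms ! (length Ms - 1)) s m) c \<in> takeuchi Ms"
    "apply_slot (length Ms - 1) (\<lambda>m. rbar (Ms ! (length Ms - 1)) m s) c \<in> takeuchi Ms"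
    unfolding k_def by simp_all
qed

lemma times_raw_simps:
  "monoid.mult (times_raw Ms) = monoid.mult (tensor Ms (R_balanced Ms))"
  "\<one>\<^bsub>times_raw Ms\<^esub> = \<one>\<^bsub>tensor Ms (R_balanced Ms)\<^esub>"
  "lact (times_raw Ms) s X = R_class Ms (apply_slot 0 (\<lambda>m. lact (Ms ! 0) s m) (representative X))"
  "lbar (times_raw Ms) s X = R_class Ms (apply_slot (length Ms - 1) (\<lambda>m. lbar (Ms ! (length Ms - 1)) s m) (representative X))"
  "ract (times_raw Ms) X s = R_class Ms (apply_slot 0 (\<lambda>m. ract (Ms ! 0) m s) (representative X))"
  "rbar (times_raw Ms) X s = R_class Ms (apply_slot (length Ms - 1) (\<lambda>m. rbar (Ms ! (length Ms - 1)) m s) (representative X))"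
  by (simp_all add: times_raw_def Let_def)

lemma carrier_times_raw:
  assumes "bimods Ms"
  shows "carrier (times_raw Ms) = R_class Ms ` takeuchi Ms"
  by (auto simp: times_raw_def Let_def takeuchi_def rels_def
      tclass_eq_iff[OF bimods_comm_group[OF assms] R_balanced_subset[OF assms]])

lemma bimodule_times_raw:
  assumes Ms: "bimods Ms" and l: "2 \<le> length Ms"
  shows "bimodule (times_raw Ms)"
proof -
  have ne: "Ms \<noteq> []" and l0: "length Ms - 1 \<noteq> 0" "0 \<noteq> length Ms - 1" using l by auto
  interpret A: bimodule "Ms ! 0" using Ms ne by simp
  interpret B: bimodule "Ms ! (length Ms - 1)" using Ms ne by simp
  note sa = slot_action_left[OF Ms ne] and cl = takeuchi_slot_actions[OF Ms ne]
  show ?thesis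
    by (rule slot_quotient_bimodule[OF bimods_comm_group[OF Ms] R_balanced_subset[OF Ms] sa(1,3,2,4)
          diff_closed_takeuchi[OF Ms] _ cl(1,3,2,4) carrier_times_raw[OF Ms] times_raw_simps(1-6)])
      (simp_all add: l0 A.act_mult B.act_mult A.commuting B.commuting takeuchiD(1) subset_iff[of "takeuchi Ms"]
        del: mem_Collect_eq One_nat_def)
qed

lemma takeuchi_single: "takeuchi [M] = sums (tuples [M])"
  by (auto simp: takeuchi_def)

context big_universe
begin

lemma presented_times:
  assumes Ms: "bimods (Ms :: ('r, 'u) bimod list)" and l: "2 \<le> length Ms"
  shows "presented TYPE('u) Ms (R_balanced Ms) (takeuchi Ms) (times_raw Ms)"
proof (rule presented.intro)
  show grp: "\<forall>K\<in>set Ms. comm_group K" using Ms by (rule bimods_comm_group)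
  show B: "R_balanced Ms \<subseteq> sums (tuples Ms)" by (rule R_balanced_subset[OF Ms])
  obtain f :: "('u list \<Rightarrow>\<^sub>0 int) \<Rightarrow> 'u" where "inj f" using frag_universe_embeds by blast
  show "\<exists>f :: ('u list \<Rightarrow>\<^sub>0 int) set \<Rightarrow> 'u. inj_on f (carrier (times_raw Ms))"
    by (rule tclass_embeds[OF grp B \<open>inj f\<close>]) (auto simp: carrier_times_raw[OF Ms])
  show "tensor_rels Ms (R_balanced Ms) \<subseteq> takeuchi Ms"
    using rels_subset_takeuchi[OF Ms] by (simp add: rels_def)
  show "carrier (times_raw Ms) = R_class Ms ` takeuchi Ms" by (rule carrier_times_raw[OF Ms])
  show "takeuchi Ms \<subseteq> sums (tuples Ms)" using takeuchiD(1) by blast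
qed (simp_all only: bimodule_times_raw[OF Ms l] times_raw_simps diff_closed_takeuchi[OF Ms])

lemma end_raw_embeds: "\<exists>f :: ('r \<Rightarrow> 'r) \<Rightarrow> 'u. inj_on f (carrier (end_raw :: ('r, _) bimod))"
  using End_embeds by (simp add: end_raw_def)

lemma bimodule_timesR:
  assumes Ms: "bimods (Ms :: ('r, 'u) bimod list)"
  shows "bimodule (timesR Ms)"
proof -
  consider "Ms = []" | M where "Ms = [M]" | "2 \<le> length Ms"
    by (cases Ms rule: timesR.cases) auto
  then show ?thesis
  proof cases
    case 1
    then show ?thesis using bimodule_small[OF bimodule_end_raw end_raw_embeds] by simp
  next
    case 2
    then show ?thesis using Ms by simp
  next
    case 3
    interpret T: presented Ms "R_balanced Ms" "takeuchi Ms" "times_raw Ms" u by (rule presented_times[OF Ms 3])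
    show ?thesis using T.bimodule_sm by (simp add: timesR_small[OF 3])
  qed
qed

context
  fixes Ms :: "('r, 'u) bimod list"
  assumes Ms: "bimods Ms" and ne: "Ms \<noteq> []"
begin

text \<open>A common interface for one factor, where \<open>times_of\<close> is summation in that
  factor, and for several, where it is the code of a class. Later arguments about nonempty products
  go through it and do not see the difference.\<close>

lemma times_of_closed: "c \<in> takeuchi Ms \<Longrightarrow> times_of Ms c \<in> carrier (timesR Ms)"
  and times_of_eq_iff: "c \<in> takeuchi Ms \<Longrightarrow> d \<in> takeuchi Ms \<Longrightarrow> times_of Ms c = times_of Ms d \<longleftrightarrow> c - d \<in> rels Ms"
  and times_rep_closed: "x \<in> carrier (timesR Ms) \<Longrightarrow> times_rep Ms x \<in> takeuchi Ms"
  and times_of_rep: "x \<in> carrier (timesR Ms) \<Longrightarrow> times_of Ms (times_rep Ms x) = x"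
  and times_of_add: "c \<in> takeuchi Ms \<Longrightarrow> d \<in> takeuchi Ms \<Longrightarrow>
    times_of Ms c \<otimes>\<^bsub>timesR Ms\<^esub> times_of Ms d = times_of Ms (c + d)"
  and times_of_act: "c \<in> takeuchi Ms \<Longrightarrow>
      lact (timesR Ms) s (times_of Ms c) = times_of Ms (apply_slot 0 (\<lambda>m. lact (Ms ! 0) s m) c)"
    "c \<in> takeuchi Ms \<Longrightarrow>
      ract (timesR Ms) (times_of Ms c) s = times_of Ms (apply_slot 0 (\<lambda>m. ract (Ms ! 0) m s) c)"
    "c \<in> takeuchi Ms \<Longrightarrow>
      lbar (timesR Ms) s (times_of Ms c) = times_of Ms (apply_slot (length Ms - 1) (\<lambda>m. lbar (Ms ! (length Ms - 1)) s m) c)"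
    "c \<in> takeuchi Ms \<Longrightarrow>
      rbar (timesR Ms) (times_of Ms c) s = times_of Ms (apply_slot (length Ms - 1) (\<lambda>m. rbar (Ms ! (length Ms - 1)) m s) c)"
proof -
  \<comment> \<open>The facts are bundled so that the distinction between one factor and several is
    made once.\<close>
  define P where "P \<longleftrightarrow> (\<forall>c\<in>takeuchi Ms. times_of Ms c \<in> carrier (timesR Ms)) \<and>
    (\<forall>c\<in>takeuchi Ms. \<forall>d\<in>takeuchi Ms. times_of Ms c = times_of Ms d \<longleftrightarrow> c - d \<in> rels Ms) \<and>
    (\<forall>x\<in>carrier (timesR Ms). times_rep Ms x \<in> takeuchi Ms \<and> times_of Ms (times_rep Ms x) = x) \<and>
    (\<forall>c\<in>takeuchi Ms. \<forall>d\<in>takeuchi Ms. times_of Ms c \<otimes>\<^bsub>timesR Ms\<^esub> times_of Ms d = times_of Ms (c + d)) \<and>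
    (\<forall>c\<in>takeuchi Ms. \<forall>s. lact (timesR Ms) s (times_of Ms c) = times_of Ms (apply_slot 0 (\<lambda>m. lact (Ms ! 0) s m) c) \<and>
      ract (timesR Ms) (times_of Ms c) s = times_of Ms (apply_slot 0 (\<lambda>m. ract (Ms ! 0) m s) c) \<and>
      lbar (timesR Ms) s (times_of Ms c) = times_of Ms (apply_slot (length Ms - 1) (\<lambda>m. lbar (Ms ! (length Ms - 1)) s m) c) \<and>
      rbar (timesR Ms) (times_of Ms c) s = times_of Ms (apply_slot (length Ms - 1) (\<lambda>m. rbar (Ms ! (length Ms - 1)) m s) c))"
  have P
  proof (cases "length Ms = 1")
    case True
    then obtain M where M: "Ms = [M]" by (auto simp: length_Suc_conv)
    then have bM: "bimodule M" using Ms by simp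
    interpret M: bimodule M by fact
    have hd: "hd \<in> tuples [M] \<rightarrow> carrier M" by (auto elim!: tuples_ConsE)
    have R: "diff_closed (rels [M])" using bM by (intro diff_closed_rels) simp
    have of: "times_of [M] c = evaluate M hd c" for c by (simp add: times_of_def)
    have rep: "times_rep [M] x = frag_of [x]" for x by (simp add: times_rep_def)
    have eq: "evaluate M hd c = evaluate M hd d \<longleftrightarrow> c - d \<in> rels [M]"
      if c: "c \<in> sums (tuples [M])" and d: "d \<in> sums (tuples [M])" for c d
    proof
      assume *: "evaluate M hd c = evaluate M hd d"
      have "(c - frag_of [evaluate M hd c]) - (d - frag_of [evaluate M hd d]) \<in> rels [M]"
        by (intro diff_closedD(2)[OF R] evaluate_single bM c d)
      then show "c - d \<in> rels [M]" using * by (simp add: algebra_simps)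
    next
      assume "c - d \<in> rels [M]"
      then have "evaluate M hd (c - d) = \<one>\<^bsub>M\<^esub>" by (rule evaluate_rels_single[OF bM])
      moreover have "Poly_Mapping.keys (c - d) \<subseteq> tuples [M]" using c d keys_diff by fastforce
      ultimately show "evaluate M hd c = evaluate M hd d"
        using M.evaluate_add[OF hd, of "c - d" d] M.evaluate_closed[OF hd, of d] d by simp
    qed
    have slot: "evaluate M hd (apply_slot 0 h c) = h (evaluate M hd c)"
      if h: "h \<in> hom M M" and c: "c \<in> sums (tuples [M])" for h c
    proof -
      have "h (evaluate M hd c) = evaluate M (\<lambda>t. h (hd t)) c"
        by (rule M.evaluate_hom_comp[OF M.comm_group_axioms h hd]) (use c in simp)
      also have "\<dots> = evaluate M (\<lambda>t. evaluate M hd (frag_of (t[0 := h (t ! 0)]))) c"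
      proof (rule M.evaluate_cong)
        have pt: "h (hd t) = evaluate M hd (frag_of (t[0 := h (t ! 0)])) \<and>
            evaluate M hd (frag_of (t[0 := h (t ! 0)])) \<in> carrier M" if t0: "t \<in> tuples [M]" for t
        proof -
          obtain a where "t = [a]" "a \<in> carrier M" using t0 by (auto elim!: tuples_ConsE)
          moreover then have "h a \<in> carrier M" using h by (auto simp: hom_def)
          ultimately show ?thesis by simp
        qed
        then show "h (hd t) = evaluate M hd (frag_of (t[0 := h (t ! 0)]))" if "t \<in> Poly_Mapping.keys c" for t
          using that c by blast
        show "(\<lambda>t. evaluate M hd (frag_of (t[0 := h (t ! 0)]))) \<in> Poly_Mapping.keys c \<rightarrow> carrier M"
          using pt c by blast
      qed
      also have "\<dots> = evaluate M hd (apply_slot 0 h c)"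
        unfolding apply_slot_def using h c
        by (subst M.evaluate_frag_extend[OF hd]) (auto simp: hom_def elim!: tuples_ConsE)
      finally show ?thesis by simp
    qed
    have add: "evaluate M hd (c + d) = evaluate M hd c \<otimes>\<^bsub>M\<^esub> evaluate M hd d"
      if "c \<in> sums (tuples [M])" "d \<in> sums (tuples [M])" for c d
      using that by (intro M.evaluate_add[OF hd]) auto
    show ?thesis
      unfolding P_def M of rep takeuchi_single timesR.simps
      by (simp add: evaluate_single(1)[OF bM] eq slot[OF bimodule_homs(1)[OF bM]] slot[OF bimodule_homs(2)[OF bM]]
          slot[OF bimodule_homs(3)[OF bM]] slot[OF bimodule_homs(4)[OF bM]] add del: mem_Collect_eq)
  next
    case False
    then have l: "2 \<le> length Ms" using ne by (cases Ms rule: timesR.cases) auto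
    interpret T: presented Ms "R_balanced Ms" "takeuchi Ms" "times_raw Ms" u by (rule presented_times[OF Ms l])
    have of: "times_of Ms c = T.el c" for c using False by (simp add: times_of_def)
    have rep: "times_rep Ms x = T.rp x" for x using False by (simp add: times_rep_def)
    note act = slot_action_left[OF Ms ne]
    note sa = slot_action_tclass[OF bimods_comm_group[OF Ms] R_balanced_subset[OF Ms]]
    show ?thesis
      unfolding P_def of rep timesR_small[OF l]
      by (simp add: T.el_closed T.el_eq_iff T.rp_closed T.el_rp T.el_add rels_def del: One_nat_def)
        (simp add: T.small T.tclass_mem times_raw_simps sa[OF act(1)] sa[OF act(2)] sa[OF act(3)] sa[OF act(4)]
          del: One_nat_def)
  qed
  then show "c \<in> takeuchi Ms \<Longrightarrow> times_of Ms c \<in> carrier (timesR Ms)"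
    "c \<in> takeuchi Ms \<Longrightarrow> d \<in> takeuchi Ms \<Longrightarrow> times_of Ms c = times_of Ms d \<longleftrightarrow> c - d \<in> rels Ms"
    "x \<in> carrier (timesR Ms) \<Longrightarrow> times_rep Ms x \<in> takeuchi Ms"
    "x \<in> carrier (timesR Ms) \<Longrightarrow> times_of Ms (times_rep Ms x) = x"
    "c \<in> takeuchi Ms \<Longrightarrow> d \<in> takeuchi Ms \<Longrightarrow> times_of Ms c \<otimes>\<^bsub>timesR Ms\<^esub> times_of Ms d = times_of Ms (c + d)"
    "c \<in> takeuchi Ms \<Longrightarrow>
      lact (timesR Ms) s (times_of Ms c) = times_of Ms (apply_slot 0 (\<lambda>m. lact (Ms ! 0) s m) c)"
    "c \<in> takeuchi Ms \<Longrightarrow>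
      ract (timesR Ms) (times_of Ms c) s = times_of Ms (apply_slot 0 (\<lambda>m. ract (Ms ! 0) m s) c)"
    "c \<in> takeuchi Ms \<Longrightarrow>
      lbar (timesR Ms) s (times_of Ms c) = times_of Ms (apply_slot (length Ms - 1) (\<lambda>m. lbar (Ms ! (length Ms - 1)) s m) c)"
    "c \<in> takeuchi Ms \<Longrightarrow>
      rbar (timesR Ms) (times_of Ms c) s = times_of Ms (apply_slot (length Ms - 1) (\<lambda>m. rbar (Ms ! (length Ms - 1)) m s) c)"
    unfolding P_def by blast+
qed

lemma times_rep_of_mod: "c \<in> takeuchi Ms \<Longrightarrow> times_rep Ms (times_of Ms c) - c \<in> rels Ms"
  using times_of_eq_iff[of "times_rep Ms (times_of Ms c)" c] times_of_closed times_rep_closed times_of_rep by simp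

lemma times_cases:
  assumes "x \<in> carrier (timesR Ms)"
  obtains c where "c \<in> takeuchi Ms" "x = times_of Ms c"
  using assms times_rep_closed times_of_rep by metis

end

end

section \<open>Bimodule maps of Takeuchi products induced by functions on tuples\<close>

subsection \<open>Maps induced by maps of tuples\<close>

lemma mod_cong:
  assumes "diff_closed H" "x - x' \<in> H" "y - y' \<in> H" "x' - y' \<in> H"
  shows "x - y \<in> H"
  using diff_closedD(2)[OF assms(1) diff_closedD(4)[OF assms(1,2,4)] assms(3)] by (simp add: algebra_simps)

lemma mod_cong_add:
  assumes "diff_closed H" "x - x' \<in> H" "y - y' \<in> H" "z - z' \<in> H" "x' - y' - z' \<in> H"
  shows "x - y - z \<in> H"
proof -
  have "x - y - z = (x - x') - (y - y') - (z - z') + (x' - y' - z')" by simp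
  also have "\<dots> \<in> H" by (intro diff_closedD(2,4)[OF assms(1)] assms(2-))
  finally show ?thesis .
qed

text \<open>Balancing is required on all tuples, since relations involve tuples outside the Takeuchi
  product. Compatibility with the outer actions is required only on Takeuchi sums and modulo
  \<open>rels\<close>: for a unitor whose End(R) stands at an end, one of the right actions is
  matched only there.\<close>

definition transports ::
    "('r::{ring,monoid_mult}, 'a) bimod list \<Rightarrow> ('r, 'a) bimod list \<Rightarrow> ('a list \<Rightarrow> ('a list \<Rightarrow>\<^sub>0 int)) \<Rightarrow> bool" where
  "transports Ms Ns f \<longleftrightarrow> balanced_on Ms (rels Ns) f \<and> (\<forall>c\<in>takeuchi Ms. frag_extend f c \<in> takeuchi Ns \<and>
     (\<forall>s. frag_extend f (apply_slot 0 (\<lambda>m. lact (Ms ! 0) s m) c)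
        - apply_slot 0 (\<lambda>m. lact (Ns ! 0) s m) (frag_extend f c) \<in> rels Ns \<and>
      frag_extend f (apply_slot 0 (\<lambda>m. ract (Ms ! 0) m s) c)
        - apply_slot 0 (\<lambda>m. ract (Ns ! 0) m s) (frag_extend f c) \<in> rels Ns \<and>
      frag_extend f (apply_slot (length Ms - 1) (\<lambda>m. lbar (Ms ! (length Ms - 1)) s m) c)
        - apply_slot (length Ns - 1) (\<lambda>m. lbar (Ns ! (length Ns - 1)) s m) (frag_extend f c) \<in> rels Ns \<and>
      frag_extend f (apply_slot (length Ms - 1) (\<lambda>m. rbar (Ms ! (length Ms - 1)) m s) c)
        - apply_slot (length Ns - 1) (\<lambda>m. rbar (Ns ! (length Ns - 1)) m s) (frag_extend f c) \<in> rels Ns))"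

text \<open>Two slot numbers and two operations occur because flattening and contraction shift
  positions and can turn an action on one factor into an action on a neighbour.\<close>

definition slot_corr ::
    "('r::{ring,monoid_mult}, 'a) bimod list \<Rightarrow> ('r, 'a) bimod list \<Rightarrow> ('a list \<Rightarrow> ('a list \<Rightarrow>\<^sub>0 int)) \<Rightarrow>
      nat \<Rightarrow> ('a \<Rightarrow> 'a) \<Rightarrow> nat \<Rightarrow> ('a \<Rightarrow> 'a) \<Rightarrow> bool" where
  "slot_corr Ms Ns f i g j h \<longleftrightarrow> (\<forall>t\<in>tuples Ms. f (t[i := g (t ! i)]) - apply_slot j h (f t) \<in> rels Ns)"

lemma slot_corrD:
  assumes "bimods Ns" "slot_corr Ms Ns f i g j h" "c \<in> sums (tuples Ms)"
  shows "frag_extend f (apply_slot i g c) - apply_slot j h (frag_extend f c) \<in> rels Ns"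
  unfolding frag_extend_apply_slot apply_slot_frag_extend
  using assms by (intro frag_extend_cong_mod[OF diff_closed_rels]) (auto simp: slot_corr_def)

text \<open>Up to relations, the difference in the target is the image of the source condition at
  slots \<open>i\<close> and \<open>i + 1\<close>, and \<open>f\<close> maps relations to
  relations.\<close>

lemma slot_corr_pair:
  assumes Ms: "bimods Ms" and Ns: "bimods Ns" and f: "balanced_on Ms (rels Ns) f" and c: "c \<in> takeuchi Ms"
    and i: "Suc i < length Ms"
    and l: "slot_corr Ms Ns f i (\<lambda>m. rbar (Ms ! i) m s) j g"
    and r: "slot_corr Ms Ns f (Suc i) (\<lambda>m. ract (Ms ! Suc i) m s) k h"
  shows "apply_slot j g (frag_extend f c) - apply_slot k h (frag_extend f c) \<in> rels Ns"
proof -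
  note R = diff_closed_rels[OF Ns] and cs = takeuchiD(1)[OF c]
  have "frag_extend f (apply_slot i (\<lambda>m. rbar (Ms ! i) m s) c - apply_slot (Suc i) (\<lambda>m. ract (Ms ! Suc i) m s) c) \<in> rels Ns"
    by (rule frag_extend_rels[OF Ms R f takeuchiD(2)[OF c i]])
  then show ?thesis
    by (intro mod_cong[OF R mod_sym[OF R slot_corrD[OF Ns l cs]] mod_sym[OF R slot_corrD[OF Ns r cs]]])
      (simp add: frag_extend_diff)
qed

lemma transportsI:
  assumes Ns: "bimods Ns"
    and sums: "\<And>t. t \<in> tuples Ms \<Longrightarrow> f t \<in> sums (tuples Ns)" and bal: "balanced_on Ms (rels Ns) f"
    and tak: "\<And>c j s. c \<in> takeuchi Ms \<Longrightarrow> Suc j < length Ns \<Longrightarrow>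
      apply_slot j (\<lambda>m. rbar (Ns ! j) m s) (frag_extend f c)
        - apply_slot (Suc j) (\<lambda>m. ract (Ns ! Suc j) m s) (frag_extend f c) \<in> rels Ns"
    and "\<And>c s. c \<in> takeuchi Ms \<Longrightarrow> frag_extend f (apply_slot 0 (\<lambda>m. lact (Ms ! 0) s m) c)
        - apply_slot 0 (\<lambda>m. lact (Ns ! 0) s m) (frag_extend f c) \<in> rels Ns"
      "\<And>c s. c \<in> takeuchi Ms \<Longrightarrow> frag_extend f (apply_slot 0 (\<lambda>m. ract (Ms ! 0) m s) c)
        - apply_slot 0 (\<lambda>m. ract (Ns ! 0) m s) (frag_extend f c) \<in> rels Ns"
      "\<And>c s. c \<in> takeuchi Ms \<Longrightarrow> frag_extend f (apply_slot (length Ms - 1) (\<lambda>m. lbar (Ms ! (length Ms - 1)) s m) c)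
        - apply_slot (length Ns - 1) (\<lambda>m. lbar (Ns ! (length Ns - 1)) s m) (frag_extend f c) \<in> rels Ns"
      "\<And>c s. c \<in> takeuchi Ms \<Longrightarrow> frag_extend f (apply_slot (length Ms - 1) (\<lambda>m. rbar (Ms ! (length Ms - 1)) m s) c)
        - apply_slot (length Ns - 1) (\<lambda>m. rbar (Ns ! (length Ns - 1)) m s) (frag_extend f c) \<in> rels Ns"
  shows "transports Ms Ns f"
proof -
  have "frag_extend f c \<in> takeuchi Ns" if c: "c \<in> takeuchi Ms" for c
  proof -
    have "Poly_Mapping.keys (frag_extend f c) \<subseteq> tuples Ns"
      by (rule keys_frag_extend_subset) (use takeuchiD(1)[OF c] sums in blast)
    then show ?thesis using tak[OF c] by (simp add: takeuchi_def)
  qed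
  then show ?thesis using bal assms(5-8) by (simp add: transports_def del: One_nat_def)
qed

context big_universe
begin

text \<open>Representatives of one element differ by a relation, which \<open>f\<close> sends into
  \<open>rels\<close>. This yields the computation rule on arbitrary Takeuchi sums, and additivity
  and linearity are read off from it.\<close>

lemma times_arrow:
  assumes Ms: "bimods (Ms :: ('r, 'u) bimod list)" "Ms \<noteq> []" and Ns: "bimods Ns" "Ns \<noteq> []"
    and f: "transports Ms Ns f"
  defines "A \<equiv> mk_arr (timesR Ms) (timesR Ns) (\<lambda>x. times_of Ns (frag_extend f (times_rep Ms x)))"
  shows "A \<in> bimod_Hom (timesR Ms) (timesR Ns)"
    and "c \<in> takeuchi Ms \<Longrightarrow> bfun A (times_of Ms c) = times_of Ns (frag_extend f c)"
proof -
  let ?g = "\<lambda>x. times_of Ns (frag_extend f (times_rep Ms x))"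
  note R = diff_closed_rels[OF Ns(1)]
  have bal: "balanced_on Ms (rels Ns) f" and tak: "\<And>c. c \<in> takeuchi Ms \<Longrightarrow> frag_extend f c \<in> takeuchi Ns"
    using f by (auto simp: transports_def)
  have g: "?g (times_of Ms c) = times_of Ns (frag_extend f c)" if c: "c \<in> takeuchi Ms" for c
  proof -
    have "times_rep Ms (times_of Ms c) \<in> takeuchi Ms"
      by (intro times_rep_closed[OF Ms] times_of_closed[OF Ms] c)
    moreover have "frag_extend f (times_rep Ms (times_of Ms c)) - frag_extend f c \<in> rels Ns"
      using frag_extend_rels[OF Ms(1) R bal times_rep_of_mod[OF Ms c]] by (simp add: frag_extend_diff)
    ultimately show ?thesis using c by (simp add: times_of_eq_iff[OF Ns] tak)
  qed
  then show "c \<in> takeuchi Ms \<Longrightarrow> bfun A (times_of Ms c) = times_of Ns (frag_extend f c)"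
    unfolding A_def by (simp add: times_of_closed[OF Ms])
  have "?g \<in> bimod_hom (timesR Ms) (timesR Ns)"
  proof (rule bimod_homI)
    have "?g x \<in> carrier (timesR Ns)" if "x \<in> carrier (timesR Ms)" for x
      by (intro times_of_closed[OF Ns] tak times_rep_closed[OF Ms] that)
    moreover have "?g (x \<otimes>\<^bsub>timesR Ms\<^esub> y) = ?g x \<otimes>\<^bsub>timesR Ns\<^esub> ?g y"
      if x: "x \<in> carrier (timesR Ms)" and y: "y \<in> carrier (timesR Ms)" for x y
    proof -
      obtain c d where cd: "c \<in> takeuchi Ms" "d \<in> takeuchi Ms" "x = times_of Ms c" "y = times_of Ms d"
        using times_cases[OF Ms x] times_cases[OF Ms y] by metis
      then show ?thesis
        using diff_closedD(4)[OF diff_closed_takeuchi[OF Ms(1)] cd(1,2)]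
        by (simp only: times_of_add[OF Ms] times_of_add[OF Ns] g frag_extend_add tak)
    qed
    ultimately show "?g \<in> hom (timesR Ms) (timesR Ns)" by (intro homI)
  next
    fix x s assume "x \<in> carrier (timesR Ms)"
    then obtain c where c: "c \<in> takeuchi Ms" and x: "x = times_of Ms c"
      using times_cases[OF Ms] by blast
    note act = takeuchi_slot_actions[OF Ms c] and act' = takeuchi_slot_actions[OF Ns tak[OF c]]
    show "?g (lact (timesR Ms) s x) = lact (timesR Ns) s (?g x)"
      "?g (lbar (timesR Ms) s x) = lbar (timesR Ns) s (?g x)"
      "?g (ract (timesR Ms) x s) = ract (timesR Ns) (?g x) s"
      "?g (rbar (timesR Ms) x s) = rbar (timesR Ns) (?g x) s"
      unfolding x times_of_act[OF Ms c] g[OF c] times_of_act[OF Ns tak[OF c]] g[OF act(1)] g[OF act(2)] g[OF act(3)] g[OF act(4)]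
      using f c by (simp_all add: times_of_eq_iff[OF Ns] tak act act' transports_def del: One_nat_def)
  qed
  then show "A \<in> bimod_Hom (timesR Ms) (timesR Ns)"
    unfolding A_def by (intro mk_arr_Hom bimodule_timesR Ms Ns)
qed

lemma times_eqI:
  assumes Ms: "bimods (Ms :: ('r, 'u) bimod list)" "Ms \<noteq> []"
    and f: "f \<in> bimod_Hom (timesR Ms) N" and g: "g \<in> bimod_Hom (timesR Ms) N"
    and "\<And>c. c \<in> takeuchi Ms \<Longrightarrow> bfun f (times_of Ms c) = bfun g (times_of Ms c)"
  shows "f = g"
proof (rule arr_eqI[OF f g])
  fix x assume "x \<in> carrier (timesR Ms)"
  then show "bfun f x = bfun g x" using times_cases[OF Ms] assms(5) by metis
qed

end


section \<open>The product of a family of bimodule maps\<close>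

subsection \<open>Functoriality\<close>

lemma map2_bfun_tuples:
  assumes "\<forall>f\<in>set fs. f \<in> Arr bimod_moncat" "t \<in> tuples (map bdom fs)"
  shows "map2 bfun fs t \<in> tuples (map bcod fs)"
proof -
  have l: "length t = length fs" using tuples_length[OF assms(2)] by simp
  have "bfun (fs ! i) (t ! i) \<in> carrier (bcod (fs ! i))" if "i < length fs" for i
    using assms(1) tuples_nth[OF assms(2), of i] that nth_mem[OF that] bimod_homD(2)[of "bfun (fs ! i)"] by fastforce
  then show ?thesis using l by (simp add: tuples_def)
qed

lemma slot_corr_map:
  assumes "bimods Ns" "i < length fs" "\<And>a. a \<in> carrier (bdom (fs ! i)) \<Longrightarrow> bfun (fs ! i) (g a) = h (bfun (fs ! i) a)"
  shows "slot_corr (map bdom fs) Ns (\<lambda>t. frag_of (map2 bfun fs t)) i g i h"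
  unfolding slot_corr_def
proof
  fix t assume t: "t \<in> tuples (map bdom fs)"
  have l: "length t = length fs" using tuples_length[OF t] by simp
  have "map2 bfun fs (t[i := g (t ! i)]) = (map2 bfun fs t)[i := h (map2 bfun fs t ! i)]"
    using l assms tuples_nth[OF t, of i] by (intro nth_equalityI) (auto simp: nth_list_update)
  then show "frag_of (map2 bfun fs (t[i := g (t ! i)])) - apply_slot i h (frag_of (map2 bfun fs t)) \<in> rels Ns"
    using diff_closedD(1)[OF diff_closed_rels[OF assms(1)]] by simp
qed

text \<open>A bimodule map commutes with all four actions in its slot, so every slot corresponds to
  itself.\<close>

lemma transports_map:
  fixes fs :: "('r::{ring,monoid_mult}, 'u) bimod_arr list"
  assumes fs: "\<forall>f\<in>set fs. f \<in> Arr bimod_moncat" and ne: "fs \<noteq> []"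
  shows "transports (map bdom fs) (map bcod fs) (\<lambda>t. frag_of (map2 bfun fs t))"
proof -
  let ?Ms = "map bdom fs" and ?Ns = "map bcod fs"
  let ?f = "\<lambda>t. frag_of (map2 bfun fs t)"
  have Ms: "bimods ?Ms" and Ns: "bimods ?Ns" using fs by auto
  note R = diff_closed_rels[OF Ns]
  have hm: "bfun f \<in> bimod_hom (bdom f) (bcod f)" if "f \<in> set fs" for f using fs that by auto
  have bal: "balanced_on ?Ms (rels ?Ns) ?f"
  proof (rule balanced_onI)
    fix A M B t u a b
    assume split: "?Ms = A @ M # B" and t: "t \<in> tuples A" and u: "u \<in> tuples B" and ab: "a \<in> carrier M" "b \<in> carrier M"
    obtain fa f fb where *: "fs = fa @ f # fb" "A = map bdom fa" "M = bdom f" "B = map bdom fb"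
      using split by (auto simp: map_eq_append_conv map_eq_Cons_conv)
    have l: "length t = length fa" using t * by (simp add: tuples_length)
    show "?f (t @ (a \<otimes>\<^bsub>M\<^esub> b) # u) - ?f (t @ a # u) - ?f (t @ b # u) \<in> rels ?Ns"
      using rels_mult[OF map2_bfun_tuples map2_bfun_tuples, of fa t fb u "bfun f a" "bcod f" "bfun f b"]
        * fs t u ab l bimod_homD(2,3)[OF hm[of f]] by simp
  next
    fix A M N B t u a b s
    assume split: "?Ms = A @ M # N # B" and t: "t \<in> tuples A" and u: "u \<in> tuples B" and ab: "a \<in> carrier M" "b \<in> carrier N"
    obtain fa f g fb where *: "fs = fa @ f # g # fb" "A = map bdom fa" "M = bdom f" "N = bdom g" "B = map bdom fb"
      using split by (auto simp: map_eq_append_conv map_eq_Cons_conv)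
    have l: "length t = length fa" using t * by (simp add: tuples_length)
    show "?f (t @ lbar M s a # b # u) - ?f (t @ a # lact N s b # u) \<in> rels ?Ns"
      using rels_balanced[OF map2_bfun_tuples map2_bfun_tuples, of fa t fb u "bfun f a" "bcod f" "bfun g b" "bcod g" s]
        * fs t u ab l bimod_homD(2,4,5)[OF hm[of f]] bimod_homD(2,4,5)[OF hm[of g]] by simp
  qed
  note corr = slot_corr_map[OF Ns]
  have len: "length fs - 1 < length fs" using ne by simp
  show ?thesis
  proof (rule transportsI[OF Ns _ bal])
    show "?f t \<in> sums (tuples ?Ns)" if "t \<in> tuples ?Ms" for t
      using map2_bfun_tuples[OF fs that] by simp
    show "apply_slot j (\<lambda>m. rbar (?Ns ! j) m s) (frag_extend ?f c)
        - apply_slot (Suc j) (\<lambda>m. ract (?Ns ! Suc j) m s) (frag_extend ?f c) \<in> rels ?Ns"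
      if "c \<in> takeuchi ?Ms" "Suc j < length ?Ns" for c j s
      by (rule slot_corr_pair[OF Ms Ns bal that(1) _ corr corr])
        (use that bimod_homD[OF hm] in auto)
    fix c s assume "c \<in> takeuchi ?Ms"
    then have cs: "c \<in> sums (tuples ?Ms)" by (rule takeuchiD)
    show "frag_extend ?f (apply_slot 0 (\<lambda>m. lact (?Ms ! 0) s m) c) - apply_slot 0 (\<lambda>m. lact (?Ns ! 0) s m) (frag_extend ?f c) \<in> rels ?Ns"
      "frag_extend ?f (apply_slot 0 (\<lambda>m. ract (?Ms ! 0) m s) c) - apply_slot 0 (\<lambda>m. ract (?Ns ! 0) m s) (frag_extend ?f c) \<in> rels ?Ns"
      by (rule slot_corrD[OF Ns corr cs]; use ne bimod_homD[OF hm] in simp)+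
    show "frag_extend ?f (apply_slot (length ?Ms - 1) (\<lambda>m. lbar (?Ms ! (length ?Ms - 1)) s m) c)
        - apply_slot (length ?Ns - 1) (\<lambda>m. lbar (?Ns ! (length ?Ns - 1)) s m) (frag_extend ?f c) \<in> rels ?Ns"
      "frag_extend ?f (apply_slot (length ?Ms - 1) (\<lambda>m. rbar (?Ms ! (length ?Ms - 1)) m s) c)
        - apply_slot (length ?Ns - 1) (\<lambda>m. rbar (?Ns ! (length ?Ns - 1)) m s) (frag_extend ?f c) \<in> rels ?Ns"
      unfolding length_map
      by (rule slot_corrD[OF Ns corr cs]; use len bimod_homD[OF hm] in \<open>simp del: One_nat_def\<close>)+
  qed
qed

section \<open>Flattening nested products and contracting End(R)\<close>

subsection \<open>Associators and unitors\<close>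

declare timesR.simps(1) [simp del]

text \<open>A single function on tuples for associators and unitors, so that naturality and
  coherence can be stated uniformly in \<open>Ns\<close>. It describes the structure map when some
  factor remains (\<open>lasc_insertion\<close>); otherwise the map is the identity of
  End(R).\<close>

definition insertion :: "('r::{ring,monoid_mult}, 'u) bimod list \<Rightarrow> ('r, 'u) bimod list
    \<Rightarrow> ('r, 'u) bimod list \<Rightarrow> 'u list \<Rightarrow> ('u list \<Rightarrow>\<^sub>0 int)" where
  "insertion Ms Ns Ps t = (if Ns = [] then frag_of (contract Ms Ps t) else
     frag_extend (\<lambda>u. frag_of (take (length Ms) t @ u @ drop (Suc (length Ms)) t)) (times_rep Ns (t ! length Ms)))"

abbreviation assoc where
  "assoc \<equiv> lasc times_structure"

lemma lasc_insertion:
  assumes "Ms @ Ns @ Ps \<noteq> []"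
  shows "assoc Ms Ns Ps = mk_arr (timesR (Ms @ timesR Ns # Ps)) (timesR (Ms @ Ns @ Ps))
    (\<lambda>x. times_of (Ms @ Ns @ Ps) (frag_extend (insertion Ms Ns Ps) (times_rep (Ms @ timesR Ns # Ps) x)))"
  using assms by (auto simp: times_structure_def times_unitor_def times_assoc_def insertion_def[abs_def])

lemma insertion_flatten:
  "Ns \<noteq> [] \<Longrightarrow> length ms = length Ms \<Longrightarrow>
    insertion Ms Ns Ps (ms @ y # ps) = frag_extend (\<lambda>u. frag_of (ms @ u @ ps)) (times_rep Ns y)"
  by (simp add: insertion_def nth_append)

lemma insertion_unit_right:
  "length ms = length Ms \<Longrightarrow>
    insertion Ms [] (N # Ps) (ms @ y # n # ps) = frag_of (ms @ lact N (end_dec y 1) n # ps)"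
  by (simp add: insertion_def contract_def nth_append Let_def)

lemma insertion_unit_left:
  "length ms = length Ms \<Longrightarrow>
    insertion (Ms @ [M]) [] [] (ms @ [m, y]) = frag_of (ms @ [lbar M (end_dec y 1) m])"
  by (simp add: insertion_def contract_def nth_append Let_def)

lemma balanced_on_cong:
  assumes "\<And>t. length t = length Ms \<Longrightarrow> f t = g t" "balanced_on Ms H g"
  shows "balanced_on Ms H f"
proof (rule balanced_onI)
  fix A M B t u a b
  assume "Ms = A @ M # B" "t \<in> tuples A" "u \<in> tuples B" "a \<in> carrier M" "b \<in> carrier M"
  then show "f (t @ (a \<otimes>\<^bsub>M\<^esub> b) # u) - f (t @ a # u) - f (t @ b # u) \<in> H"
    using balanced_on_mult[of A M B H g t u a b] assms by (simp add: tuples_length)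
next
  fix A M N B t u a b s
  assume "Ms = A @ M # N # B" "t \<in> tuples A" "u \<in> tuples B" "a \<in> carrier M" "b \<in> carrier N"
  then show "f (t @ lbar M s a # b # u) - f (t @ a # lact N s b # u) \<in> H"
    using balanced_on_bal[of A M N B H g t u a b s] assms by (simp add: tuples_length)
qed

lemma balanced_on_Nil: "balanced_on [] H f"
  by (simp add: balanced_on_def)

lemma context_slot:
  assumes "e \<in> sums (tuples Ns)" "k < length Ns" "length ms = n"
  shows "apply_slot (n + k) g (frag_extend (\<lambda>u. frag_of (ms @ u @ ps)) e)
    = frag_extend (\<lambda>u. frag_of (ms @ u @ ps)) (apply_slot k g e)"
  unfolding apply_slot_frag_extend frag_extend_apply_slot
  using assms by (intro frag_extend_eq) (auto simp: nth_append list_update_append dest!: subsetD tuples_length)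

lemma tuples_middleE:
  assumes "t \<in> tuples (Ms @ Q # Ps)"
  obtains ms y ps where "t = ms @ y # ps" "ms \<in> tuples Ms" "y \<in> carrier Q" "ps \<in> tuples Ps" "length ms = length Ms"
proof -
  obtain ms v where *: "t = ms @ v" "ms \<in> tuples Ms" "v \<in> tuples (Q # Ps)"
    using assms by (rule tuples_appendE)
  obtain y ps where "v = y # ps" "y \<in> carrier Q" "ps \<in> tuples Ps" using *(3) by (rule tuples_ConsE)
  then show ?thesis using that * tuples_length by blast
qed

context big_universe
begin

context
  fixes Ms Ns Ps :: "('r, 'u) bimod list"
  assumes bim: "bimods Ms" "bimods Ns" "bimods Ps" and ne: "Ns \<noteq> []"
begin

lemma bim3: "bimods (Ms @ Ns @ Ps)"
  using bim by auto

text \<open>Flattening unpacks the nested element with the representative chosen by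
  \<open>times_rep\<close>. Modulo relations any Takeuchi sum \<open>d\<close> for that element may
  be used, because a relation among the inner entries stays one in context.\<close>

lemma insertion_times_of:
  assumes "ms \<in> tuples Ms" "ps \<in> tuples Ps" "d \<in> takeuchi Ns"
  shows "insertion Ms Ns Ps (ms @ times_of Ns d # ps) - frag_extend (\<lambda>u. frag_of (ms @ u @ ps)) d \<in> rels (Ms @ Ns @ Ps)"
  using rels_context[OF bim assms(1,2) times_rep_of_mod[OF bim(2) ne assms(3)]] assms
  by (simp add: insertion_flatten[OF ne] tuples_length frag_extend_diff)

text \<open>At its boundaries the nested product acts through its first or last factor, so balancing
  against a neighbour in \<open>Ms\<close> or \<open>Ps\<close> turns into a balancing relation with
  that inner factor. Inside \<open>Ms\<close> or \<open>Ps\<close> the nested entry is a mere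
  context.\<close>

lemma insertion_balanced: "balanced_on (Ms @ timesR Ns # Ps) (rels (Ms @ Ns @ Ps)) (insertion Ms Ns Ps)"
proof (rule balanced_on_middle)
  note R = diff_closed_rels[OF bim3]
  note cases = times_cases[OF bim(2) ne]
  have rep: "v \<in> tuples Ns" if "v \<in> Poly_Mapping.keys (times_rep Ns y)" "y \<in> carrier (timesR Ns)" for v y
    using takeuchiD(1)[OF times_rep_closed[OF bim(2) ne that(2)]] that(1) by auto
  show "balanced_on Ms (rels (Ms @ Ns @ Ps)) (\<lambda>ms. insertion Ms Ns Ps (ms @ y # ps))"
    if "y \<in> carrier (timesR Ns)" "ps \<in> tuples Ps" for y ps
  proof (rule balanced_on_cong[OF insertion_flatten[OF ne] balanced_on_frag_extend[OF R]])
    fix v assume "v \<in> Poly_Mapping.keys (times_rep Ns y)"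
    then have "v @ ps \<in> tuples (Ns @ Ps)" using rep that by (intro tuples_appendI) auto
    from balanced_on_context[of "[]" "[]", OF _ this, of Ms]
    show "balanced_on Ms (rels (Ms @ Ns @ Ps)) (\<lambda>ms. frag_of (ms @ v @ ps))" by simp
  qed
  show "balanced_on Ps (rels (Ms @ Ns @ Ps)) (\<lambda>ps. insertion Ms Ns Ps (ms @ y # ps))"
    if "ms \<in> tuples Ms" "y \<in> carrier (timesR Ns)" for ms y
  proof (rule balanced_on_cong[OF insertion_flatten[OF ne tuples_length[OF that(1)]] balanced_on_frag_extend[OF R]])
    fix v assume "v \<in> Poly_Mapping.keys (times_rep Ns y)"
    then have "ms @ v \<in> tuples (Ms @ Ns)" using rep that by (intro tuples_appendI) auto
    from balanced_on_context[OF this, of "[]" "[]" Ps]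
    show "balanced_on Ps (rels (Ms @ Ns @ Ps)) (\<lambda>ps. frag_of (ms @ v @ ps))" by simp
  qed
  show "insertion Ms Ns Ps (ms @ (y \<otimes>\<^bsub>timesR Ns\<^esub> y') # ps) - insertion Ms Ns Ps (ms @ y # ps)
      - insertion Ms Ns Ps (ms @ y' # ps) \<in> rels (Ms @ Ns @ Ps)"
    if "ms \<in> tuples Ms" "y \<in> carrier (timesR Ns)" "y' \<in> carrier (timesR Ns)" "ps \<in> tuples Ps" for ms y y' ps
  proof -
    note a = that
    obtain c d where cd: "c \<in> takeuchi Ns" "d \<in> takeuchi Ns" "y = times_of Ns c" "y' = times_of Ns d"
      using cases[OF a(2)] cases[OF a(3)] by metis
    note s = diff_closedD(4)[OF diff_closed_takeuchi[OF bim(2)] cd(1,2)]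
    show ?thesis
      unfolding cd(3,4) times_of_add[OF bim(2) ne cd(1,2)]
      by (rule mod_cong_add[OF R insertion_times_of[OF a(1,4) s] insertion_times_of[OF a(1,4) cd(1)]
            insertion_times_of[OF a(1,4) cd(2)]])
        (simp add: frag_extend_add diff_closedD(1)[OF R])
  qed
  show "insertion Ms Ns Ps (ms @ lbar M s a # y # ps) - insertion Ms Ns Ps (ms @ a # lact (timesR Ns) s y # ps)
      \<in> rels (Ms @ Ns @ Ps)"
    if "Ms = A @ [M]" "ms \<in> tuples A" "a \<in> carrier M" "y \<in> carrier (timesR Ns)" "ps \<in> tuples Ps" for A M ms a y ps s
  proof -
    note a = that
    obtain d where d: "d \<in> takeuchi Ns" "y = times_of Ns d" using cases[OF a(4)] by blast
    have M: "bimodule M" using bim a by auto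
    obtain N Ns' where N: "Ns = N # Ns'" using ne by (cases Ns) auto
    let ?d = "apply_slot 0 (\<lambda>m. lact (Ns ! 0) s m) d"
    have d': "?d \<in> takeuchi Ns" by (rule takeuchi_slot_actions[OF bim(2) ne d(1)])
    have ms: "ms @ [lbar M s a] \<in> tuples Ms" "ms @ [a] \<in> tuples Ms"
      using a bimodule.closed[OF M] by (auto intro: tuples_appendI)
    have "frag_extend (\<lambda>u. frag_of ((ms @ [lbar M s a]) @ u @ ps)) d
        - frag_extend (\<lambda>u. frag_of ((ms @ [a]) @ u @ ps)) ?d \<in> rels (Ms @ Ns @ Ps)"
      unfolding frag_extend_apply_slot
    proof (rule frag_extend_cong_mod[OF R])
      fix u assume "u \<in> Poly_Mapping.keys d"
      then have "u \<in> tuples Ns" using takeuchiD(1)[OF d(1)] by auto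
      then obtain x v where u: "u = x # v" "x \<in> carrier N" "v \<in> tuples Ns'" unfolding N by (rule tuples_ConsE)
      show "frag_of ((ms @ [lbar M s a]) @ u @ ps) - frag_of ((ms @ [a]) @ u[0 := lact (Ns ! 0) s (u ! 0)] @ ps)
          \<in> rels (Ms @ Ns @ Ps)"
        using rels_balanced[OF a(2) tuples_appendI[OF u(3) a(5)] a(3) u(2)] by (simp add: u N a(1))
    qed
    note m = this
    have e1: "insertion Ms Ns Ps (ms @ lbar M s a # times_of Ns d # ps)
        - frag_extend (\<lambda>u. frag_of ((ms @ [lbar M s a]) @ u @ ps)) d \<in> rels (Ms @ Ns @ Ps)"
      using insertion_times_of[OF ms(1) a(5) d(1)] by simp
    have e2: "insertion Ms Ns Ps (ms @ a # times_of Ns ?d # ps)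
        - frag_extend (\<lambda>u. frag_of ((ms @ [a]) @ u @ ps)) ?d \<in> rels (Ms @ Ns @ Ps)"
      using insertion_times_of[OF ms(2) a(5) d'] by simp
    show ?thesis
      unfolding d(2) times_of_act(1)[OF bim(2) ne d(1)] by (rule mod_cong[OF R e1 e2 m])
  qed
  show "insertion Ms Ns Ps (ms @ lbar (timesR Ns) s y # b # ps) - insertion Ms Ns Ps (ms @ y # lact N s b # ps)
      \<in> rels (Ms @ Ns @ Ps)"
    if "Ps = N # B" "ms \<in> tuples Ms" "y \<in> carrier (timesR Ns)" "b \<in> carrier N" "ps \<in> tuples B" for N B ms b y ps s
  proof -
    note a = that
    obtain d where d: "d \<in> takeuchi Ns" "y = times_of Ns d" using cases[OF a(3)] by blast
    have N: "bimodule N" using bim a by auto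
    obtain Ns' K where K: "Ns = Ns' @ [K]" using ne by (cases Ns rule: rev_cases) auto
    let ?d = "apply_slot (length Ns - 1) (\<lambda>m. lbar (Ns ! (length Ns - 1)) s m) d"
    have d': "?d \<in> takeuchi Ns" by (rule takeuchi_slot_actions[OF bim(2) ne d(1)])
    have ps: "b # ps \<in> tuples Ps" "lact N s b # ps \<in> tuples Ps"
      using a bimodule.closed[OF N] by auto
    have "frag_extend (\<lambda>u. frag_of (ms @ u @ b # ps)) ?d
        - frag_extend (\<lambda>u. frag_of (ms @ u @ lact N s b # ps)) d \<in> rels (Ms @ Ns @ Ps)"
      unfolding frag_extend_apply_slot
    proof (rule frag_extend_cong_mod[OF R])
      fix u assume "u \<in> Poly_Mapping.keys d"
      then have "u \<in> tuples Ns" using takeuchiD(1)[OF d(1)] by auto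
      then obtain v x where u: "u = v @ [x]" "x \<in> carrier K" "v \<in> tuples Ns'"
        unfolding K by (auto elim!: tuples_appendE tuples_ConsE)
      show "frag_of (ms @ u[length Ns - 1 := lbar (Ns ! (length Ns - 1)) s (u ! (length Ns - 1))] @ b # ps)
          - frag_of (ms @ u @ lact N s b # ps) \<in> rels (Ms @ Ns @ Ps)"
        using rels_balanced[OF tuples_appendI[OF a(2) u(3)] a(5) u(2) a(4)] tuples_length[OF u(3)]
        by (simp add: u K a(1) nth_append list_update_append)
    qed
    then show ?thesis
      unfolding d(2) times_of_act(3)[OF bim(2) ne d(1)]
      by (rule mod_cong[OF R insertion_times_of[OF a(2) ps(1) d'] insertion_times_of[OF a(2) ps(2) d(1)]])
  qed
qed

lemma insertion_slot_left:
  assumes "i < length Ms"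
  shows "slot_corr (Ms @ timesR Ns # Ps) (Ms @ Ns @ Ps) (insertion Ms Ns Ps) i g i g"
  unfolding slot_corr_def
proof
  fix t assume "t \<in> tuples (Ms @ timesR Ns # Ps)"
  then obtain ms y ps where t: "t = ms @ y # ps" "length ms = length Ms" by (rule tuples_middleE)
  then show "insertion Ms Ns Ps (t[i := g (t ! i)]) - apply_slot i g (insertion Ms Ns Ps t) \<in> rels (Ms @ Ns @ Ps)"
    using assms diff_closedD(1)[OF diff_closed_rels[OF bim3]]
    by (simp add: list_update_append nth_append insertion_flatten[OF ne] apply_slot_frag_extend)
qed

lemma insertion_slot_right:
  assumes "k < length Ps"
  shows "slot_corr (Ms @ timesR Ns # Ps) (Ms @ Ns @ Ps) (insertion Ms Ns Ps)
    (Suc (length Ms) + k) g (length Ms + length Ns + k) g"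
  unfolding slot_corr_def
proof
  fix t assume "t \<in> tuples (Ms @ timesR Ns # Ps)"
  then obtain ms y ps where t: "t = ms @ y # ps" "length ms = length Ms" "y \<in> carrier (timesR Ns)"
    by (rule tuples_middleE)
  have "apply_slot (length Ms + length Ns + k) g (insertion Ms Ns Ps t) = insertion Ms Ns Ps (ms @ y # ps[k := g (ps ! k)])"
    unfolding t insertion_flatten[OF ne t(2)] apply_slot_frag_extend
    using takeuchiD(1)[OF times_rep_closed[OF bim(2) ne t(3)]] t(2)
    by (intro frag_extend_eq) (auto simp: nth_append list_update_append dest!: subsetD tuples_length)
  then show "insertion Ms Ns Ps (t[Suc (length Ms) + k := g (t ! (Suc (length Ms) + k))])
      - apply_slot (length Ms + length Ns + k) g (insertion Ms Ns Ps t) \<in> rels (Ms @ Ns @ Ps)"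
    using t(2) diff_closedD(1)[OF diff_closed_rels[OF bim3]]
    by (simp add: t(1) list_update_append nth_append)
qed

text \<open>An action on the nested element is computed on some inner slot \<open>k\<close>, and
  after flattening that slot has position \<open>length Ms + k\<close>.\<close>

lemma insertion_slot_middle:
  assumes "k < length Ns" "\<And>d. d \<in> takeuchi Ns \<Longrightarrow> apply_slot k h d \<in> takeuchi Ns \<and> g (times_of Ns d) = times_of Ns (apply_slot k h d)"
  shows "slot_corr (Ms @ timesR Ns # Ps) (Ms @ Ns @ Ps) (insertion Ms Ns Ps) (length Ms) g (length Ms + k) h"
  unfolding slot_corr_def
proof
  fix t assume "t \<in> tuples (Ms @ timesR Ns # Ps)"
  then obtain ms y ps where t: "t = ms @ y # ps" "length ms = length Ms" "y \<in> carrier (timesR Ns)"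
      "ms \<in> tuples Ms" "ps \<in> tuples Ps"
    by (rule tuples_middleE)
  define d where "d = times_rep Ns y"
  have d: "d \<in> takeuchi Ns" "times_of Ns d = y"
    using times_rep_closed[OF bim(2) ne t(3)] times_of_rep[OF bim(2) ne t(3)] by (simp_all add: d_def)
  have "insertion Ms Ns Ps (ms @ times_of Ns (apply_slot k h d) # ps)
      - frag_extend (\<lambda>u. frag_of (ms @ u @ ps)) (apply_slot k h d) \<in> rels (Ms @ Ns @ Ps)"
    using assms(2)[OF d(1)] by (intro insertion_times_of t) simp
  moreover have "t[length Ms := g (t ! length Ms)] = ms @ g y # ps"
    by (simp add: t(1) t(2)[symmetric])
  ultimately show "insertion Ms Ns Ps (t[length Ms := g (t ! length Ms)])
      - apply_slot (length Ms + k) h (insertion Ms Ns Ps t) \<in> rels (Ms @ Ns @ Ps)"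
    using assms(2)[OF d(1)] d(2)
    by (simp add: t(1) insertion_flatten[OF ne t(2)] d_def[symmetric]
        context_slot[OF takeuchiD(1)[OF d(1)] assms(1) t(2)])
qed

lemma insertion_transports: "transports (Ms @ timesR Ns # Ps) (Ms @ Ns @ Ps) (insertion Ms Ns Ps)"
proof -
  let ?L = "Ms @ timesR Ns # Ps" and ?T = "Ms @ Ns @ Ps" and ?f = "insertion Ms Ns Ps"
  have L: "bimods ?L" using bim bimodule_timesR[OF bim(2)] by auto
  note R = diff_closed_rels[OF bim3]
  note act = takeuchi_slot_actions[OF bim(2) ne] and tact = times_of_act[OF bim(2) ne]
  have ln: "0 < length Ns" "length Ns - 1 < length Ns" using ne by auto
  have first: "slot_corr ?L ?T ?f (length Ms) (lact (timesR Ns) s) (length Ms) (lact (Ns ! 0) s)"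
    "slot_corr ?L ?T ?f (length Ms) (\<lambda>m. ract (timesR Ns) m s) (length Ms) (\<lambda>m. ract (Ns ! 0) m s)" for s
    using insertion_slot_middle[OF ln(1), of "lact (Ns ! 0) s" "lact (timesR Ns) s"]
      insertion_slot_middle[OF ln(1), of "\<lambda>m. ract (Ns ! 0) m s" "\<lambda>m. ract (timesR Ns) m s"] act tact by auto
  have last: "slot_corr ?L ?T ?f (length Ms) (lbar (timesR Ns) s) (length Ms + (length Ns - 1)) (lbar (Ns ! (length Ns - 1)) s)"
    "slot_corr ?L ?T ?f (length Ms) (\<lambda>m. rbar (timesR Ns) m s) (length Ms + (length Ns - 1)) (\<lambda>m. rbar (Ns ! (length Ns - 1)) m s)" for s
    by (rule insertion_slot_middle[OF ln(2)]; simp add: act tact del: One_nat_def)+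
  note pair = slot_corr_pair[OF L bim3 insertion_balanced]
  show ?thesis
  proof (rule transportsI[OF bim3 _ insertion_balanced])
    fix t assume "t \<in> tuples ?L"
    then obtain ms y ps where t: "t = ms @ y # ps" "length ms = length Ms" "y \<in> carrier (timesR Ns)"
      "ms \<in> tuples Ms" "ps \<in> tuples Ps" by (rule tuples_middleE)
    have "Poly_Mapping.keys (frag_extend (\<lambda>u. frag_of (ms @ u @ ps)) (times_rep Ns y)) \<subseteq> tuples ?T"
      using takeuchiD(1)[OF times_rep_closed[OF bim(2) ne t(3)]] t(4,5)
      by (intro keys_frag_extend_subset) (auto intro!: tuples_appendI)
    then show "?f t \<in> sums (tuples ?T)" by (simp add: t(1) insertion_flatten[OF ne t(2)])
  next
    fix c j s assume c: "c \<in> takeuchi ?L" and j: "Suc j < length ?T"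
    consider "Suc j < length Ms" | "Suc j = length Ms" | k where "j = length Ms + k" "Suc k < length Ns"
      | "Suc j = length Ms + length Ns" | k where "j = length Ms + length Ns + k"
    proof (cases "length Ms \<le> j")
      case True
      then obtain k where k: "j = length Ms + k" by (auto simp: le_iff_add)
      show ?thesis
      proof (cases "length Ns \<le> k")
        case True
        then obtain l where "k = length Ns + l" by (auto simp: le_iff_add)
        then show ?thesis using that(5)[of l] k by simp
      next
        case False
        then consider "Suc k < length Ns" | "Suc k = length Ns" by linarith
        then show ?thesis using that(3,4) k by cases auto
      qed
    next
      case False
      then consider "Suc j < length Ms" | "Suc j = length Ms" by linarith
      then show ?thesis using that(1,2) by cases auto
    qed
    then show "apply_slot j (\<lambda>m. rbar (?T ! j) m s) (frag_extend ?f c)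
        - apply_slot (Suc j) (\<lambda>m. ract (?T ! Suc j) m s) (frag_extend ?f c) \<in> rels ?T"
    proof cases
      case 1
      then show ?thesis
        by (intro pair[OF c, of j]) (auto simp: nth_append intro: insertion_slot_left)
    next
      case 2
      then show ?thesis
        using first(2) ln by (intro pair[OF c, of j]) (auto simp: nth_append intro: insertion_slot_left)
    next
      \<comment> \<open>Both slots lie inside the nested product: here the condition comes from the
        inner representative of each nested entry, and in the other cases from the outer sum
        \<open>c\<close>.\<close>
      case (3 k)
      have nth: "?T ! j = Ns ! k" "?T ! Suc j = Ns ! Suc k" using 3 by (simp_all add: nth_append)
      show ?thesis
        unfolding nth apply_slot_frag_extend
      proof (rule frag_extend_cong_mod[OF R])
        fix t assume "t \<in> Poly_Mapping.keys c"
        then have "t \<in> tuples ?L" using takeuchiD(1)[OF c] by auto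
        then obtain ms y ps where t: "t = ms @ y # ps" "length ms = length Ms" "y \<in> carrier (timesR Ns)"
          "ms \<in> tuples Ms" "ps \<in> tuples Ps" by (rule tuples_middleE)
        note d = times_rep_closed[OF bim(2) ne t(3)]
        have kl: "k < length Ns" using 3 by simp
        have "frag_extend (\<lambda>u. frag_of (ms @ u @ ps)) (apply_slot k (\<lambda>m. rbar (Ns ! k) m s) (times_rep Ns y)
            - apply_slot (Suc k) (\<lambda>m. ract (Ns ! Suc k) m s) (times_rep Ns y)) \<in> rels ?T"
          by (rule rels_context[OF bim t(4,5) takeuchiD(2)[OF d 3(2)]])
        then show "apply_slot j (\<lambda>m. rbar (Ns ! k) m s) (?f t) - apply_slot (Suc j) (\<lambda>m. ract (Ns ! Suc k) m s) (?f t) \<in> rels ?T"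
          using context_slot[OF takeuchiD(1)[OF d] kl t(2)] context_slot[OF takeuchiD(1)[OF d] 3(2) t(2)]
          by (simp add: t(1) insertion_flatten[OF ne t(2)] 3(1) frag_extend_diff)
      qed
    next
      case 4
      then have j': "j = length Ms + (length Ns - 1)" "Suc j = length Ms + length Ns + 0" and P: "0 < length Ps"
        using 4 ln(1) j by (arith, simp, simp)
      have nth: "?T ! j = Ns ! (length Ns - 1)" using ln unfolding j'(1) by (simp add: nth_append)
      have "slot_corr ?L ?T ?f (length Ms) (\<lambda>m. rbar (?L ! length Ms) m s) j (\<lambda>m. rbar (Ns ! (length Ns - 1)) m s)"
        unfolding j'(1) using last(2) by simp
      moreover have "slot_corr ?L ?T ?f (Suc (length Ms)) (\<lambda>m. ract (?L ! Suc (length Ms)) m s) (Suc j) (\<lambda>m. ract (?T ! Suc j) m s)"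
        unfolding j'(2) using insertion_slot_right[OF P] by (simp add: nth_append)
      ultimately show ?thesis
        unfolding nth using P by (intro pair[OF c, of "length Ms"]) auto
    next
      case (5 k)
      have P: "k < length Ps" "Suc k < length Ps" using 5 j by auto
      show ?thesis
        using insertion_slot_right[OF P(1)] insertion_slot_right[OF P(2)] P
        by (intro pair[OF c, of "Suc (length Ms) + k"]) (auto simp: nth_append 5)
    qed
  next
    fix c s assume "c \<in> takeuchi ?L"
    then have cs: "c \<in> sums (tuples ?L)" by (rule takeuchiD)
    note corr = slot_corrD[OF bim3 _ cs]
    show "frag_extend ?f (apply_slot 0 (\<lambda>m. lact (?L ! 0) s m) c) - apply_slot 0 (\<lambda>m. lact (?T ! 0) s m) (frag_extend ?f c) \<in> rels ?T"
      "frag_extend ?f (apply_slot 0 (\<lambda>m. ract (?L ! 0) m s) c) - apply_slot 0 (\<lambda>m. ract (?T ! 0) m s) (frag_extend ?f c) \<in> rels ?T"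
      using corr[OF insertion_slot_left[of 0]] corr[OF first(1)] corr[OF first(2)] ln
      by (cases "Ms = []"; simp add: nth_append)+
    have L1: "length ?L - 1 = (if Ps = [] then length Ms else Suc (length Ms) + (length Ps - 1))"
      and T1: "length ?T - 1 = (if Ps = [] then length Ms + (length Ns - 1) else length Ms + length Ns + (length Ps - 1))"
      using ne by (cases Ps; cases Ns; simp)+
    have nth: "?L ! length Ms = timesR Ns" "Ps = [] \<Longrightarrow> ?T ! (length Ms + (length Ns - 1)) = Ns ! (length Ns - 1)"
      "?L ! (Suc (length Ms) + k) = ?T ! (length Ms + length Ns + k)" for k
      by (simp_all add: nth_append)
    show "frag_extend ?f (apply_slot (length ?L - 1) (\<lambda>m. lbar (?L ! (length ?L - 1)) s m) c)
        - apply_slot (length ?T - 1) (\<lambda>m. lbar (?T ! (length ?T - 1)) s m) (frag_extend ?f c) \<in> rels ?T"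
    proof (cases "Ps = []")
      case True
      show ?thesis unfolding L1 T1 if_P[OF True] nth(1) nth(2)[OF True] by (rule corr[OF last(1)])
    next
      case False
      show ?thesis unfolding L1 T1 if_not_P[OF False] nth(3)
        by (rule corr[OF insertion_slot_right]) (use False in simp)
    qed
    show "frag_extend ?f (apply_slot (length ?L - 1) (\<lambda>m. rbar (?L ! (length ?L - 1)) m s) c)
        - apply_slot (length ?T - 1) (\<lambda>m. rbar (?T ! (length ?T - 1)) m s) (frag_extend ?f c) \<in> rels ?T"
    proof (cases "Ps = []")
      case True
      show ?thesis unfolding L1 T1 if_P[OF True] nth(1) nth(2)[OF True] by (rule corr[OF last(2)])
    next
      case False
      show ?thesis unfolding L1 T1 if_not_P[OF False] nth(3)
        by (rule corr[OF insertion_slot_right]) (use False in simp)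
    qed
  qed
qed

end

lemma end_dec_simps:
  assumes "y \<in> carrier End"
  shows "y' \<in> carrier End \<Longrightarrow>
      end_dec (y \<otimes>\<^bsub>End\<^esub> y') = (\<lambda>x :: 'r. end_dec y x + end_dec y' x)"
    "end_dec (lact (timesR []) s y) = (\<lambda>x :: 'r. s * end_dec y x)"
    "end_dec (lbar (timesR []) s y) = (\<lambda>x :: 'r. end_dec y x * s)"
    "end_dec (ract (timesR []) y s) = (\<lambda>x :: 'r. end_dec y (s * x))"
    "end_dec (rbar (timesR []) y s) = (\<lambda>x :: 'r. end_dec y (x * s))"
    "end_dec y ((a :: 'r) + b) = end_dec y a + end_dec y b"
proof -
  note sm = small_simps[OF end_raw_embeds]
  have E: "bimodule (end_raw :: ('r, 'r \<Rightarrow> 'r) bimod)" by (rule bimodule_end_raw)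
  obtain f :: "'r \<Rightarrow> 'r" where f: "f \<in> carrier (end_raw :: ('r, _) bimod)" "y = enc (carrier (end_raw :: ('r, _) bimod)) f"
    using assms sm(1) by (auto simp: timesR.simps(1))
  have dec: "end_dec (enc (carrier (end_raw :: ('r, _) bimod)) g :: 'u) = g" if "g \<in> carrier (end_raw :: ('r, _) bimod)" for g :: "'r \<Rightarrow> 'r"
    unfolding end_dec_def by (rule dec_enc[OF end_raw_embeds that])
  note cl = bimodule.closed[OF E f(1)]
  show "end_dec (lact (timesR []) s y) = (\<lambda>x :: 'r. s * end_dec y x)"
    "end_dec (lbar (timesR []) s y) = (\<lambda>x :: 'r. end_dec y x * s)"
    "end_dec (ract (timesR []) y s) = (\<lambda>x :: 'r. end_dec y (s * x))"
    "end_dec (rbar (timesR []) y s) = (\<lambda>x :: 'r. end_dec y (x * s))"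
    unfolding timesR.simps f(2) sm(4)[OF f(1)] sm(5)[OF f(1)] sm(6)[OF f(1)] sm(7)[OF f(1)]
      dec[OF f(1)] dec[OF cl(1)] dec[OF cl(2)] dec[OF cl(3)] dec[OF cl(4)]
    by (simp_all add: end_raw_def)
  show "end_dec y (a + b) = end_dec y a + end_dec y b"
    using f(1) unfolding f(2) dec[OF f(1)] by (simp add: end_raw_def hom_def)
  show "end_dec (y \<otimes>\<^bsub>End\<^esub> y') = (\<lambda>x :: 'r. end_dec y x + end_dec y' x)"
    if y': "y' \<in> carrier End"
  proof -
    obtain g :: "'r \<Rightarrow> 'r" where g: "g \<in> carrier (end_raw :: ('r, _) bimod)" "y' = enc (carrier (end_raw :: ('r, _) bimod)) g"
      using y' sm(1) by (auto simp: timesR.simps(1))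
    show ?thesis
      unfolding timesR.simps f(2) g(2) sm(2)[OF f(1) g(1)] dec[OF f(1)] dec[OF g(1)]
        dec[OF bimodule_mult_closed[OF E f(1) g(1)]]
      by (simp add: end_raw_def)
  qed
qed

context
  fixes Ms Ps :: "('r, 'u) bimod list" and N :: "('r, 'u) bimod"
  assumes bim: "bimods Ms" "bimodule N" "bimods Ps"
begin

interpretation N: bimodule N by (rule bim)

lemma bimU: "bimods (Ms @ N # Ps)"
  using bim by auto

text \<open>Between the last factor of \<open>Ms\<close> and End(R), balancing becomes balancing
  against \<open>N\<close>, because (s phi)(1) = s phi(1). Between End(R) and \<open>N\<close> the
  two contracted tuples coincide, because (phi(1) s) n = phi(1) (s n).\<close>

lemma unit_right_balanced: "balanced_on (Ms @ timesR [] # N # Ps) (rels (Ms @ N # Ps)) (insertion Ms [] (N # Ps))"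
proof (rule balanced_on_middle)
  note R = diff_closed_rels[OF bimU]
  show "balanced_on Ms (rels (Ms @ N # Ps)) (\<lambda>ms. insertion Ms [] (N # Ps) (ms @ y # ps))"
    if y: "y \<in> carrier (timesR [])" and ps: "ps \<in> tuples (N # Ps)" for y ps
  proof -
    obtain n qs where n: "ps = n # qs" "n \<in> carrier N" "qs \<in> tuples Ps" using ps by (rule tuples_ConsE)
    have "lact N (end_dec y 1) n # qs \<in> tuples (N # Ps)" using n N.closed by simp
    from balanced_on_context[of "[]" "[]", OF _ this, of Ms]
    show ?thesis unfolding n(1) by (intro balanced_on_cong[OF insertion_unit_right]) simp_all
  qed
  show "balanced_on (N # Ps) (rels (Ms @ N # Ps)) (\<lambda>ps. insertion Ms [] (N # Ps) (ms @ y # ps))"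
    if ms: "ms \<in> tuples Ms" and y: "y \<in> carrier (timesR [])" for ms y
  proof (rule balanced_onI)
    note l = tuples_length[OF ms]
    fix A M B t u a b
    assume *: "N # Ps = A @ M # B" "t \<in> tuples A" "u \<in> tuples B" "a \<in> carrier M" "b \<in> carrier M"
    show "insertion Ms [] (N # Ps) (ms @ y # t @ (a \<otimes>\<^bsub>M\<^esub> b) # u) - insertion Ms [] (N # Ps) (ms @ y # t @ a # u)
        - insertion Ms [] (N # Ps) (ms @ y # t @ b # u) \<in> rels (Ms @ N # Ps)"
    proof (cases A)
      case Nil
      then have MN: "M = N" "B = Ps" "t = []" using * by auto
      show ?thesis
        using rels_mult[OF ms *(3)[unfolded MN], of "lact N (end_dec y 1) a" N "lact N (end_dec y 1) b"]
          *(4,5)[unfolded MN]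
        by (simp add: MN insertion_unit_right[OF l] N.closed N.additive)
    next
      case (Cons A1 A')
      then obtain n t' where t: "t = n # t'" "n \<in> carrier N" "t' \<in> tuples A'" using * by (auto elim!: tuples_ConsE)
      have "ms @ lact N (end_dec y 1) n # t' \<in> tuples (Ms @ N # A')"
        using t ms N.closed by (auto intro!: tuples_appendI)
      from rels_mult[OF this *(3,4,5)] show ?thesis
        using * Cons by (simp add: t insertion_unit_right[OF l])
    qed
  next
    note l = tuples_length[OF ms]
    fix A M K B t u a b s
    assume *: "N # Ps = A @ M # K # B" "t \<in> tuples A" "u \<in> tuples B" "a \<in> carrier M" "b \<in> carrier K"
    show "insertion Ms [] (N # Ps) (ms @ y # t @ lbar M s a # b # u)
        - insertion Ms [] (N # Ps) (ms @ y # t @ a # lact K s b # u) \<in> rels (Ms @ N # Ps)"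
    proof (cases A)
      case Nil
      then have MN: "M = N" "K # B = Ps" "t = []" using * by auto
      show ?thesis
        using rels_balanced[OF ms *(3) _ *(5), of "lact N (end_dec y 1) a" N s] *(4)[unfolded MN]
        by (simp add: MN(1,3) MN(2)[symmetric] insertion_unit_right[OF l] N.closed N.commuting)
    next
      case (Cons A1 A')
      then obtain n t' where t: "t = n # t'" "n \<in> carrier N" "t' \<in> tuples A'" using * by (auto elim!: tuples_ConsE)
      have "ms @ lact N (end_dec y 1) n # t' \<in> tuples (Ms @ N # A')"
        using t ms N.closed by (auto intro!: tuples_appendI)
      from rels_balanced[OF this *(3,4,5)] show ?thesis
        using * Cons by (simp add: t insertion_unit_right[OF l])
    qed
  qed
  fix ms y y' ps s
  assume ms: "ms \<in> tuples Ms" and y: "y \<in> carrier End" "y' \<in> carrier End"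
    and ps: "ps \<in> tuples (N # Ps)"
  obtain n qs where n: "ps = n # qs" "n \<in> carrier N" "qs \<in> tuples Ps" using ps by (rule tuples_ConsE)
  show "insertion Ms [] (N # Ps) (ms @ (y \<otimes>\<^bsub>End\<^esub> y') # ps) - insertion Ms [] (N # Ps) (ms @ y # ps)
      - insertion Ms [] (N # Ps) (ms @ y' # ps) \<in> rels (Ms @ N # Ps)"
    using rels_mult[OF ms n(3), of "lact N (end_dec y 1) n" N "lact N (end_dec y' 1) n"] n y
    by (simp add: insertion_unit_right[OF tuples_length[OF ms]] end_dec_simps(1) N.scalar_additive N.closed)
next
  fix A M ms a y ps s
  assume *: "Ms = A @ [M]" "ms \<in> tuples A" "a \<in> carrier M" "y \<in> carrier End" "ps \<in> tuples (N # Ps)"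
  obtain n qs where n: "ps = n # qs" "n \<in> carrier N" "qs \<in> tuples Ps" using *(5) by (rule tuples_ConsE)
  show "insertion Ms [] (N # Ps) (ms @ lbar M s a # y # ps) - insertion Ms [] (N # Ps) (ms @ a # lact (timesR []) s y # ps)
      \<in> rels (Ms @ N # Ps)"
    using rels_balanced[OF *(2) n(3) *(3), of "lact N (end_dec y 1) n" N s] n *
      insertion_unit_right[of "ms @ [lbar M s a]" Ms N Ps y n qs]
      insertion_unit_right[of "ms @ [a]" Ms N Ps "lact (timesR []) s y" n qs]
    by (simp add: tuples_length[OF *(2)] end_dec_simps N.closed N.act_mult)
next
  fix K B ms b y ps s
  assume *: "N # Ps = K # B" "ms \<in> tuples Ms" "y \<in> carrier End" "b \<in> carrier K" "ps \<in> tuples B"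
  then have K: "K = N" by simp
  show "insertion Ms [] (N # Ps) (ms @ lbar (timesR []) s y # b # ps)
      - insertion Ms [] (N # Ps) (ms @ y # lact K s b # ps) \<in> rels (Ms @ N # Ps)"
    using diff_closedD(1)[OF diff_closed_rels[OF bimU]] *(3) *(4)[unfolded K]
    by (simp add: K insertion_unit_right[OF tuples_length[OF *(2)]] end_dec_simps N.act_mult)
qed

lemma unit_right_tuplesE:
  assumes "t \<in> tuples (Ms @ timesR [] # N # Ps)"
  obtains ms y n ps where "t = ms @ y # n # ps" "ms \<in> tuples Ms" "y \<in> carrier End"
    "n \<in> carrier N" "ps \<in> tuples Ps" "length ms = length Ms"
proof -
  obtain ms y qs where "t = ms @ y # qs" "ms \<in> tuples Ms" "y \<in> carrier End"
    "qs \<in> tuples (N # Ps)" "length ms = length Ms"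
    using assms by (rule tuples_middleE)
  then show ?thesis using that by (metis tuples_ConsE)
qed

lemma unit_right_slot_left:
  assumes "i < length Ms"
  shows "slot_corr (Ms @ timesR [] # N # Ps) (Ms @ N # Ps) (insertion Ms [] (N # Ps)) i g i g"
  unfolding slot_corr_def
proof
  fix t assume "t \<in> tuples (Ms @ timesR [] # N # Ps)"
  then obtain ms y n ps where t: "t = ms @ y # n # ps" "length ms = length Ms" by (rule unit_right_tuplesE)
  then show "insertion Ms [] (N # Ps) (t[i := g (t ! i)]) - apply_slot i g (insertion Ms [] (N # Ps) t) \<in> rels (Ms @ N # Ps)"
    using assms diff_closedD(1)[OF diff_closed_rels[OF bimU]]
    by (simp add: list_update_append nth_append insertion_unit_right)
qed

text \<open>For \<open>k = 0\<close> the slot is that of \<open>N\<close>, whose entry has been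
  multiplied by phi(1); an operation there must commute with left multiplication.\<close>

lemma unit_right_slot_right:
  assumes "k < Suc (length Ps)" "k = 0 \<Longrightarrow> (\<And>n x. n \<in> carrier N \<Longrightarrow> g (lact N x n) = lact N x (g n))"
  shows "slot_corr (Ms @ timesR [] # N # Ps) (Ms @ N # Ps) (insertion Ms [] (N # Ps)) (Suc (length Ms) + k) g (length Ms + k) g"
  unfolding slot_corr_def
proof
  fix t assume "t \<in> tuples (Ms @ timesR [] # N # Ps)"
  then obtain ms y n ps where t: "t = ms @ y # n # ps" "length ms = length Ms" "n \<in> carrier N" by (rule unit_right_tuplesE)
  then show "insertion Ms [] (N # Ps) (t[Suc (length Ms) + k := g (t ! (Suc (length Ms) + k))])
      - apply_slot (length Ms + k) g (insertion Ms [] (N # Ps) t) \<in> rels (Ms @ N # Ps)"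
    using assms diff_closedD(1)[OF diff_closed_rels[OF bimU]]
    by (cases k) (simp_all add: list_update_append nth_append insertion_unit_right)
qed

lemma unit_right_slot_lact:
  "slot_corr (Ms @ timesR [] # N # Ps) (Ms @ N # Ps) (insertion Ms [] (N # Ps))
    (length Ms) (lact (timesR []) s) (length Ms) (lact N s)"
  unfolding slot_corr_def
proof
  fix t assume "t \<in> tuples (Ms @ timesR [] # N # Ps)"
  then obtain ms y n ps where t: "t = ms @ y # n # ps" "length ms = length Ms" "n \<in> carrier N"
    "y \<in> carrier End" by (rule unit_right_tuplesE)
  then show "insertion Ms [] (N # Ps) (t[length Ms := lact (timesR []) s (t ! length Ms)])
      - apply_slot (length Ms) (lact N s) (insertion Ms [] (N # Ps) t) \<in> rels (Ms @ N # Ps)"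
    using diff_closedD(1)[OF diff_closed_rels[OF bimU]]
    by (simp add: list_update_append nth_append insertion_unit_right end_dec_simps N.act_mult)
qed

text \<open>The two right actions on \<open>End(R)\<close> agree after evaluation at \<open>1\<close>, so that two Takeuchi conditions
  combine into one across the contracted slot.\<close>

lemma unit_right_ract:
  assumes c: "c \<in> takeuchi (Ms @ timesR [] # N # Ps)"
  shows "frag_extend (insertion Ms [] (N # Ps)) (apply_slot (length Ms) (\<lambda>m. ract (timesR []) m s) c)
    - apply_slot (length Ms) (\<lambda>m. ract N m s) (frag_extend (insertion Ms [] (N # Ps)) c) \<in> rels (Ms @ N # Ps)"
proof -
  let ?L = "Ms @ timesR [] # N # Ps" and ?f = "insertion Ms [] (N # Ps)"
  have E: "bimodule End" by (rule bimodule_timesR) simp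
  have L: "bimods ?L" using bimU E by auto
  note R = diff_closed_rels[OF bimU]
  have eq: "frag_extend ?f (apply_slot (length Ms) (\<lambda>m. ract (timesR []) m s) c)
      = frag_extend ?f (apply_slot (length Ms) (\<lambda>m. rbar (timesR []) m s) c)"
    unfolding frag_extend_apply_slot
  proof (rule frag_extend_eq)
    fix t assume "t \<in> Poly_Mapping.keys c"
    then have "t \<in> tuples ?L" using takeuchiD(1)[OF c] by auto
    then obtain ms y n ps where t: "t = ms @ y # n # ps" "length ms = length Ms" "n \<in> carrier N"
      "y \<in> carrier End" by (rule unit_right_tuplesE)
    then show "?f (t[length Ms := ract (timesR []) (t ! length Ms) s]) = ?f (t[length Ms := rbar (timesR []) (t ! length Ms) s])"
      by (simp add: list_update_append nth_append insertion_unit_right end_dec_simps)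
  qed
  have nth: "?L ! length Ms = timesR []" "?L ! Suc (length Ms) = N" by (simp_all add: nth_append)
  have "apply_slot (length Ms) (\<lambda>m. rbar (timesR []) m s) c - apply_slot (Suc (length Ms)) (\<lambda>m. ract N m s) c \<in> rels ?L"
    using takeuchiD(2)[OF c, of "length Ms" s] unfolding nth by simp
  from frag_extend_rels[OF L R unit_right_balanced this]
  have "frag_extend ?f (apply_slot (length Ms) (\<lambda>m. ract (timesR []) m s) c)
      - frag_extend ?f (apply_slot (Suc (length Ms)) (\<lambda>m. ract N m s) c) \<in> rels (Ms @ N # Ps)"
    unfolding eq frag_extend_diff .
  moreover have "frag_extend ?f (apply_slot (Suc (length Ms)) (\<lambda>m. ract N m s) c)
      - apply_slot (length Ms) (\<lambda>m. ract N m s) (frag_extend ?f c) \<in> rels (Ms @ N # Ps)"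
    using unit_right_slot_right[of 0 "\<lambda>m. ract N m s"] takeuchiD(1)[OF c]
    by (intro slot_corrD[OF bimU]) (simp_all add: N.commuting)
  ultimately show ?thesis by (rule mod_trans[OF R])
qed

lemma unit_right_transports: "transports (Ms @ timesR [] # N # Ps) (Ms @ N # Ps) (insertion Ms [] (N # Ps))"
proof -
  let ?L = "Ms @ timesR [] # N # Ps" and ?T = "Ms @ N # Ps" and ?f = "insertion Ms [] (N # Ps)"
  have E: "bimodule End" by (rule bimodule_timesR) simp
  have L: "bimods ?L" using bimU E by auto
  note R = diff_closed_rels[OF bimU]
  note pair = slot_corr_pair[OF L bimU unit_right_balanced]
  show ?thesis
  proof (rule transportsI[OF bimU _ unit_right_balanced])
    fix t assume "t \<in> tuples ?L"
    then obtain ms y n ps where t: "t = ms @ y # n # ps" "ms \<in> tuples Ms" "y \<in> carrier End"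
      "n \<in> carrier N" "ps \<in> tuples Ps" "length ms = length Ms" by (rule unit_right_tuplesE)
    then show "?f t \<in> sums (tuples ?T)" by (simp add: insertion_unit_right tuples_append_iff N.closed)
  next
    fix c j s assume c: "c \<in> takeuchi ?L" and j: "Suc j < length ?T"
    have cs: "c \<in> sums (tuples ?L)" using c by (rule takeuchiD)
    consider "Suc j < length Ms" | "Suc j = length Ms" | k where "j = length Ms + k"
    proof (cases "length Ms \<le> j")
      case True
      then show ?thesis using that(3) by (auto simp: le_iff_add)
    next
      case False
      then consider "Suc j < length Ms" | "Suc j = length Ms" by linarith
      then show ?thesis using that(1,2) by cases auto
    qed
    then show "apply_slot j (\<lambda>m. rbar (?T ! j) m s) (frag_extend ?f c)
        - apply_slot (Suc j) (\<lambda>m. ract (?T ! Suc j) m s) (frag_extend ?f c) \<in> rels ?T"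
    proof cases
      case 1
      then show ?thesis
        by (intro pair[OF c, where i = j and s = s]) (auto simp: nth_append intro: unit_right_slot_left)
    next
      case 2
      have nth: "?L ! j = ?T ! j" "?T ! length Ms = N" "?L ! length Ms = timesR []" using 2 by (simp_all add: nth_append)
      have "frag_extend ?f (apply_slot j (\<lambda>m. rbar (?L ! j) m s) c - apply_slot (Suc j) (\<lambda>m. ract (?L ! Suc j) m s) c) \<in> rels ?T"
        using 2 by (intro frag_extend_rels[OF L R unit_right_balanced] takeuchiD(2)[OF c]) simp
      then have m: "frag_extend ?f (apply_slot j (\<lambda>m. rbar (?T ! j) m s) c)
          - frag_extend ?f (apply_slot (length Ms) (\<lambda>m. ract (timesR []) m s) c) \<in> rels ?T"
        unfolding nth frag_extend_diff 2 .
      have e1: "apply_slot j (\<lambda>m. rbar (?T ! j) m s) (frag_extend ?f c)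
          - frag_extend ?f (apply_slot j (\<lambda>m. rbar (?T ! j) m s) c) \<in> rels ?T"
        by (rule mod_sym[OF R slot_corrD[OF bimU unit_right_slot_left cs]]) (use 2 in simp)
      show ?thesis
        unfolding nth(2) 2 by (rule mod_cong[OF R e1 mod_sym[OF R unit_right_ract[OF c]] m])
    next
      case (3 k)
      have nth: "?L ! (Suc (length Ms) + i) = ?T ! (length Ms + i)" for i by (simp add: nth_append)
      show ?thesis
      proof (rule pair[OF c, where i = "Suc (length Ms) + k" and s = s])
        show "Suc (Suc (length Ms) + k) < length ?L" using j 3 by simp
        show "slot_corr ?L ?T ?f (Suc (length Ms) + k) (\<lambda>m. rbar (?L ! (Suc (length Ms) + k)) m s) j (\<lambda>m. rbar (?T ! j) m s)"
          unfolding nth 3 by (rule unit_right_slot_right) (use j 3 in \<open>auto simp: nth_append N.commuting\<close>)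
        show "slot_corr ?L ?T ?f (Suc (Suc (length Ms) + k)) (\<lambda>m. ract (?L ! Suc (Suc (length Ms) + k)) m s)
            (Suc j) (\<lambda>m. ract (?T ! Suc j) m s)"
          using unit_right_slot_right[of "Suc k" "\<lambda>m. ract (?T ! (length Ms + Suc k)) m s"] nth[of "Suc k"] j 3 by simp
      qed
    qed
  next
    fix c s assume c: "c \<in> takeuchi ?L"
    then have cs: "c \<in> sums (tuples ?L)" by (rule takeuchiD)
    note corr = slot_corrD[OF bimU _ cs]
    \<comment> \<open>With \<open>Ms\<close> empty, the outer actions of the source are those on
      End(R): the left one is matched tuple by tuple, the right one only on Takeuchi sums.\<close>
    show "frag_extend ?f (apply_slot 0 (\<lambda>m. lact (?L ! 0) s m) c) - apply_slot 0 (\<lambda>m. lact (?T ! 0) s m) (frag_extend ?f c) \<in> rels ?T"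
      "frag_extend ?f (apply_slot 0 (\<lambda>m. ract (?L ! 0) m s) c) - apply_slot 0 (\<lambda>m. ract (?T ! 0) m s) (frag_extend ?f c) \<in> rels ?T"
      using corr[OF unit_right_slot_left[of 0]] corr[OF unit_right_slot_lact] unit_right_ract[OF c]
      by (cases "Ms = []"; simp add: nth_append)+
    have last: "length ?L - 1 = Suc (length Ms) + length Ps" "length ?T - 1 = length Ms + length Ps" by simp_all
    have nth: "?L ! (Suc (length Ms) + length Ps) = ?T ! (length Ms + length Ps)" by (simp add: nth_append)
    have comm: "g (lact N x n) = lact N x (g n)"
      if "length Ps = 0" "n \<in> carrier N" "g = lbar (?T ! (length Ms + length Ps)) s \<or> g = (\<lambda>m. rbar (?T ! (length Ms + length Ps)) m s)" for n x g
      using that by (auto simp: nth_append N.commuting)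
    show "frag_extend ?f (apply_slot (length ?L - 1) (\<lambda>m. lbar (?L ! (length ?L - 1)) s m) c)
        - apply_slot (length ?T - 1) (\<lambda>m. lbar (?T ! (length ?T - 1)) s m) (frag_extend ?f c) \<in> rels ?T"
      "frag_extend ?f (apply_slot (length ?L - 1) (\<lambda>m. rbar (?L ! (length ?L - 1)) m s) c)
        - apply_slot (length ?T - 1) (\<lambda>m. rbar (?T ! (length ?T - 1)) m s) (frag_extend ?f c) \<in> rels ?T"
      unfolding last nth
      by (rule corr, rule unit_right_slot_right, simp, rule comm; simp)+
  qed
qed

end

context
  fixes Ms :: "('r, 'u) bimod list" and M :: "('r, 'u) bimod"
  assumes bim: "bimods Ms" "bimodule M"
begin

interpretation M: bimodule M by (rule bim)

lemma bimL: "bimods (Ms @ [M])"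
  using bim by auto

lemma unit_left_tuplesE:
  assumes "t \<in> tuples (Ms @ [M, timesR []])"
  obtains ms m y where "t = ms @ [m, y]" "ms \<in> tuples Ms" "m \<in> carrier M"
    "y \<in> carrier End" "length ms = length Ms"
proof -
  obtain ms m qs where *: "t = ms @ m # qs" "ms \<in> tuples Ms" "m \<in> carrier M"
    "qs \<in> tuples [End]" "length ms = length Ms"
    using assms by (rule tuples_middleE)
  obtain y where "qs = [y]" "y \<in> carrier End"
    using *(4) by (rule tuples_ConsE) simp
  then show ?thesis using that * by blast
qed

text \<open>Here phi(1) acts on the left neighbour through the opposite ring. Across the last
  boundary the contracted tuples agree because that action reverses products: acting by s and then
  by phi(1) is acting by s phi(1).\<close>

lemma unit_left_balanced: "balanced_on (Ms @ [M, timesR []]) (rels (Ms @ [M])) (insertion (Ms @ [M]) [] [])"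
proof -
  note R = diff_closed_rels[OF bimL]
  have "balanced_on ((Ms @ [M]) @ timesR [] # []) (rels (Ms @ [M])) (insertion (Ms @ [M]) [] [])"
  proof (rule balanced_on_middle)
    fix y ps assume y: "y \<in> carrier End" and "ps \<in> tuples ([] :: ('r, 'u) bimod list)"
    then have ps: "ps = []" by simp
    show "balanced_on (Ms @ [M]) (rels (Ms @ [M])) (\<lambda>ms. insertion (Ms @ [M]) [] [] (ms @ y # ps))"
      unfolding ps
    proof (rule balanced_on_middle)
      fix m qs assume m: "m \<in> carrier M" and "qs \<in> tuples ([] :: ('r, 'u) bimod list)"
      then have qs: "qs = []" by simp
      have "[lbar M (end_dec y 1) m] \<in> tuples [M]" using m M.closed by simp
      from balanced_on_context[of "[]" "[]", OF _ this, of Ms]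
      have b: "balanced_on Ms (rels (Ms @ [M])) (\<lambda>ms. frag_of (ms @ [lbar M (end_dec y 1) m]))" by simp
      show "balanced_on Ms (rels (Ms @ [M])) (\<lambda>ms. insertion (Ms @ [M]) [] [] ((ms @ m # qs) @ [y]))"
        unfolding qs by (rule balanced_on_cong[OF _ b]) (simp add: insertion_unit_left)
    next
      show "balanced_on [] (rels (Ms @ [M])) (\<lambda>qs. insertion (Ms @ [M]) [] [] ((ms @ m # qs) @ [y]))" for ms m
        by (rule balanced_on_Nil)
    next
      fix ms m m' qs assume *: "ms \<in> tuples Ms" "m \<in> carrier M" "m' \<in> carrier M" "qs \<in> tuples ([] :: ('r, 'u) bimod list)"
      then show "insertion (Ms @ [M]) [] [] ((ms @ (m \<otimes>\<^bsub>M\<^esub> m') # qs) @ [y]) - insertion (Ms @ [M]) [] [] ((ms @ m # qs) @ [y])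
          - insertion (Ms @ [M]) [] [] ((ms @ m' # qs) @ [y]) \<in> rels (Ms @ [M])"
        using rels_mult[OF *(1), of "[]" "[]" "lbar M (end_dec y 1) m" M "lbar M (end_dec y 1) m'"]
        by (simp add: insertion_unit_left[OF tuples_length[OF *(1)]] M.closed M.additive)
    next
      fix A K ms a m qs s
      assume *: "Ms = A @ [K]" "ms \<in> tuples A" "a \<in> carrier K" "m \<in> carrier M" "qs \<in> tuples ([] :: ('r, 'u) bimod list)"
      then show "insertion (Ms @ [M]) [] [] ((ms @ lbar K s a # m # qs) @ [y])
          - insertion (Ms @ [M]) [] [] ((ms @ a # lact M s m # qs) @ [y]) \<in> rels (Ms @ [M])"
        using rels_balanced[OF *(2) _ *(3), of "[]" "[]" "lbar M (end_dec y 1) m" M s]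
          insertion_unit_left[of "ms @ [lbar K s a]" Ms M m y] insertion_unit_left[of "ms @ [a]" Ms M "lact M s m" y]
        by (simp add: tuples_length[OF *(2)] M.closed M.commuting)
    qed (simp_all)
  next
    show "balanced_on [] (rels (Ms @ [M])) (\<lambda>ps. insertion (Ms @ [M]) [] [] (ms @ y # ps))" for ms y
      by (rule balanced_on_Nil)
  next
    fix ms y y' ps
    assume *: "ms \<in> tuples (Ms @ [M])" "y \<in> carrier End" "y' \<in> carrier End"
      "ps \<in> tuples ([] :: ('r, 'u) bimod list)"
    obtain as m where as: "ms = as @ [m]" "as \<in> tuples Ms" "m \<in> carrier M"
      using *(1) by (auto elim!: tuples_appendE tuples_ConsE)
    show "insertion (Ms @ [M]) [] [] (ms @ (y \<otimes>\<^bsub>End\<^esub> y') # ps) - insertion (Ms @ [M]) [] [] (ms @ y # ps)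
        - insertion (Ms @ [M]) [] [] (ms @ y' # ps) \<in> rels (Ms @ [M])"
      using rels_mult[OF as(2), of "[]" "[]" "lbar M (end_dec y 1) m" M "lbar M (end_dec y' 1) m"] * as(3)
      by (simp add: as(1) insertion_unit_left[OF tuples_length[OF as(2)]] end_dec_simps(1) M.closed M.scalar_additive)
  next
    fix A K ms a y ps s
    assume *: "Ms @ [M] = A @ [K]" "ms \<in> tuples A" "a \<in> carrier K" "y \<in> carrier End"
      "ps \<in> tuples ([] :: ('r, 'u) bimod list)"
    then have K: "K = M" "A = Ms" by simp_all
    have "length ms = length Ms" using tuples_length[OF *(2)] K by simp
    then show "insertion (Ms @ [M]) [] [] (ms @ lbar K s a # y # ps)
        - insertion (Ms @ [M]) [] [] (ms @ a # lact (timesR []) s y # ps) \<in> rels (Ms @ [M])"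
      using *(3,4,5) diff_closedD(1)[OF R] by (simp add: K insertion_unit_left end_dec_simps M.act_mult)
  qed simp_all
  then show ?thesis by simp
qed

lemma unit_left_slot:
  assumes "i \<le> length Ms" "i = length Ms \<Longrightarrow> (\<And>m x. m \<in> carrier M \<Longrightarrow> g (lbar M x m) = lbar M x (g m))"
  shows "slot_corr (Ms @ [M, timesR []]) (Ms @ [M]) (insertion (Ms @ [M]) [] []) i g i g"
  unfolding slot_corr_def
proof
  fix t assume "t \<in> tuples (Ms @ [M, timesR []])"
  then obtain ms m y where t: "t = ms @ [m, y]" "length ms = length Ms" "m \<in> carrier M" by (rule unit_left_tuplesE)
  show "insertion (Ms @ [M]) [] [] (t[i := g (t ! i)]) - apply_slot i g (insertion (Ms @ [M]) [] [] t) \<in> rels (Ms @ [M])"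
  proof (cases "i < length Ms")
    case True
    then show ?thesis
      using t diff_closedD(1)[OF diff_closed_rels[OF bimL]]
      by (simp add: list_update_append nth_append insertion_unit_left)
  next
    case False
    then have i: "i = length ms" using assms(1) t(2) by simp
    show ?thesis
      using assms(2) i t(2,3) diff_closedD(1)[OF diff_closed_rels[OF bimL]] insertion_unit_left[OF t(2)]
      by (simp add: t(1) nth_append list_update_append)
  qed
qed

lemma unit_left_slot_lbar:
  "slot_corr (Ms @ [M, timesR []]) (Ms @ [M]) (insertion (Ms @ [M]) [] [])
    (Suc (length Ms)) (lbar (timesR []) s) (length Ms) (lbar M s)"
  unfolding slot_corr_def
proof
  fix t assume "t \<in> tuples (Ms @ [M, timesR []])"
  then obtain ms m y where t: "t = ms @ [m, y]" "m \<in> carrier M" "y \<in> carrier End"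
    "length ms = length Ms" by (rule unit_left_tuplesE)
  then show "insertion (Ms @ [M]) [] [] (t[Suc (length Ms) := lbar (timesR []) s (t ! Suc (length Ms))])
      - apply_slot (length Ms) (lbar M s) (insertion (Ms @ [M]) [] [] t) \<in> rels (Ms @ [M])"
    using diff_closedD(1)[OF diff_closed_rels[OF bimL]]
    by (simp add: list_update_append nth_append insertion_unit_left end_dec_simps M.act_mult)
qed

text \<open>Evaluation at 1 does not distinguish the two right actions on End(R), both giving
  phi(s). The Takeuchi condition between \<open>M\<close> and End(R) then replaces the action of s
  on End(R) by \<open>rbar\<close> on \<open>M\<close>, the action required after
  contraction.\<close>

lemma unit_left_rbar:
  assumes c: "c \<in> takeuchi (Ms @ [M, timesR []])"
  shows "frag_extend (insertion (Ms @ [M]) [] []) (apply_slot (Suc (length Ms)) (\<lambda>m. rbar (timesR []) m s) c)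
    - apply_slot (length Ms) (\<lambda>m. rbar M m s) (frag_extend (insertion (Ms @ [M]) [] []) c) \<in> rels (Ms @ [M])"
proof -
  let ?L = "Ms @ [M, timesR []]" and ?f = "insertion (Ms @ [M]) [] []"
  have E: "bimodule End" by (rule bimodule_timesR) simp
  have L: "bimods ?L" using bimL E by auto
  note R = diff_closed_rels[OF bimL]
  have eq: "frag_extend ?f (apply_slot (Suc (length Ms)) (\<lambda>m. ract (timesR []) m s) c)
      = frag_extend ?f (apply_slot (Suc (length Ms)) (\<lambda>m. rbar (timesR []) m s) c)"
    unfolding frag_extend_apply_slot
  proof (rule frag_extend_eq)
    fix t assume "t \<in> Poly_Mapping.keys c"
    then have "t \<in> tuples ?L" using takeuchiD(1)[OF c] by auto
    then obtain ms m y where t: "t = ms @ [m, y]" "m \<in> carrier M" "y \<in> carrier End"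
      "length ms = length Ms" by (rule unit_left_tuplesE)
    then show "?f (t[Suc (length Ms) := ract (timesR []) (t ! Suc (length Ms)) s])
        = ?f (t[Suc (length Ms) := rbar (timesR []) (t ! Suc (length Ms)) s])"
      by (simp add: list_update_append nth_append insertion_unit_left end_dec_simps)
  qed
  have nth: "?L ! length Ms = M" "?L ! Suc (length Ms) = timesR []" by (simp_all add: nth_append)
  have "apply_slot (length Ms) (\<lambda>m. rbar M m s) c - apply_slot (Suc (length Ms)) (\<lambda>m. ract (timesR []) m s) c \<in> rels ?L"
    using takeuchiD(2)[OF c, of "length Ms" s] unfolding nth by simp
  from frag_extend_rels[OF L R unit_left_balanced this]
  have "frag_extend ?f (apply_slot (length Ms) (\<lambda>m. rbar M m s) c)
      - frag_extend ?f (apply_slot (Suc (length Ms)) (\<lambda>m. rbar (timesR []) m s) c) \<in> rels (Ms @ [M])"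
    unfolding eq[symmetric] frag_extend_diff .
  moreover have "frag_extend ?f (apply_slot (length Ms) (\<lambda>m. rbar M m s) c)
      - apply_slot (length Ms) (\<lambda>m. rbar M m s) (frag_extend ?f c) \<in> rels (Ms @ [M])"
    using unit_left_slot[of "length Ms" "\<lambda>m. rbar M m s"] takeuchiD(1)[OF c]
    by (intro slot_corrD[OF bimL]) (simp_all add: M.commuting)
  ultimately show ?thesis using mod_trans[OF R mod_sym[OF R]] by blast
qed

lemma unit_left_transports: "transports (Ms @ [M, timesR []]) (Ms @ [M]) (insertion (Ms @ [M]) [] [])"
proof -
  let ?L = "Ms @ [M, timesR []]" and ?T = "Ms @ [M]" and ?f = "insertion (Ms @ [M]) [] []"
  have E: "bimodule End" by (rule bimodule_timesR) simp
  have L: "bimods ?L" using bimL E by auto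
  show ?thesis
  proof (rule transportsI[OF bimL _ unit_left_balanced])
    fix t assume "t \<in> tuples ?L"
    then obtain ms m y where "t = ms @ [m, y]" "ms \<in> tuples Ms" "m \<in> carrier M" "length ms = length Ms"
      by (rule unit_left_tuplesE)
    then show "?f t \<in> sums (tuples ?T)" by (simp add: insertion_unit_left tuples_append_iff M.closed)
  next
    fix c j s assume c: "c \<in> takeuchi ?L" and j: "Suc j < length ?T"
    have nth: "?L ! j = ?T ! j" "?L ! Suc j = ?T ! Suc j" using j by (simp_all add: nth_append)
    show "apply_slot j (\<lambda>m. rbar (?T ! j) m s) (frag_extend ?f c)
        - apply_slot (Suc j) (\<lambda>m. ract (?T ! Suc j) m s) (frag_extend ?f c) \<in> rels ?T"
    proof (rule slot_corr_pair[OF L bimL unit_left_balanced c, where i = j and s = s])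
      show "Suc j < length ?L" using j by simp
      show "slot_corr ?L ?T ?f j (\<lambda>m. rbar (?L ! j) m s) j (\<lambda>m. rbar (?T ! j) m s)"
        unfolding nth by (rule unit_left_slot) (use j in auto)
      show "slot_corr ?L ?T ?f (Suc j) (\<lambda>m. ract (?L ! Suc j) m s) (Suc j) (\<lambda>m. ract (?T ! Suc j) m s)"
        unfolding nth by (rule unit_left_slot) (use j in \<open>auto simp: nth_append M.commuting\<close>)
    qed
  next
    fix c s assume c: "c \<in> takeuchi ?L"
    then have cs: "c \<in> sums (tuples ?L)" by (rule takeuchiD)
    note corr = slot_corrD[OF bimL _ cs]
    have nth: "?L ! 0 = ?T ! 0" by (simp add: nth_append)
    show "frag_extend ?f (apply_slot 0 (\<lambda>m. lact (?L ! 0) s m) c) - apply_slot 0 (\<lambda>m. lact (?T ! 0) s m) (frag_extend ?f c) \<in> rels ?T"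
      "frag_extend ?f (apply_slot 0 (\<lambda>m. ract (?L ! 0) m s) c) - apply_slot 0 (\<lambda>m. ract (?T ! 0) m s) (frag_extend ?f c) \<in> rels ?T"
      unfolding nth by (rule corr, rule unit_left_slot, simp, simp add: M.commuting)+
    have last: "length ?L - 1 = Suc (length Ms)" "length ?T - 1 = length Ms" by simp_all
    have nth': "?L ! Suc (length Ms) = timesR []" "?T ! length Ms = M" by (simp_all add: nth_append)
    show "frag_extend ?f (apply_slot (length ?L - 1) (\<lambda>m. lbar (?L ! (length ?L - 1)) s m) c)
        - apply_slot (length ?T - 1) (\<lambda>m. lbar (?T ! (length ?T - 1)) s m) (frag_extend ?f c) \<in> rels ?T"
      "frag_extend ?f (apply_slot (length ?L - 1) (\<lambda>m. rbar (?L ! (length ?L - 1)) m s) c)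
        - apply_slot (length ?T - 1) (\<lambda>m. rbar (?T ! (length ?T - 1)) m s) (frag_extend ?f c) \<in> rels ?T"
      unfolding last nth' by (rule corr[OF unit_left_slot_lbar], rule unit_left_rbar[OF c])
  qed
qed

end

lemma transports_insertion:
  assumes bim: "bimods (Ms :: ('r, 'u) bimod list)" "bimods Ns" "bimods Ps" and ne: "Ms @ Ns @ Ps \<noteq> []"
  shows "transports (Ms @ timesR Ns # Ps) (Ms @ Ns @ Ps) (insertion Ms Ns Ps)"
proof (cases "Ns = []")
  case False
  then show ?thesis by (rule insertion_transports[OF bim])
next
  case Ns: True
  show ?thesis
  proof (cases Ps)
    case (Cons N Qs)
    then show ?thesis using unit_right_transports[OF bim(1), of N Qs] bim Ns by simp
  next
    case Nil
    then obtain A M where "Ms = A @ [M]" using ne Ns by (cases Ms rule: rev_cases) auto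
    then show ?thesis using unit_left_transports[of A M] bim Ns Nil by simp
  qed
qed

lemma lasc_arrow:
  assumes bim: "bimods (Ms :: ('r, 'u) bimod list)" "bimods Ns" "bimods Ps" and ne: "Ms @ Ns @ Ps \<noteq> []"
  shows "assoc Ms Ns Ps \<in> bimod_Hom (timesR (Ms @ timesR Ns # Ps)) (timesR (Ms @ Ns @ Ps))"
    and "c \<in> takeuchi (Ms @ timesR Ns # Ps) \<Longrightarrow>
      bfun (assoc Ms Ns Ps) (times_of (Ms @ timesR Ns # Ps) c)
        = times_of (Ms @ Ns @ Ps) (frag_extend (insertion Ms Ns Ps) c)"
proof -
  have L: "bimods (Ms @ timesR Ns # Ps)" and T: "bimods (Ms @ Ns @ Ps)"
    using bim bimodule_timesR[OF bim(2)] by auto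
  have ne': "Ms @ timesR Ns # Ps \<noteq> []" by simp
  show "assoc Ms Ns Ps \<in> bimod_Hom (timesR (Ms @ timesR Ns # Ps)) (timesR (Ms @ Ns @ Ps))"
    unfolding lasc_insertion[OF ne] by (rule times_arrow(1)[OF L ne' T ne transports_insertion[OF bim ne]])
  show "bfun (assoc Ms Ns Ps) (times_of (Ms @ timesR Ns # Ps) c)
        = times_of (Ms @ Ns @ Ps) (frag_extend (insertion Ms Ns Ps) c)" if "c \<in> takeuchi (Ms @ timesR Ns # Ps)"
    unfolding lasc_insertion[OF ne] by (rule times_arrow(2)[OF L ne' T ne transports_insertion[OF bim ne] that])
qed

end

section \<open>Naturality and coherence of the Takeuchi product\<close>

subsection \<open>The lax monoidal category\<close>

lemma times_structure_sel [simp]: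
  "lamO times_structure = timesR" "lamM times_structure = times_map" "lunit times_structure = bimod_id"
  by (simp_all add: times_structure_def)

lemma lasc_Nil: "assoc [] [] [] = bimod_id (timesR [])"
  by (simp add: times_structure_def times_unitor_def)

lemma transports_takeuchi: "transports Ms Ns f \<Longrightarrow> c \<in> takeuchi Ms \<Longrightarrow> frag_extend f c \<in> takeuchi Ns"
  by (simp add: transports_def)

lemma Arr_Hom: "f \<in> Arr bimod_moncat \<Longrightarrow> f \<in> bimod_Hom (bdom f) (bcod f)"
  by (auto simp: bimod_Hom_def)

lemma Hom_Arr: "f \<in> bimod_Hom M N \<Longrightarrow> f \<in> Arr bimod_moncat"
  by (auto simp: bimod_Hom_def)

lemma bimod_id_Arr: "bimodule M \<Longrightarrow> bimod_id M \<in> Arr bimod_moncat"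
  using bimod_id_Hom[of M] by (auto simp: bimod_Hom_def)

lemma map2_bfun_id:
  "t \<in> tuples Ms \<Longrightarrow> map2 bfun (map bimod_id Ms) t = t"
  by (auto simp: tuples_def intro!: nth_equalityI)

context big_universe
begin

text \<open>The functions \<open>f\<close> and \<open>g\<close> are compared on every tuple,
  including those outside the Takeuchi product; this is agreement in the ambient tensor product over
  R.\<close>

lemma times_of_eqI:
  assumes "bimods (Ns :: ('r, 'u) bimod list)" "Ns \<noteq> []"
    and "frag_extend f c \<in> takeuchi Ns" "frag_extend g c \<in> takeuchi Ns" "c \<in> sums (tuples Ms)"
    and "\<And>t. t \<in> tuples Ms \<Longrightarrow> f t - g t \<in> rels Ns"
  shows "times_of Ns (frag_extend f c) = times_of Ns (frag_extend g c)"
  unfolding times_of_eq_iff[OF assms(1-4)]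
  by (rule frag_extend_cong_mod[OF diff_closed_rels[OF assms(1)]]) (use assms(5,6) in auto)

lemma
  assumes fs: "\<forall>f\<in>set fs. f \<in> Arr bimod_moncat"
  shows times_map_Hom: "times_map fs \<in> bimod_Hom (timesR (map bdom fs)) (timesR (map bcod fs) :: ('r, 'u) bimod)"
    and times_map_times_of: "fs \<noteq> [] \<Longrightarrow> c \<in> takeuchi (map bdom fs) \<Longrightarrow>
      bfun (times_map fs) (times_of (map bdom fs) c) = times_of (map bcod fs) (frag_extend (\<lambda>t. frag_of (map2 bfun fs t)) c)"
proof -
  have Ms: "bimods (map bdom fs)" and Ns: "bimods (map bcod fs)" using fs by auto
  show "times_map fs \<in> bimod_Hom (timesR (map bdom fs)) (timesR (map bcod fs))"
  proof (cases "fs = []")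
    case True
    then show ?thesis using bimod_id_Hom[OF bimodule_timesR[of "[]"]] by (simp add: times_map_def)
  next
    case False
    then show ?thesis
      using times_arrow(1)[OF Ms _ Ns _ transports_map[OF fs False]] by (simp add: times_map_def)
  qed
  show "bfun (times_map fs) (times_of (map bdom fs) c) = times_of (map bcod fs) (frag_extend (\<lambda>t. frag_of (map2 bfun fs t)) c)"
    if "fs \<noteq> []" "c \<in> takeuchi (map bdom fs)"
    using times_arrow(2)[OF Ms _ Ns _ transports_map[OF fs that(1)] that(2)] that(1) by (simp add: times_map_def)
qed

lemma times_map_id:
  assumes Ms: "bimods (Ms :: ('r, 'u) bimod list)"
  shows "times_map (map bimod_id Ms) = bimod_id (timesR Ms)"
proof (cases "Ms = []")
  case True
  then show ?thesis by (simp add: times_map_def)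
next
  case False
  have A: "\<forall>f\<in>set (map bimod_id Ms). f \<in> Arr bimod_moncat" using Ms bimod_id_Arr by auto
  have dom: "map bdom (map bimod_id Ms) = Ms" "map bcod (map bimod_id Ms) = Ms" by (simp_all add: map_idI)
  show ?thesis
  proof (rule times_eqI[OF Ms False])
    show "times_map (map bimod_id Ms) \<in> bimod_Hom (timesR Ms) (timesR Ms)"
      using times_map_Hom[OF A] unfolding dom .
    show "bimod_id (timesR Ms) \<in> bimod_Hom (timesR Ms) (timesR Ms)" by (rule bimod_id_Hom[OF bimodule_timesR[OF Ms]])
    fix c assume c: "c \<in> takeuchi Ms"
    have "frag_extend (\<lambda>t. frag_of (map2 bfun (map bimod_id Ms) t)) c = frag_extend frag_of c"
      using takeuchiD(1)[OF c] by (intro frag_extend_eq) (auto simp only: map2_bfun_id mem_Collect_eq subset_iff)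
    moreover have "c \<in> takeuchi (map bdom (map bimod_id Ms))" using c unfolding dom .
    moreover have "map bimod_id Ms \<noteq> []" using False by simp
    ultimately show "bfun (times_map (map bimod_id Ms)) (times_of Ms c) = bfun (bimod_id (timesR Ms)) (times_of Ms c)"
      using times_map_times_of[OF A, of c] unfolding dom by (simp add: times_of_closed[OF Ms False c])
  qed
qed

lemma times_map_comp:
  assumes fs: "\<forall>f\<in>set fs. f \<in> Arr (bimod_moncat :: (('r, 'u) bimod, _) moncat)"
    and gs: "\<forall>g\<in>set gs. g \<in> Arr (bimod_moncat :: (('r, 'u) bimod, _) moncat)"
    and match: "map bcod fs = map bdom gs"
  shows "times_map (map2 (Comp bimod_moncat) gs fs) = times_map gs \<cdot> times_map fs"
proof -
  have l: "length fs = length gs" using match by (metis length_map)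
  have f: "fs ! i \<in> bimod_Hom (bdom (fs ! i)) (bdom (gs ! i))" "gs ! i \<in> bimod_Hom (bdom (gs ! i)) (bcod (gs ! i))"
    if "i < length fs" for i
  proof -
    have "bcod (fs ! i) = bdom (gs ! i)" using match that l by (metis nth_map)
    then show "fs ! i \<in> bimod_Hom (bdom (fs ! i)) (bdom (gs ! i))" "gs ! i \<in> bimod_Hom (bdom (gs ! i)) (bcod (gs ! i))"
      using Arr_Hom[OF bspec[OF fs nth_mem[of i]]] Arr_Hom[OF bspec[OF gs nth_mem[of i]]] that l by simp_all
  qed
  let ?h = "map2 (Comp bimod_moncat) gs fs"
  have h: "\<forall>f\<in>set ?h. f \<in> Arr bimod_moncat"
  proof
    fix k assume "k \<in> set ?h"
    then obtain i where "i < length fs" "k = gs ! i \<cdot> fs ! i"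
      using l by (auto simp: in_set_conv_nth)
    then show "k \<in> Arr bimod_moncat"
      using comp_Hom[OF f] by (fastforce simp: bimod_Hom_def)
  qed
  have d: "map bdom ?h = map bdom fs" "map bcod ?h = map bcod gs"
    using l by (auto intro!: nth_equalityI)
  have c: "times_map gs \<cdot> times_map fs \<in> bimod_Hom (timesR (map bdom fs)) (timesR (map bcod gs))"
    using comp_Hom[OF times_map_Hom[OF fs]] times_map_Hom[OF gs] match by simp
  show ?thesis
  proof (cases "fs = []")
    case True
    then show ?thesis using l bimod_id_Hom[OF bimodule_timesR[of "[]"]] arr_eqI[OF _ c] by (simp add: times_map_def)
  next
    case False
    then have ne: "gs \<noteq> []" "?h \<noteq> []" "map bdom fs \<noteq> []" using l by auto
    have Ms: "bimods (map bdom fs)" using fs by auto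
    show ?thesis
    proof (rule times_eqI[OF Ms ne(3) _ c])
      show "times_map ?h \<in> bimod_Hom (timesR (map bdom fs)) (timesR (map bcod gs))"
        using times_map_Hom[OF h] unfolding d .
      fix c assume c: "c \<in> takeuchi (map bdom fs)"
      have c': "frag_extend (\<lambda>t. frag_of (map2 bfun fs t)) c \<in> takeuchi (map bdom gs)"
        using transports_takeuchi[OF transports_map[OF fs False] c] match by simp
      have "map2 bfun ?h t = map2 bfun gs (map2 bfun fs t)" if "t \<in> tuples (map bdom fs)" for t
        using l tuples_length[OF that] tuples_nth[OF that] by (auto intro!: nth_equalityI)
      then have "frag_extend (\<lambda>t. frag_of (map2 bfun ?h t)) c
          = frag_extend (\<lambda>t. frag_of (map2 bfun gs t)) (frag_extend (\<lambda>t. frag_of (map2 bfun fs t)) c)"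
        unfolding frag_extend_compose frag_extend_of
        using takeuchiD(1)[OF c] by (intro frag_extend_eq) auto
      then show "bfun (times_map ?h) (times_of (map bdom fs) c) = bfun (times_map gs \<cdot> times_map fs) (times_of (map bdom fs) c)"
        using times_map_times_of[OF h ne(2), unfolded d, OF c] times_map_times_of[OF fs False c]
          times_map_times_of[OF gs ne(1) c'] match times_of_closed[OF Ms ne(3) c] bimod_HomD(3)[OF times_map_Hom[OF fs]]
        by simp
    qed
  qed
qed

lemma lam_functor_times: "cat_functor (power_cat Bimod n) Bimod timesR times_map"
proof (intro cat_functor.intro cat_functor_axioms.intro category_power category_bimod)
  show "timesR xs \<in> Obj Bimod" if "xs \<in> Obj (power_cat Bimod n)" for xs
    using that by (auto intro!: bimodule_timesR)
  show "times_map fs \<in> Hom Bimod (timesR xs) (timesR ys)" if "fs \<in> Hom (power_cat Bimod n) xs ys" for fs xs ys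
  proof -
    have "map bdom fs = xs" "map bcod fs = ys" "\<forall>f\<in>set fs. f \<in> Arr bimod_moncat"
      using that by (auto simp: Hom_def power_cat_def)
    then show ?thesis using times_map_Hom[of fs] by simp
  qed
  show "times_map (Idn (power_cat Bimod n) xs) = Idn Bimod (timesR xs)" if "xs \<in> Obj (power_cat Bimod n)" for xs
    using that times_map_id[of xs] by auto
  show "times_map (gs \<bullet>\<^bsub>power_cat Bimod n\<^esub> fs) = times_map gs \<cdot> times_map fs"
    if "fs \<in> Hom (power_cat Bimod n) xs ys" "gs \<in> Hom (power_cat Bimod n) ys zs" for fs gs xs ys zs
  proof -
    have "map bcod fs = map bdom gs" "\<forall>f\<in>set fs. f \<in> Arr bimod_moncat" "\<forall>f\<in>set gs. f \<in> Arr bimod_moncat"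
      using that by (auto simp: Hom_def power_cat_def)
    then show ?thesis using times_map_comp[of fs gs] by simp
  qed
qed

lemma lasc_Hom_times:
  assumes bim: "bimods (Ms :: ('r, 'u) bimod list)" "bimods Ns" "bimods Ps"
  shows "assoc Ms Ns Ps \<in> bimod_Hom (timesR (Ms @ timesR Ns # Ps)) (timesR (Ms @ Ns @ Ps))"
proof (cases "Ms @ Ns @ Ps = []")
  case True
  then show ?thesis using bimod_id_Hom[OF bimodule_timesR[of "[]"]] by (simp add: lasc_Nil)
qed (rule lasc_arrow(1)[OF bim])

text \<open>For nonempty \<open>gs\<close>, the chosen representative of the image and the image of
  the chosen representative differ by a relation. For empty \<open>gs\<close>, the two sides agree
  because a bimodule map commutes with the action of phi(1) on the neighbour.\<close>

lemma insertion_map: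
  fixes fs gs hs :: "('r, 'u) bimod_arr list"
  assumes fs: "\<forall>f\<in>set fs. f \<in> Arr bimod_moncat" and gs: "\<forall>f\<in>set gs. f \<in> Arr bimod_moncat"
    and hs: "\<forall>f\<in>set hs. f \<in> Arr bimod_moncat" and ne: "fs @ gs @ hs \<noteq> []"
    and t: "t \<in> tuples (map bdom fs @ timesR (map bdom gs) # map bdom hs)"
  shows "insertion (map bcod fs) (map bcod gs) (map bcod hs) (map2 bfun (fs @ times_map gs # hs) t)
    - frag_extend (\<lambda>u. frag_of (map2 bfun (fs @ gs @ hs) u)) (insertion (map bdom fs) (map bdom gs) (map bdom hs) t)
    \<in> rels (map bcod fs @ map bcod gs @ map bcod hs)"
proof -
  have dom: "bimods (map bdom fs)" "bimods (map bdom gs)" "bimods (map bdom hs)"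
    and cod: "bimods (map bcod fs)" "bimods (map bcod gs)" "bimods (map bcod hs)" using fs gs hs by auto
  have T: "bimods (map bcod fs @ map bcod gs @ map bcod hs)" using cod by auto
  note zero = diff_closedD(1)[OF diff_closed_rels[OF T]]
  obtain ms y ps where t: "t = ms @ y # ps" "ms \<in> tuples (map bdom fs)" "y \<in> carrier (timesR (map bdom gs))"
    "ps \<in> tuples (map bdom hs)" "length ms = length (map bdom fs)"
    using t by (rule tuples_middleE)
  have l: "length ms = length fs" "length ps = length hs" using tuples_length[OF t(2)] tuples_length[OF t(4)] by simp_all
  have mt: "map2 bfun (fs @ times_map gs # hs) t = map2 bfun fs ms @ bfun (times_map gs) y # map2 bfun hs ps"
    by (simp add: t(1) l)
  note ms' = map2_bfun_tuples[OF fs t(2)] and ps' = map2_bfun_tuples[OF hs t(4)]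
  show ?thesis
  proof (cases "gs = []")
    case False
    then have ne: "map bdom gs \<noteq> []" "map bcod gs \<noteq> []" by auto
    define d where "d = times_rep (map bdom gs) y"
    have d: "d \<in> takeuchi (map bdom gs)" "times_of (map bdom gs) d = y"
      unfolding d_def by (rule times_rep_closed[OF dom(2) ne(1) t(3)], rule times_of_rep[OF dom(2) ne(1) t(3)])
    have e: "frag_extend (\<lambda>t. frag_of (map2 bfun gs t)) d \<in> takeuchi (map bcod gs)"
      by (rule transports_takeuchi[OF transports_map[OF gs False] d(1)])
    have G: "bfun (times_map gs) y = times_of (map bcod gs) (frag_extend (\<lambda>t. frag_of (map2 bfun gs t)) d)"
      using times_map_times_of[OF gs False d(1)] d(2) by simp
    have "frag_extend (\<lambda>u. frag_of (map2 bfun fs ms @ u @ map2 bfun hs ps)) (frag_extend (\<lambda>t. frag_of (map2 bfun gs t)) d)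
        = frag_extend (\<lambda>u. frag_of (map2 bfun (fs @ gs @ hs) u)) (insertion (map bdom fs) (map bdom gs) (map bdom hs) t)"
      unfolding t(1) insertion_flatten[OF ne(1) t(5)] d_def[symmetric] frag_extend_compose frag_extend_of
      using takeuchiD(1)[OF d(1)] l by (intro frag_extend_eq) (auto dest!: subsetD tuples_length)
    then show ?thesis
      unfolding mt G using insertion_times_of[OF cod ne(2) ms' ps' e] by simp
  next
    case gs: True
    have y: "bfun (times_map gs) y = y" using t(3) gs by (simp add: times_map_def)
    have l': "length (map2 bfun fs ms) = length (map bcod fs)" using l by simp
    show ?thesis
    proof (cases hs)
      case (Cons h hs')
      then obtain n qs where n: "ps = n # qs" "n \<in> carrier (bdom h)"
        using t(4) by (auto elim: tuples_ConsE)
      have "bfun h \<in> bimod_hom (bdom h) (bcod h)" using hs Cons by simp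
      note lh = bimod_homD(4)[OF this n(2)]
      show ?thesis
        unfolding mt y using zero l lh insertion_unit_right[OF l', of "bcod h" "map bcod hs'" y "bfun h n"]
          insertion_unit_right[OF t(5), of "bdom h" "map bdom hs'" y n qs]
        by (simp add: t(1) Cons n(1) gs)
    next
      case Nil
      then obtain fs' f where f: "fs = fs' @ [f]" using ne gs by (cases fs rule: rev_cases) auto
      obtain ms' m where m: "ms = ms' @ [m]" "m \<in> carrier (bdom f)" "length ms' = length fs'"
        using t(2) unfolding f by (auto elim!: tuples_appendE tuples_ConsE dest: tuples_length)
      have "bfun f \<in> bimod_hom (bdom f) (bcod f)" using fs f by simp
      note lf = bimod_homD(5)[OF this m(2)]
      have "ps = []" using l Nil by simp
      then show ?thesis
        unfolding mt y using zero lf insertion_unit_left[of ms' "map bdom fs'" "bdom f" m y]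
          insertion_unit_left[of "map2 bfun fs' ms'" "map bcod fs'" "bcod f" "bfun f m" y]
        by (simp add: t(1) f m(1,3) Nil gs)
    qed
  qed
qed

lemma lasc_natural_times:
  fixes fs gs hs :: "('r, 'u) bimod_arr list"
  assumes fs: "\<forall>f\<in>set fs. f \<in> Arr bimod_moncat" and gs: "\<forall>f\<in>set gs. f \<in> Arr bimod_moncat"
    and hs: "\<forall>f\<in>set hs. f \<in> Arr bimod_moncat"
  shows "assoc (map bcod fs) (map bcod gs) (map bcod hs) \<cdot> times_map (fs @ times_map gs # hs)
    = times_map (fs @ gs @ hs) \<cdot> assoc (map bdom fs) (map bdom gs) (map bdom hs)"
proof -
  have dom: "bimods (map bdom fs)" "bimods (map bdom gs)" "bimods (map bdom hs)"
    and cod: "bimods (map bcod fs)" "bimods (map bcod gs)" "bimods (map bcod hs)" using fs gs hs by auto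
  note G = times_map_Hom[OF gs]
  have fGh: "\<forall>f\<in>set (fs @ times_map gs # hs). f \<in> Arr bimod_moncat"
    using fs hs bimod_HomD[OF G] G by (auto simp: bimod_Hom_def)
  have fgh: "\<forall>f\<in>set (fs @ gs @ hs). f \<in> Arr bimod_moncat" using fs gs hs by auto
  have mapG: "map bdom (fs @ times_map gs # hs) = map bdom fs @ timesR (map bdom gs) # map bdom hs"
    "map bcod (fs @ times_map gs # hs) = map bcod fs @ timesR (map bcod gs) # map bcod hs"
    using bimod_HomD(3,4)[OF G] by simp_all
  have mapg: "map bdom (fs @ gs @ hs) = map bdom fs @ map bdom gs @ map bdom hs"
    "map bcod (fs @ gs @ hs) = map bcod fs @ map bcod gs @ map bcod hs" by simp_all
  note A = times_map_Hom[OF fGh, unfolded mapG] and B = lasc_Hom_times[OF cod]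
    and C = lasc_Hom_times[OF dom] and D = times_map_Hom[OF fgh, unfolded mapg]
  show ?thesis
  proof (cases "fs @ gs @ hs = []")
    case True
    then show ?thesis
      using times_map_id[of "[timesR []]"] times_map_id[of "[]"] bimodule_timesR[of "[]"]
      by (simp add: lasc_Nil)
  next
    case False
    let ?L = "map bdom fs @ timesR (map bdom gs) # map bdom hs" and ?L' = "map bcod fs @ timesR (map bcod gs) # map bcod hs"
    let ?T = "map bdom fs @ map bdom gs @ map bdom hs" and ?T' = "map bcod fs @ map bcod gs @ map bcod hs"
    have ne: "?L \<noteq> []" "?T \<noteq> []" "?T' \<noteq> []" using False by auto
    have L: "bimods ?L" using dom bimodule_timesR[OF dom(2)] by auto
    have T': "bimods ?T'" using cod by auto
    note tl = transports_insertion[OF dom ne(2)] and tl' = transports_insertion[OF cod ne(3)]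
    have fGh_ne: "fs @ times_map gs # hs \<noteq> []" by simp
    note tm = transports_map[OF fGh fGh_ne, unfolded mapG] and tm' = transports_map[OF fgh False, unfolded mapg]
    show ?thesis
    proof (rule times_eqI[OF L ne(1) comp_Hom[OF A B] comp_Hom[OF C D]])
      fix c assume c: "c \<in> takeuchi ?L"
      note c1 = transports_takeuchi[OF tm c] and c2 = transports_takeuchi[OF tl c]
      have "times_of ?T' (frag_extend (insertion (map bcod fs) (map bcod gs) (map bcod hs))
          (frag_extend (\<lambda>t. frag_of (map2 bfun (fs @ times_map gs # hs) t)) c))
        = times_of ?T' (frag_extend (\<lambda>t. frag_of (map2 bfun (fs @ gs @ hs) t))
          (frag_extend (insertion (map bdom fs) (map bdom gs) (map bdom hs)) c))"
        using transports_takeuchi[OF tl' c1] transports_takeuchi[OF tm' c2]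
        unfolding frag_extend_compose
        by (rule times_of_eqI[OF T' ne(3) _ _ takeuchiD(1)[OF c]])
          (use insertion_map[OF fs gs hs False] in simp)
      then show "bfun (assoc (map bcod fs) (map bcod gs) (map bcod hs) \<cdot> times_map (fs @ times_map gs # hs)) (times_of ?L c)
        = bfun (times_map (fs @ gs @ hs) \<cdot> assoc (map bdom fs) (map bdom gs) (map bdom hs)) (times_of ?L c)"
        using times_map_times_of[OF fGh fGh_ne, unfolded mapG, OF c] lasc_arrow(2)[OF cod ne(3) c1]
          times_map_times_of[OF fgh False, unfolded mapg, OF c2] lasc_arrow(2)[OF dom ne(2) c]
          times_of_closed[OF L ne(1) c] bimod_HomD(3)[OF A] bimod_HomD(3)[OF C]
        by simp
    qed
  qed
qed

text \<open>Strict normality: a product of one factor is that factor, with \<open>[x]\<close> as its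
  representative, so flattening leaves tuples unchanged.\<close>

lemma lasc_single:
  assumes bim: "bimods (Ms :: ('r, 'u) bimod list)" "bimodule M" "bimods Ps"
  shows "assoc Ms [M] Ps = bimod_id (timesR (Ms @ M # Ps))"
proof -
  let ?L = "Ms @ M # Ps"
  have L: "bimods ?L" "?L \<noteq> []" and M: "bimods [M]" using bim by auto
  have ne: "Ms @ [M] @ Ps \<noteq> []" by simp
  note A = lasc_Hom_times[OF bim(1) M bim(3), simplified]
  show ?thesis
  proof (rule times_eqI[OF L A bimod_id_Hom[OF bimodule_timesR[OF L(1)]]])
    fix c assume c: "c \<in> takeuchi ?L"
    have "insertion Ms [M] Ps t = frag_of t" if t: "t \<in> tuples ?L" for t
    proof -
      obtain ms y ps where "t = ms @ y # ps" "length ms = length Ms" using t by (rule tuples_middleE)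
      then show ?thesis using insertion_flatten[of "[M]" ms Ms Ps y ps] by (simp add: times_rep_def)
    qed
    then have "frag_extend (insertion Ms [M] Ps) c = frag_extend frag_of c"
      using takeuchiD(1)[OF c] by (intro frag_extend_eq) auto
    then show "bfun (assoc Ms [M] Ps) (times_of ?L c) = bfun (bimod_id (timesR ?L)) (times_of ?L c)"
      using lasc_arrow(2)[OF bim(1) M bim(3) ne, of c] c by (simp add: times_of_closed[OF L c])
  qed
qed

text \<open>The outer product has \<open>timesR Ns\<close> as its only factor, so \<open>x\<close>
  itself is represented by \<open>[x]\<close>; flattening unpacks it with \<open>times_rep\<close>,
  and \<open>times_of\<close> packs it again.\<close>

lemma lasc_outer:
  assumes Ns: "bimods (Ns :: ('r, 'u) bimod list)"
  shows "assoc [] Ns [] = bimod_id (timesR Ns)"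
proof (cases "Ns = []")
  case True
  then show ?thesis by (simp add: lasc_Nil)
next
  case False
  have Q: "bimods [timesR Ns]" using bimodule_timesR[OF Ns] by simp
  have ne: "[] @ Ns @ [] \<noteq> []" using False by simp
  note A = lasc_Hom_times[of "[]" Ns "[]", simplified, OF Ns]
  show ?thesis
  proof (rule arr_eqI[OF A bimod_id_Hom[OF bimodule_timesR[OF Ns]]])
    fix x assume x: "x \<in> carrier (timesR Ns)"
    interpret Q: bimodule "timesR Ns" by (rule bimodule_timesR[OF Ns])
    have x': "times_of [timesR Ns] (frag_of [x]) = x" using x by (simp add: times_of_def)
    have c: "frag_of [x] \<in> takeuchi [timesR Ns]" using x by (simp add: takeuchi_single)
    have "bfun (assoc [] Ns []) x = times_of Ns (insertion [] Ns [] [x])"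
      using lasc_arrow(2)[OF _ Ns _ ne, of "frag_of [x]"] c x' by simp
    also have "insertion [] Ns [] [x] = times_rep Ns x"
      using insertion_flatten[OF False, of "[]" "[]" "[]" x "[]"] by simp
    finally show "bfun (assoc [] Ns []) x = bfun (bimod_id (timesR Ns)) x"
      using x times_of_rep[OF Ns False x] by simp
  qed
qed

text \<open>Contracting inside a nested product can differ from contracting after flattening: if
  End(R) is last inside but not last overall, the first acts on the left neighbour and the second on
  the right one. The balancing relation between those neighbours identifies the results.\<close>

lemma insertion_context:
  assumes bim: "bimods (Xs :: ('r, 'u) bimod list)" "bimods Ys" "bimods Us" "bimods Vs" "bimods Zs"
    and ne: "Ys @ Us @ Vs \<noteq> []"
    and ms: "ms \<in> tuples Xs" and ps: "ps \<in> tuples Zs" and v: "v \<in> tuples (Ys @ timesR Us # Vs)"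
  shows "frag_extend (\<lambda>w. frag_of (ms @ w @ ps)) (insertion Ys Us Vs v) - insertion (Xs @ Ys) Us (Vs @ Zs) (ms @ v @ ps)
    \<in> rels (Xs @ Ys @ Us @ Vs @ Zs)"
proof -
  have T: "bimods (Xs @ Ys @ Us @ Vs @ Zs)" using bim by auto
  note zero = diff_closedD(1)[OF diff_closed_rels[OF T]]
  obtain as b cs where v: "v = as @ b # cs" "as \<in> tuples Ys" "b \<in> carrier (timesR Us)" "cs \<in> tuples Vs" "length as = length Ys"
    using v by (rule tuples_middleE)
  have l: "length (ms @ as) = length (Xs @ Ys)" using tuples_length[OF ms] v(5) by simp
  have assoc: "ms @ v @ ps = (ms @ as) @ b # (cs @ ps)" by (simp add: v(1))
  show ?thesis
  proof (cases "Us = []")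
    case False
    show ?thesis
      unfolding assoc insertion_flatten[OF False l] using zero
      by (simp add: v(1) insertion_flatten[OF False v(5)] frag_extend_compose)
  next
    case Us: True
    show ?thesis
    proof (cases Vs)
      case (Cons V Vs')
      then obtain n cs' where "cs = n # cs'" using v(4) by (auto elim: tuples_ConsE)
      then show ?thesis
        using insertion_unit_right[OF l, of V "Vs' @ Zs" b n "cs' @ ps"] insertion_unit_right[OF v(5), of V Vs' b n cs'] zero
        by (simp add: v(1) Us Cons)
    next
      case Nil
      then obtain Ys' K where Y: "Ys = Ys' @ [K]" using ne Us by (cases Ys rule: rev_cases) auto
      obtain as' k where a: "as = as' @ [k]" "as' \<in> tuples Ys'" "k \<in> carrier K" "length as' = length Ys'"
        using v(2) unfolding Y by (rule tuples_middleE) auto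
      have cs: "cs = []" using v(4) Nil by simp
      note inner = insertion_unit_left[OF a(4), of K k b]
      show ?thesis
      proof (cases Zs)
        case Zs: Nil
        have ps: "ps = []" using ps Zs by simp
        have "length (ms @ as') = length (Xs @ Ys')" using tuples_length[OF ms] a(4) by simp
        from insertion_unit_left[OF this, of K k b] show ?thesis
          using inner zero by (simp add: v(1) Us Nil Y a(1) cs Zs ps)
      next
        \<comment> \<open>Here phi(1) acts by \<open>lbar\<close> on \<open>k\<close> on one side
          and by \<open>lact\<close> on \<open>p\<close> on the other.\<close>
        case Zs: (Cons Z Zs')
        then obtain p ps' where p: "ps = p # ps'" "p \<in> carrier Z" "ps' \<in> tuples Zs'" using ps by (auto elim: tuples_ConsE)
        show ?thesis
          using insertion_unit_right[OF l, of Z Zs' b p ps'] inner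
            rels_balanced[OF tuples_appendI[OF ms a(2)] p(3) a(3) p(2), of "end_dec b 1"]
          by (simp add: v(1) Us Nil Y a(1) cs Zs p(1))
      qed
    qed
  qed
qed

lemma lasc_nested_times:
  assumes bim: "bimods (Xs :: ('r, 'u) bimod list)" "bimods Ys" "bimods Us" "bimods Vs" "bimods Zs"
  shows "assoc Xs (Ys @ Us @ Vs) Zs
      \<cdot> times_map (map bimod_id Xs @ assoc Ys Us Vs # map bimod_id Zs)
    = assoc (Xs @ Ys) Us (Vs @ Zs) \<cdot> assoc Xs (Ys @ timesR Us # Vs) Zs"
proof -
  have N: "bimods (Ys @ Us @ Vs)" and N': "bimods (Ys @ timesR Us # Vs)" and XY: "bimods (Xs @ Ys)" and VZ: "bimods (Vs @ Zs)"
    using bim bimodule_timesR[OF bim(3)] by auto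
  note l = lasc_Hom_times[OF bim(2-4)]
  let ?fs = "map bimod_id Xs @ assoc Ys Us Vs # map bimod_id Zs"
  have fs: "\<forall>f\<in>set ?fs. f \<in> Arr bimod_moncat"
    using Hom_Arr[OF l] bim by (auto simp del: bimod_moncat_simps intro: bimod_id_Arr)
  have d: "map bdom ?fs = Xs @ timesR (Ys @ timesR Us # Vs) # Zs" "map bcod ?fs = Xs @ timesR (Ys @ Us @ Vs) # Zs"
    using bimod_HomD(3,4)[OF l] by (simp_all add: map_idI)
  note A = times_map_Hom[OF fs, unfolded d] and B = lasc_Hom_times[OF bim(1) N bim(5)]
    and C = lasc_Hom_times[OF bim(1) N' bim(5)] and D = lasc_Hom_times[OF XY bim(3) VZ]
  show ?thesis
  proof (cases "Ys @ Us @ Vs = []")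
    case True
    \<comment> \<open>The inner associator is the identity, and on the other side a single nested
      factor is left in place; both composites are the unitor for \<open>Xs\<close> and
      \<open>Zs\<close>.\<close>
    then have e: "Ys = []" "Us = []" "Vs = []" by auto
    have E: "bimodule End" by (rule bimodule_timesR) simp
    have "times_map ?fs = times_map (map bimod_id (Xs @ timesR [] # Zs))" by (simp add: e lasc_Nil)
    also have "\<dots> = bimod_id (timesR (Xs @ timesR [] # Zs))"
      by (rule times_map_id) (use bim E in auto)
    finally show ?thesis by (simp add: e lasc_single[OF bim(1) E bim(5)])
  next
    case False
    let ?L = "Xs @ timesR (Ys @ timesR Us # Vs) # Zs" and ?T = "Xs @ Ys @ Us @ Vs @ Zs"
      and ?M1 = "Xs @ timesR (Ys @ Us @ Vs) # Zs" and ?M2 = "Xs @ Ys @ timesR Us # Vs @ Zs"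
    have L: "bimods ?L" and T: "bimods ?T" using bim bimodule_timesR[OF N'] by auto
    have ne: "?L \<noteq> []" "?T \<noteq> []" "?fs \<noteq> []" "Ys @ timesR Us # Vs \<noteq> []" "Xs @ (Ys @ Us @ Vs) @ Zs \<noteq> []"
      "Xs @ (Ys @ timesR Us # Vs) @ Zs \<noteq> []" "(Xs @ Ys) @ Us @ (Vs @ Zs) \<noteq> []" using False by auto
    note R = diff_closed_rels[OF T]
    note tA = transports_map[OF fs ne(3), unfolded d] and tB = transports_insertion[OF bim(1) N bim(5) ne(5), simplified]
      and tC = transports_insertion[OF bim(1) N' bim(5) ne(6), simplified] and tD = transports_insertion[OF XY bim(3) VZ ne(7), simplified]
      and tl = transports_insertion[OF bim(2-4) False]
    have "frag_extend (insertion Xs (Ys @ Us @ Vs) Zs) (frag_of (map2 bfun ?fs t))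
        - frag_extend (insertion (Xs @ Ys) Us (Vs @ Zs)) (insertion Xs (Ys @ timesR Us # Vs) Zs t) \<in> rels ?T"
      if "t \<in> tuples ?L" for t
    proof -
      obtain ms y ps where t: "t = ms @ y # ps" "ms \<in> tuples Xs" "y \<in> carrier (timesR (Ys @ timesR Us # Vs))"
        "ps \<in> tuples Zs" "length ms = length Xs"
        using \<open>t \<in> tuples ?L\<close> by (rule tuples_middleE)
      define e where "e = times_rep (Ys @ timesR Us # Vs) y"
      have e: "e \<in> takeuchi (Ys @ timesR Us # Vs)" "times_of (Ys @ timesR Us # Vs) e = y"
        unfolding e_def by (rule times_rep_closed[OF N' ne(4) t(3)], rule times_of_rep[OF N' ne(4) t(3)])
      note e' = transports_takeuchi[OF tl e(1)]
      have y': "bfun (assoc Ys Us Vs) y = times_of (Ys @ Us @ Vs) (frag_extend (insertion Ys Us Vs) e)"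
        using lasc_arrow(2)[OF bim(2-4) False e(1)] e(2) by simp
      have m: "map2 bfun ?fs t = ms @ times_of (Ys @ Us @ Vs) (frag_extend (insertion Ys Us Vs) e) # ps"
        using t(5) tuples_length[OF t(4)] y' map2_bfun_id[OF t(2)] map2_bfun_id[OF t(4)] by (simp add: t(1))
      have 1: "insertion Xs (Ys @ Us @ Vs) Zs (map2 bfun ?fs t)
          - frag_extend (\<lambda>w. frag_of (ms @ w @ ps)) (frag_extend (insertion Ys Us Vs) e) \<in> rels ?T"
        unfolding m using insertion_times_of[OF bim(1) N bim(5) False t(2,4) e'] by simp
      have 2: "frag_extend (insertion (Xs @ Ys) Us (Vs @ Zs)) (insertion Xs (Ys @ timesR Us # Vs) Zs t)
          = frag_extend (\<lambda>v. insertion (Xs @ Ys) Us (Vs @ Zs) (ms @ v @ ps)) e"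
        unfolding t(1) insertion_flatten[OF ne(4) t(5)] e_def[symmetric] frag_extend_compose frag_extend_of ..
      have 3: "frag_extend (\<lambda>w. frag_of (ms @ w @ ps)) (frag_extend (insertion Ys Us Vs) e)
          - frag_extend (\<lambda>v. insertion (Xs @ Ys) Us (Vs @ Zs) (ms @ v @ ps)) e \<in> rels ?T"
        unfolding frag_extend_compose
        by (rule frag_extend_cong_mod[OF R insertion_context[OF bim False t(2,4)]]) (use takeuchiD(1)[OF e(1)] in auto)
      show ?thesis unfolding frag_extend_of 2 by (rule mod_trans[OF R 1 3])
    qed
    note tuple = this
    show ?thesis
    proof (rule times_eqI[OF L ne(1), of _ "timesR ?T"])
      show "assoc Xs (Ys @ Us @ Vs) Zs \<cdot> times_map ?fs \<in> bimod_Hom (timesR ?L) (timesR ?T)"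
        using comp_Hom[OF A B] by simp
      show "assoc (Xs @ Ys) Us (Vs @ Zs) \<cdot> assoc Xs (Ys @ timesR Us # Vs) Zs
          \<in> bimod_Hom (timesR ?L) (timesR ?T)"
        using comp_Hom[of _ "timesR ?L" "timesR ?M2" _ "timesR ?T"] C D by simp
      fix c assume c: "c \<in> takeuchi ?L"
      note cA = transports_takeuchi[OF tA c] and cC = transports_takeuchi[OF tC c]
      have "times_of ?T (frag_extend (insertion Xs (Ys @ Us @ Vs) Zs) (frag_extend (\<lambda>t. frag_of (map2 bfun ?fs t)) c))
        = times_of ?T (frag_extend (insertion (Xs @ Ys) Us (Vs @ Zs)) (frag_extend (insertion Xs (Ys @ timesR Us # Vs) Zs) c))"
        using transports_takeuchi[OF tB cA] transports_takeuchi[OF tD cC]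
        unfolding frag_extend_compose
        by (rule times_of_eqI[OF T ne(2) _ _ takeuchiD(1)[OF c]]) (rule tuple)
      then show "bfun (assoc Xs (Ys @ Us @ Vs) Zs \<cdot> times_map ?fs) (times_of ?L c)
        = bfun (assoc (Xs @ Ys) Us (Vs @ Zs) \<cdot> assoc Xs (Ys @ timesR Us # Vs) Zs) (times_of ?L c)"
        using times_map_times_of[OF fs ne(3), unfolded d, OF c] lasc_arrow(2)[OF bim(1) N bim(5) ne(5) cA]
          lasc_arrow(2)[OF bim(1) N' bim(5) ne(6) c] lasc_arrow(2)[OF XY bim(3) VZ ne(7), of "frag_extend (insertion Xs (Ys @ timesR Us # Vs) Zs) c"]
          cC times_of_closed[OF L ne(1) c] bimod_HomD(3)[OF A] bimod_HomD(3)[OF C]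
        by simp
    qed
  qed
qed


text \<open>Intermediate lists are tied together by equations, because the two routes bracket the
  same appended lists differently and each associator is known only for its own bracketing.\<close>

lemma lasc_comp_eqI:
  assumes bim: "bimods (As :: ('r, 'u) bimod list)" "bimods Bs" "bimods Cs" "bimods As'" "bimods Bs'" "bimods Cs'"
    "bimods Ds" "bimods Es" "bimods Fs" "bimods Ds'" "bimods Es'" "bimods Fs'"
    and L: "Ds @ timesR Es # Fs = L" "Ds' @ timesR Es' # Fs' = L"
    and M: "Ds @ Es @ Fs = As @ timesR Bs # Cs" "Ds' @ Es' @ Fs' = As' @ timesR Bs' # Cs'"
    and T: "As @ Bs @ Cs = T" "As' @ Bs' @ Cs' = T" "T \<noteq> []"
    and tuple: "\<And>t. t \<in> tuples L \<Longrightarrow> frag_extend (insertion As Bs Cs) (insertion Ds Es Fs t)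
      - frag_extend (insertion As' Bs' Cs') (insertion Ds' Es' Fs' t) \<in> rels T"
  shows "assoc As Bs Cs \<cdot> assoc Ds Es Fs
    = assoc As' Bs' Cs' \<cdot> assoc Ds' Es' Fs'"
proof -
  have bL: "bimods L" "L \<noteq> []" using bim(7-9) bimodule_timesR[OF bim(8)] by (auto simp: L(1)[symmetric])
  have bT: "bimods T" using bim(1-3) by (auto simp: T(1)[symmetric])
  have ne: "As @ Bs @ Cs \<noteq> []" "As' @ Bs' @ Cs' \<noteq> []" "Ds @ Es @ Fs \<noteq> []" "Ds' @ Es' @ Fs' \<noteq> []"
    using T M by auto
  note A = lasc_Hom_times[OF bim(7-9), unfolded L M] and B = lasc_Hom_times[OF bim(1-3), unfolded T]
    and A' = lasc_Hom_times[OF bim(10-12), unfolded L M] and B' = lasc_Hom_times[OF bim(4-6), unfolded T]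
  show ?thesis
  proof (rule times_eqI[OF bL comp_Hom[OF A B] comp_Hom[OF A' B']])
    fix c assume c: "c \<in> takeuchi L"
    note c1 = transports_takeuchi[OF transports_insertion[OF bim(7-9) ne(3), unfolded L M] c]
      and c2 = transports_takeuchi[OF transports_insertion[OF bim(10-12) ne(4), unfolded L M] c]
    note v = lasc_arrow(2)[OF bim(7-9) ne(3), unfolded L M, OF c] lasc_arrow(2)[OF bim(10-12) ne(4), unfolded L M, OF c]
      lasc_arrow(2)[OF bim(1-3) ne(1), unfolded T, OF c1] lasc_arrow(2)[OF bim(4-6) ne(2), unfolded T, OF c2]
    have "times_of T (frag_extend (insertion As Bs Cs) (frag_extend (insertion Ds Es Fs) c))
      = times_of T (frag_extend (insertion As' Bs' Cs') (frag_extend (insertion Ds' Es' Fs') c))"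
      using transports_takeuchi[OF transports_insertion[OF bim(1-3) ne(1), unfolded T] c1]
        transports_takeuchi[OF transports_insertion[OF bim(4-6) ne(2), unfolded T] c2]
      unfolding frag_extend_compose
      by (rule times_of_eqI[OF bT T(3) _ _ takeuchiD(1)[OF c]]) (rule tuple)
    then show "bfun (assoc As Bs Cs \<cdot> assoc Ds Es Fs) (times_of L c)
      = bfun (assoc As' Bs' Cs' \<cdot> assoc Ds' Es' Fs') (times_of L c)"
      using v times_of_closed[OF bL c] bimod_HomD(3)[OF A] bimod_HomD(3)[OF A'] by simp
  qed
qed

text \<open>Operations at separated positions commute, by Fubini when both flatten. The delicate
  cases have nothing between the two positions, so that a contraction acts on the other nested
  product; agreement then comes from computing this action at an inner end slot, or from
  associativity of two successive scalar actions. The case with no other factor at all is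
  \<open>lasc_end_end\<close>.\<close>

lemma insertion_parallel:
  assumes bim: "bimods (Xs :: ('r, 'u) bimod list)" "bimods Ys" "bimods Zs" "bimods Us" "bimods Vs"
    and ne: "Xs @ Ys @ Zs @ Us @ Vs \<noteq> []"
    and t: "t \<in> tuples (Xs @ timesR Ys # Zs @ timesR Us # Vs)"
  shows "frag_extend (insertion (Xs @ Ys @ Zs) Us Vs) (insertion Xs Ys (Zs @ timesR Us # Vs) t)
    - frag_extend (insertion Xs Ys (Zs @ Us @ Vs)) (insertion (Xs @ timesR Ys # Zs) Us Vs t)
    \<in> rels (Xs @ Ys @ Zs @ Us @ Vs)"
    (is "?l - ?r \<in> rels ?T")
proof -
  have T: "bimods ?T" using bim by auto
  note R = diff_closed_rels[OF T]
  note zero = diff_closedD(1)[OF R]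
  have same: ?thesis if "?l = ?r" using that zero by simp
  obtain ms y t' where t1: "t = ms @ y # t'" "ms \<in> tuples Xs" "y \<in> carrier (timesR Ys)"
      "t' \<in> tuples (Zs @ timesR Us # Vs)" "length ms = length Xs"
    using t by (rule tuples_middleE)
  obtain ps w qs where t2: "t' = ps @ w # qs" "ps \<in> tuples Zs" "w \<in> carrier (timesR Us)"
      "qs \<in> tuples Vs" "length ps = length Zs"
    using t1(4) by (rule tuples_middleE)
  note t = t1(1)[unfolded t2(1)] and ms = t1(2,5) and y = t1(3) and ps = t2(2,5) and w = t2(3) and qs = t2(4)
  have assoc: "ms @ y # ps @ v = (ms @ y # ps) @ v" for v by simp
  have lmy: "length (ms @ y # ps) = length (Xs @ timesR Ys # Zs)" using ms ps by simp
  show ?thesis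
  proof (cases "Ys = []"; cases "Us = []")
    assume Ys: "Ys \<noteq> []" and Us: "Us \<noteq> []"
    note rep = takeuchiD(1)[OF times_rep_closed[OF bim(2) Ys y]]
    have "?l = frag_extend (\<lambda>u. insertion (Xs @ Ys @ Zs) Us Vs ((ms @ u @ ps) @ w # qs)) (times_rep Ys y)"
      unfolding t insertion_flatten[OF Ys ms(2)] frag_extend_compose frag_extend_of by simp
    also have "\<dots> = frag_extend (\<lambda>u. frag_extend (\<lambda>v. frag_of ((ms @ u @ ps) @ v @ qs)) (times_rep Us w)) (times_rep Ys y)"
      using rep ms ps by (intro frag_extend_eq insertion_flatten[OF Us]) (auto dest!: subsetD tuples_length)
    also have "\<dots> = frag_extend (\<lambda>v. frag_extend (\<lambda>u. frag_of ((ms @ u @ ps) @ v @ qs)) (times_rep Ys y)) (times_rep Us w)"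
      by (rule frag_extend_swap)
    also have "\<dots> = ?r"
      unfolding t assoc insertion_flatten[OF Us lmy] frag_extend_compose frag_extend_of
      using insertion_flatten[OF Ys ms(2)] by simp
    finally show ?thesis by (rule same)
  next
    assume Ys: "Ys = []" and Us: "Us \<noteq> []"
    show ?thesis
    proof (cases Zs)
      case (Cons Z Zs')
      then obtain p ps' where p: "ps = p # ps'" using ps by (auto elim: tuples_ConsE)
      let ?p = "lact Z (end_dec y 1) p"
      have l: "length (ms @ ?p # ps') = length (Xs @ Z # Zs')" using ms ps p Cons by simp
      show ?thesis
      proof (rule same)
        have "?l = insertion (Xs @ Zs) Us Vs ((ms @ ?p # ps') @ w # qs)"
          unfolding t Ys Cons p using insertion_unit_right[OF ms(2), of Z "Zs' @ timesR Us # Vs" y p "ps' @ w # qs"] by simp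
        also have "\<dots> = frag_extend (\<lambda>v. frag_of ((ms @ ?p # ps') @ v @ qs)) (times_rep Us w)"
          using insertion_flatten[OF Us l] Cons by simp
        also have "\<dots> = ?r"
          unfolding t Ys Cons p assoc[unfolded p] insertion_flatten[OF Us lmy[unfolded Ys Cons p]] frag_extend_compose frag_extend_of
          using insertion_unit_right[OF ms(2), of Z "Zs' @ Us @ Vs" y p] by simp
        finally show "?l = ?r" .
      qed
    next
      \<comment> \<open>On one route phi(1) multiplies the nested element before it is unpacked, on
        the other it multiplies the first inner entry; these agree up to the choice of
        representative.\<close>
      case Zs: Nil
      then have p: "ps = []" using ps by simp
      obtain U Us' where U: "Us = U # Us'" using Us by (cases Us) auto
      define e where "e = times_rep Us w"
      have e: "e \<in> takeuchi Us" "times_of Us e = w"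
        unfolding e_def by (rule times_rep_closed[OF bim(4) Us w], rule times_of_rep[OF bim(4) Us w])
      let ?e = "apply_slot 0 (\<lambda>m. lact (Us ! 0) (end_dec y 1) m) e"
      have "?l = insertion Xs Us Vs (ms @ times_of Us ?e # qs)"
        unfolding times_of_act(1)[OF bim(4) Us e(1), symmetric] e(2)
        unfolding t Ys Zs p using insertion_unit_right[OF ms(2), of "timesR Us" Vs y w qs] by simp
      moreover have "?r = frag_extend (\<lambda>v. frag_of (ms @ v @ qs)) ?e"
      proof -
        have "?r = frag_extend (\<lambda>v. insertion Xs [] (Us @ Vs) (ms @ y # v @ qs)) e"
          unfolding t Ys Zs p assoc[unfolded p] insertion_flatten[OF Us lmy[unfolded Ys Zs p]] frag_extend_compose frag_extend_of e_def
          by simp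
        also have "\<dots> = frag_extend (\<lambda>v. frag_of (ms @ v @ qs)) ?e"
          unfolding frag_extend_apply_slot
        proof (rule frag_extend_eq)
          fix v assume "v \<in> Poly_Mapping.keys e"
          then have "v \<in> tuples (U # Us')" using takeuchiD(1)[OF e(1)] U by auto
          then obtain x v' where "v = x # v'" by (rule tuples_ConsE)
          then show "insertion Xs [] (Us @ Vs) (ms @ y # v @ qs) = frag_of (ms @ v[0 := lact (Us ! 0) (end_dec y 1) (v ! 0)] @ qs)"
            using insertion_unit_right[OF ms(2), of U "Us' @ Vs" y x "v' @ qs"] U by simp
        qed
        finally show ?thesis .
      qed
      ultimately show ?thesis
        using insertion_times_of[OF bim(1,4,5) Us ms(1) qs takeuchi_slot_actions(1)[OF bim(4) Us e(1)]] Ys Zs by simp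
    qed
  next
    assume Ys: "Ys \<noteq> []" and Us: "Us = []"
    note rep = takeuchiD(1)[OF times_rep_closed[OF bim(2) Ys y]]
    have l1: "?l = frag_extend (\<lambda>u. insertion (Xs @ Ys @ Zs) [] Vs ((ms @ u @ ps) @ w # qs)) (times_rep Ys y)"
      unfolding t Us insertion_flatten[OF Ys ms(2)] frag_extend_compose frag_extend_of by simp
    have len: "length (ms @ u @ ps) = length (Xs @ Ys @ Zs)" if "u \<in> Poly_Mapping.keys (times_rep Ys y)" for u
      using rep ms ps that by (auto dest!: subsetD tuples_length)
    show ?thesis
    proof (cases Vs)
      case (Cons V Vs')
      then obtain q qs' where q: "qs = q # qs'" using qs by (auto elim: tuples_ConsE)
      show ?thesis
      proof (rule same)
        have "?l = frag_extend (\<lambda>u. frag_of ((ms @ u @ ps) @ lact V (end_dec w 1) q # qs')) (times_rep Ys y)"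
          unfolding l1 unfolding Cons q by (rule frag_extend_eq, rule insertion_unit_right, rule len)
        also have "\<dots> = ?r"
          using insertion_unit_right[OF lmy, of V Vs' w q qs']
            insertion_flatten[OF Ys ms(2), of "Zs @ Vs" y "ps @ lact V (end_dec w 1) q # qs'"]
          by (simp add: t Us Cons q)
        finally show "?l = ?r" .
      qed
    next
      case Vs: Nil
      then have q: "qs = []" using qs by simp
      show ?thesis
      proof (cases Zs rule: rev_cases)
        case (snoc Zs' Z)
        obtain p ps' where p: "ps = ps' @ [p]"
          using ps(1)[unfolded snoc] by (rule tuples_middleE) auto
        have l': "length (ms @ u @ ps') = length (Xs @ Ys @ Zs')" if "u \<in> Poly_Mapping.keys (times_rep Ys y)" for u
          using len[OF that] snoc p by simp
        have lmy': "length (ms @ y # ps') = length (Xs @ timesR Ys # Zs')" using lmy snoc p by simp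
        show ?thesis
        proof (rule same)
          have "?l = frag_extend (\<lambda>u. frag_of ((ms @ u @ ps') @ [lbar Z (end_dec w 1) p])) (times_rep Ys y)"
            unfolding l1 unfolding Vs q
          proof (rule frag_extend_eq)
            fix u assume "u \<in> Poly_Mapping.keys (times_rep Ys y)"
            from insertion_unit_left[OF l'[OF this], of Z p w]
            show "insertion (Xs @ Ys @ Zs) [] [] ((ms @ u @ ps) @ [w]) = frag_of ((ms @ u @ ps') @ [lbar Z (end_dec w 1) p])"
              by (simp add: snoc p)
          qed
          also have "\<dots> = ?r"
            using insertion_unit_left[OF lmy', of Z p w]
              insertion_flatten[OF Ys ms(2), of Zs y "ps' @ [lbar Z (end_dec w 1) p]"]
            by (simp add: t Us Vs snoc p q)
          finally show "?l = ?r" .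
        qed
      next
        \<comment> \<open>The mirror case: psi stands in last position and acts through the opposite
          ring, on the nested element or on its last inner entry.\<close>
        case Zs: Nil
        then have p: "ps = []" using ps by simp
        obtain Ys' K where K: "Ys = Ys' @ [K]" using Ys by (cases Ys rule: rev_cases) auto
        define e where "e = times_rep Ys y"
        have e: "e \<in> takeuchi Ys" "times_of Ys e = y"
          unfolding e_def by (rule times_rep_closed[OF bim(2) Ys y], rule times_of_rep[OF bim(2) Ys y])
        let ?e = "apply_slot (length Ys - 1) (\<lambda>m. lbar (Ys ! (length Ys - 1)) (end_dec w 1) m) e"
        have "?r = insertion Xs Ys [] (ms @ times_of Ys ?e # [])"
          unfolding times_of_act(3)[OF bim(2) Ys e(1), symmetric] e(2)
          unfolding t Us Zs Vs p q using insertion_unit_left[OF ms(2), of "timesR Ys" y w] by simp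
        moreover have "?l = frag_extend (\<lambda>v. frag_of (ms @ v @ [])) ?e"
          unfolding l1 unfolding Zs Vs p q e_def[symmetric] frag_extend_apply_slot
        proof (rule frag_extend_eq)
          fix v assume "v \<in> Poly_Mapping.keys e"
          then have v: "v \<in> tuples (Ys' @ [K])" using takeuchiD(1)[OF e(1)] K by auto
          then obtain x v' where x: "v = v' @ [x]" "length v' = length Ys'" by (rule tuples_middleE) auto
          then show "insertion (Xs @ Ys @ []) [] [] ((ms @ v @ []) @ [w])
              = frag_of (ms @ v[length Ys - 1 := lbar (Ys ! (length Ys - 1)) (end_dec w 1) (v ! (length Ys - 1))] @ [])"
            using insertion_unit_left[of "ms @ v'" "Xs @ Ys'" K x w] K ms(2) by (simp add: nth_append list_update_append)
        qed
        moreover have "insertion Xs Ys Vs (ms @ times_of Ys ?e # qs) - frag_extend (\<lambda>v. frag_of (ms @ v @ qs)) ?e \<in> rels (Xs @ Ys @ Vs)"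
          by (rule insertion_times_of[OF bim(1,2,5) Ys ms(1) qs takeuchi_slot_actions(3)[OF bim(2) Ys e(1)]])
        ultimately have "?r - ?l \<in> rels ?T" by (simp only: Zs Us Vs q append_Nil append_Nil2)
        then show ?thesis by (rule mod_sym[OF R])
      qed
    qed
  next
    assume Ys: "Ys = []" and Us: "Us = []"
    have y: "y \<in> carrier End" and w: "w \<in> carrier End"
      using y w Ys Us by simp_all
    show ?thesis
    proof (cases Zs)
      case (Cons Z Zs')
      then obtain p ps' where p: "ps = p # ps'" "p \<in> carrier Z" "length ps' = length Zs'" using ps by (auto elim: tuples_ConsE)
      interpret Z: bimodule Z using bim(3) Cons by simp
      let ?p = "lact Z (end_dec y 1) p"
      have l: "length (ms @ ?p # ps') = length (Xs @ Z # Zs')" using ms ps p Cons by simp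
      have L: "?l = insertion (Xs @ Zs) [] Vs ((ms @ ?p # ps') @ w # qs)"
        unfolding t Ys Us Cons p(1) using insertion_unit_right[OF ms(2), of Z "Zs' @ timesR Us # Vs" y p "ps' @ w # qs"] Us by simp
      show ?thesis
      proof (cases Vs)
        case V: (Cons V Vs')
        then obtain q qs' where q: "qs = q # qs'" using qs by (auto elim: tuples_ConsE)
        show ?thesis
        proof (rule same)
          show "?l = ?r"
            using insertion_unit_right[OF l, of V Vs' w q qs'] insertion_unit_right[OF lmy, of V Vs' w q qs']
              insertion_unit_right[OF ms(2), of Z "Zs' @ Vs" y p "ps' @ lact V (end_dec w 1) q # qs'"]
            by (simp add: L) (simp add: t Ys Us Cons V p q)
        qed
      next
        case V: Nil
        then have q: "qs = []" using qs by simp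
        show ?thesis
        proof (cases Zs' rule: rev_cases)
          case Nil
          then have e: "ps' = []" using p(3) by simp
          show ?thesis
          proof (rule same)
            show "?l = ?r"
              using insertion_unit_left[OF ms(2), of Z ?p w] insertion_unit_left[of "ms @ [y]" "Xs @ [timesR []]" Z p w]
                insertion_unit_right[OF ms(2), of Z "[]" y "lbar Z (end_dec w 1) p" "[]"] p(2) ms(2)
              by (simp only: L) (simp add: t Ys Us Cons V p(1) q Nil e Z.commuting)
          qed
        next
          case (snoc Zm K)
          then obtain pm k where k: "ps' = pm @ [k]" "length pm = length Zm" using p(3) by (cases ps' rule: rev_cases) auto
          show ?thesis
          proof (rule same)
            show "?l = ?r"
              using insertion_unit_left[of "ms @ ?p # pm" "Xs @ Z # Zm" K k w]
                insertion_unit_left[of "ms @ y # p # pm" "Xs @ timesR [] # Z # Zm" K k w]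
                insertion_unit_right[OF ms(2), of Z "Zm @ [K]" y p "pm @ [lbar K (end_dec w 1) k]"] ms(2) k
              by (simp add: L) (simp add: t Ys Us Cons V p q snoc)
          qed
        qed
      qed
    next
      \<comment> \<open>Two adjacent copies of End(R) with another factor present: whichever is
        contracted first, the remaining factor is acted on by phi(1) psi(1), as evaluation at 1
        respects the actions on End(R).\<close>
      case Zs: Nil
      then have p: "ps = []" using ps by simp
      have L: "?l = insertion Xs [] Vs (ms @ lact (timesR []) (end_dec y (1 :: 'r)) w # qs)"
        unfolding t Ys Us Zs p using insertion_unit_right[OF ms(2), of "timesR []" Vs y w qs] by simp
      show ?thesis
      proof (cases Vs)
        case V: (Cons V Vs')
        then obtain q qs' where q: "qs = q # qs'" "q \<in> carrier V" using qs by (auto elim: tuples_ConsE)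
        interpret V: bimodule V using bim(5) V by simp
        show ?thesis
        proof (rule same)
          show "?l = ?r"
            using insertion_unit_right[OF ms(2), of V Vs' "lact (timesR []) (end_dec y (1 :: 'r)) w" q qs']
              insertion_unit_right[of "ms @ [y]" "Xs @ [timesR []]" V Vs' w q qs']
              insertion_unit_right[OF ms(2), of V Vs' y "lact V (end_dec w 1) q" qs'] ms(2)
            by (simp add: L) (simp add: t Ys Us Zs V p q end_dec_simps[OF w] V.act_mult)
        qed
      next
        case V: Nil
        then have q: "qs = []" using qs by simp
        obtain As X where X: "Xs = As @ [X]" using ne Ys Us Zs V by (cases Xs rule: rev_cases) auto
        obtain as m where m: "ms = as @ [m]" "length as = length As"
          using ms(1)[unfolded X] by (rule tuples_middleE) auto
        show ?thesis
        proof (rule same)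
          show "?l = ?r"
            using insertion_unit_left[OF m(2), of X m "lact (timesR []) (end_dec y (1 :: 'r)) w"]
              insertion_unit_left[OF ms(2), of "timesR []" y w]
              insertion_unit_left[OF m(2), of X m "lbar (timesR []) (end_dec w (1 :: 'r)) y"]
            by (simp add: L) (simp add: t Ys Us Zs V p q X m end_dec_simps[OF w] end_dec_simps[OF y])
        qed
      qed
    qed
  qed
qed

lemma end_enc_dec:
  "y \<in> carrier End \<Longrightarrow> end_enc (end_dec y :: 'r \<Rightarrow> 'r) = y"
  using dec_enc[OF end_raw_embeds] small_simps(1)[OF end_raw_embeds]
  by (auto simp: timesR.simps(1) end_dec_def end_enc_def)

text \<open>The Takeuchi condition exchanges \<open>\<phi>(x)\<close> and \<open>\<psi>(x)\<close>, hence the two contractions of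
  \<open>End(R) \<times> End(R)\<close> agree.\<close>

lemma takeuchi_end:
  assumes c: "c \<in> takeuchi [End, timesR []]"
  shows "evaluate ring_group (\<lambda>t. end_dec (t ! 0) 1 * end_dec (t ! 1) x) c
    = evaluate ring_group (\<lambda>t. end_dec (t ! 0) x * end_dec (t ! 1) (1 :: 'r)) c"
proof -
  let ?E = "End"
  let ?f = "\<lambda>t. end_dec (t ! 0) 1 * (end_dec (t ! 1) 1 :: 'r)"
  interpret G: comm_group "ring_group :: 'r monoid" by (rule comm_group_ring_group)
  have E: "bimods [?E, ?E]" using bimodule_timesR[of "[]"] by simp
  have inv: "inv\<^bsub>ring_group\<^esub> a = - a" for a :: 'r
    by (rule G.inv_equality) simp_all
  have diff: "evaluate ring_group h (c - d) = evaluate ring_group h c - (evaluate ring_group h d :: 'r)" for h :: "'x \<Rightarrow> 'r" and c d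
    using G.evaluate_diff[of h UNIV c d] by (simp add: inv)
  have ext: "evaluate ring_group h (frag_extend f c) = (evaluate ring_group (\<lambda>t. evaluate ring_group h (f t)) c :: 'r)"
    for h :: "'x \<Rightarrow> 'r" and f :: "'y \<Rightarrow> _" and c
    by (rule G.evaluate_frag_extend[of _ UNIV UNIV]) simp_all
  \<comment> \<open>\<open>balanced_on\<close> takes formal sums as values, so a function with
    values in R is encoded by one-term sums, read modulo the kernel of evaluation in R.\<close>
  let ?H = "{d :: 'r \<Rightarrow>\<^sub>0 int. evaluate ring_group (\<lambda>a. a) d = (0 :: 'r)}"
  have H: "diff_closed ?H" by (auto simp: diff_closed_def diff)
  have "balanced_on [?E, ?E] ?H (\<lambda>t. frag_of (?f t))"
  proof (rule balanced_onI)
    fix Ms1 M Ms2 t u a b assume *: "[?E, ?E] = Ms1 @ M # Ms2" "t \<in> tuples Ms1" "u \<in> tuples Ms2" "a \<in> carrier M" "b \<in> carrier M"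
    then have "M = ?E \<and> (\<exists>k\<in>carrier ?E. t = [] \<and> u = [k] \<or> t = [k] \<and> u = [])"
      by (auto simp: Cons_eq_append_conv elim!: tuples_ConsE)
    then show "frag_of (?f (t @ (a \<otimes>\<^bsub>M\<^esub> b) # u)) - frag_of (?f (t @ a # u)) - frag_of (?f (t @ b # u)) \<in> ?H"
      using *(4,5) by (auto simp: diff end_dec_simps distrib_left distrib_right)
  next
    fix Ms1 M N Ms2 t u a b s
    assume "[?E, ?E] = Ms1 @ M # N # Ms2" "t \<in> tuples Ms1" "u \<in> tuples Ms2" "a \<in> carrier M" "b \<in> carrier N"
    then show "frag_of (?f (t @ lbar M s a # b # u)) - frag_of (?f (t @ a # lact N s b # u)) \<in> ?H"
      by (auto simp: Cons_eq_append_conv diff end_dec_simps algebra_simps)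
  qed
  \<comment> \<open>The function phi(1) psi(1) is balanced, so it can be applied to the Takeuchi
    condition for the scalar \<open>x\<close>; the right actions turn the values at 1 into phi(x) in
    one slot and psi(x) in the other.\<close>
  from frag_extend_rels[OF E H this takeuchiD(2)[OF c, of 0 x]]
  have "evaluate ring_group (\<lambda>a. a) (frag_extend (\<lambda>t. frag_of (?f t)) (apply_slot 0 (\<lambda>m. rbar ?E m x) c))
    = evaluate ring_group (\<lambda>a. a) (frag_extend (\<lambda>t. frag_of (?f t)) (apply_slot 1 (\<lambda>m. ract ?E m x) c))"
    by (simp add: frag_extend_diff diff)
  moreover have "evaluate ring_group (\<lambda>t. ?f (t[0 := rbar ?E (t ! 0) x])) c = evaluate ring_group (\<lambda>t. end_dec (t ! 0) x * end_dec (t ! 1) 1) c"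
    using takeuchiD(1)[OF c] by (intro G.evaluate_cong) (auto dest!: subsetD elim!: tuples_ConsE simp: end_dec_simps)
  moreover have "evaluate ring_group (\<lambda>t. ?f (t[1 := ract ?E (t ! 1) x])) c = evaluate ring_group (\<lambda>t. end_dec (t ! 0) 1 * end_dec (t ! 1) x) c"
    using takeuchiD(1)[OF c] by (intro G.evaluate_cong) (auto dest!: subsetD elim!: tuples_ConsE simp: end_dec_simps)
  ultimately show ?thesis
    unfolding frag_extend_apply_slot ext by simp
qed

text \<open>The case left out of \<open>insertion_parallel\<close>: both unitors end in End(R), as a
  product of one factor. The comparison is therefore one of values at each \<open>x\<close>, where
  \<open>takeuchi_end\<close> applies.\<close>

lemma lasc_end_end:
  "assoc [] [] [timesR []] = assoc [timesR []] [] ([] :: ('r, 'u) bimod list)"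
proof -
  let ?E = "End"
  have E: "bimodule ?E" by (rule bimodule_timesR) simp
  interpret E: bimodule ?E by (rule E)
  interpret G: comm_group "ring_group :: 'r monoid" by (rule comm_group_ring_group)
  have L: "bimods [?E, ?E]" and E1: "bimods [?E]" and N: "bimods ([] :: ('r, 'u) bimod list)" using E by simp_all
  note A = lasc_Hom_times[OF N N E1] and B = lasc_Hom_times[OF E1 N N]
  show ?thesis
  proof (rule times_eqI[OF L, of _ ?E])
    fix c assume c: "c \<in> takeuchi [?E, ?E]"
    note cs = takeuchiD(1)[OF c]
    have t: "t ! 0 \<in> carrier ?E" "t ! 1 \<in> carrier ?E" "t = [t ! 0, t ! 1]" if "t \<in> tuples [?E, ?E]" for t
      using that by (auto elim!: tuples_ConsE)
    \<comment> \<open>With the single factor End(R), \<open>times_of\<close> is summation in End(R),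
      and evaluation of endomorphisms at \<open>x\<close> is additive, so the value is a sum of
      values over the tuples.\<close>
    have val: "end_dec (times_of [?E] (frag_extend f c)) x = evaluate ring_group (\<lambda>t. end_dec (h t) x) c"
        "times_of [?E] (frag_extend f c) \<in> carrier ?E"
      if h: "\<And>t. t \<in> tuples [?E, ?E] \<Longrightarrow> f t = frag_of [h t] \<and> h t \<in> carrier ?E" for f h and x :: 'r
    proof -
      have hd: "hd \<in> tuples [?E] \<rightarrow> carrier ?E" and h': "h \<in> tuples [?E, ?E] \<rightarrow> carrier ?E"
        using h by (auto elim!: tuples_ConsE)
      have "times_of [?E] (frag_extend f c) = evaluate ?E (\<lambda>t. evaluate ?E hd (f t)) c"
        using E.evaluate_frag_extend[OF hd, of "tuples [?E, ?E]" f c] cs h by (simp add: times_of_def)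
      also have "\<dots> = evaluate ?E h c"
        using cs h by (intro E.evaluate_cong) (auto simp: subset_iff)
      finally have e: "times_of [?E] (frag_extend f c) = evaluate ?E h c" .
      have hom: "(\<lambda>y. end_dec y x) \<in> hom ?E (ring_group :: 'r monoid)"
        by (rule homI) (auto simp: end_dec_simps)
      show "end_dec (times_of [?E] (frag_extend f c)) x = evaluate ring_group (\<lambda>t. end_dec (h t) x) c"
        unfolding e by (rule G.evaluate_hom_comp[OF _ hom h']) (use cs E.comm_group_axioms in auto)
      show "times_of [?E] (frag_extend f c) \<in> carrier ?E"
        unfolding e using E.evaluate_closed[OF h'] cs by simp
    qed
    have l: "insertion [] [] [?E] t = frag_of [lact ?E (end_dec (t ! 0) 1) (t ! 1)]
        \<and> lact ?E (end_dec (t ! 0) 1) (t ! 1) \<in> carrier ?E"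
      and r: "insertion [?E] [] [] t = frag_of [lbar ?E (end_dec (t ! 1) 1) (t ! 0)]
        \<and> lbar ?E (end_dec (t ! 1) 1) (t ! 0) \<in> carrier ?E" if "t \<in> tuples [?E, ?E]" for t
      using insertion_unit_right[of "[]" "[]" ?E "[]" "t ! 0" "t ! 1" "[]"]
        insertion_unit_left[of "[]" "[]" ?E "t ! 0" "t ! 1"] t[OF that] by (simp_all add: E.closed)
    have L1: "end_dec (times_of [?E] (frag_extend (insertion [] [] [?E]) c)) x
        = evaluate ring_group (\<lambda>t. end_dec (lact ?E (end_dec (t ! 0) 1) (t ! 1)) x) c"
      "times_of [?E] (frag_extend (insertion [] [] [?E]) c) \<in> carrier ?E" for x :: 'r
      by (rule val; rule l; assumption)+
    have R1: "end_dec (times_of [?E] (frag_extend (insertion [?E] [] []) c)) x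
        = evaluate ring_group (\<lambda>t. end_dec (lbar ?E (end_dec (t ! 1) 1) (t ! 0)) x) c"
      "times_of [?E] (frag_extend (insertion [?E] [] []) c) \<in> carrier ?E" for x :: 'r
      by (rule val; rule r; assumption)+
    have "end_dec (times_of [?E] (frag_extend (insertion [] [] [?E]) c)) x
        = end_dec (times_of [?E] (frag_extend (insertion [?E] [] []) c)) x" for x :: 'r
    proof -
      have "evaluate ring_group (\<lambda>t. end_dec (lact ?E (end_dec (t ! 0) 1) (t ! 1)) x) c
        = evaluate ring_group (\<lambda>t. end_dec (t ! 0) 1 * end_dec (t ! 1) x) c"
        using cs t by (intro G.evaluate_cong) (auto simp: end_dec_simps subset_iff)
      moreover have "evaluate ring_group (\<lambda>t. end_dec (lbar ?E (end_dec (t ! 1) 1) (t ! 0)) x) c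
        = evaluate ring_group (\<lambda>t. end_dec (t ! 0) x * end_dec (t ! 1) 1) c"
        using cs t by (intro G.evaluate_cong) (auto simp: end_dec_simps subset_iff)
      ultimately show ?thesis unfolding L1(1) R1(1) using takeuchi_end[OF c, of x] by simp
    qed
    then have "(end_dec (times_of [?E] (frag_extend (insertion [] [] [?E]) c)) :: 'r \<Rightarrow> 'r)
        = end_dec (times_of [?E] (frag_extend (insertion [?E] [] []) c))" by (rule ext)
    from arg_cong[OF this, of "end_enc :: _ \<Rightarrow> 'u"]
    have "times_of [?E] (frag_extend (insertion [] [] [?E]) c) = times_of [?E] (frag_extend (insertion [?E] [] []) c)"
      unfolding end_enc_dec[OF L1(2)] end_enc_dec[OF R1(2)] .
    then show "bfun (assoc [] [] [?E]) (times_of [?E, ?E] c) = bfun (assoc [?E] [] []) (times_of [?E, ?E] c)"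
      using lasc_arrow(2)[OF N N E1, of c] lasc_arrow(2)[OF E1 N N, of c] c by simp
  qed (use A B in simp_all)
qed

lemma lasc_parallel_times:
  assumes bim: "bimods (Xs :: ('r, 'u) bimod list)" "bimods Ys" "bimods Zs" "bimods Us" "bimods Vs"
  shows "assoc (Xs @ Ys @ Zs) Us Vs \<cdot> assoc Xs Ys (Zs @ timesR Us # Vs)
    = assoc Xs Ys (Zs @ Us @ Vs) \<cdot> assoc (Xs @ timesR Ys # Zs) Us Vs"
proof (cases "Xs @ Ys @ Zs @ Us @ Vs = []")
  case True
  then show ?thesis by (simp add: lasc_end_end)
next
  case False
  show ?thesis
    by (rule lasc_comp_eqI[where L = "Xs @ timesR Ys # Zs @ timesR Us # Vs" and T = "Xs @ Ys @ Zs @ Us @ Vs"])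
      (use bim bimodule_timesR[OF bim(2)] bimodule_timesR[OF bim(4)] insertion_parallel[OF bim False] False in auto)
qed

lemma times_map_single:
  assumes f: "f \<in> bimod_Hom (M :: ('r, 'u) bimod) N"
  shows "times_map [f] = f"
proof -
  have A: "\<forall>f\<in>set [f]. f \<in> Arr bimod_moncat" using Hom_Arr[OF f] by simp
  note T = times_map_Hom[OF A]
  have d: "bdom f = M" "bcod f = N" using bimod_HomD[OF f] by simp_all
  show "times_map [f] = f"
  proof (rule arr_eqI[OF _ f])
    show "times_map [f] \<in> bimod_Hom M N" using T d by simp
    fix x assume x: "x \<in> carrier M"
    have c: "frag_of [x] \<in> takeuchi (map bdom [f])" using x d bimod_HomD(1)[OF f] by (simp add: takeuchi_single)
    interpret M: bimodule M using bimod_HomD(1)[OF f] .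
    interpret N: bimodule N using bimod_HomD(2)[OF f] .
    show "bfun (times_map [f]) x = bfun f x"
      using bimod_HomD(6)[OF f x] times_map_times_of[OF A _ c] x d by (simp add: times_of_def)
  qed
qed

lemma lax_monoidal_category_times: "lax_monoidal_category Bimod times_structure"
proof (intro lax_monoidal_category.intro lax_monoidal_category_axioms.intro category_bimod)
  fix n show "cat_functor (power_cat Bimod n) Bimod (lamO times_structure) (lamM times_structure)"
    using lam_functor_times by simp
next
  fix Xs Ys Zs :: "('r, 'u) bimod list" assume *: "set Xs \<subseteq> Obj Bimod" "set Ys \<subseteq> Obj Bimod" "set Zs \<subseteq> Obj Bimod"
  then have bim: "bimods Xs" "bimods Ys" "bimods Zs" by auto
  show "assoc Xs Ys Zs \<in> Hom Bimod (lamO times_structure (Xs @ [lamO times_structure Ys] @ Zs))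
      (lamO times_structure (Xs @ Ys @ Zs))"
    using lasc_Hom_times[OF bim] by simp
next
  fix fs gs hs :: "('r, 'u) bimod_arr list" assume *: "set fs \<subseteq> Arr Bimod" "set gs \<subseteq> Arr Bimod" "set hs \<subseteq> Arr Bimod"
  show "assoc (map (Cod Bimod) fs) (map (Cod Bimod) gs) (map (Cod Bimod) hs)
      \<cdot> lamM times_structure (fs @ [lamM times_structure gs] @ hs)
    = lamM times_structure (fs @ gs @ hs) \<cdot> assoc (map (Dom Bimod) fs) (map (Dom Bimod) gs) (map (Dom Bimod) hs)"
    using lasc_natural_times[of fs gs hs] * by (simp add: subset_iff)
next
  fix M assume "M \<in> Obj Bimod"
  then show "lunit times_structure M \<in> Hom Bimod M (lamO times_structure [M])"
    using bimod_id_Hom by simp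
next
  fix f M N assume f: "f \<in> Hom Bimod M N"
  then have f': "f \<in> bimod_Hom M N" by simp
  from times_map_single[OF f']
  show "lunit times_structure N \<cdot> f = lamM times_structure [f] \<cdot> lunit times_structure M"
    using category.Idn_left[OF category_bimod f] category.Idn_right[OF category_bimod f] by simp
next
  fix Ys :: "('r, 'u) bimod list" assume *: "set Ys \<subseteq> Obj Bimod"
  then have Ys: "bimods Ys" by auto
  show "assoc [] Ys [] \<cdot> lunit times_structure (lamO times_structure Ys) = Idn Bimod (lamO times_structure Ys)"
    using lasc_outer[OF Ys] category.Idn_left[OF category_bimod, of "bimod_id (timesR Ys)"] bimod_id_Hom[OF bimodule_timesR[OF Ys]]
    by simp
next
  fix Xs Zs :: "('r, 'u) bimod list" and M assume *: "set Xs \<subseteq> Obj Bimod" "M \<in> Obj Bimod" "set Zs \<subseteq> Obj Bimod"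
  then have bim: "bimods Xs" "bimodule M" "bimods Zs" and b: "bimods (Xs @ M # Zs)" by auto
  show "assoc Xs [M] Zs \<cdot> lamM times_structure (map (Idn Bimod) Xs @ [lunit times_structure M] @ map (Idn Bimod) Zs)
    = Idn Bimod (lamO times_structure (Xs @ [M] @ Zs))"
    using lasc_single[OF bim] times_map_id[OF b] category.Idn_left[OF category_bimod, of "bimod_id (timesR (Xs @ M # Zs))"]
      bimod_id_Hom[OF bimodule_timesR[OF b]]
    by simp
next
  fix Xs Ys Zs Us Vs :: "('r, 'u) bimod list"
  assume "set Xs \<subseteq> Obj Bimod" "set Ys \<subseteq> Obj Bimod" "set Zs \<subseteq> Obj Bimod" "set Us \<subseteq> Obj Bimod" "set Vs \<subseteq> Obj Bimod"
  then have bim: "bimods Xs" "bimods Ys" "bimods Zs" "bimods Us" "bimods Vs" by auto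
  show "assoc (Xs @ Ys @ Zs) Us Vs
      \<cdot> assoc Xs Ys (Zs @ [lamO times_structure Us] @ Vs)
    = assoc Xs Ys (Zs @ Us @ Vs) \<cdot> assoc (Xs @ [lamO times_structure Ys] @ Zs) Us Vs"
    using lasc_parallel_times[OF bim] by simp
next
  fix Xs Ys Us Vs Zs :: "('r, 'u) bimod list"
  assume "set Xs \<subseteq> Obj Bimod" "set Ys \<subseteq> Obj Bimod" "set Us \<subseteq> Obj Bimod" "set Vs \<subseteq> Obj Bimod" "set Zs \<subseteq> Obj Bimod"
  then have bim: "bimods Xs" "bimods Ys" "bimods Us" "bimods Vs" "bimods Zs" by auto
  show "assoc Xs (Ys @ Us @ Vs) Zs
      \<cdot> lamM times_structure (map (Idn Bimod) Xs @ [assoc Ys Us Vs] @ map (Idn Bimod) Zs)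
    = assoc (Xs @ Ys) Us (Vs @ Zs) \<cdot> assoc Xs (Ys @ [lamO times_structure Us] @ Vs) Zs"
    using lasc_nested_times[OF bim] by simp
qed

end

section \<open>The shuffle on formal sums and its descent to Takeuchi products\<close>

subsection \<open>The interchange maps\<close>

definition pures :: "('r, 'u) bimod list \<Rightarrow> ('r, 'u) bimod list \<Rightarrow> 'u list \<Rightarrow> 'u list \<Rightarrow> 'u list" where
  "pures Ms Ns t u = map (\<lambda>i. pure (Ms ! i) (Ns ! i) (t ! i) (u ! i)) [0..<length Ms]"

text \<open>The biadditive extension of the shuffle before passage to classes. Working with it
  separates the formal identities from the question of which relations it respects.\<close>

definition interchange :: "('r, 'u) bimod list \<Rightarrow> ('r, 'u) bimod list \<Rightarrow> ('u list \<Rightarrow>\<^sub>0 int) \<Rightarrow> ('u list \<Rightarrow>\<^sub>0 int)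
    \<Rightarrow> ('u list \<Rightarrow>\<^sub>0 int)" where
  "interchange Ms Ns c d = frag_extend (\<lambda>t. frag_extend (\<lambda>u. frag_of (pures Ms Ns t u)) d) c"

lemma pures_length [simp]: "length (pures Ms Ns t u) = length Ms"
  by (simp add: pures_def)

lemma pures_nth [simp]: "i < length Ms \<Longrightarrow> pures Ms Ns t u ! i = pure (Ms ! i) (Ns ! i) (t ! i) (u ! i)"
  by (simp add: pures_def)

lemma pures_Cons [simp]: "pures (M # Ms) (N # Ns) (m # t) (n # u) = pure M N m n # pures Ms Ns t u"
  by (rule nth_equalityI) (auto simp: nth_Cons split: nat.split)

lemma pures_Nil [simp]: "pures [] Ns t u = []"
  by (simp add: pures_def)

lemma pures_append:
  "length Ns = length Ms \<Longrightarrow> length t = length Ms \<Longrightarrow> length u = length Ms \<Longrightarrow>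
    pures (Ms @ Ms') (Ns @ Ns') (t @ t') (u @ u') = pures Ms Ns t u @ pures Ms' Ns' t' u'"
  by (rule nth_equalityI) (auto simp: nth_append)

lemma pures_update:
  "i < length Ms \<Longrightarrow> length t = length Ms \<Longrightarrow> pures Ms Ns (t[i := m]) u = (pures Ms Ns t u)[i := pure (Ms ! i) (Ns ! i) m (u ! i)]"
  "i < length Ms \<Longrightarrow> length u = length Ms \<Longrightarrow> pures Ms Ns t (u[i := n]) = (pures Ms Ns t u)[i := pure (Ms ! i) (Ns ! i) (t ! i) n]"
  by (auto intro!: nth_equalityI simp: nth_list_update)

text \<open>Shuffles are defined slot by slot, so indexed updates fit them better than split
  lists.\<close>

lemma balanced_on_nthI:
  assumes mult: "\<And>t i a b. t \<in> tuples Ms \<Longrightarrow> i < length Ms \<Longrightarrow> a \<in> carrier (Ms ! i) \<Longrightarrow> b \<in> carrier (Ms ! i) \<Longrightarrow>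
        f (t[i := a \<otimes>\<^bsub>Ms ! i\<^esub> b]) - f (t[i := a]) - f (t[i := b]) \<in> H"
    and bal: "\<And>t j s. t \<in> tuples Ms \<Longrightarrow> Suc j < length Ms \<Longrightarrow>
        f (t[j := lbar (Ms ! j) s (t ! j)]) - f (t[Suc j := lact (Ms ! Suc j) s (t ! Suc j)]) \<in> H"
  shows "balanced_on Ms H f"
proof (rule balanced_onI)
  fix A M B t u a b
  assume *: "Ms = A @ M # B" "t \<in> tuples A" "u \<in> tuples B" "a \<in> carrier M" "b \<in> carrier M"
  then have "t @ a # u \<in> tuples Ms" by (simp add: tuples_appendI)
  from mult[OF this, of "length A" a b] show "f (t @ (a \<otimes>\<^bsub>M\<^esub> b) # u) - f (t @ a # u) - f (t @ b # u) \<in> H"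
    using * tuples_length[of t A] by (simp add: nth_append list_update_append)
next
  fix A M N B t u a b s
  assume *: "Ms = A @ M # N # B" "t \<in> tuples A" "u \<in> tuples B" "a \<in> carrier M" "b \<in> carrier N"
  then have "t @ a # b # u \<in> tuples Ms" by (simp add: tuples_appendI)
  from bal[OF this, of "length A" s] show "f (t @ lbar M s a # b # u) - f (t @ a # lact N s b # u) \<in> H"
    using * tuples_length[of t A] by (simp add: nth_append list_update_append)
qed

lemma rels_nth:
  assumes "t \<in> tuples Ms"
  shows "i < length Ms \<Longrightarrow> a \<in> carrier (Ms ! i) \<Longrightarrow> b \<in> carrier (Ms ! i) \<Longrightarrow>
      frag_of (t[i := a \<otimes>\<^bsub>Ms ! i\<^esub> b]) - frag_of (t[i := a]) - frag_of (t[i := b]) \<in> rels Ms"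
    and "Suc j < length Ms \<Longrightarrow>
      frag_of (t[j := lbar (Ms ! j) s (t ! j)]) - frag_of (t[Suc j := lact (Ms ! Suc j) s (t ! Suc j)]) \<in> rels Ms"
  unfolding rels_def tensor_rels_def
  by (rule generate.incl, use assms in \<open>fastforce simp: multilinear_rels_def R_balanced_def\<close>)+

context big_universe
begin

context
  fixes Ms Ns :: "('r, 'u) bimod list"
  assumes Ms: "bimods Ms" and Ns: "bimods Ns" and len: "length Ns = length Ms"
begin

private abbreviation "Ts \<equiv> map2 tens Ms Ns"

lemma bimods_tens: "bimods Ts"
  using Ms Ns by (auto elim!: in_set_zipE intro: bimodule_tens)

private lemma nth_bimodules: "i < length Ms \<Longrightarrow> bimodule (Ms ! i)" "i < length Ms \<Longrightarrow> bimodule (Ns ! i)"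
  using Ms Ns len by simp_all

private lemma nth_tens: "i < length Ms \<Longrightarrow> Ts ! i = tens (Ms ! i) (Ns ! i)"
  using len by simp

private lemmas pure_nth_closed = pure_closed[OF nth_bimodules(1,2)]

private lemmas pure_nth_simps = pure_simps[OF nth_bimodules(1,2)]

lemma pures_tuples:
  assumes "t \<in> tuples Ms" "v \<in> tuples Ns"
  shows "pures Ms Ns t v \<in> tuples Ts"
  using tuples_nth[OF assms(1)] tuples_nth[OF assms(2)] len by (simp add: tuples_def pure_nth_closed)

text \<open>The left actions on a slot of the target act on its left factor, so for a fixed second
  tuple the relations in the first argument pass directly to the target.\<close>

lemma pures_balanced_left:
  assumes v: "v \<in> tuples Ns"
  shows "balanced_on Ms (rels Ts) (\<lambda>t. frag_of (pures Ms Ns t v))"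
proof (rule balanced_on_nthI)
  fix t i a b assume t: "t \<in> tuples Ms" and i: "i < length Ms" and ab: "a \<in> carrier (Ms ! i)" "b \<in> carrier (Ms ! i)"
  have vi: "v ! i \<in> carrier (Ns ! i)" using tuples_nth[OF v] i len by simp
  show "frag_of (pures Ms Ns (t[i := a \<otimes>\<^bsub>Ms ! i\<^esub> b]) v) - frag_of (pures Ms Ns (t[i := a]) v) - frag_of (pures Ms Ns (t[i := b]) v) \<in> rels Ts"
    using rels_nth(1)[OF pures_tuples[OF t v], of i "pure (Ms ! i) (Ns ! i) a (v ! i)" "pure (Ms ! i) (Ns ! i) b (v ! i)"]
      i ab vi len tuples_length[OF t]
    by (simp add: pures_update pure_nth_closed pure_nth_simps)
next
  fix t j s assume t: "t \<in> tuples Ms" and j: "Suc j < length Ms"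
  then have *: "j < length Ms" "t ! j \<in> carrier (Ms ! j)" "v ! j \<in> carrier (Ns ! j)"
      "t ! Suc j \<in> carrier (Ms ! Suc j)" "v ! Suc j \<in> carrier (Ns ! Suc j)"
    using tuples_nth[OF v] tuples_nth[OF t] len by simp_all
  show "frag_of (pures Ms Ns (t[j := lbar (Ms ! j) s (t ! j)]) v) - frag_of (pures Ms Ns (t[Suc j := lact (Ms ! Suc j) s (t ! Suc j)]) v) \<in> rels Ts"
    using rels_nth(2)[OF pures_tuples[OF t v], of j s] * j len tuples_length[OF t]
    by (simp add: pures_update pure_nth_simps)
qed

lemma interchange_swap: "interchange Ms Ns c d = frag_extend (\<lambda>u. frag_extend (\<lambda>t. frag_of (pures Ms Ns t u)) c) d"
  unfolding interchange_def by (rule frag_extend_swap)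

lemma interchange_additive:
  "interchange Ms Ns (c - c') d = interchange Ms Ns c d - interchange Ms Ns c' d"
  "interchange Ms Ns (c + c') d = interchange Ms Ns c d + interchange Ms Ns c' d"
  "interchange Ms Ns c (d - d') = interchange Ms Ns c d - interchange Ms Ns c d'"
  "interchange Ms Ns c (d + d') = interchange Ms Ns c d + interchange Ms Ns c d'"
  unfolding interchange_swap[of c "d - d'"] interchange_swap[of c "d + d'"] interchange_swap[of c d] interchange_swap[of c d']
  by (simp_all add: frag_extend_diff frag_extend_add)
    (simp_all add: interchange_def frag_extend_diff frag_extend_add interchange_swap[unfolded interchange_def, symmetric])

lemma interchange_rels_left:
  assumes "c \<in> rels Ms" "d \<in> sums (tuples Ns)"
  shows "interchange Ms Ns c d \<in> rels Ts"
  unfolding interchange_def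
  by (rule frag_extend_rels[OF Ms diff_closed_rels[OF bimods_tens] balanced_on_frag_extend[OF diff_closed_rels[OF bimods_tens]] assms(1)])
    (rule pures_balanced_left, use assms(2) in auto)

text \<open>An operation on a slot of the target is realized on the left factor or on the right one,
  and a middle scalar may move between them; these three forms yield the bilinearity laws.\<close>

lemma interchange_slot:
  assumes c: "c \<in> sums (tuples Ms)" and d: "d \<in> sums (tuples Ns)" and i: "i < length Ms"
  shows "(\<And>m n. m \<in> carrier (Ms ! i) \<Longrightarrow> n \<in> carrier (Ns ! i) \<Longrightarrow> G (pure (Ms ! i) (Ns ! i) m n) = pure (Ms ! i) (Ns ! i) (f m) n)
      \<Longrightarrow> apply_slot i G (interchange Ms Ns c d) = interchange Ms Ns (apply_slot i f c) d"
    and "(\<And>m n. m \<in> carrier (Ms ! i) \<Longrightarrow> n \<in> carrier (Ns ! i) \<Longrightarrow> G (pure (Ms ! i) (Ns ! i) m n) = pure (Ms ! i) (Ns ! i) m (g n))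
      \<Longrightarrow> apply_slot i G (interchange Ms Ns c d) = interchange Ms Ns c (apply_slot i g d)"
    and "(\<And>m n. m \<in> carrier (Ms ! i) \<Longrightarrow> n \<in> carrier (Ns ! i) \<Longrightarrow> pure (Ms ! i) (Ns ! i) (f m) n = pure (Ms ! i) (Ns ! i) m (g n))
      \<Longrightarrow> interchange Ms Ns (apply_slot i f c) d = interchange Ms Ns c (apply_slot i g d)"
proof -
  have *: "t ! i \<in> carrier (Ms ! i)" "length t = length Ms" if "t \<in> Poly_Mapping.keys c" for t
    using c that i tuples_nth[of t Ms i] tuples_length[of t Ms] by auto
  have **: "t ! i \<in> carrier (Ns ! i)" "length t = length Ms" if "t \<in> Poly_Mapping.keys d" for t
    using d that i len tuples_nth[of t Ns i] tuples_length[of t Ns] by auto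
  show "apply_slot i G (interchange Ms Ns c d) = interchange Ms Ns (apply_slot i f c) d"
    if "\<And>m n. m \<in> carrier (Ms ! i) \<Longrightarrow> n \<in> carrier (Ns ! i) \<Longrightarrow> G (pure (Ms ! i) (Ns ! i) m n) = pure (Ms ! i) (Ns ! i) (f m) n"
    unfolding interchange_def apply_slot_frag_extend frag_extend_apply_slot
    by (intro frag_extend_eq) (simp add: * ** i that pures_update)
  show "apply_slot i G (interchange Ms Ns c d) = interchange Ms Ns c (apply_slot i g d)"
    if "\<And>m n. m \<in> carrier (Ms ! i) \<Longrightarrow> n \<in> carrier (Ns ! i) \<Longrightarrow> G (pure (Ms ! i) (Ns ! i) m n) = pure (Ms ! i) (Ns ! i) m (g n)"
    unfolding interchange_def apply_slot_frag_extend frag_extend_apply_slot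
    by (intro frag_extend_eq) (simp add: * ** i that pures_update)
  show "interchange Ms Ns (apply_slot i f c) d = interchange Ms Ns c (apply_slot i g d)"
    if "\<And>m n. m \<in> carrier (Ms ! i) \<Longrightarrow> n \<in> carrier (Ns ! i) \<Longrightarrow> pure (Ms ! i) (Ns ! i) (f m) n = pure (Ms ! i) (Ns ! i) m (g n)"
    unfolding interchange_def frag_extend_apply_slot
    by (intro frag_extend_eq) (simp add: * ** i that pures_update)
qed

text \<open>A left scalar on an entry of \<open>u\<close> crosses the tensor sign and becomes a
  right scalar on the matching entry of \<open>t\<close>. A balancing relation in \<open>u\<close>
  is thereby turned into a Takeuchi condition on the first argument, which holds for the sum
  \<open>c\<close> though not for each of its tuples.\<close>

lemma pures_balanced_right:
  assumes c: "c \<in> takeuchi Ms"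
  shows "balanced_on Ns (rels Ts) (\<lambda>u. frag_extend (\<lambda>t. frag_of (pures Ms Ns t u)) c)"
proof (rule balanced_on_nthI)
  note R = diff_closed_rels[OF bimods_tens] and cs = takeuchiD(1)[OF c]
  fix u i a b assume u: "u \<in> tuples Ns" and i: "i < length Ns" and ab: "a \<in> carrier (Ns ! i)" "b \<in> carrier (Ns ! i)"
  have "frag_of (pures Ms Ns t (u[i := a \<otimes>\<^bsub>Ns ! i\<^esub> b])) - frag_of (pures Ms Ns t (u[i := a])) - frag_of (pures Ms Ns t (u[i := b])) \<in> rels Ts"
    if t: "t \<in> tuples Ms" for t
    using rels_nth(1)[OF pures_tuples[OF t u], of i "pure (Ms ! i) (Ns ! i) (t ! i) a" "pure (Ms ! i) (Ns ! i) (t ! i) b"]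
      i ab len tuples_length[OF u] tuples_nth[OF t, of i]
    by (simp add: pures_update pure_nth_closed pure_nth_simps)
  then show "frag_extend (\<lambda>t. frag_of (pures Ms Ns t (u[i := a \<otimes>\<^bsub>Ns ! i\<^esub> b]))) c - frag_extend (\<lambda>t. frag_of (pures Ms Ns t (u[i := a]))) c
      - frag_extend (\<lambda>t. frag_of (pures Ms Ns t (u[i := b]))) c \<in> rels Ts"
    unfolding frag_extend_fun_diff[symmetric] by (intro frag_extend_mem[OF R]) (use cs in auto)
next
  note R = diff_closed_rels[OF bimods_tens] and cs = takeuchiD(1)[OF c]
  fix u j s assume u: "u \<in> tuples Ns" and j: "Suc j < length Ns"
  have *: "j < length Ms" "Suc j < length Ms" "u ! j \<in> carrier (Ns ! j)" "u ! Suc j \<in> carrier (Ns ! Suc j)"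
    using tuples_nth[OF u] j len by simp_all
  have "frag_extend (\<lambda>t. frag_of (pures Ms Ns t (u[j := lbar (Ns ! j) s (u ! j)]))) c
      = frag_extend (\<lambda>t. frag_of (pures Ms Ns t u)) (apply_slot j (\<lambda>m. rbar (Ms ! j) m s) c)"
    unfolding frag_extend_apply_slot
    using cs * len tuples_length[OF u]
    by (intro frag_extend_eq) (simp add: pures_update subset_iff tuples_length tuples_nth pure_nth_simps)
  moreover have "frag_extend (\<lambda>t. frag_of (pures Ms Ns t (u[Suc j := lact (Ns ! Suc j) s (u ! Suc j)]))) c
      = frag_extend (\<lambda>t. frag_of (pures Ms Ns t u)) (apply_slot (Suc j) (\<lambda>m. ract (Ms ! Suc j) m s) c)"
    unfolding frag_extend_apply_slot
    using cs * len tuples_length[OF u]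
    by (intro frag_extend_eq) (simp add: pures_update subset_iff tuples_length tuples_nth pure_nth_simps)
  ultimately show "frag_extend (\<lambda>t. frag_of (pures Ms Ns t (u[j := lbar (Ns ! j) s (u ! j)]))) c
      - frag_extend (\<lambda>t. frag_of (pures Ms Ns t (u[Suc j := lact (Ns ! Suc j) s (u ! Suc j)]))) c \<in> rels Ts"
    using frag_extend_rels[OF Ms R pures_balanced_left[OF u] takeuchiD(2)[OF c *(2)]] by (simp add: frag_extend_diff)
qed

lemma interchange_rels_right:
  assumes "c \<in> takeuchi Ms" "d \<in> rels Ns"
  shows "interchange Ms Ns c d \<in> rels Ts"
  unfolding interchange_swap
  by (rule frag_extend_rels[OF Ns diff_closed_rels[OF bimods_tens] pures_balanced_right[OF assms(1)] assms(2)])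

text \<open>Right actions on the tensor products are actions on the right factors, so the condition
  for the result is the image of that for \<open>d\<close>. Sending its relation to a relation uses
  the Takeuchi condition for \<open>c\<close>.\<close>

lemma interchange_takeuchi:
  assumes c: "c \<in> takeuchi Ms" and d: "d \<in> takeuchi Ns"
  shows "interchange Ms Ns c d \<in> takeuchi Ts"
proof -
  note cs = takeuchiD(1)[OF c] and ds = takeuchiD(1)[OF d]
  have "interchange Ms Ns c d \<in> sums (tuples Ts)"
    unfolding interchange_def mem_Collect_eq
    by (intro keys_frag_extend_subset) (use pures_tuples cs ds in auto)
  moreover have "apply_slot j (\<lambda>m. rbar (Ts ! j) m s) (interchange Ms Ns c d)
      - apply_slot (Suc j) (\<lambda>m. ract (Ts ! Suc j) m s) (interchange Ms Ns c d) \<in> rels Ts" if j: "Suc j < length Ms" for j s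
  proof -
    have "apply_slot j (\<lambda>m. rbar (Ts ! j) m s) (interchange Ms Ns c d)
        = interchange Ms Ns c (apply_slot j (\<lambda>m. rbar (Ns ! j) m s) d)"
      by (rule interchange_slot(2)[OF cs ds]) (use j in \<open>simp_all add: nth_tens pure_nth_simps del: nth_map\<close>)
    moreover have "apply_slot (Suc j) (\<lambda>m. ract (Ts ! Suc j) m s) (interchange Ms Ns c d)
        = interchange Ms Ns c (apply_slot (Suc j) (\<lambda>m. ract (Ns ! Suc j) m s) d)"
      by (rule interchange_slot(2)[OF cs ds]) (use j in \<open>simp_all add: nth_tens pure_nth_simps del: nth_map\<close>)
    ultimately show ?thesis
      using interchange_rels_right[OF c takeuchiD(2)[OF d, of j s]] j len by (simp add: interchange_additive)
  qed
  ultimately show ?thesis using len by (simp add: takeuchi_def)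
qed

context
  assumes ne: "Ms \<noteq> []"
begin

private lemma ne': "Ns \<noteq> []" "Ts \<noteq> []"
  using ne len by (auto simp: zip_eq_Nil_iff)

lemma shuffle_interchange: "shuffle Ms Ns x y = times_of Ts (interchange Ms Ns (times_rep Ms x) (times_rep Ns y))"
  by (simp add: shuffle_def interchange_def pures_def)

text \<open>Replacing the representatives one at a time gives two relations of different origin: the
  change of \<open>c\<close> is harmless against any formal sum, the change of \<open>d\<close>
  against a Takeuchi sum.\<close>

lemma shuffle_times_of:
  assumes c: "c \<in> takeuchi Ms" and d: "d \<in> takeuchi Ns"
  shows "shuffle Ms Ns (times_of Ms c) (times_of Ns d) = times_of Ts (interchange Ms Ns c d)"
proof -
  let ?c = "times_rep Ms (times_of Ms c)" and ?d = "times_rep Ns (times_of Ns d)"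
  have cd: "?c \<in> takeuchi Ms" "?d \<in> takeuchi Ns"
    using times_rep_closed[OF Ms ne] times_of_closed[OF Ms ne c] times_rep_closed[OF Ns ne'(1)] times_of_closed[OF Ns ne'(1) d] by auto
  have "interchange Ms Ns (?c - c) ?d \<in> rels Ts" "interchange Ms Ns c (?d - d) \<in> rels Ts"
    using interchange_rels_left[OF times_rep_of_mod[OF Ms ne c] takeuchiD(1)[OF cd(2)]]
      interchange_rels_right[OF c times_rep_of_mod[OF Ns ne'(1) d]] by auto
  from diff_closedD(4)[OF diff_closed_rels[OF bimods_tens] this]
  have "interchange Ms Ns ?c ?d - interchange Ms Ns c d \<in> rels Ts"
    by (simp add: interchange_additive)
  then show ?thesis
    unfolding shuffle_interchange
    using times_of_eq_iff[OF bimods_tens ne'(2)] interchange_takeuchi[OF cd] interchange_takeuchi[OF c d] by simp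
qed

text \<open>The actions of the products live in the first and the last slot, so each law is an
  instance of \<open>interchange_slot\<close> at position \<open>0\<close> or
  \<open>length Ms - 1\<close>.\<close>

lemma shuffle_bilinear: "bilinear_map (timesR Ms) (timesR Ns) (timesR Ts) (shuffle Ms Ns)"
proof (rule bilinear_mapI)
  have l: "0 < length Ms" "length Ms - 1 < length Ms" using ne by auto
  note nths = nth_tens[OF l(1)] nth_tens[OF l(2)]
  fix x y s assume "x \<in> carrier (timesR Ms)" "y \<in> carrier (timesR Ns)"
  then obtain c d where c: "c \<in> takeuchi Ms" "x = times_of Ms c" and d: "d \<in> takeuchi Ns" "y = times_of Ns d"
    using times_cases[OF Ms ne] times_cases[OF Ns ne'(1)] by metis
  note cs = takeuchiD(1)[OF c(1)] and ds = takeuchiD(1)[OF d(1)]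
  note slot = interchange_slot[OF cs ds l(1)] interchange_slot[OF cs ds l(2)]
  note i = interchange_takeuchi[OF c(1) d(1)]
  note ac = takeuchi_slot_actions[OF Ms ne c(1)] and ad = takeuchi_slot_actions[OF Ns ne'(1) d(1), unfolded len]
  note tc = times_of_act[OF Ms ne c(1)] and td = times_of_act[OF Ns ne'(1) d(1), unfolded len]
    and ti = times_of_act[OF bimods_tens ne'(2) i, unfolded length_map length_zip len min.idem nths]
  show "shuffle Ms Ns x y \<in> carrier (timesR Ts)"
    unfolding c(2) d(2) shuffle_times_of[OF c(1) d(1)] by (rule times_of_closed[OF bimods_tens ne'(2) i])
  show "shuffle Ms Ns (ract (timesR Ms) x s) y = shuffle Ms Ns x (lact (timesR Ns) s y)"
    unfolding c(2) d(2) tc td shuffle_times_of[OF ac(2) d(1)] shuffle_times_of[OF c(1) ad(1)]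
    by (rule arg_cong[of _ _ "times_of Ts"], rule slot(3)) (rule pure_nth_simps(3)[OF l(1) l(1)])
  show "shuffle Ms Ns (rbar (timesR Ms) x s) y = shuffle Ms Ns x (lbar (timesR Ns) s y)"
    unfolding c(2) d(2) tc td shuffle_times_of[OF ac(4) d(1)] shuffle_times_of[OF c(1) ad(3)]
    by (rule arg_cong[of _ _ "times_of Ts"], rule slot(6)) (rule pure_nth_simps(4)[OF l(2) l(2)])
  show "shuffle Ms Ns (lact (timesR Ms) s x) y = lact (timesR Ts) s (shuffle Ms Ns x y)"
    unfolding c(2) d(2) tc shuffle_times_of[OF ac(1) d(1)] shuffle_times_of[OF c(1) d(1)] ti
    by (rule arg_cong[of _ _ "times_of Ts"], rule slot(1)[symmetric]) (rule pure_nth_simps(5)[OF l(1) l(1)])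
  show "shuffle Ms Ns (lbar (timesR Ms) s x) y = lbar (timesR Ts) s (shuffle Ms Ns x y)"
    unfolding c(2) d(2) tc shuffle_times_of[OF ac(3) d(1)] shuffle_times_of[OF c(1) d(1)] ti
    by (rule arg_cong[of _ _ "times_of Ts"], rule slot(4)[symmetric]) (rule pure_nth_simps(6)[OF l(2) l(2)])
  show "shuffle Ms Ns x (ract (timesR Ns) y s) = ract (timesR Ts) (shuffle Ms Ns x y) s"
    unfolding c(2) d(2) td shuffle_times_of[OF c(1) ad(2)] shuffle_times_of[OF c(1) d(1)] ti
    by (rule arg_cong[of _ _ "times_of Ts"], rule slot(2)[symmetric]) (rule pure_nth_simps(7)[OF l(1) l(1)])
  show "shuffle Ms Ns x (rbar (timesR Ns) y s) = rbar (timesR Ts) (shuffle Ms Ns x y) s"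
    unfolding c(2) d(2) td shuffle_times_of[OF c(1) ad(4)] shuffle_times_of[OF c(1) d(1)] ti
    by (rule arg_cong[of _ _ "times_of Ts"], rule slot(5)[symmetric]) (rule pure_nth_simps(8)[OF l(2) l(2)])
  {
    fix x' assume "x' \<in> carrier (timesR Ms)"
    then obtain c' where c': "c' \<in> takeuchi Ms" "x' = times_of Ms c'" using times_cases[OF Ms ne] by metis
    note cc = diff_closedD(4)[OF diff_closed_takeuchi[OF Ms] c(1) c'(1)]
    show "shuffle Ms Ns (x \<otimes>\<^bsub>timesR Ms\<^esub> x') y = shuffle Ms Ns x y \<otimes>\<^bsub>timesR Ts\<^esub> shuffle Ms Ns x' y"
      unfolding c(2) c'(2) d(2) times_of_add[OF Ms ne c(1) c'(1)] shuffle_times_of[OF cc d(1)] interchange_additive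
        shuffle_times_of[OF c(1) d(1)] shuffle_times_of[OF c'(1) d(1)]
      by (rule times_of_add[OF bimods_tens ne'(2) i interchange_takeuchi[OF c'(1) d(1)], symmetric])
  }
  {
    fix y' assume "y' \<in> carrier (timesR Ns)"
    then obtain d' where d': "d' \<in> takeuchi Ns" "y' = times_of Ns d'" using times_cases[OF Ns ne'(1)] by metis
    note dd = diff_closedD(4)[OF diff_closed_takeuchi[OF Ns] d(1) d'(1)]
    show "shuffle Ms Ns x (y \<otimes>\<^bsub>timesR Ns\<^esub> y') = shuffle Ms Ns x y \<otimes>\<^bsub>timesR Ts\<^esub> shuffle Ms Ns x y'"
      unfolding c(2) d'(2) d(2) times_of_add[OF Ns ne'(1) d(1) d'(1)] shuffle_times_of[OF c(1) dd] interchange_additive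
        shuffle_times_of[OF c(1) d(1)] shuffle_times_of[OF c(1) d'(1)]
      by (rule times_of_add[OF bimods_tens ne'(2) i interchange_takeuchi[OF c(1) d'(1)], symmetric])
  }
qed

text \<open>This includes one factor, where \<open>chi_map\<close> is an identity by definition: the
  shuffle of one-entry tuples is the pure tensor itself.\<close>

lemma chi_interchange:
  assumes c: "c \<in> takeuchi Ms" and d: "d \<in> takeuchi Ns"
  shows "bfun (chi_map Ms Ns) (pure (timesR Ms) (timesR Ns) (times_of Ms c) (times_of Ns d)) = times_of Ts (interchange Ms Ns c d)"
proof (cases "length Ms = 1")
  case False
  then show ?thesis
    using tens_arr_pure[OF bimodule_timesR[OF Ms] bimodule_timesR[OF Ns] bimodule_timesR[OF bimods_tens] shuffle_bilinear
        times_of_closed[OF Ms ne c] times_of_closed[OF Ns ne'(1) d]] ne shuffle_times_of[OF c d]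
    by (simp add: chi_map_def)
next
  case True
  then obtain M N where MN: "Ms = [M]" "Ns = [N]" using len by (auto simp: length_Suc_conv)
  have b: "bimodule M" "bimodule N" using Ms Ns MN by auto
  interpret T: bimodule "tens M N" by (rule bimodule_tens[OF b])
  let ?x = "times_of Ms c" and ?y = "times_of Ns d"
  have xy: "?x \<in> carrier M" "?y \<in> carrier N"
    using times_of_closed[OF Ms ne c] times_of_closed[OF Ns ne'(1) d] MN by simp_all
  note p = pure_closed[OF b xy]
  have "shuffle Ms Ns ?x ?y = pure M N ?x ?y"
    using p MN by (simp add: shuffle_def times_rep_def times_of_def)
  then show ?thesis
    using p shuffle_times_of[OF c d] MN by (simp add: chi_map_def)
qed

end

end

end

lemma interchange_frag_of: "interchange Ms Ns (frag_of t) (frag_of u) = frag_of (pures Ms Ns t u)"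
  by (simp add: interchange_def)

lemma frag_extend_interchange:
  "frag_extend F (interchange Ms Ns c d) = frag_extend (\<lambda>t. frag_extend (\<lambda>u. F (pures Ms Ns t u)) d) c"
  by (simp add: interchange_def frag_extend_compose)

lemma interchange_frag_extend:
  "interchange Ms Ns (frag_extend F c) (frag_extend G d)
    = frag_extend (\<lambda>t. frag_extend (\<lambda>u. interchange Ms Ns (F t) (G u)) d) c"
  unfolding interchange_def frag_extend_compose
  by (rule arg_cong[of _ _ "\<lambda>h. frag_extend h c"], rule ext) (rule frag_extend_swap)

lemma frag_extend_eq2:
  assumes "c \<in> sums A" "d \<in> sums B" "\<And>t u. t \<in> A \<Longrightarrow> u \<in> B \<Longrightarrow> F t u = G t u"
  shows "frag_extend (\<lambda>t. frag_extend (F t) d) c = frag_extend (\<lambda>t. frag_extend (G t) d) c"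
  using assms by (intro frag_extend_eq) auto

lemma map_pures:
  assumes "length ts = length Ms"
    and "\<And>i. i < length Ms \<Longrightarrow> bfun (fs ! i) (pure (Ms ! i) (Ns ! i) (t ! i) (v ! i)) = ts ! i"
    and "length fs = length Ms"
  shows "map2 bfun fs (pures Ms Ns t v) = ts"
  using assms by (auto intro!: nth_equalityI)

lemma comp_apply:
  "f \<in> bimod_Hom M N \<Longrightarrow> x \<in> carrier M \<Longrightarrow> bfun (g \<bullet>\<^bsub>bimod_moncat\<^esub> f) x = bfun g (bfun f x)"
  by (simp add: bimod_Hom_def)

section \<open>Composition in End(R), naturality and associativity of the interchange maps\<close>

context big_universe
begin

lemma bimodule_End: "bimodule End"
  by (rule bimodule_timesR) simp

lemma end_enc_closed:
  assumes "h \<in> hom ring_group (ring_group :: 'r monoid)"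
  shows "end_enc h \<in> carrier End" "end_dec (end_enc h :: 'u) = h"
  using assms dec_enc[OF end_raw_embeds, of h] small_simps(1)[OF end_raw_embeds]
  by (auto simp: timesR.simps(1) end_dec_def end_enc_def end_raw_def)

lemma end_dec_hom: "y \<in> carrier End \<Longrightarrow> end_dec y \<in> hom ring_group (ring_group :: 'r monoid)"
  by (rule homI) (simp_all add: end_dec_simps)

lemma end_eqI:
  assumes "y \<in> carrier End" "y' \<in> carrier End"
    and "\<And>x :: 'r. end_dec y x = end_dec y' x"
  shows "y = y'"
proof -
  have "(end_dec y :: 'r \<Rightarrow> 'r) = end_dec y'" using assms(3) by (rule ext)
  from arg_cong[OF this, of "end_enc :: _ \<Rightarrow> 'u"] show ?thesis
    unfolding end_enc_dec[OF assms(1)] end_enc_dec[OF assms(2)] .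
qed

definition end_comp :: "'u \<Rightarrow> 'u \<Rightarrow> 'u" where
  "end_comp y z = end_enc ((end_dec y :: 'r \<Rightarrow> 'r) \<circ> end_dec z)"

lemma end_comp:
  assumes "y \<in> carrier End" "z \<in> carrier End"
  shows "end_comp y z \<in> carrier End" "end_dec (end_comp y z) = (\<lambda>x :: 'r. end_dec y (end_dec z x))"
proof -
  have "end_dec y \<circ> end_dec z \<in> hom ring_group (ring_group :: 'r monoid)"
    by (rule Group.hom_compose[OF end_dec_hom[OF assms(2)] end_dec_hom[OF assms(1)]])
  from end_enc_closed[OF this] show "end_comp y z \<in> carrier End"
    "end_dec (end_comp y z) = (\<lambda>x :: 'r. end_dec y (end_dec z x))"
    by (simp_all add: end_comp_def comp_def)
qed

text \<open>Composition is balanced because a right scalar on the outer map multiplies its argument,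
  as a left scalar on the inner map multiplies its value.\<close>

lemma end_comp_bilinear: "bilinear_map (timesR []) (timesR []) End end_comp"
proof -
  interpret E: bimodule "End" by (rule bimodule_End)
  show ?thesis
    by (rule bilinear_mapI; (rule end_comp(1) | rule end_eqI))
      (simp_all add: end_comp end_dec_simps E.closed)
qed

lemma chi_Nil:
  shows "chi_map [] [] \<in> bimod_Hom (tens (timesR []) (timesR [])) End"
    and "y \<in> carrier End \<Longrightarrow> z \<in> carrier End \<Longrightarrow>
      bfun (chi_map [] [] :: ('r, 'u) bimod_arr) (pure End (timesR []) y z) = end_comp y z"
proof -
  have eq: "(chi_map [] [] :: ('r, 'u) bimod_arr) = tens_arr (timesR []) (timesR []) (timesR []) end_comp"
    by (simp add: chi_map_def end_comp_def[abs_def])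
  show "chi_map [] [] \<in> bimod_Hom (tens (timesR []) (timesR [])) End"
    unfolding eq by (rule tens_arr_Hom[OF bimodule_End bimodule_End bimodule_End end_comp_bilinear])
  show "y \<in> carrier End \<Longrightarrow> z \<in> carrier End \<Longrightarrow>
      bfun (chi_map [] [] :: ('r, 'u) bimod_arr) (pure End (timesR []) y z) = end_comp y z"
    unfolding eq by (rule tens_arr_pure[OF bimodule_End bimodule_End bimodule_End end_comp_bilinear])
qed

lemma chi_Hom:
  assumes Ms: "bimods (Ms :: ('r, 'u) bimod list)" and Ns: "bimods Ns" and len: "length Ns = length Ms"
  shows "chi_map Ms Ns \<in> bimod_Hom (tens (timesR Ms) (timesR Ns)) (timesR (map2 tens Ms Ns))"
proof -
  consider "Ms = []" "Ns = []" | M N where "Ms = [M]" "Ns = [N]" | "Ms \<noteq> []" "length Ms \<noteq> 1"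
    using len by (cases Ms; cases "tl Ms"; cases Ns) auto
  then show ?thesis
  proof cases
    case 1
    then show ?thesis using chi_Nil(1) by simp
  next
    case 2
    then show ?thesis using bimod_id_Hom[OF bimodule_tens] Ms Ns by (simp add: chi_map_def)
  next
    case 3
    then show ?thesis
      using tens_arr_Hom[OF bimodule_timesR[OF Ms] bimodule_timesR[OF Ns] bimodule_timesR[OF bimods_tens[OF Ms Ns len]]
          shuffle_bilinear[OF Ms Ns len]]
      by (simp add: chi_map_def)
  qed
qed

lemma tens_times_eqI:
  assumes Ms: "bimods (Ms :: ('r, 'u) bimod list)" "Ms \<noteq> []" and Ns: "bimods Ns" "Ns \<noteq> []"
    and "f \<in> bimod_Hom (tens (timesR Ms) (timesR Ns)) P" "g \<in> bimod_Hom (tens (timesR Ms) (timesR Ns)) P"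
    and "\<And>c d. c \<in> takeuchi Ms \<Longrightarrow> d \<in> takeuchi Ns \<Longrightarrow>
      bfun f (pure (timesR Ms) (timesR Ns) (times_of Ms c) (times_of Ns d))
      = bfun g (pure (timesR Ms) (timesR Ns) (times_of Ms c) (times_of Ns d))"
  shows "f = g"
proof (rule tens_Hom_eqI[OF bimodule_timesR[OF Ms(1)] bimodule_timesR[OF Ns(1)] bimod_HomD(2)[OF assms(5)] assms(5,6)])
  fix x y assume "x \<in> carrier (timesR Ms)" "y \<in> carrier (timesR Ns)"
  then show "bfun f (pure (timesR Ms) (timesR Ns) x y) = bfun g (pure (timesR Ms) (timesR Ns) x y)"
    using times_cases[OF Ms] times_cases[OF Ns] assms(7) by metis
qed

text \<open>Both sides apply the tensor product of the maps slot by slot to pure tensors, so they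
  coincide already as formal sums. With no factors the product maps are identities.\<close>

lemma chi_natural:
  fixes fs gs :: "('r, 'u) bimod_arr list"
  assumes fs: "\<forall>f\<in>set fs. f \<in> Arr bimod_moncat" and gs: "\<forall>f\<in>set gs. f \<in> Arr bimod_moncat" and len: "length gs = length fs"
  shows "chi_map (map bcod fs) (map bcod gs) \<cdot> (times_map fs \<boxdot>\<^bsub>Bimod\<^esub> times_map gs)
    = times_map (map2 (tensM Bimod) fs gs) \<cdot> chi_map (map bdom fs) (map bdom gs)"
proof -
  have bim: "bimods (map bdom fs)" "bimods (map bdom gs)" "bimods (map bcod fs)" "bimods (map bcod gs)" using fs gs by auto
  have len': "length (map bdom gs) = length (map bdom fs)" "length (map bcod gs) = length (map bcod fs)" using len by simp_all
  let ?hs = "map2 (tensM Bimod) fs gs"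
  have h: "fs ! i \<in> bimod_Hom (bdom (fs ! i)) (bcod (fs ! i))" "gs ! i \<in> bimod_Hom (bdom (gs ! i)) (bcod (gs ! i))"
      if "i < length fs" for i
    using Arr_Hom[OF bspec[OF fs nth_mem[of i]]] Arr_Hom[OF bspec[OF gs nth_mem[of i]]] that len by simp_all
  note hh = tens_map_Hom[OF h]
  have hs: "\<forall>f\<in>set ?hs. f \<in> Arr bimod_moncat"
  proof
    fix k assume "k \<in> set ?hs"
    then obtain i where "i < length fs" "k = fs ! i \<boxdot>\<^bsub>Bimod\<^esub> gs ! i" using len by (auto simp: in_set_conv_nth)
    then show "k \<in> Arr bimod_moncat" using Hom_Arr[OF hh[of i]] by (simp del: bimod_moncat_simps)
  qed
  have d: "map bdom ?hs = map2 tens (map bdom fs) (map bdom gs)" "map bcod ?hs = map2 tens (map bcod fs) (map bcod gs)"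
    using len bimod_HomD(3,4)[OF hh] by (auto intro!: nth_equalityI)
  note F = times_map_Hom[OF fs] and G = times_map_Hom[OF gs] and H = times_map_Hom[OF hs, unfolded d]
  note C = chi_Hom[OF bim(1,2) len'(1)] and D = chi_Hom[OF bim(3,4) len'(2)]
  note FG = tens_map_Hom[OF F G]
  interpret B: monoidal_category Bimod by (rule monoidal_category_bimod)
  show ?thesis
  proof (cases "fs = []")
    case True
    then have gs: "gs = []" using len by simp
    have id: "times_map [] = Idn Bimod (timesR [])" by (simp add: times_map_def)
    have "chi_map [] [] \<cdot> Idn Bimod (tens (timesR []) (timesR [])) = Idn Bimod (timesR []) \<cdot> chi_map [] []"
      using B.Idn_left[of "chi_map [] []"] B.Idn_right[of "chi_map [] []"] chi_Nil(1) by simp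
    then show ?thesis
      using B.tensM_Idn[of "timesR []" "timesR []"] bimodule_End unfolding True gs by (simp add: id del: bimod_moncat_simps(5))
  next
    case False
    then have ne: "map bdom fs \<noteq> []" "map bdom gs \<noteq> []" "map bcod fs \<noteq> []" "map bcod gs \<noteq> []" "gs \<noteq> []" "?hs \<noteq> []"
      using len by (auto simp: zip_eq_Nil_iff)
    show ?thesis
    proof (rule tens_times_eqI[OF bim(1) ne(1) bim(2) ne(2) comp_Hom[OF FG D] comp_Hom[OF C H]])
      fix c e assume c: "c \<in> takeuchi (map bdom fs)" and e: "e \<in> takeuchi (map bdom gs)"
      let ?x = "times_of (map bdom fs) c" and ?y = "times_of (map bdom gs) e"
      let ?c = "frag_extend (\<lambda>t. frag_of (map2 bfun fs t)) c" and ?e = "frag_extend (\<lambda>t. frag_of (map2 bfun gs t)) e"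
      have x: "?x \<in> carrier (timesR (map bdom fs))" and y: "?y \<in> carrier (timesR (map bdom gs))"
        using times_of_closed[OF bim(1) ne(1) c] times_of_closed[OF bim(2) ne(2) e] .
      have p: "pure (timesR (map bdom fs)) (timesR (map bdom gs)) ?x ?y \<in> carrier (tens (timesR (map bdom fs)) (timesR (map bdom gs)))"
        by (rule pure_closed[OF bimodule_timesR[OF bim(1)] bimodule_timesR[OF bim(2)] x y])
      have ce: "?c \<in> takeuchi (map bcod fs)" "?e \<in> takeuchi (map bcod gs)"
        using transports_takeuchi[OF transports_map[OF fs False] c] transports_takeuchi[OF transports_map[OF gs ne(5)] e] .
      note i = interchange_takeuchi[OF bim(1,2) len'(1) c e]
      have "interchange (map bcod fs) (map bcod gs) ?c ?e
          = frag_extend (\<lambda>t. frag_of (map2 bfun ?hs t)) (interchange (map bdom fs) (map bdom gs) c e)"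
        unfolding interchange_frag_extend frag_extend_interchange interchange_frag_of
      proof (rule frag_extend_eq2[OF takeuchiD(1)[OF c] takeuchiD(1)[OF e]])
        fix t v assume t: "t \<in> tuples (map bdom fs)" and v: "v \<in> tuples (map bdom gs)"
        have "map2 bfun ?hs (pures (map bdom fs) (map bdom gs) t v) = pures (map bcod fs) (map bcod gs) (map2 bfun fs t) (map2 bfun gs v)"
          by (rule map_pures) (use len tuples_length[OF t] tuples_length[OF v] tuples_nth[OF t] tuples_nth[OF v] tens_map_pure[OF h] in simp_all)
        then show "frag_of (pures (map bcod fs) (map bcod gs) (map2 bfun fs t) (map2 bfun gs v))
            = frag_of (map2 bfun ?hs (pures (map bdom fs) (map bdom gs) t v))" by simp
      qed
      then show "bfun (chi_map (map bcod fs) (map bcod gs) \<cdot> (times_map fs \<boxdot>\<^bsub>Bimod\<^esub> times_map gs))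
          (pure (timesR (map bdom fs)) (timesR (map bdom gs)) ?x ?y)
        = bfun (times_map ?hs \<cdot> chi_map (map bdom fs) (map bdom gs)) (pure (timesR (map bdom fs)) (timesR (map bdom gs)) ?x ?y)"
        using comp_apply[OF FG p] comp_apply[OF C p] tens_map_pure[OF F G x y] times_map_times_of[OF fs False c] times_map_times_of[OF gs ne(5) e]
          chi_interchange[OF bim(3,4) len'(2) ne(3) ce] chi_interchange[OF bim(1,2) len'(1) ne(1) c e]
          times_map_times_of[OF hs ne(6), unfolded d, OF i]
        by simp
    qed
  qed
qed

text \<open>On tuples the law is the associator on pure tensors in each slot; with no factors it is
  associativity of composition in End(R).\<close>

lemma chi_assoc:
  assumes Ms: "bimods (Ms :: ('r, 'u) bimod list)" and Ns: "bimods Ns" and Ps: "bimods Ps"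
    and len: "length Ns = length Ms" "length Ps = length Ms"
  shows "times_map (map (\<lambda>(M, N, P). asc Bimod M N P) (zip Ms (zip Ns Ps))) \<cdot> chi_map (map2 tens Ms Ns) Ps
      \<cdot> (chi_map Ms Ns \<boxdot>\<^bsub>Bimod\<^esub> bimod_id (timesR Ps))
    = chi_map Ms (map2 tens Ns Ps) \<cdot> (bimod_id (timesR Ms) \<boxdot>\<^bsub>Bimod\<^esub> chi_map Ns Ps)
      \<cdot> asc Bimod (timesR Ms) (timesR Ns) (timesR Ps)"
    (is "times_map ?as \<cdot> _ = _")
proof -
  let ?Ts = "map2 tens Ms Ns" and ?Us = "map2 tens Ns Ps"
  have len2: "length Ps = length Ns" "length Ps = length ?Ts" "length ?Us = length Ms" using len by simp_all
  note Ts = bimods_tens[OF Ms Ns len(1)] and Us = bimods_tens[OF Ns Ps len2(1)]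
  note tM = bimodule_timesR[OF Ms] and tN = bimodule_timesR[OF Ns] and tP = bimodule_timesR[OF Ps]
  have ai: "asc Bimod (Ms ! i) (Ns ! i) (Ps ! i) \<in> bimod_Hom (tens (tens (Ms ! i) (Ns ! i)) (Ps ! i)) (tens (Ms ! i) (tens (Ns ! i) (Ps ! i)))"
    if "i < length Ms" for i
    using asc_Hom[of "Ms ! i" "Ns ! i" "Ps ! i"] Ms Ns Ps len that by simp
  have as: "\<forall>f\<in>set ?as. f \<in> Arr bimod_moncat"
  proof
    fix k assume "k \<in> set ?as"
    then obtain i where "i < length Ms" "k = asc Bimod (Ms ! i) (Ns ! i) (Ps ! i)" using len by (auto simp: in_set_conv_nth)
    then show "k \<in> Arr bimod_moncat" using Hom_Arr[OF ai[of i]] by (simp del: bimod_moncat_simps)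
  qed
  have d: "map bdom ?as = map2 tens ?Ts Ps" "map bcod ?as = map2 tens Ms ?Us"
    using len bimod_HomD(3,4)[OF ai] by (auto intro!: nth_equalityI)
  note A = times_map_Hom[OF as, unfolded d]
  note C1 = chi_Hom[OF Ms Ns len(1)] and C2 = chi_Hom[OF Ts Ps len2(2)] and C3 = chi_Hom[OF Ns Ps len2(1)] and C4 = chi_Hom[OF Ms Us len2(3)]
  note I1 = tens_map_Hom[OF C1 bimod_id_Hom[OF tP]] and I2 = tens_map_Hom[OF bimod_id_Hom[OF tM] C3]
  note AA = asc_Hom[OF tM tN tP]
  note IC = comp_Hom[OF I1 C2] and AI = comp_Hom[OF AA I2]
  note L = comp_Hom[OF IC A] and L' = comp_Hom[OF AI C4]
  show ?thesis
  proof (rule tens3_Hom_eqI[OF tM tN tP L L'])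
    fix x y z assume x: "x \<in> carrier (timesR Ms)" and y: "y \<in> carrier (timesR Ns)" and z: "z \<in> carrier (timesR Ps)"
    note xy = pure_closed[OF tM tN x y] and yz = pure_closed[OF tN tP y z]
    note xyz = pure_closed[OF bimodule_tens[OF tM tN] tP xy z] and xyz' = pure_closed[OF tM bimodule_tens[OF tN tP] x yz]
    note cl1 = bimod_HomD(6)[OF C1 xy] and cl3 = bimod_HomD(6)[OF C3 yz]
    note cl = pure_closed[OF bimodule_timesR[OF Ts] tP cl1 z]
    have "bfun (times_map ?as) (bfun (chi_map ?Ts Ps) (pure (timesR ?Ts) (timesR Ps) (bfun (chi_map Ms Ns) (pure (timesR Ms) (timesR Ns) x y)) z))
      = bfun (chi_map Ms ?Us) (pure (timesR Ms) (timesR ?Us) x (bfun (chi_map Ns Ps) (pure (timesR Ns) (timesR Ps) y z)))"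
    proof (cases "Ms = []")
      case True
      then have e: "Ns = []" "Ps = []" using len by simp_all
      have [simp]: "x \<in> carrier End" "y \<in> carrier End" "z \<in> carrier End"
        using x y z True e by simp_all
      have "end_comp (end_comp x y) z = end_comp x (end_comp y z)"
        by (rule end_eqI) (simp_all add: end_comp)
      then show ?thesis
        by (simp add: True e chi_Nil(2) end_comp(1) times_map_def)
    next
      case False
      then have ne: "Ms \<noteq> []" "Ns \<noteq> []" "Ps \<noteq> []" "?Ts \<noteq> []" "?Us \<noteq> []" "?as \<noteq> []" using len by (auto simp: zip_eq_Nil_iff)
      obtain c k e where c: "c \<in> takeuchi Ms" "x = times_of Ms c" and k: "k \<in> takeuchi Ns" "y = times_of Ns k"
        and e: "e \<in> takeuchi Ps" "z = times_of Ps e"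
        using times_cases[OF Ms ne(1) x] times_cases[OF Ns ne(2) y] times_cases[OF Ps ne(3) z] by metis
      note i1 = interchange_takeuchi[OF Ms Ns len(1) c(1) k(1)] and i3 = interchange_takeuchi[OF Ns Ps len2(1) k(1) e(1)]
      note i2 = interchange_takeuchi[OF Ts Ps len2(2) i1 e(1)]
      have "frag_extend (\<lambda>t. frag_of (map2 bfun ?as t)) (interchange ?Ts Ps (interchange Ms Ns c k) e)
          = interchange Ms ?Us c (interchange Ns Ps k e)"
        unfolding interchange_def frag_extend_compose frag_extend_of
      proof (rule frag_extend_eq2[OF takeuchiD(1)[OF c(1)] takeuchiD(1)[OF k(1)]], rule frag_extend_eq)
        fix t v w assume t: "t \<in> tuples Ms" and v: "v \<in> tuples Ns" and "w \<in> Poly_Mapping.keys e"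
        then have w: "w \<in> tuples Ps" using takeuchiD(1)[OF e(1)] by auto
        have "map2 bfun ?as (pures ?Ts Ps (pures Ms Ns t v) w) = pures Ms ?Us t (pures Ns Ps v w)"
        proof (rule map_pures)
          fix i assume "i < length ?Ts"
          then have i: "i < length Ms" by simp
          have "bimodule (Ms ! i)" "bimodule (Ns ! i)" "bimodule (Ps ! i)" using Ms Ns Ps len i by simp_all
          note a = asc_pure[OF this, of "t ! i" "v ! i" "w ! i"]
          show "bfun (?as ! i) (pure (?Ts ! i) (Ps ! i) (pures Ms Ns t v ! i) (w ! i)) = pures Ms ?Us t (pures Ns Ps v w) ! i"
            using i len a tuples_nth[OF t] tuples_nth[OF v] tuples_nth[OF w] by simp
        qed (use len in simp_all)
        then show "frag_of (map2 bfun ?as (pures ?Ts Ps (pures Ms Ns t v) w)) = frag_of (pures Ms ?Us t (pures Ns Ps v w))" by simp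
      qed
      then show ?thesis
        unfolding c(2) k(2) e(2) chi_interchange[OF Ms Ns len(1) ne(1) c(1) k(1)] chi_interchange[OF Ns Ps len2(1) ne(2) k(1) e(1)]
          chi_interchange[OF Ts Ps len2(2) ne(4) i1 e(1)] chi_interchange[OF Ms Us len2(3) ne(1) c(1) i3]
          times_map_times_of[OF as ne(6), unfolded d, OF i2]
        by simp
    qed
    then show "bfun (times_map ?as \<cdot> chi_map ?Ts Ps \<cdot> (chi_map Ms Ns \<boxdot>\<^bsub>Bimod\<^esub> bimod_id (timesR Ps)))
        (pure (tens (timesR Ms) (timesR Ns)) (timesR Ps) (pure (timesR Ms) (timesR Ns) x y) z)
      = bfun (chi_map Ms ?Us \<cdot> (bimod_id (timesR Ms) \<boxdot>\<^bsub>Bimod\<^esub> chi_map Ns Ps)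
        \<cdot> asc Bimod (timesR Ms) (timesR Ns) (timesR Ps))
        (pure (tens (timesR Ms) (timesR Ns)) (timesR Ps) (pure (timesR Ms) (timesR Ns) x y) z)"
      unfolding comp_apply[OF IC xyz] comp_apply[OF I1 xyz] comp_apply[OF AI xyz] comp_apply[OF AA xyz] asc_pure[OF tM tN tP x y z]
        tens_map_pure[OF C1 bimod_id_Hom[OF tP] xy z] tens_map_pure[OF bimod_id_Hom[OF tM] C3 x yz]
        bimod_id_sel(3)[OF z] bimod_id_sel(3)[OF x] .
  qed
qed


section \<open>Bimodule maps out of R^e and the unit laws\<close>

subsection \<open>The maps out of the enveloping ring\<close>


lemma env_Hom_eqI:
  assumes "f \<in> bimod_Hom Env M" "g \<in> bimod_Hom Env M"
    and "bfun f (env_el 1 (1 :: 'r)) = bfun g (env_el 1 (1 :: 'r))"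
  shows "f = g"
  using arr_eqI[OF assms(1,2)] env_bimod_hom_eqI[OF bimod_HomD(2)[OF assms(1)] bimod_HomD(5)[OF assms(1)] bimod_HomD(5)[OF assms(2)] assms(3)]
  by blast

text \<open>The map acts on \<open>q\<close> from the left by the two components \<open>a\<close>
  and \<open>b\<close>. It respects the left actions for every \<open>q\<close>; centrality turns
  right scalars into left ones.\<close>

lemma env_Hom_exists:
  assumes M: "bimodule (M :: ('r, 'u) bimod)" and q: "q \<in> carrier M"
    and central: "\<And>s. ract M q s = lact M s q" "\<And>s. rbar M q s = lbar M s q"
  obtains f where "f \<in> bimod_Hom Env M" "bfun f (env_el 1 (1 :: 'r)) = q"
proof -
  interpret M: bimodule M by (rule M)
  let ?\<phi> = "\<lambda>t. lact M (t ! 0) (lbar M (t ! 1) q)"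
  define F where "F x = evaluate M ?\<phi> (env_rep x)" for x :: 'u
  note lb = M.closed(2)[OF q]
  have ev: "F \<in> hom Env M" "F (env_el a b :: 'u) = lact M a (lbar M b q)" for a b :: 'r
    using env_evaluate[OF M.comm_group_axioms, of ?\<phi>] lb by (simp_all add: F_def[abs_def] M.closed M.scalar_additive M.additive q)
  have G: "group M" by (rule bimodule_group[OF M])
  note E = bimodule_homs[OF bimodule_env] and homs = bimodule_homs[OF M]
  have "F \<in> bimod_hom env M"
  proof (rule bimod_homI[OF ev(1)])
    fix x s assume x: "x \<in> carrier Env"
    show "F (lact env s x) = lact M s (F x)"
      by (rule env_hom_eqI[OF G hom_comp[OF E(1) ev(1)] hom_comp[OF ev(1) homs(1)] _ x])
        (simp add: env_el_act ev(2) M.act_mult lb)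
    show "F (lbar env s x) = lbar M s (F x)"
      by (rule env_hom_eqI[OF G hom_comp[OF E(2) ev(1)] hom_comp[OF ev(1) homs(2)] _ x])
        (simp add: env_el_act ev(2) M.act_mult lb M.commuting q M.closed)
    show "F (ract env x s) = ract M (F x) s"
      by (rule env_hom_eqI[OF G hom_comp[OF E(3) ev(1)] hom_comp[OF ev(1) homs(3)] _ x])
        (simp add: env_el_act ev(2) M.act_mult lb M.commuting q M.closed central flip: M.commuting)
    show "F (rbar env x s) = rbar M (F x) s"
      by (rule env_hom_eqI[OF G hom_comp[OF E(4) ev(1)] hom_comp[OF ev(1) homs(4)] _ x])
        (simp add: env_el_act ev(2) M.act_mult lb M.commuting q M.closed central flip: M.commuting)
  qed
  note H = mk_arr_Hom[OF bimodule_env M this]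
  show ?thesis
    by (rule that[OF H]) (simp add: env_el_closed ev(2) M.unital q)
qed

lemma bimods_env: "bimods (replicate n Env)"
  using bimodule_env by simp

text \<open>On \<open>(1, 1)\<close> left and right scalars agree, so the Takeuchi condition for
  this tuple is a balancing relation.\<close>

lemma env_ones:
  fixes n :: nat
  defines "Es \<equiv> replicate n Env" and "os \<equiv> replicate n (env_el 1 (1 :: 'r)) :: 'u list"
  shows "os \<in> tuples Es" "frag_of os \<in> takeuchi Es"
proof -
  show os: "os \<in> tuples Es" by (simp add: Es_def os_def tuples_def env_el_closed)
  have "apply_slot j (\<lambda>m. rbar (Es ! j) m s) (frag_of os) - apply_slot (Suc j) (\<lambda>m. ract (Es ! Suc j) m s) (frag_of os) \<in> rels Es"
    if "Suc j < length Es" for j s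
    using rels_nth(2)[OF os that, of s] that by (simp add: Es_def os_def env_el_act)
  with os show "frag_of os \<in> takeuchi Es" by (simp add: takeuchi_def)
qed

definition w_value :: "nat \<Rightarrow> 'u" where
  "w_value n = (if n = 0 then end_enc (id :: 'r \<Rightarrow> 'r)
     else times_of (replicate n Env) (frag_of (replicate n (env_el 1 (1 :: 'r)))))"

text \<open>Resolves the definite description in \<open>w_map\<close>: the prescribed image of
  \<open>(1, 1)\<close> is central, which gives existence. For \<open>n = 0\<close> this says that s
  acts on the identity endomorphism equally from both sides.\<close>

lemma w_arrow:
  shows "w_map n \<in> bimod_Hom Env (timesR (replicate n env))"
    and "bfun (w_map n :: ('r, 'u) bimod_arr) (env_el 1 (1 :: 'r)) = w_value n"
proof -
  let ?Es = "replicate n Env" and ?one = "env_el 1 (1 :: 'r) :: 'u"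
  have "w_value n \<in> carrier (timesR ?Es) \<and> (\<forall>s. ract (timesR ?Es) (w_value n) s = lact (timesR ?Es) s (w_value n)
      \<and> rbar (timesR ?Es) (w_value n) s = lbar (timesR ?Es) s (w_value n))"
  proof (cases "n = 0")
    case True
    interpret E: bimodule "End" by (rule bimodule_End)
    have "id \<in> hom ring_group (ring_group :: 'r monoid)" by (rule homI) simp_all
    note id = end_enc_closed[OF this]
    then show ?thesis
      using True by (auto simp: w_value_def intro!: end_eqI E.closed simp: end_dec_simps)
  next
    case False
    then have ne: "?Es \<noteq> []" and l: "0 < length ?Es" "length ?Es - 1 < length ?Es" by auto
    note c = env_ones(2)[of n]
    have n: "?Es ! 0 = env" "?Es ! (length ?Es - 1) = env"
      "replicate n ?one ! 0 = ?one" "replicate n ?one ! (length ?Es - 1) = ?one"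
      using l by simp_all
    show ?thesis
      using False times_of_closed[OF bimods_env ne c]
      by (simp only: w_value_def if_False times_of_act[OF bimods_env ne c] apply_slot_of n) (simp add: env_el_act)
  qed
  then obtain f where f: "f \<in> bimod_Hom env (timesR ?Es)" "bfun f ?one = w_value n"
    using env_Hom_exists[OF bimodule_timesR[OF bimods_env]] by metis
  have eq: "(if n = 0 then end_enc (id :: 'r \<Rightarrow> 'r)
        else times_of ?Es (frag_of (replicate n (env_one TYPE('r))))) = w_value n"
    by (simp add: w_value_def env_one_el)
  have "w_map n = f"
    unfolding w_map_def eq Hom_bimod
  proof (rule the_equality)
    show "f \<in> bimod_Hom env (timesR ?Es) \<and> bfun f (env_one TYPE('r)) = w_value n"
      using f by (simp add: env_one_el)
    fix g assume "g \<in> bimod_Hom env (timesR ?Es) \<and> bfun g (env_one TYPE('r)) = w_value n"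
    then show "g = f" using env_Hom_eqI[OF _ f(1), of g] f(2) by (simp add: env_one_el)
  qed
  then show "w_map n \<in> bimod_Hom Env (timesR ?Es)" "bfun (w_map n :: ('r, 'u) bimod_arr) ?one = w_value n"
    using f by simp_all
qed

text \<open>A shuffle with copies of \<open>(1, 1)\<close> puts \<open>(1, 1)\<close> next to every
  entry, and the unitors in the slots remove it again. With no factors, the law says that the
  identity endomorphism is neutral for composition.\<close>

lemma chi_env:
  assumes Ms: "bimods (Ms :: ('r, 'u) bimod list)"
  defines "Es \<equiv> replicate (length Ms) Env"
  shows "times_map (map (lun Bimod) Ms) \<cdot> chi_map Es Ms \<cdot> (w_map (length Ms) \<boxdot>\<^bsub>Bimod\<^esub> bimod_id (timesR Ms))
      = lun Bimod (timesR Ms)" (is "times_map ?ls \<cdot> _ = _")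
    and "times_map (map (run Bimod) Ms) \<cdot> chi_map Ms Es \<cdot> (bimod_id (timesR Ms) \<boxdot>\<^bsub>Bimod\<^esub> w_map (length Ms))
      = run Bimod (timesR Ms)" (is "times_map ?rs \<cdot> _ = _")
proof -
  let ?one = "env_el 1 (1 :: 'r) :: 'u"
  interpret T: bimodule "timesR Ms" by (rule bimodule_timesR[OF Ms])
  note tM = bimodule_timesR[OF Ms]
  have Es: "bimods Es" unfolding Es_def by (rule bimods_env)
  note tE = bimodule_timesR[OF Es] and E1 = env_el_closed[of 1 "1 :: 'r"]
  have len: "length Ms = length Es" "length Es = length Ms" by (simp_all add: Es_def)
  have nth: "Es ! i = env" "bimodule (Ms ! i)" if "i < length Ms" for i using that Ms by (simp_all add: Es_def)
  note li = lun_Hom[OF nth(2)] and ri = run_Hom[OF nth(2)]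
  have fs: "\<forall>f\<in>set ?ls. f \<in> Arr bimod_moncat" "\<forall>f\<in>set ?rs. f \<in> Arr bimod_moncat"
    using Hom_Arr[OF lun_Hom] Hom_Arr[OF run_Hom] Ms by (auto simp del: bimod_moncat_simps)
  have d: "map bdom ?ls = map2 tens Es Ms" "map bcod ?ls = Ms" "map bdom ?rs = map2 tens Ms Es" "map bcod ?rs = Ms"
    using bimod_HomD(3,4)[OF li] bimod_HomD(3,4)[OF ri] len(2) nth(1) by (auto intro!: nth_equalityI)
  note w = w_arrow[of "length Ms", folded Es_def]
  note A = times_map_Hom[OF fs(1), unfolded d] and B = times_map_Hom[OF fs(2), unfolded d]
  note C = chi_Hom[OF Es Ms len(1)] and D = chi_Hom[OF Ms Es len(2)]
  note WI = tens_map_Hom[OF w(1) bimod_id_Hom[OF tM]] and IW = tens_map_Hom[OF bimod_id_Hom[OF tM] w(1)]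
  note L = comp_Hom[OF comp_Hom[OF WI C] A] and R = comp_Hom[OF comp_Hom[OF IW D] B]
  have wv: "w_value (length Ms) \<in> carrier (timesR Es)" using bimod_HomD(6)[OF w(1) E1] w(2) by simp
  have main: "bfun (times_map ?ls) (bfun (chi_map Es Ms) (pure (timesR Es) (timesR Ms) (w_value (length Ms)) m)) = m
      \<and> bfun (times_map ?rs) (bfun (chi_map Ms Es) (pure (timesR Ms) (timesR Es) m (w_value (length Ms)))) = m"
    if m: "m \<in> carrier (timesR Ms)" for m
  proof (cases "Ms = []")
    case True
    have m': "m \<in> carrier End" using m True by simp
    have wv': "w_value 0 \<in> carrier End" "end_dec (w_value 0) = (id :: 'r \<Rightarrow> 'r)"
      using end_enc_closed[of "id :: 'r \<Rightarrow> 'r"] by (simp_all add: w_value_def hom_def)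
    have "end_comp (w_value 0) m = m" "end_comp m (w_value 0) = m"
      by (rule end_eqI; simp add: m' wv' end_comp)+
    then show ?thesis using True by (simp add: Es_def chi_Nil(2) m' wv' times_map_def)
  next
    case False
    then have ne: "Ms \<noteq> []" "Es \<noteq> []" "?ls \<noteq> []" "?rs \<noteq> []" by (auto simp: Es_def)
    obtain c where c: "c \<in> takeuchi Ms" "m = times_of Ms c" using times_cases[OF Ms False m] by blast
    note o = env_ones[of "length Ms", folded Es_def]
    have wo: "w_value (length Ms) = times_of Es (frag_of (replicate (length Ms) ?one))" using False by (simp add: w_value_def Es_def)
    note i = interchange_takeuchi[OF Es Ms len(1) o(2) c(1)] and j = interchange_takeuchi[OF Ms Es len(2) c(1) o(2)]
    have t: "map2 bfun ?ls (pures Es Ms (replicate (length Ms) ?one) t) = t"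
      "map2 bfun ?rs (pures Ms Es t (replicate (length Ms) ?one)) = t" if "t \<in> tuples Ms" for t
      using that tuples_length[OF that] tuples_nth[OF that] lun_pure[OF nth(2), where a = "1 :: 'r" and b = "1 :: 'r"]
        bimodule.unital[OF nth(2)] bimodule.closed[OF nth(2)]
      by (intro map_pures; simp add: Es_def)+
    have "frag_extend (\<lambda>t. frag_of (map2 bfun ?ls t)) (interchange Es Ms (frag_of (replicate (length Ms) ?one)) c) = frag_extend frag_of c"
      "frag_extend (\<lambda>t. frag_of (map2 bfun ?rs t)) (interchange Ms Es c (frag_of (replicate (length Ms) ?one))) = frag_extend frag_of c"
      unfolding frag_extend_interchange frag_extend_of
      by (rule frag_extend_eq, use takeuchiD(1)[OF c(1)] t in \<open>simp add: subset_iff\<close>)+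
    then show ?thesis
      unfolding c(2) wo chi_interchange[OF Es Ms len(1) ne(2) o(2) c(1)] chi_interchange[OF Ms Es len(2) ne(1) c(1) o(2)]
        times_map_times_of[OF fs(1) ne(3), unfolded d, OF i] times_map_times_of[OF fs(2) ne(4), unfolded d, OF j]
      by simp
  qed
  show "times_map ?ls \<cdot> chi_map Es Ms \<cdot> (w_map (length Ms) \<boxdot>\<^bsub>Bimod\<^esub> bimod_id (timesR Ms)) = lun Bimod (timesR Ms)"
  proof (rule tens_env_Hom_eqI[OF tM L lun_Hom[OF tM]])
    fix m assume m: "m \<in> carrier (timesR Ms)"
    note p = pure_closed[OF bimodule_env tM E1 m]
    show "bfun (times_map ?ls \<cdot> chi_map Es Ms \<cdot> (w_map (length Ms) \<boxdot>\<^bsub>Bimod\<^esub> bimod_id (timesR Ms))) (pure env (timesR Ms) ?one m)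
      = bfun (lun Bimod (timesR Ms)) (pure env (timesR Ms) ?one m)"
      unfolding comp_apply[OF comp_Hom[OF WI C] p] comp_apply[OF WI p] tens_map_pure[OF w(1) bimod_id_Hom[OF tM] E1 m] w(2) bimod_id_sel(3)[OF m]
        lun_pure(1)[OF tM m] using main[OF m] m by (simp add: T.unital)
  qed
  show "times_map ?rs \<cdot> chi_map Ms Es \<cdot> (bimod_id (timesR Ms) \<boxdot>\<^bsub>Bimod\<^esub> w_map (length Ms)) = run Bimod (timesR Ms)"
  proof (rule tens_env_Hom_eqI'[OF tM R run_Hom[OF tM]])
    fix m assume m: "m \<in> carrier (timesR Ms)"
    note p = pure_closed[OF tM bimodule_env m E1]
    show "bfun (times_map ?rs \<cdot> chi_map Ms Es \<cdot> (bimod_id (timesR Ms) \<boxdot>\<^bsub>Bimod\<^esub> w_map (length Ms))) (pure (timesR Ms) env m ?one)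
      = bfun (run Bimod (timesR Ms)) (pure (timesR Ms) env m ?one)"
      unfolding comp_apply[OF comp_Hom[OF IW D] p] comp_apply[OF IW p] tens_map_pure[OF bimod_id_Hom[OF tM] w(1) m E1] w(2) bimod_id_sel(3)[OF m]
        lun_pure(2)[OF tM m] using main[OF m] m by (simp add: T.unital)
  qed
qed

lemma lax_monoidal_functor_times:
  "lax_monoidal_functor (power_moncat Bimod n) Bimod timesR times_map chi_map (w_map n)"
proof (intro lax_monoidal_functor.intro lax_monoidal_functor_axioms.intro monoidal_category_power monoidal_category_bimod)
  show "cat_functor (power_moncat Bimod n) Bimod timesR times_map"
  proof -
    interpret F: cat_functor "power_cat Bimod n" Bimod timesR times_map by (rule lam_functor_times)
    interpret P: monoidal_category "power_moncat Bimod n" by (rule monoidal_category_power[OF monoidal_category_bimod])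
    show ?thesis
      by (intro cat_functor.intro P.category_axioms category_bimod cat_functor_axioms.intro)
        (use F.FO_Obj F.FM_Hom F.FM_Idn F.FM_Comp in \<open>simp_all del: bimod_moncat_simps Hom_bimod\<close>)
  qed
next
  fix Ms Ns assume "Ms \<in> Obj (power_moncat Bimod n)" "Ns \<in> Obj (power_moncat Bimod n)"
  then have *: "bimods Ms" "bimods Ns" "length Ns = length Ms" by auto
  show "chi_map Ms Ns \<in> Hom Bimod (timesR Ms \<boxtimes>\<^bsub>Bimod\<^esub> timesR Ns) (timesR (Ms \<boxtimes>\<^bsub>power_moncat Bimod n\<^esub> Ns))"
    using chi_Hom[OF *] by simp
next
  fix fs gs Ms Ms' Ns Ns'
  assume "fs \<in> Hom (power_moncat Bimod n) Ms Ms'" "gs \<in> Hom (power_moncat Bimod n) Ns Ns'"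
  then have "\<forall>f\<in>set fs. f \<in> Arr bimod_moncat" "\<forall>f\<in>set gs. f \<in> Arr bimod_moncat" "length gs = length fs"
    and d: "Ms = map bdom fs" "Ms' = map bcod fs" "Ns = map bdom gs" "Ns' = map bcod gs"
    by (auto simp: Hom_def power_cat_def)
  from chi_natural[OF this(1-3)]
  show "chi_map Ms' Ns' \<cdot> (times_map fs \<boxdot>\<^bsub>Bimod\<^esub> times_map gs)
      = times_map (fs \<boxdot>\<^bsub>power_moncat Bimod n\<^esub> gs) \<cdot> chi_map Ms Ns"
    by (simp add: d)
next
  show "w_map n \<in> Hom Bimod (munit Bimod) (timesR (munit (power_moncat Bimod n)))"
    using w_arrow(1)[of n] by simp
next
  fix Ms Ns Ps assume "Ms \<in> Obj (power_moncat Bimod n)" "Ns \<in> Obj (power_moncat Bimod n)" "Ps \<in> Obj (power_moncat Bimod n)"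
  then have *: "bimods Ms" "bimods Ns" "bimods Ps" "length Ns = length Ms" "length Ps = length Ms" by auto
  show "times_map (asc (power_moncat Bimod n) Ms Ns Ps) \<cdot> chi_map (Ms \<boxtimes>\<^bsub>power_moncat Bimod n\<^esub> Ns) Ps
      \<cdot> (chi_map Ms Ns \<boxdot>\<^bsub>Bimod\<^esub> Idn Bimod (timesR Ps))
    = chi_map Ms (Ns \<boxtimes>\<^bsub>power_moncat Bimod n\<^esub> Ps) \<cdot> (Idn Bimod (timesR Ms) \<boxdot>\<^bsub>Bimod\<^esub> chi_map Ns Ps)
      \<cdot> asc Bimod (timesR Ms) (timesR Ns) (timesR Ps)"
    using chi_assoc[OF *] by simp
next
  fix Ms assume "Ms \<in> Obj (power_moncat Bimod n)"
  then have Ms: "bimods Ms" and n: "n = length Ms" by auto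
  show "times_map (lun (power_moncat Bimod n) Ms) \<cdot> chi_map (munit (power_moncat Bimod n)) Ms
      \<cdot> (w_map n \<boxdot>\<^bsub>Bimod\<^esub> Idn Bimod (timesR Ms)) = lun Bimod (timesR Ms)"
    using chi_env(1)[OF Ms] by (simp add: n)
  show "times_map (run (power_moncat Bimod n) Ms) \<cdot> chi_map Ms (munit (power_moncat Bimod n))
      \<cdot> (Idn Bimod (timesR Ms) \<boxdot>\<^bsub>Bimod\<^esub> w_map n) = run Bimod (timesR Ms)"
    using chi_env(2)[OF Ms] by (simp add: n)
qed


section \<open>Interchange maps and units against associators and unitors\<close>

subsection \<open>Compatibility of the interchange maps with the associators\<close>


lemma map_ids_Hom:
  assumes bim: "bimods (Xs :: ('r, 'u) bimod list)" "bimods Zs" and f: "f \<in> bimod_Hom M N"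
  shows "\<forall>g\<in>set (map bimod_id Xs @ f # map bimod_id Zs). g \<in> Arr bimod_moncat"
    and "map bdom (map bimod_id Xs @ f # map bimod_id Zs) = Xs @ M # Zs"
    and "map bcod (map bimod_id Xs @ f # map bimod_id Zs) = Xs @ N # Zs"
  using Hom_Arr[OF f] bim bimod_HomD(3,4)[OF f]
  by (auto simp del: bimod_moncat_simps intro: bimod_id_Arr simp: map_idI)

lemma map2_bfun_ids:
  assumes "ms \<in> tuples Xs" "ps \<in> tuples Zs"
  shows "map2 bfun (map bimod_id Xs @ f # map bimod_id Zs) (ms @ y # ps) = ms @ bfun f y # ps"
  using map2_bfun_id[OF assms(1)] map2_bfun_id[OF assms(2)] tuples_length[OF assms(1)] tuples_length[OF assms(2)] by simp

lemma times_of_eqI_mod: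
  assumes "bimods (Ns :: ('r, 'u) bimod list)" "Ns \<noteq> []" "c \<in> takeuchi Ns" "d \<in> takeuchi Ns" "c - d \<in> rels Ns"
  shows "times_of Ns c = times_of Ns d"
  using assms by (simp add: times_of_eq_iff)

context
  fixes Xs Ys Zs Xs' Ys' Zs' :: "('r, 'u) bimod list"
  assumes bim: "bimods Xs" "bimods Ys" "bimods Zs" and bim': "bimods Xs'" "bimods Ys'" "bimods Zs'"
    and len: "length Xs' = length Xs" "length Ys' = length Ys" "length Zs' = length Zs"
begin

private abbreviation "T \<equiv> Xs @ Ys @ Zs"
private abbreviation "T' \<equiv> Xs' @ Ys' @ Zs'"
private abbreviation "S \<equiv> map2 tens Xs Xs' @ map2 tens Ys Ys' @ map2 tens Zs Zs'"

private lemma bT: "bimods T" "bimods T'"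
  using bim bim' by auto

private lemma S_eq: "map2 tens T T' = S"
  using len by simp

private lemma bS: "bimods S" "bimods (map2 tens Xs Xs')" "bimods (map2 tens Ys Ys')" "bimods (map2 tens Zs Zs')"
  using bimods_tens[OF bim(1) bim'(1) len(1)] bimods_tens[OF bim(2) bim'(2) len(2)] bimods_tens[OF bim(3) bim'(3) len(3)]
  by auto

lemma pures_middle:
  assumes "length ms = length Xs" "length ms' = length Xs" "length a = length Ys" "length b = length Ys"
  shows "pures T T' (ms @ a @ ps) (ms' @ b @ ps') = pures Xs Xs' ms ms' @ pures Ys Ys' a b @ pures Zs Zs' ps ps'"
  using assms len by (simp add: pures_append)

text \<open>Over fixed entries \<open>v\<close> of the second factor, contracting \<open>\<phi>(1)\<close> and \<open>\<psi>(1)\<close> separately agrees with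
  contracting \<open>(\<phi> \<circ> \<psi>)(1) = \<phi>(\<psi>(1))\<close> because of the Takeuchi condition for the scalar \<open>\<psi>(1)\<close>.\<close>

lemma interchange_contract:
  assumes Ys: "Ys = []" and ne: "Xs @ Zs \<noteq> []" and c: "c \<in> takeuchi (Xs @ timesR [] # Zs)"
    and v: "v \<in> tuples (Xs' @ timesR [] # Zs')"
  shows "frag_extend (\<lambda>t. interchange T T' (insertion Xs [] Zs t) (insertion Xs' [] Zs' v)) c
    - frag_extend (\<lambda>t. insertion (map2 tens Xs Xs') [] (map2 tens Zs Zs')
        (pures Xs Xs' (take (length Xs) t) (take (length Xs) v) @ end_comp (t ! length Xs) (v ! length Xs)
          # pures Zs Zs' (drop (Suc (length Xs)) t) (drop (Suc (length Xs)) v))) c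
    \<in> rels S"
proof -
  have Ys': "Ys' = []" using Ys len by simp
  obtain ms' z ps' where v: "v = ms' @ z # ps'" "ms' \<in> tuples Xs'" "z \<in> carrier End"
      "ps' \<in> tuples Zs'" "length ms' = length Xs'"
    using v by (rule tuples_middleE)
  let ?s = "end_dec z 1 :: 'r" and ?L = "Xs @ timesR [] # Zs" and ?f = "insertion Xs [] Zs"
  note R = diff_closed_rels[OF bS(1)] and cs = takeuchiD(1)[OF c]
  have L: "bimods ?L" using bim bimodule_End by auto
  have bXZ: "bimods (Xs @ Zs)" using bim by auto
  have "balanced_on (Xs @ timesR [] # Zs) (rels (Xs @ [] @ Zs)) ?f"
    using transports_insertion[OF bim(1) _ bim(3), of "[]"] ne by (simp add: transports_def)
  then have bal: "frag_extend ?f (apply_slot j (\<lambda>m. rbar (?L ! j) m ?s) c) - frag_extend ?f (apply_slot (Suc j) (\<lambda>m. ract (?L ! Suc j) m ?s) c)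
      \<in> rels (Xs @ Zs)" if "Suc j < length ?L" for j
    using frag_extend_rels[OF L diff_closed_rels[OF bXZ] _ takeuchiD(2)[OF c that]] by (simp add: frag_extend_diff)
  have len0: "length T' = length T" using len by simp
  \<comment> \<open>Shuffling against the fixed tuple \<open>x\<close> is balanced in the first
    argument, so a congruence found after contraction in the first argument passes to the
    target.\<close>
  have pbal: "frag_extend (\<lambda>t. frag_of (pures T T' t x)) d \<in> rels S" if "d \<in> rels (Xs @ Zs)" "x \<in> tuples (Xs' @ Zs')" for d x
  proof -
    have "d \<in> rels T" "x \<in> tuples T'" using that Ys Ys' by simp_all
    from frag_extend_rels[OF bT(1) R[folded S_eq] pures_balanced_left[OF bT len0 this(2)] this(1)]
    show ?thesis unfolding S_eq .
  qed
  let ?Y = "\<lambda>t. insertion (map2 tens Xs Xs') [] (map2 tens Zs Zs')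
        (pures Xs Xs' (take (length Xs) t) (take (length Xs) v) @ end_comp (t ! length Xs) (v ! length Xs)
          # pures Zs Zs' (drop (Suc (length Xs)) t) (drop (Suc (length Xs)) v))"
  let ?X = "\<lambda>t. interchange T T' (?f t) (insertion Xs' [] Zs' v)"
  show ?thesis
  proof (cases Zs)
    case (Cons Z Zs1)
    then obtain Z' Zs1' where Z': "Zs' = Z' # Zs1'" using len by (cases Zs') auto
    obtain p' qs' where p': "ps' = p' # qs'" "p' \<in> carrier Z'" "qs' \<in> tuples Zs1'" using v(4)[unfolded Z'] by (rule tuples_ConsE)
    have Z: "bimodule Z" "bimodule Z'" using bim bim' Cons Z' by auto
    interpret Z: bimodule Z by (rule Z)
    have x: "ms' @ p' # qs' \<in> tuples (Xs' @ Zs')" using v p' Z' by (simp add: tuples_appendI)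
    let ?P = "\<lambda>t. frag_of (pures T T' t (ms' @ p' # qs'))"
    have nth: "?L ! length Xs = timesR []" "?L ! Suc (length Xs) = Z" using Cons by (simp_all add: nth_append)
    \<comment> \<open>The scalar is psi(1). Acting with it on End(R) gives phi(psi(1)), the
      contraction of the composite. Acting with it on \<open>Z\<close> from the right gives phi(1) p
      psi(1), and psi(1) then crosses the tensor sign to multiply \<open>p'\<close>. The Takeuchi
      condition between End(R) and \<open>Z\<close> compares the two.\<close>
    have "frag_extend ?P (frag_extend ?f (apply_slot (length Xs) (\<lambda>m. rbar (timesR []) m ?s) c)) = frag_extend ?Y c
      \<and> frag_extend ?P (frag_extend ?f (apply_slot (Suc (length Xs)) (\<lambda>m. ract Z m ?s) c)) = frag_extend ?X c"
      unfolding frag_extend_apply_slot frag_extend_compose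
    proof (intro conjI frag_extend_eq)
      fix t assume "t \<in> Poly_Mapping.keys c"
      then have "t \<in> tuples ?L" using cs by auto
      then obtain ms y ps where t: "t = ms @ y # ps" "ms \<in> tuples Xs" "y \<in> carrier End"
          "ps \<in> tuples Zs" "length ms = length Xs" by (rule tuples_middleE)
      obtain p qs where p: "ps = p # qs" "p \<in> carrier Z" "qs \<in> tuples Zs1" using t(4)[unfolded Cons] by (rule tuples_ConsE)
      note ins = insertion_unit_right[OF t(5), of Z Zs1]
      have ins': "insertion Xs' [] Zs' v = frag_of (ms' @ lact Z' ?s p' # qs')"
        using insertion_unit_right[OF v(5), of Z' Zs1' z p' qs'] by (simp add: v(1) Z' p')
      have pm: "pures T T' (ms @ a # qs) (ms' @ b # qs') = pures Xs Xs' ms ms' @ pure Z Z' a b # pures Zs1 Zs1' qs qs'" for a b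
        using t(5) v(5) len Ys Ys' Cons Z' by (simp add: pures_append)
      have lS: "length (pures Xs Xs' ms ms') = length (map2 tens Xs Xs')" using len by simp
      have "?Y t = frag_of (pures Xs Xs' ms ms' @ lact (tens Z Z') (end_dec y ?s) (pure Z Z' p p') # pures Zs1 Zs1' qs qs')"
        using insertion_unit_right[OF lS, of "tens Z Z'" "map2 tens Zs1 Zs1'" "end_comp y z" "pure Z Z' p p'" "pures Zs1 Zs1' qs qs'"]
          t(5) v(5) len end_comp(2)[OF t(3) v(3)]
        by (simp add: t(1) v(1) p(1) p'(1) Cons Z' nth_append)
      moreover have "?f (t[length Xs := rbar (timesR []) (t ! length Xs) ?s]) = frag_of (ms @ lact Z (end_dec y ?s) p # qs)"
        using t(5) ins[of "rbar (timesR []) y ?s" p qs] end_dec_simps(5)[OF t(3), of ?s]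
        by (simp add: t(1) p(1) Cons nth_append list_update_append)
      ultimately show "frag_extend ?P (?f (t[length Xs := rbar (timesR []) (t ! length Xs) ?s])) = ?Y t"
        using pure_simps(5)[OF Z p(2) p'(2)] by (simp add: pm)
      have "?X t = frag_of (pures Xs Xs' ms ms' @ pure Z Z' (lact Z (end_dec y 1) p) (lact Z' ?s p') # pures Zs1 Zs1' qs qs')"
        using ins[of y p qs] by (simp add: ins' interchange_frag_of t(1) p(1) Cons pm[unfolded Cons])
      moreover have "?f (t[Suc (length Xs) := ract Z (t ! Suc (length Xs)) ?s]) = frag_of (ms @ lact Z (end_dec y 1) (ract Z p ?s) # qs)"
        using t(5) ins[of y "ract Z p ?s" qs] by (simp add: t(1) p(1) Cons nth_append list_update_append)
      ultimately show "frag_extend ?P (?f (t[Suc (length Xs) := ract Z (t ! Suc (length Xs)) ?s])) = ?X t"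
        using pure_simps(3)[OF Z Z.closed(1)[OF p(2)] p'(2), of "end_dec y 1" ?s] p(2) by (simp add: pm Z.commuting)
    qed
    moreover have "frag_extend ?P (frag_extend ?f (apply_slot (length Xs) (\<lambda>m. rbar (timesR []) m ?s) c)
        - frag_extend ?f (apply_slot (Suc (length Xs)) (\<lambda>m. ract Z m ?s) c)) \<in> rels S"
      by (rule pbal[OF _ x]) (use bal[of "length Xs"] Cons in \<open>simp add: nth[unfolded Cons]\<close>)
    ultimately have "frag_extend ?Y c - frag_extend ?X c \<in> rels S" by (simp only: frag_extend_diff)
    then show ?thesis by (rule mod_sym[OF R])
  next
    case Zs: Nil
    then have Zs': "Zs' = []" using len by simp
    obtain As K where A: "Xs = As @ [K]" using ne Zs by (cases Xs rule: rev_cases) auto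
    then obtain As' K' where A': "Xs' = As' @ [K']" "length As' = length As" using len by (cases Xs' rule: rev_cases) auto
    obtain as' k' where k': "ms' = as' @ [k']" "as' \<in> tuples As'" "k' \<in> carrier K'" "length as' = length As'"
      using v(2)[unfolded A'] by (rule tuples_middleE) auto
    have ps': "ps' = []" using v(4) Zs' by simp
    have K: "bimodule K" "bimodule K'" using bim bim' A A' by auto
    interpret K: bimodule K by (rule K)
    have x: "as' @ [k'] \<in> tuples (Xs' @ Zs')" using v(2) k'(1) Zs' by simp
    let ?P = "\<lambda>t. frag_of (pures T T' t (as' @ [k']))"
    have nth: "?L ! length As = K" "?L ! Suc (length As) = timesR []" using A by (simp_all add: nth_append)
    \<comment> \<open>The mirror computation with End(R) last: the relevant condition is that
      between \<open>K\<close> and End(R), the two sides exchange their roles, and psi(1) crosses to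
      \<open>k'\<close> through the opposite ring.\<close>
    have "frag_extend ?P (frag_extend ?f (apply_slot (length As) (\<lambda>m. rbar K m ?s) c)) = frag_extend ?X c
      \<and> frag_extend ?P (frag_extend ?f (apply_slot (Suc (length As)) (\<lambda>m. ract (timesR []) m ?s) c)) = frag_extend ?Y c"
      unfolding frag_extend_apply_slot frag_extend_compose
    proof (intro conjI frag_extend_eq)
      fix t assume "t \<in> Poly_Mapping.keys c"
      then have "t \<in> tuples ?L" using cs by auto
      then obtain ms y ps where t: "t = ms @ y # ps" "ms \<in> tuples Xs" "y \<in> carrier End"
          "ps \<in> tuples Zs" "length ms = length Xs" by (rule tuples_middleE)
      obtain as k where k: "ms = as @ [k]" "k \<in> carrier K" "length as = length As" using t(2)[unfolded A] by (rule tuples_middleE) auto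
      have ps: "ps = []" using t(4) Zs by simp
      note ins = insertion_unit_left[OF k(3), of K]
      have ins': "insertion Xs' [] Zs' v = frag_of (as' @ [lbar K' ?s k'])"
        using insertion_unit_left[OF k'(4), of K' k' z] by (simp add: v(1) A' k'(1) Zs' ps')
      have pm: "pures T T' (as @ [a]) (as' @ [b]) = pures As As' as as' @ [pure K K' a b]" for a b
        using k(3) k'(4) A' Ys Ys' A Zs Zs' by (simp add: pures_append)
      have TT: "T = As @ [K]" "T' = As' @ [K']" using A A' Ys Ys' Zs Zs' by simp_all
      have lS: "length (pures As As' as as') = length (map2 tens As As')" using A' by simp
      have "?Y t = frag_of (pures As As' as as' @ [lbar (tens K K') (end_dec y ?s) (pure K K' k k')])"
        using insertion_unit_left[OF lS, of "tens K K'" "pure K K' k k'" "end_comp y z"]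
          t(5) v(5) k(3) k'(4) A'(2) end_comp(2)[OF t(3) v(3)]
        by (simp add: t(1) v(1) k(1) k'(1) ps ps' A A' Zs Zs' pures_append nth_append)
      moreover have "?f (t[Suc (length As) := ract (timesR []) (t ! Suc (length As)) ?s]) = frag_of (as @ [lbar K (end_dec y ?s) k])"
        using k(3) ins[of k "ract (timesR []) y ?s"] end_dec_simps(4)[OF t(3), of ?s]
        by (simp add: t(1) k(1) ps A Zs nth_append list_update_append)
      ultimately show "frag_extend ?P (?f (t[Suc (length As) := ract (timesR []) (t ! Suc (length As)) ?s])) = ?Y t"
        using pure_simps(6)[OF K k(2) k'(3)] by (simp add: pm)
      have "?X t = frag_of (pures As As' as as' @ [pure K K' (lbar K (end_dec y 1) k) (lbar K' ?s k')])"
        unfolding TT using ins[of k y] by (simp add: ins' interchange_frag_of t(1) k(1) ps A Zs pm[unfolded TT])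
      moreover have "?f (t[length As := rbar K (t ! length As) ?s]) = frag_of (as @ [lbar K (end_dec y 1) (rbar K k ?s)])"
        using k(3) ins[of "rbar K k ?s" y] by (simp add: t(1) k(1) ps A Zs nth_append list_update_append)
      ultimately show "frag_extend ?P (?f (t[length As := rbar K (t ! length As) ?s])) = ?X t"
        using pure_simps(4)[OF K K.closed(2)[OF k(2)] k'(3), of "end_dec y 1" ?s] k(2) by (simp add: pm K.commuting)
    qed
    moreover have "frag_extend ?P (frag_extend ?f (apply_slot (length As) (\<lambda>m. rbar K m ?s) c)
        - frag_extend ?f (apply_slot (Suc (length As)) (\<lambda>m. ract (timesR []) m ?s) c)) \<in> rels S"
      by (rule pbal[OF bal[of "length As", unfolded nth] x]) (simp add: A)
    ultimately show ?thesis by (simp only: frag_extend_diff)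
  qed
qed

text \<open>For nonempty \<open>Ys\<close> the sides agree modulo relations for each pair of tuples,
  by the freedom to choose the representative of the nested interchange. For empty \<open>Ys\<close>
  this fails for single pairs, and \<open>interchange_contract\<close> compares whole sums in the
  first argument.\<close>

lemma chi_lasc_times:
  shows "chi_map T T' \<cdot> (assoc Xs Ys Zs \<boxdot>\<^bsub>Bimod\<^esub> assoc Xs' Ys' Zs')
    = assoc (map2 tens Xs Xs') (map2 tens Ys Ys') (map2 tens Zs Zs')
      \<cdot> times_map (map bimod_id (map2 tens Xs Xs') @ chi_map Ys Ys' # map bimod_id (map2 tens Zs Zs'))
      \<cdot> chi_map (Xs @ timesR Ys # Zs) (Xs' @ timesR Ys' # Zs')"
proof -
  let ?L = "Xs @ timesR Ys # Zs" and ?L' = "Xs' @ timesR Ys' # Zs'" and ?M = "map2 tens Xs Xs' @ tens (timesR Ys) (timesR Ys') # map2 tens Zs Zs'"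
  let ?fs = "map bimod_id (map2 tens Xs Xs') @ chi_map Ys Ys' # map bimod_id (map2 tens Zs Zs')"
  let ?lS = "assoc (map2 tens Xs Xs') (map2 tens Ys Ys') (map2 tens Zs Zs')"
  note l = lasc_Hom_times[OF bim] and l' = lasc_Hom_times[OF bim'] and lS = lasc_Hom_times[OF bS(2-4)]
  have L: "bimods ?L" "bimods ?L'" "?L \<noteq> []" "?L' \<noteq> []"
    using bim bim' bimodule_timesR[OF bim(2)] bimodule_timesR[OF bim'(2)] by auto
  have len': "length T' = length T" "length ?L' = length ?L" using len by simp_all
  have M_eq: "map2 tens ?L ?L' = ?M" using len by simp
  note f = chi_Hom[OF bim(2) bim'(2) len(2)]
  note fs = map_ids_Hom[OF bS(2,4) f]
  note ll = tens_map_Hom[OF l l'] and CT = chi_Hom[OF bT len'(1), unfolded S_eq] and CL = chi_Hom[OF L(1,2) len'(2), unfolded M_eq]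
    and M = times_map_Hom[OF fs(1), unfolded fs(2,3)]
  note CM = comp_Hom[OF CL M]
  show ?thesis
  proof (cases "T = []")
    case True
    \<comment> \<open>With no factors the associators are identities, and the interchange with the
      single factor End(R) on either side is one too; what remains is \<open>chi_map [] []\<close>
      on both sides.\<close>
    then have e: "Xs = []" "Ys = []" "Zs = []" "Xs' = []" "Ys' = []" "Zs' = []" using len by simp_all
    interpret B: monoidal_category Bimod by (rule monoidal_category_bimod)
    have E: "timesR [] \<in> Obj Bimod" using bimodule_End by simp
    have id: "bimod_id (timesR []) \<boxdot>\<^bsub>Bimod\<^esub> bimod_id (timesR []) = bimod_id (tens (timesR []) (timesR []))"
      using B.tensM_Idn[OF E E] by simp
    have "chi_map [timesR []] [timesR []] = bimod_id (tens (timesR []) End)" by (simp add: chi_map_def)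
    then show ?thesis
      using B.Idn_left[of "chi_map [] []"] B.Idn_right[of "chi_map [] []"] chi_Nil(1) times_map_single[OF chi_Nil(1)]
      by (simp add: e lasc_Nil id)
  next
    case False
    then have ne: "T \<noteq> []" "T' \<noteq> []" "S \<noteq> []" using len by (auto simp: zip_eq_Nil_iff)
    note R = diff_closed_rels[OF bS(1)]
    note tr = transports_insertion[OF bim ne(1)] and tr' = transports_insertion[OF bim' ne(2)] and trS = transports_insertion[OF bS(2-4) ne(3)]
    show ?thesis
    proof (rule tens_times_eqI[OF L(1,3) L(2,4) comp_Hom[OF ll CT] comp_Hom[OF CM lS]])
      fix c d assume c: "c \<in> takeuchi ?L" and d: "d \<in> takeuchi ?L'"
      let ?x = "times_of ?L c" and ?y = "times_of ?L' d"
      note cs = takeuchiD(1)[OF c] and ds = takeuchiD(1)[OF d]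
      note x = times_of_closed[OF L(1,3) c] and y = times_of_closed[OF L(2,4) d]
      note p = pure_closed[OF bimodule_timesR[OF L(1)] bimodule_timesR[OF L(2)] x y]
      note c1 = transports_takeuchi[OF tr c] and d1 = transports_takeuchi[OF tr' d]
      note i1 = interchange_takeuchi[OF bT len'(1) c1 d1, unfolded S_eq]
      note i2 = interchange_takeuchi[OF L(1,2) len'(2) c d, unfolded M_eq]
      note i3 = transports_takeuchi[OF transports_map[OF fs(1), unfolded fs(2,3)], OF _ i2]
      let ?I = "interchange T T' (frag_extend (insertion Xs Ys Zs) c) (frag_extend (insertion Xs' Ys' Zs') d)"
      let ?J = "frag_extend (\<lambda>t. frag_of (map2 bfun ?fs t)) (interchange ?L ?L' c d)"
      let ?ins = "insertion (map2 tens Xs Xs') (map2 tens Ys Ys') (map2 tens Zs Zs')"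
      have J: "?J \<in> takeuchi (map2 tens Xs Xs' @ timesR (map2 tens Ys Ys') # map2 tens Zs Zs')" by (rule i3) simp
      have m: "map2 bfun ?fs (pures ?L ?L' (ms @ y # ps) (ms' @ z # ps'))
          = pures Xs Xs' ms ms' @ bfun (chi_map Ys Ys') (pure (timesR Ys) (timesR Ys') y z) # pures Zs Zs' ps ps'"
        if "ms \<in> tuples Xs" "ms' \<in> tuples Xs'" "ps \<in> tuples Zs" "ps' \<in> tuples Zs'" for ms ms' y z ps ps'
        using map2_bfun_ids[OF pures_tuples[OF bim(1) bim'(1) len(1) that(1,2)] pures_tuples[OF bim(3) bim'(3) len(3) that(3,4)]]
          tuples_length[OF that(1)] tuples_length[OF that(2)] len
        by (simp only: pures_append pures_Cons)
      have "?I - frag_extend ?ins ?J \<in> rels S"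
        unfolding frag_extend_interchange frag_extend_compose interchange_frag_extend frag_extend_of
      proof (cases "Ys = []")
        case Ys: False
        then have Ys': "Ys' \<noteq> []" and YS: "map2 tens Ys Ys' \<noteq> []" using len by (auto simp: zip_eq_Nil_iff)
        have "interchange T T' (insertion Xs Ys Zs t) (insertion Xs' Ys' Zs' v) - ?ins (map2 bfun ?fs (pures ?L ?L' t v)) \<in> rels S"
          if tv: "t \<in> tuples ?L" "v \<in> tuples ?L'" for t v
        proof -
          obtain ms y ps where t: "t = ms @ y # ps" "ms \<in> tuples Xs" "y \<in> carrier (timesR Ys)" "ps \<in> tuples Zs" "length ms = length Xs"
            using tv(1) by (rule tuples_middleE)
          obtain ms' z ps' where v: "v = ms' @ z # ps'" "ms' \<in> tuples Xs'" "z \<in> carrier (timesR Ys')" "ps' \<in> tuples Zs'" "length ms' = length Xs'"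
            using tv(2) by (rule tuples_middleE)
          note ry = times_rep_closed[OF bim(2) Ys t(3)] and rz = times_rep_closed[OF bim'(2) Ys' v(3)]
          note i = interchange_takeuchi[OF bim(2) bim'(2) len(2) ry rz]
          have chi: "bfun (chi_map Ys Ys') (pure (timesR Ys) (timesR Ys') y z)
              = times_of (map2 tens Ys Ys') (interchange Ys Ys' (times_rep Ys y) (times_rep Ys' z))"
            using chi_interchange[OF bim(2) bim'(2) len(2) Ys ry rz] times_of_rep[OF bim(2) Ys t(3)] times_of_rep[OF bim'(2) Ys' v(3)] by simp
          have "interchange T T' (insertion Xs Ys Zs t) (insertion Xs' Ys' Zs' v)
              = frag_extend (\<lambda>u. frag_of (pures Xs Xs' ms ms' @ u @ pures Zs Zs' ps ps')) (interchange Ys Ys' (times_rep Ys y) (times_rep Ys' z))"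
            unfolding t(1) v(1) insertion_flatten[OF Ys t(5)] insertion_flatten[OF Ys' v(5)] interchange_frag_extend frag_extend_interchange
              interchange_frag_of
          proof (rule frag_extend_eq2[OF takeuchiD(1)[OF ry] takeuchiD(1)[OF rz]])
            fix a b assume "a \<in> tuples Ys" "b \<in> tuples Ys'"
            then have "length a = length Ys" "length b = length Ys" using tuples_length[of a Ys] tuples_length[of b Ys'] len by simp_all
            then show "frag_of (pures T T' (ms @ a @ ps) (ms' @ b @ ps')) = frag_of (pures Xs Xs' ms ms' @ pures Ys Ys' a b @ pures Zs Zs' ps ps')"
              using pures_middle[of ms ms' a b ps ps'] t(5) v(5) len by simp
          qed
          moreover note mod_sym[OF R insertion_times_of[OF bS(2-4) YS pures_tuples[OF bim(1) bim'(1) len(1) t(2) v(2)]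
                pures_tuples[OF bim(3) bim'(3) len(3) t(4) v(4)] i]]
          ultimately show ?thesis
            unfolding t(1) v(1) m[OF t(2) v(2) t(4) v(4)] chi by simp
        qed
        then show "frag_extend (\<lambda>t. frag_extend (\<lambda>u. interchange T T' (insertion Xs Ys Zs t) (insertion Xs' Ys' Zs' u)) d) c
            - frag_extend (\<lambda>t. frag_extend (\<lambda>u. ?ins (map2 bfun ?fs (pures ?L ?L' t u))) d) c \<in> rels S"
          using cs ds by (intro frag_extend_cong_mod[OF R]) (auto simp: subset_iff)
      next
        case Ys: True
        then have Ys': "Ys' = []" using len by simp
        show "frag_extend (\<lambda>t. frag_extend (\<lambda>u. interchange T T' (insertion Xs Ys Zs t) (insertion Xs' Ys' Zs' u)) d) c
            - frag_extend (\<lambda>t. frag_extend (\<lambda>u. ?ins (map2 bfun ?fs (pures ?L ?L' t u))) d) c \<in> rels S"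
          \<comment> \<open>The order of summation is exchanged so that a tuple \<open>v\<close> of
            the second argument is fixed while the sum over \<open>c\<close>, whose Takeuchi
            condition is used, stays whole.\<close>
          unfolding frag_extend_swap[of _ d c]
        proof (rule frag_extend_cong_mod[OF R])
          fix v assume "v \<in> Poly_Mapping.keys d"
          then have v: "v \<in> tuples (Xs' @ timesR [] # Zs')" using ds Ys' by auto
          then obtain ms' z ps' where v': "v = ms' @ z # ps'" "ms' \<in> tuples Xs'" "z \<in> carrier End" "ps' \<in> tuples Zs'"
            "length ms' = length Xs'" by (rule tuples_middleE)
          have "frag_extend (\<lambda>t. ?ins (map2 bfun ?fs (pures ?L ?L' t v))) c = frag_extend (\<lambda>t. insertion (map2 tens Xs Xs') [] (map2 tens Zs Zs')
            (pures Xs Xs' (take (length Xs) t) (take (length Xs) v) @ end_comp (t ! length Xs) (v ! length Xs)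
              # pures Zs Zs' (drop (Suc (length Xs)) t) (drop (Suc (length Xs)) v))) c"
          proof (rule frag_extend_eq)
            fix t assume "t \<in> Poly_Mapping.keys c"
            then have "t \<in> tuples ?L" using cs by auto
            then obtain ms y ps where t: "t = ms @ y # ps" "ms \<in> tuples Xs" "y \<in> carrier (timesR Ys)" "ps \<in> tuples Zs" "length ms = length Xs"
              by (rule tuples_middleE)
            show "?ins (map2 bfun ?fs (pures ?L ?L' t v)) = insertion (map2 tens Xs Xs') [] (map2 tens Zs Zs')
              (pures Xs Xs' (take (length Xs) t) (take (length Xs) v) @ end_comp (t ! length Xs) (v ! length Xs)
                # pures Zs Zs' (drop (Suc (length Xs)) t) (drop (Suc (length Xs)) v))"
              unfolding t(1) v'(1) m[OF t(2) v'(2) t(4) v'(4)] using t(3,5) v'(3,5) len Ys Ys' by (simp add: chi_Nil(2) nth_append)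
          qed
          then show "frag_extend (\<lambda>t. interchange T T' (insertion Xs Ys Zs t) (insertion Xs' Ys' Zs' v)) c
              - frag_extend (\<lambda>t. ?ins (map2 bfun ?fs (pures ?L ?L' t v))) c \<in> rels S"
            using interchange_contract[OF Ys _ _ v] False c by (simp only: Ys Ys' append_Nil) blast
        qed
      qed
      then have "times_of S ?I = times_of S (frag_extend ?ins ?J)"
        by (rule times_of_eqI_mod[OF bS(1) ne(3) i1 transports_takeuchi[OF trS J]])
      then show "bfun (chi_map T T' \<cdot> (assoc Xs Ys Zs \<boxdot>\<^bsub>Bimod\<^esub> assoc Xs' Ys' Zs'))
          (pure (timesR ?L) (timesR ?L') ?x ?y)
        = bfun (?lS \<cdot> times_map ?fs \<cdot> chi_map ?L ?L') (pure (timesR ?L) (timesR ?L') ?x ?y)"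
        unfolding comp_apply[OF ll p] comp_apply[OF CM p] comp_apply[OF CL p] tens_map_pure[OF l l' x y]
          lasc_arrow(2)[OF bim ne(1) c] lasc_arrow(2)[OF bim' ne(2) d] chi_interchange[OF bT len'(1) ne(1) c1 d1, unfolded S_eq]
          chi_interchange[OF L(1,2) len'(2) L(3) c d, unfolded M_eq]
        using times_map_times_of[OF fs(1), unfolded fs(2,3), OF _ i2] lasc_arrow(2)[OF bS(2-4) ne(3) J] by simp
    qed
  qed
qed

end

text \<open>Since \<open>w_map\<close> counts factors, the outer map has index
  \<open>a + 1 + c\<close>. On \<open>(1, 1)\<close> the right-hand side yields a tuple of copies of
  \<open>(1, 1)\<close> with one nested value in the middle, which flattening or contraction turns
  into the tuple of \<open>a + b + c\<close> copies.\<close>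

lemma w_lasc_times:
  "(w_map (a + b + c) :: ('r, 'u) bimod_arr) = assoc (replicate a env) (replicate b env) (replicate c env)
    \<cdot> times_map (map bimod_id (replicate a env) @ w_map b # map bimod_id (replicate c env)) \<cdot> w_map (a + 1 + c)"
proof -
  let ?E = "Env" and ?o = "env_el 1 (1 :: 'r) :: 'u"
  let ?A = "replicate a ?E" and ?B = "replicate b ?E" and ?C = "replicate c ?E"
  let ?fs = "map bimod_id ?A @ w_map b # map bimod_id ?C"
  interpret E: bimodule ?E by (rule bimodule_env)
  note o = env_el_closed[of 1 "1 :: 'r"]
  have r: "replicate (a + b + c) x = replicate a x @ replicate b x @ replicate c x"
    "replicate (a + 1 + c) x = replicate a x @ x # replicate c x" for x :: 'x
    by (simp_all add: replicate_add replicate_append_same flip: replicate_app_Cons_same)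
  note w = w_arrow[of b]
  note fs = map_ids_Hom[OF bimods_env[of a] bimods_env[of c] w(1)]
  note W = w_arrow(1)[of "a + b + c", unfolded r] and W1 = w_arrow(1)[of "a + 1 + c", unfolded r]
    and M = times_map_Hom[OF fs(1), unfolded fs(2,3)] and L = lasc_Hom_times[OF bimods_env[of a] bimods_env[of b] bimods_env[of c]]
  have bE: "bimods (?A @ ?E # ?C)" "bimods (?A @ ?B @ ?C)" "bimods (?A @ timesR ?B # ?C)"
    using bimodule_env bimodule_timesR[OF bimods_env] by auto
  note WM = comp_Hom[OF W1 M]
  show ?thesis
  proof (rule env_Hom_eqI[OF W comp_Hom[OF WM L]])
    let ?q = "frag_of (replicate a ?o @ ?o # replicate c ?o)" and ?t = "replicate a ?o @ w_value b # replicate c ?o"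
    have q: "?q \<in> takeuchi (?A @ ?E # ?C)" using env_ones(2)[of "a + 1 + c", unfolded r] .
    have v: "w_value (a + 1 + c) = times_of (?A @ ?E # ?C) ?q" by (simp only: w_value_def r) simp
    note oa = env_ones(1)[of a] and oc = env_ones(1)[of c]
    have m: "frag_extend (\<lambda>t. frag_of (map2 bfun ?fs t)) ?q = frag_of ?t"
      unfolding frag_extend_of map2_bfun_ids[OF oa oc] w(2) ..
    have t: "frag_of ?t \<in> takeuchi (?A @ timesR ?B # ?C)"
      using transports_takeuchi[OF transports_map[OF fs(1), unfolded fs(2,3)] q] unfolding m by simp
    have 1: "bfun (times_map ?fs) (w_value (a + 1 + c)) = times_of (?A @ timesR ?B # ?C) (frag_of ?t)"
      using times_map_times_of[OF fs(1), unfolded fs(2,3), OF _ q] unfolding v m by simp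
    have wb: "w_value b \<in> carrier (timesR ?B)" using bimod_HomD(6)[OF w(1) o] w(2) by simp
    have "bfun (assoc ?A ?B ?C) (times_of (?A @ timesR ?B # ?C) (frag_of ?t)) = w_value (a + b + c)"
    proof (cases "a + b + c = 0")
      case True
      then show ?thesis using wb by (simp add: lasc_Nil times_of_def bimodule.axioms(1) comm_group.evaluate_of[OF bimodule.axioms(1)[OF bimodule_End]])
    next
      case False
      then have ne: "?A @ ?B @ ?C \<noteq> []" by auto
      have v': "w_value (a + b + c) = times_of (?A @ ?B @ ?C) (frag_of (replicate a ?o @ replicate b ?o @ replicate c ?o))"
        using False by (simp only: w_value_def r if_False)
      have q': "frag_of (replicate a ?o @ replicate b ?o @ replicate c ?o) \<in> takeuchi (?A @ ?B @ ?C)"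
        using env_ones(2)[of "a + b + c", unfolded r] .
      note i = transports_takeuchi[OF transports_insertion[OF bimods_env bimods_env bimods_env ne] t]
      have "insertion ?A ?B ?C ?t - frag_of (replicate a ?o @ replicate b ?o @ replicate c ?o) \<in> rels (?A @ ?B @ ?C)"
      proof (cases "b = 0")
        case b: False
        then have Bne: "?B \<noteq> []" and wb': "w_value b = times_of ?B (frag_of (replicate b ?o))" by (simp_all add: w_value_def)
        show ?thesis
          using insertion_times_of[OF bimods_env bimods_env bimods_env Bne oa oc env_ones(2)[of b]] unfolding wb' by simp
      next
        \<comment> \<open>Contracting the identity endomorphism multiplies a neighbouring
          \<open>(1, 1)\<close> by id(1) = 1; the neighbour is the one on the right unless
          \<open>c\<close> is 0.\<close>
        case b: True
        have one: "end_dec (w_value b) 1 = (1 :: 'r)"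
          using end_enc_closed(2)[of "id :: 'r \<Rightarrow> 'r"] b by (simp add: w_value_def hom_def)
        note zero = diff_closedD(1)[OF diff_closed_rels[OF bE(2)]]
        show ?thesis
        proof (cases c)
          case (Suc c')
          then show ?thesis
            using insertion_unit_right[of "replicate a ?o" ?A ?E "replicate c' ?E" "w_value b" ?o "replicate c' ?o"] zero
            by (simp add: b one[unfolded b] E.unital o)
        next
          case 0
          then obtain a' where a: "a = Suc a'" using False b by (cases a) auto
          have s: "replicate a x = replicate a' x @ [x]" for x :: 'x by (simp add: a replicate_append_same)
          show ?thesis
            using insertion_unit_left[of "replicate a' ?o" "replicate a' ?E" ?E ?o "w_value b"] zero
            unfolding s by (simp add: b 0 one[unfolded b] E.unital o)
        qed
      qed
      then have "times_of (?A @ ?B @ ?C) (insertion ?A ?B ?C ?t) = w_value (a + b + c)"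
        unfolding v' using times_of_eqI_mod[OF bE(2) ne i q'] by (simp only: frag_extend_of)
      then show ?thesis using lasc_arrow(2)[OF bimods_env bimods_env bimods_env ne t] by (simp only: frag_extend_of)
    qed
    then show "bfun (w_map (a + b + c) :: ('r, 'u) bimod_arr) ?o = bfun (assoc ?A ?B ?C \<cdot> times_map ?fs \<cdot> w_map (a + 1 + c)) ?o"
      unfolding comp_apply[OF WM o] comp_apply[OF W1 o] w_arrow(2) 1 by (rule sym)
  qed
qed

lemma w_one: "(w_map 1 :: ('r, 'u) bimod_arr) = bimod_id env"
proof (rule env_Hom_eqI)
  interpret E: bimodule "Env" by (rule bimodule_env)
  show "w_map 1 \<in> bimod_Hom Env env" using w_arrow(1)[of 1] by simp
  show "bimod_id env \<in> bimod_Hom Env env" by (rule bimod_id_Hom[OF bimodule_env])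
  show "bfun (w_map 1 :: ('r, 'u) bimod_arr) (env_el 1 (1 :: 'r)) = bfun (bimod_id Env) (env_el 1 (1 :: 'r))"
    unfolding w_arrow(2) by (simp add: w_value_def times_of_def env_el_closed)
qed

lemma lax_strong_duoidal_category_times: "lax_strong_duoidal_category Bimod times_structure chi_map w_map"
proof (intro lax_strong_duoidal_category.intro lax_strong_duoidal_category_axioms.intro monoidal_category_bimod
    lax_monoidal_category_times)
  fix n
  show "lax_monoidal_functor (power_moncat Bimod n) Bimod (lamO times_structure) (lamM times_structure) chi_map (w_map n)"
    using lax_monoidal_functor_times by simp
next
  interpret B: monoidal_category Bimod by (rule monoidal_category_bimod)
  fix M N assume M: "M \<in> Obj Bimod" and N: "N \<in> Obj Bimod"
  have "bimod_id (tens M N) \<cdot> bimod_id (tens M N) = bimod_id (tens M N)"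
    using B.Idn_left[OF B.Idn_Hom[OF B.tensO_Obj[OF M N]]] by simp
  then show "chi_map [M] [N] \<cdot> (lunit times_structure M \<boxdot>\<^bsub>Bimod\<^esub> lunit times_structure N) = lunit times_structure (M \<boxtimes>\<^bsub>Bimod\<^esub> N)"
    using B.tensM_Idn[OF M N] by (simp add: chi_map_def)
next
  fix Xs Ys Zs Xs' Ys' Zs' :: "('r, 'u) bimod list"
  assume *: "set Xs \<subseteq> Obj Bimod" "set Ys \<subseteq> Obj Bimod" "set Zs \<subseteq> Obj Bimod"
    "set Xs' \<subseteq> Obj Bimod" "set Ys' \<subseteq> Obj Bimod" "set Zs' \<subseteq> Obj Bimod"
    and len: "length Xs' = length Xs" "length Ys' = length Ys" "length Zs' = length Zs"
  from * have "bimods Xs" "bimods Ys" "bimods Zs" "bimods Xs'" "bimods Ys'" "bimods Zs'" by auto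
  from chi_lasc_times[OF this len]
  show "chi_map (Xs @ Ys @ Zs) (Xs' @ Ys' @ Zs') \<cdot> (assoc Xs Ys Zs \<boxdot>\<^bsub>Bimod\<^esub> assoc Xs' Ys' Zs')
    = assoc (map2 (tensO Bimod) Xs Xs') (map2 (tensO Bimod) Ys Ys') (map2 (tensO Bimod) Zs Zs')
      \<cdot> lamM times_structure (map (Idn Bimod) (map2 (tensO Bimod) Xs Xs') @ [chi_map Ys Ys']
        @ map (Idn Bimod) (map2 (tensO Bimod) Zs Zs'))
      \<cdot> chi_map (Xs @ [lamO times_structure Ys] @ Zs) (Xs' @ [lamO times_structure Ys'] @ Zs')"
    by simp
next
  show "w_map 1 = lunit times_structure (munit Bimod)"
    using w_one by simp
next
  fix a b c
  show "w_map (a + b + c) = assoc (replicate a (munit Bimod)) (replicate b (munit Bimod)) (replicate c (munit Bimod))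
    \<cdot> lamM times_structure (replicate a (Idn Bimod (munit Bimod)) @ [w_map b] @ replicate c (Idn Bimod (munit Bimod)))
    \<cdot> w_map (a + 1 + c)"
    using w_lasc_times[of a b c] by simp
qed

end

text \<open>The assumptions only fix a universe large enough for all constructions; for every ring
  they hold with the type \<open>nat + ('r \<Rightarrow> 'r)\<close> as universe.\<close>

theorem mainTheorem7:
  assumes "infinite (UNIV :: 'u set)"
    and "\<exists>e :: ('r::{ring,monoid_mult} \<Rightarrow> 'r) \<Rightarrow> 'u. inj_on e (hom ring_group ring_group)"
  shows "lax_strong_duoidal_category
    (bimod_moncat :: (('r, 'u) bimod, ('r, 'u) bimod_arr) moncat)
    times_structure chi_map w_map"
proof -
  interpret big_universe "TYPE('r)" "TYPE('u)"
    using assms by unfold_locales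
  show ?thesis by (rule lax_strong_duoidal_category_times)
qed

end
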